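(* Let $T = T[1,N]$ be a text over an unbounded, totally ordered alphabet $\Sigma$ (symbols can only be compared, each comparison taking $O(1)$ time), where $T[N]$ is an endmarker symbol that occurs nowhere else in $T$ and is smaller than every other symbol. Let $K \le N$ and let $[i, i+K-1] \subseteq [1,N]$ be a range of $K$ consecutive ranks. Then both of the following can be computed in $O(K\log K + N)$ time: (1) (partial compression) the segment $L[i..i+K-1]$ of the Burrows–Wheeler transform $L$ of $T$; (2) (partial text indexing) the $K$-partial text index for the ranks $i, i+1, \ldots, i+K-1$, i.e. the suffixes of $T$ having lexicographic ranks $i, \ldots, i+K-1$, in sorted order, together with the lengths of the longest common prefixes between consecutive ones among them.
   Context: For $1 \le j \le N$ the suffix $T_j$ is $T[j,N]$; suffixes are ordered lexicographically, and the rank of a suffix is its position ($1$ to $N$) in this sorted order. The Burrows–Wheeler transform of $T$ is the string $L[1,N]$ such that $L[r] = T[j-1]$ if $T_j$ is the suffix of rank $r$ and $j>1$, and $L[r]=T[N]$ if $j=1$. The longest common prefix length $\mathrm{lcp}(T_a,T_b)$ is the smallest $\ell \ge 0$ with $T[a+\ell]\ne T[b+\ell]$. Running time is measured in the comparison model (time and number of symbol comparisons are asymptotically the same here). *)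

theory Defs
  imports Complex_Main "HOL-Library.List_Lexorder" "HOL-Library.Log_Nat"
begin

text \<open>A text \<open>T[1,N]\<close> is a list; positions and ranks are counted from 1.
  Lists are compared by the lexicographic order of \<^theory>\<open>HOL-Library.List_Lexorder\<close>.\<close>

definition text_symbol :: "'a list \<Rightarrow> nat \<Rightarrow> 'a" where
  "text_symbol T j = T ! (j - 1)"

definition text_suffix :: "'a list \<Rightarrow> nat \<Rightarrow> 'a list" where
  "text_suffix T j = drop (j - 1) T"

definition endmarked :: "'a::linorder list \<Rightarrow> bool" where
  "endmarked T \<longleftrightarrow> T \<noteq> [] \<and>
     (\<forall>j. 1 \<le> j \<and> j < length T \<longrightarrow> text_symbol T (length T) < text_symbol T j)"

definition suffix_array :: "'a::linorder list \<Rightarrow> nat list" where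
  "suffix_array T = sort_key (text_suffix T) [1..<Suc (length T)]"

definition suffix_of_rank :: "'a::linorder list \<Rightarrow> nat \<Rightarrow> nat" where
  "suffix_of_rank T r = suffix_array T ! (r - 1)"

definition bwt :: "'a::linorder list \<Rightarrow> nat \<Rightarrow> 'a" where
  "bwt T r = (let j = suffix_of_rank T r in
     if j > 1 then text_symbol T (j - 1) else text_symbol T (length T))"

text \<open>Only meaningful for an endmarked text and distinct \<open>a, b \<in> {1..N}\<close>: the endmarker then
  forces a mismatch before either suffix is exhausted.\<close>

definition lcp :: "'a list \<Rightarrow> nat \<Rightarrow> nat \<Rightarrow> nat" where
  "lcp T a b = (LEAST l. text_symbol T (a + l) \<noteq> text_symbol T (b + l))"


text \<open>Programs work on registers and a random-access memory holding \<open>w\<close>-bit words, and on a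
  separate random-access memory of symbols. Symbols can only be copied (\<open>Copy\<close>) and compared
  (\<open>SymLess\<close>), so a program text does not mention the alphabet. All arithmetic is modulo
  \<open>2 ^ w\<close>, which rules out packing large amounts of data into one word; subtraction is
  truncated at 0.\<close>

datatype aexp =
    Const nat
  | Reg string
  | Mem aexp
  | Add aexp aexp
  | Sub aexp aexp
  | Mul aexp aexp
  | Div aexp aexp

datatype bexp =
    Less aexp aexp
  | SymLess aexp aexp
  | Neg bexp
  | Conj bexp bexp

datatype com =
    Skip
  | Assign string aexp
  | Store aexp aexp
  | Copy aexp aexp
  | Seq com com
  | Cond bexp com com
  | While bexp com

record 'a state =
  regs :: "string \<Rightarrow> nat"
  mem :: "nat \<Rightarrow> nat"
  syms :: "nat \<Rightarrow> 'a"

primrec aval :: "nat \<Rightarrow> 'a state \<Rightarrow> aexp \<Rightarrow> nat" where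
  "aval w s (Const n) = n mod 2 ^ w"
| "aval w s (Reg x) = regs s x"
| "aval w s (Mem a) = mem s (aval w s a)"
| "aval w s (Add a b) = (aval w s a + aval w s b) mod 2 ^ w"
| "aval w s (Sub a b) = aval w s a - aval w s b"
| "aval w s (Mul a b) = (aval w s a * aval w s b) mod 2 ^ w"
| "aval w s (Div a b) = aval w s a div aval w s b"

primrec bval :: "nat \<Rightarrow> 'a::linorder state \<Rightarrow> bexp \<Rightarrow> bool" where
  "bval w s (Less a b) = (aval w s a < aval w s b)"
| "bval w s (SymLess a b) = (syms s (aval w s a) < syms s (aval w s b))"
| "bval w s (Neg b) = (\<not> bval w s b)"
| "bval w s (Conj b c) = (bval w s b \<and> bval w s c)"

text \<open>Every elementary operation, symbol comparisons included, takes one time unit.\<close>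

primrec atime :: "aexp \<Rightarrow> nat" where
  "atime (Const n) = 1"
| "atime (Reg x) = 1"
| "atime (Mem a) = atime a + 1"
| "atime (Add a b) = atime a + atime b + 1"
| "atime (Sub a b) = atime a + atime b + 1"
| "atime (Mul a b) = atime a + atime b + 1"
| "atime (Div a b) = atime a + atime b + 1"

primrec btime :: "bexp \<Rightarrow> nat" where
  "btime (Less a b) = atime a + atime b + 1"
| "btime (SymLess a b) = atime a + atime b + 1"
| "btime (Neg b) = btime b + 1"
| "btime (Conj b c) = btime b + btime c + 1"

text \<open>\<open>exec w P s t s'\<close>: on a machine with \<open>w\<close>-bit words, program \<open>P\<close> started in \<open>s\<close> halts in
  \<open>s'\<close> after \<open>t\<close> time units.\<close>

inductive exec :: "nat \<Rightarrow> com \<Rightarrow> 'a::linorder state \<Rightarrow> nat \<Rightarrow> 'a state \<Rightarrow> bool" for w where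
  Skip: "exec w Skip s 1 s"
| Assign: "exec w (Assign x a) s (atime a + 1) (s\<lparr>regs := (regs s)(x := aval w s a)\<rparr>)"
| Store: "exec w (Store a b) s (atime a + atime b + 1)
    (s\<lparr>mem := (mem s)(aval w s a := aval w s b)\<rparr>)"
| Copy: "exec w (Copy a b) s (atime a + atime b + 1)
    (s\<lparr>syms := (syms s)(aval w s a := syms s (aval w s b))\<rparr>)"
| Seq: "exec w P s t s' \<Longrightarrow> exec w Q s' u s'' \<Longrightarrow> exec w (Seq P Q) s (t + u) s''"
| CondTrue: "bval w s b \<Longrightarrow> exec w P s t s' \<Longrightarrow> exec w (Cond b P Q) s (btime b + 1 + t) s'"
| CondFalse: "\<not> bval w s b \<Longrightarrow> exec w Q s t s' \<Longrightarrow> exec w (Cond b P Q) s (btime b + 1 + t) s'"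
| WhileFalse: "\<not> bval w s b \<Longrightarrow> exec w (While b P) s (btime b + 1) s"
| WhileTrue: "bval w s b \<Longrightarrow> exec w P s t s' \<Longrightarrow> exec w (While b P) s' u s'' \<Longrightarrow>
    exec w (While b P) s (btime b + 1 + t + u) s''"

text \<open>The text occupies the symbol cells \<open>1..N\<close>; the other symbol cells have arbitrary contents.\<close>

definition initial_state :: "'a list \<Rightarrow> nat \<Rightarrow> nat \<Rightarrow> 'a state \<Rightarrow> bool" where
  "initial_state T K i s \<longleftrightarrow>
     regs s = (\<lambda>_. 0)(''N'' := length T, ''K'' := K, ''i'' := i) \<and>
     mem s = (\<lambda>_. 0) \<and>
     (\<forall>j\<in>{1..length T}. syms s j = text_symbol T j)"

text \<open>A problem is given by its admissible inputs \<open>(T, K, i)\<close> and a postcondition relating an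
  input to the final state. It is solvable in time \<open>O(f)\<close> if one program solves it on all
  inputs, on words of \<open>\<Theta>(log N)\<close> bits; \<open>floorlog 2 N\<close> is the bit length of \<open>N\<close>. The constant is
  required to work for every input, so there are no exceptional small inputs.\<close>

definition solvable_in_time ::
  "('a::linorder list \<Rightarrow> nat \<Rightarrow> nat \<Rightarrow> bool) \<Rightarrow> ('a list \<Rightarrow> nat \<Rightarrow> nat \<Rightarrow> 'a state \<Rightarrow> bool) \<Rightarrow>
   (nat \<Rightarrow> nat \<Rightarrow> real) \<Rightarrow> bool" where
  "solvable_in_time inp post f \<longleftrightarrow>
     (\<exists>P. \<exists>c>0. \<exists>C. \<forall>T K i s. inp T K i \<longrightarrow> initial_state T K i s \<longrightarrow>
        (\<exists>t s'. exec (c * floorlog 2 (length T)) P s t s' \<and>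
           real t \<le> C * f K (length T) \<and> post T K i s'))"

definition rank_range_input :: "'a::linorder list \<Rightarrow> nat \<Rightarrow> nat \<Rightarrow> bool" where
  "rank_range_input T K i \<longleftrightarrow>
     endmarked T \<and> 1 \<le> K \<and> K \<le> length T \<and> 1 \<le> i \<and> i + K - 1 \<le> length T"

text \<open>The symbols \<open>L[i], \<dots>, L[i+K-1]\<close> are delivered in the symbol cells \<open>N+1..N+K\<close>.\<close>

definition outputs_bwt_segment :: "'a::linorder list \<Rightarrow> nat \<Rightarrow> nat \<Rightarrow> 'a state \<Rightarrow> bool" where
  "outputs_bwt_segment T K i s \<longleftrightarrow> (\<forall>k<K. syms s (length T + 1 + k) = bwt T (i + k))"

text \<open>A suffix is represented by its starting position. The \<open>K\<close> suffixes are delivered in the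
  memory cells \<open>0..K-1\<close>, and the \<open>K-1\<close> common prefix lengths in the cells \<open>K..2K-2\<close>.\<close>

definition outputs_partial_index :: "'a::linorder list \<Rightarrow> nat \<Rightarrow> nat \<Rightarrow> 'a state \<Rightarrow> bool" where
  "outputs_partial_index T K i s \<longleftrightarrow>
     (\<forall>k<K. mem s k = suffix_of_rank T (i + k)) \<and>
     (\<forall>k<K - 1. mem s (K + k) =
        lcp T (suffix_of_rank T (i + k)) (suffix_of_rank T (i + k + 1)))"

end

theory Submission
  imports Defs "HOL-Library.Product_Lexorder"
begin

text \<open>
  To find the suffix of a given rank, maintain a set \<open>A\<close> of active suffixes that is an interval of the
  suffix order and contains the wanted one; every other position is labelled as below or above \<open>A\<close>.
  The active suffixes share a prefix, the token. Comparing pairs (symbol, label) at the end of the token,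
  a round splits \<open>A\<close> around an approximate median and keeps the part containing the wanted suffix. If it
  is one of the outer parts, \<open>A\<close> shrinks by a constant factor. Otherwise all survivors carry the same pair,
  so their tokens grow by the token found there; where an active suffix follows directly, a run of equal
  tokens is ordered by its length and by what follows it. Each growing token swallows another one, and a
  token is swallowed only once, so the whole selection takes linear time. The median is approximated by a
  merge sort that drops every second element of a run after each pass.

  Selecting the lowest and the highest of the \<open>K\<close> ranks yields the \<open>K\<close> target positions. Cut the text
  into blocks that end at the next target. A block comparison is decided inside the blocks, by a symbol or
  by a label telling that a position has rank below or above the range, unless the blocks are equal. The
  blocks have total length \<open>O(N)\<close>, so a merge sort that remembers common prefix lengths orders them
  in time \<open>O(K log K + N)\<close>. Prefix doubling on the sequence of \<open>K\<close> block names orders the targets in time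
  \<open>O(K log K)\<close>. As their ranks are consecutive, Kasai's amortisation bounds the cost of the common prefixes
  by \<open>O(N)\<close>, even though only the targets are visited.

  The program is written in an array language whose variables and arrays are interleaved in the memory of
  the machine; its running time is tracked by credits, one per loop iteration.
\<close>

section \<open>An array language and its compilation\<close>

text \<open>Selection is linear because of \<open>tokens_ok\<close>: a symbol and a label, compared
  in constant time, determine a whole token, so a round costs a constant per active suffix however
  long the tokens have become. The obstacle is a token that ends at an active position: the token to
  be swallowed would itself be growing. Hence two alternating modes. In mode 0 every token ends at
  an inactive position (or nothing has been matched) and may be extended; in mode 1 the survivors
  are separated by run labels, where adjacent active tokens always carry different labels, so that a
  class with a single label satisfies the requirement of mode 0 again.

  Overflow is not excluded program by program. A loop iteration raises the stored values by at most
  a constant, so the running time bounds all values by a polynomial in \<open>N\<close>, and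
  \<open>O(log N)\<close> bits suffice; only sums of two variable quantities need an argument of
  their own.\<close>

datatype reg = RK | Ri | Rr | Rn | Rmode | Rlow | Rhigh | Rpv | Rlt | Reqc | Rch | Rm | Ra | Rq |
  Rx | Ry | Rlen | Rs | Rth | Ro | Rje | Rli | Rie | Rj | Ru | Rv | Rl | Rtk | Rflat | Rh | RL | RH | Rk

datatype arr = Lab | Fr | En | Act | Cls | Tl | Buf | Buf2 | Lc | Sd | Tg | Ix | Rnk | Sa | Tmp |
  Cnt | Sa2 | Rnk2 | Out

datatype hexp =
    Lin nat nat
  | V reg
  | Arr arr hexp
  | Inc hexp nat
  | Plus hexp hexp
  | Minus hexp hexp

datatype hbexp =
    Lt hexp hexp
  | SymLt hexp hexp
  | Not hbexp
  | And hbexp hbexp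

datatype hcom =
    Nop
  | Set reg hexp            ("_ ::= _" [1000, 61] 61)
  | Put arr hexp hexp
  | CopySym hexp hexp
  | Then hcom hcom          (infixr ";;" 60)
  | If hbexp hcom hcom
  | Loop hbexp hcom

abbreviation Lit :: "nat \<Rightarrow> hexp" where "Lit \<equiv> Lin 0"

abbreviation When :: "hbexp \<Rightarrow> hcom \<Rightarrow> hcom" where "When b P \<equiv> If b P Nop"

record 'a hstate =
  size_of :: nat
  rg :: "reg \<Rightarrow> nat"
  ar :: "arr \<Rightarrow> nat \<Rightarrow> nat"
  sy :: "nat \<Rightarrow> 'a"

primrec ev :: "'a hstate \<Rightarrow> hexp \<Rightarrow> nat" where
  "ev s (Lin a b) = a * size_of s + b"
| "ev s (V x) = rg s x"
| "ev s (Arr k e) = ar s k (ev s e)"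
| "ev s (Inc e c) = ev s e + c"
| "ev s (Plus e f) = ev s e + ev s f"
| "ev s (Minus e f) = ev s e - ev s f"

text \<open>Sums of two variable quantities carry an overflow obligation; increments by constants do not,
  since the running time bounds their total effect. \<^const>\<open>Out\<close> is write-only because its cells
  \<open>0..2N-1\<close> sit below all other arrays.\<close>

primrec eok :: "'a hstate \<Rightarrow> hexp \<Rightarrow> bool" where
  "eok s (Lin a b) = (a \<le> 4 \<and> b \<le> 8)"
| "eok s (V x) = True"
| "eok s (Arr k e) = (k \<noteq> Out \<and> eok s e)"
| "eok s (Inc e c) = eok s e"
| "eok s (Plus e f) = (eok s e \<and> eok s f \<and> ev s e + ev s f \<le> 4 * size_of s + 8)"
| "eok s (Minus e f) = (eok s e \<and> eok s f)"

primrec bv :: "'a::linorder hstate \<Rightarrow> hbexp \<Rightarrow> bool" where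
  "bv s (Lt e f) = (ev s e < ev s f)"
| "bv s (SymLt e f) = (sy s (ev s e) < sy s (ev s f))"
| "bv s (Not b) = (\<not> bv s b)"
| "bv s (And b c) = (bv s b \<and> bv s c)"

primrec bok :: "'a hstate \<Rightarrow> hbexp \<Rightarrow> bool" where
  "bok s (Lt e f) = (eok s e \<and> eok s f)"
| "bok s (SymLt e f) = (eok s e \<and> eok s f)"
| "bok s (Not b) = bok s b"
| "bok s (And b c) = (bok s b \<and> bok s c)"

text \<open>Only loop iterations are charged: between two of them the running time is bounded by the
  program text.\<close>

inductive hexec :: "hcom \<Rightarrow> 'a::linorder hstate \<Rightarrow> nat \<Rightarrow> 'a hstate \<Rightarrow> bool" where
  "hexec Nop s 0 s"
| "eok s e \<Longrightarrow> hexec (x ::= e) s 0 (s\<lparr>rg := (rg s)(x := ev s e)\<rparr>)"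
| "eok s e \<Longrightarrow> eok s f \<Longrightarrow> k = Out \<longrightarrow> ev s e < 2 * size_of s \<Longrightarrow>
    hexec (Put k e f) s 0 (s\<lparr>ar := (ar s)(k := (ar s k)(ev s e := ev s f))\<rparr>)"
| "eok s e \<Longrightarrow> eok s f \<Longrightarrow> hexec (CopySym e f) s 0 (s\<lparr>sy := (sy s)(ev s e := sy s (ev s f))\<rparr>)"
| "hexec P s t s' \<Longrightarrow> hexec Q s' u s'' \<Longrightarrow> hexec (P ;; Q) s (t + u) s''"
| "bok s b \<Longrightarrow> bv s b \<Longrightarrow> hexec P s t s' \<Longrightarrow> hexec (If b P Q) s t s'"
| "bok s b \<Longrightarrow> \<not> bv s b \<Longrightarrow> hexec Q s t s' \<Longrightarrow> hexec (If b P Q) s t s'"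
| "bok s b \<Longrightarrow> \<not> bv s b \<Longrightarrow> hexec (Loop b P) s 0 s"
| "bok s b \<Longrightarrow> bv s b \<Longrightarrow> hexec P s t s' \<Longrightarrow> hexec (Loop b P) s' u s'' \<Longrightarrow>
    hexec (Loop b P) s (Suc (t + u)) s''"

fun reg_name :: "reg \<Rightarrow> string" where
  "reg_name RK = ''K''" | "reg_name Ri = ''i''" | "reg_name Rr = ''r''" | "reg_name Rn = ''n''"
| "reg_name Rmode = ''mode''" | "reg_name Rlow = ''low''" | "reg_name Rhigh = ''high''"
| "reg_name Rpv = ''pv''" | "reg_name Rlt = ''lt''" | "reg_name Reqc = ''eqc''"
| "reg_name Rch = ''ch''" | "reg_name Rm = ''m''" | "reg_name Ra = ''a''" | "reg_name Rq = ''q''"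
| "reg_name Rx = ''x''" | "reg_name Ry = ''y''" | "reg_name Rlen = ''len''" | "reg_name Rs = ''s''"
| "reg_name Rth = ''th''" | "reg_name Ro = ''o''" | "reg_name Rje = ''je''" | "reg_name Rli = ''li''"
| "reg_name Rie = ''ie''" | "reg_name Rj = ''j''" | "reg_name Ru = ''u''" | "reg_name Rv = ''v''"
| "reg_name Rl = ''l''" | "reg_name Rtk = ''tk''" | "reg_name Rflat = ''flat''"
| "reg_name Rh = ''h''" | "reg_name RL = ''L''" | "reg_name RH = ''H''" | "reg_name Rk = ''k''"

lemma reg_name_inj: "reg_name x = reg_name y \<longleftrightarrow> x = y"
  by (cases x; cases y; simp)

lemma reg_name_N: "reg_name x \<noteq> ''N''"
  by (cases x) auto

fun arr_code :: "arr \<Rightarrow> nat" where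
  "arr_code Lab = 0" | "arr_code Fr = 1" | "arr_code En = 2" | "arr_code Act = 3"
| "arr_code Cls = 4" | "arr_code Tl = 5" | "arr_code Buf = 6" | "arr_code Buf2 = 7"
| "arr_code Lc = 8" | "arr_code Sd = 9" | "arr_code Tg = 10" | "arr_code Ix = 11"
| "arr_code Rnk = 12" | "arr_code Sa = 13" | "arr_code Tmp = 14" | "arr_code Cnt = 15"
| "arr_code Sa2 = 16" | "arr_code Rnk2 = 17" | "arr_code Out = 18"

lemma arr_code_inj: "arr_code x = arr_code y \<longleftrightarrow> x = y"
  by (cases x; cases y; simp)

lemma arr_code_less: "arr_code x < 20"
  by (cases x) auto

text \<open>Shifting the index by \<open>N\<close> puts every interleaved cell at
  \<open>20 * N\<close> or beyond, clear of the \<open>2 * N\<close> output cells. Interleaving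
  gives each array an unlimited index range without fixing lengths in advance; the factor 20 exceeds
  all codes.\<close>

definition address :: "nat \<Rightarrow> arr \<Rightarrow> nat \<Rightarrow> nat" where
  "address N k j = (if k = Out then j else 20 * (j + N) + arr_code k)"

lemma address_inj:
  assumes "k \<noteq> Out" "k' \<noteq> Out"
  shows "address N k j = address N k' j' \<longleftrightarrow> k = k' \<and> j = j'"
proof
  assume *: "address N k j = address N k' j'"
  then have "20 * (j + N) + arr_code k = 20 * (j' + N) + arr_code k'"
    using assms by (simp add: address_def)
  then have "j = j' \<and> arr_code k = arr_code k'"
    using arr_code_less[of k] arr_code_less[of k'] by presburger
  then show "k = k' \<and> j = j'" using arr_code_inj by simp
qed simp

lemma address_ge: "k \<noteq> Out \<Longrightarrow> 2 * N \<le> address N k j"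
  by (simp add: address_def)

primrec compile_exp :: "hexp \<Rightarrow> aexp" where
  "compile_exp (Lin a b) = Add (Mul (Const a) (Reg ''N'')) (Const b)"
| "compile_exp (V x) = Reg (reg_name x)"
| "compile_exp (Arr k e) = Mem (Add (Mul (Const 20) (Add (compile_exp e) (Reg ''N''))) (Const (arr_code k)))"
| "compile_exp (Inc e c) = Add (compile_exp e) (Const c)"
| "compile_exp (Plus e f) = Add (compile_exp e) (compile_exp f)"
| "compile_exp (Minus e f) = Sub (compile_exp e) (compile_exp f)"

primrec compile_bexp :: "hbexp \<Rightarrow> bexp" where
  "compile_bexp (Lt e f) = Less (compile_exp e) (compile_exp f)"
| "compile_bexp (SymLt e f) = SymLess (compile_exp e) (compile_exp f)"
| "compile_bexp (Not b) = Neg (compile_bexp b)"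
| "compile_bexp (And b c) = Conj (compile_bexp b) (compile_bexp c)"

primrec compile :: "hcom \<Rightarrow> com" where
  "compile Nop = Skip"
| "compile (x ::= e) = Assign (reg_name x) (compile_exp e)"
| "compile (Put k e f) = Store (if k = Out then compile_exp e else
     Add (Mul (Const 20) (Add (compile_exp e) (Reg ''N''))) (Const (arr_code k))) (compile_exp f)"
| "compile (CopySym e f) = Copy (compile_exp e) (compile_exp f)"
| "compile (P ;; Q) = Seq (compile P) (compile Q)"
| "compile (If b P Q) = Cond (compile_bexp b) (compile P) (compile Q)"
| "compile (Loop b P) = While (compile_bexp b) (compile P)"

text \<open>\<open>growth\<close> bounds how much a program without iterations can increase the largest stored value,
  \<open>steps\<close> how long it can run.\<close>

primrec exp_growth :: "hexp \<Rightarrow> nat" where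
  "exp_growth (Lin a b) = 0"
| "exp_growth (V x) = 0"
| "exp_growth (Arr k e) = exp_growth e"
| "exp_growth (Inc e c) = exp_growth e + c"
| "exp_growth (Plus e f) = exp_growth e + exp_growth f"
| "exp_growth (Minus e f) = exp_growth e + exp_growth f"

primrec bexp_growth :: "hbexp \<Rightarrow> nat" where
  "bexp_growth (Lt e f) = exp_growth e + exp_growth f"
| "bexp_growth (SymLt e f) = exp_growth e + exp_growth f"
| "bexp_growth (Not b) = bexp_growth b"
| "bexp_growth (And b c) = bexp_growth b + bexp_growth c"

primrec growth :: "hcom \<Rightarrow> nat" where
  "growth Nop = 0"
| "growth (x ::= e) = exp_growth e"
| "growth (Put k e f) = exp_growth e + exp_growth f"
| "growth (CopySym e f) = exp_growth e + exp_growth f"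
| "growth (P ;; Q) = growth P + growth Q"
| "growth (If b P Q) = bexp_growth b + growth P + growth Q"
| "growth (Loop b P) = bexp_growth b + growth P"

primrec steps :: "hcom \<Rightarrow> nat" where
  "steps Nop = 1"
| "steps (x ::= e) = atime (compile_exp e) + 1"
| "steps (Put k e f) = atime (compile_exp e) + atime (compile_exp f) + 8"
| "steps (CopySym e f) = atime (compile_exp e) + atime (compile_exp f) + 1"
| "steps (P ;; Q) = steps P + steps Q"
| "steps (If b P Q) = btime (compile_bexp b) + 1 + steps P + steps Q"
| "steps (Loop b P) = btime (compile_bexp b) + 1 + steps P"

section \<open>Simulation of the array language by the word machine\<close>

definition represents :: "'a hstate \<Rightarrow> 'a state \<Rightarrow> bool" where
  "represents s \<sigma> \<longleftrightarrow> regs \<sigma> ''N'' = size_of s \<and> (\<forall>x. regs \<sigma> (reg_name x) = rg s x) \<and>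
     (\<forall>k j. k \<noteq> Out \<longrightarrow> mem \<sigma> (address (size_of s) k j) = ar s k j) \<and>
     (\<forall>j<2 * size_of s. mem \<sigma> j = ar s Out j) \<and> syms \<sigma> = sy s"

text \<open>\<open>eok\<close> caps \<open>Lin\<close> terms and sums of variable quantities by
  \<open>4 * size_of s + 8\<close>. Keeping \<open>B\<close> above this cap is the reason why
  neither contributes to \<open>exp_growth\<close>.\<close>

definition values_below :: "'a hstate \<Rightarrow> nat \<Rightarrow> bool" where
  "values_below s B \<longleftrightarrow> (\<forall>x. rg s x \<le> B) \<and> (\<forall>k j. ar s k j \<le> B) \<and> 4 * size_of s + 8 \<le> B"

lemma values_below_mono: "values_below s B \<Longrightarrow> B \<le> C \<Longrightarrow> values_below s C"
  unfolding values_below_def by (meson order_trans)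

text \<open>The largest intermediate value of an evaluation is a cell address, 20 times an index
  shifted by \<open>N\<close>, plus a code below 20. The last premise keeps that below
  \<open>2 ^ w\<close>, so no reduction modulo \<open>2 ^ w\<close> takes effect.\<close>

lemma compile_exp:
  assumes "represents s \<sigma>" "values_below s B" "eok s e" "20 * (B + exp_growth e + size_of s) + 20 < 2 ^ w"
  shows "aval w \<sigma> (compile_exp e) = ev s e" "ev s e \<le> B + exp_growth e"
proof -
  have "aval w \<sigma> (compile_exp e) = ev s e \<and> ev s e \<le> B + exp_growth e"
    using assms(3,4)
  proof (induction e)
    case (Lin a b)
    have "a * size_of s \<le> 4 * size_of s" using Lin by simp
    moreover have "b \<le> 8" "4 * size_of s + 8 \<le> B" using Lin assms(2) by (simp_all add: values_below_def)
    ultimately have "a * size_of s + b \<le> B" by linarith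
    moreover have "a * size_of s + b < 2 ^ w" "a * size_of s < 2 ^ w" "b < 2 ^ w" "a < 2 ^ w"
      using calculation Lin by (simp_all add: assms(2))
    ultimately show ?case using assms(1) by (simp add: represents_def)
  next
    case (V x)
    then show ?case using assms(1,2) by (simp add: represents_def values_below_def)
  next
    case (Arr k e)
    then have IH: "aval w \<sigma> (compile_exp e) = ev s e" "ev s e \<le> B + exp_growth e" "k \<noteq> Out" by auto
    have N: "regs \<sigma> ''N'' = size_of s" using assms(1) by (simp add: represents_def)
    have c: "arr_code k < 20" by (rule arr_code_less)
    have "20 * (ev s e + size_of s) + arr_code k < 2 ^ w" "20 * (ev s e + size_of s) < 2 ^ w"
       "ev s e + size_of s < 2 ^ w" "20 < (2::nat) ^ w" "arr_code k < 2 ^ w"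
      using Arr.prems IH(2) c by simp_all
    then have "aval w \<sigma> (compile_exp (Arr k e)) = mem \<sigma> (address (size_of s) k (ev s e))"
      using IH N by (simp add: address_def)
    then show ?case using assms(1,2) IH(3)
      by (simp add: represents_def values_below_def trans_le_add1)
  next
    case (Inc e c)
    then have "aval w \<sigma> (compile_exp e) = ev s e" "ev s e \<le> B + exp_growth e" by auto
    moreover have "ev s e + c < 2 ^ w" "c < 2 ^ w" using Inc.prems calculation by simp_all
    ultimately show ?case by simp
  next
    case (Plus e f)
    then have "aval w \<sigma> (compile_exp e) = ev s e" "aval w \<sigma> (compile_exp f) = ev s f" by auto
    moreover have "ev s e + ev s f \<le> B" using Plus.prems assms(2) by (simp add: values_below_def)
    moreover have "B < 2 ^ w" using Plus.prems by simp
    ultimately show ?case by simp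
  next
    case (Minus e f)
    then have "aval w \<sigma> (compile_exp e) = ev s e" "aval w \<sigma> (compile_exp f) = ev s f"
      using Minus.prems by auto
    moreover have "eok s e" "20 * (B + exp_growth e + size_of s) + 20 < 2 ^ w" using Minus.prems by simp_all
    then have "ev s e \<le> B + exp_growth e" using Minus.IH(1) by blast
    ultimately show ?case by simp
  qed
  then show "aval w \<sigma> (compile_exp e) = ev s e" "ev s e \<le> B + exp_growth e" by auto
qed

lemma compile_bexp:
  assumes "represents s \<sigma>" "values_below s B" "bok s b" "20 * (B + bexp_growth b + size_of s) + 20 < 2 ^ w"
  shows "bval w \<sigma> (compile_bexp b) = bv s b"
  using assms(3,4)
proof (induction b)
  case (Lt e f)
  then show ?case using compile_exp(1)[OF assms(1,2)] by simp
next
  case (SymLt e f)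
  then show ?case using compile_exp(1)[OF assms(1,2)] assms(1) by (simp add: represents_def)
qed auto

lemma fits_mono:
  "20 * (B + x + N) + 20 < (W::nat) \<Longrightarrow> y \<le> x \<Longrightarrow> 20 * (B + y + N) + 20 < W"
  "20 * (B + x + N) + 20 < (W::nat) \<Longrightarrow> y + z \<le> x \<Longrightarrow> 20 * (B + y + z + N) + 20 < W"
  by simp_all

text \<open>A run with \<open>t\<close> iterations is charged as \<open>t + 1\<close> stretches free
  of iterations, each bounded by the program text. In the loop case the additional iteration
  supplies the unit that joins \<open>t + 1\<close> and \<open>u + 1\<close>. The same count bounds
  time and the growth of values, which rules out overflow of increments without range
  invariants.\<close>

lemma compile_correct:
  assumes "hexec P s t s'" "represents s \<sigma>" "values_below s B"
    "20 * (B + growth P * (t + 1) + size_of s) + 20 < 2 ^ w"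
  shows "\<exists>u \<sigma>'. exec w (compile P) \<sigma> u \<sigma>' \<and> u \<le> steps P * (t + 1) \<and> represents s' \<sigma>' \<and>
    values_below s' (B + growth P * (t + 1)) \<and> size_of s' = size_of s"
  using assms
proof (induction arbitrary: \<sigma> B rule: hexec.induct)
  case (1 s)
  have "exec w Skip \<sigma> 1 \<sigma>" by (rule exec.Skip)
  then show ?case using 1 by auto
next
  case (2 s e x)
  note v = compile_exp[OF 2(2,3,1), of w]
  have v1: "aval w \<sigma> (compile_exp e) = ev s e" "ev s e \<le> B + exp_growth e" using v 2(4) by auto
  let ?\<sigma> = "\<sigma>\<lparr>regs := (regs \<sigma>)(reg_name x := ev s e)\<rparr>"
  have "exec w (compile (x ::= e)) \<sigma> (atime (compile_exp e) + 1) ?\<sigma>"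
    using exec.Assign[of w "reg_name x" "compile_exp e" \<sigma>] v1 by simp
  moreover have "represents (s\<lparr>rg := (rg s)(x := ev s e)\<rparr>) ?\<sigma>"
    using 2(2) reg_name_N[of x] by (auto simp: represents_def reg_name_inj)
  moreover have "values_below (s\<lparr>rg := (rg s)(x := ev s e)\<rparr>) (B + exp_growth e)"
    using 2(3) v1(2) by (auto simp: values_below_def trans_le_add1)
  ultimately show ?case by (intro exI[of _ "atime (compile_exp e) + 1"] exI[of _ ?\<sigma>]) auto
next
  case (3 s e f k)
  note N = 3(6)
  have v1: "aval w \<sigma> (compile_exp e) = ev s e" "ev s e \<le> B + exp_growth e"
    using compile_exp[OF 3(4,5,1), of w] N by auto
  have v2: "aval w \<sigma> (compile_exp f) = ev s f" "ev s f \<le> B + exp_growth f"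
    using compile_exp[OF 3(4,5,2), of w] N by auto
  have R: "regs \<sigma> ''N'' = size_of s" using 3(4) by (simp add: represents_def)
  have c: "arr_code k < 20" by (rule arr_code_less)
  let ?a = "if k = Out then compile_exp e else
     Add (Mul (Const 20) (Add (compile_exp e) (Reg ''N''))) (Const (arr_code k))"
  have "20 * (ev s e + size_of s) + arr_code k < 2 ^ w" "20 * (ev s e + size_of s) < 2 ^ w"
       "ev s e + size_of s < 2 ^ w" "20 < (2::nat) ^ w" "arr_code k < 2 ^ w"
    using N v1(2) c by simp_all
  then have a: "aval w \<sigma> ?a = address (size_of s) k (ev s e)"
    using v1(1) R by (simp add: address_def)
  let ?\<sigma> = "\<sigma>\<lparr>mem := (mem \<sigma>)(address (size_of s) k (ev s e) := ev s f)\<rparr>"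
  let ?s = "s\<lparr>ar := (ar s)(k := (ar s k)(ev s e := ev s f))\<rparr>"
  have "exec w (compile (Put k e f)) \<sigma> (atime ?a + atime (compile_exp f) + 1) ?\<sigma>"
    using exec.Store[of w ?a "compile_exp f" \<sigma>] v2(1) a by (simp del: aval.simps)
  moreover have "represents ?s ?\<sigma>"
  proof (cases "k = Out")
    case True
    then have lt: "ev s e < 2 * size_of s" using 3(3) by simp
    have "address (size_of s) k' j \<noteq> ev s e" if "k' \<noteq> Out" for k' j
      using address_ge[OF that, of "size_of s" j] lt by simp
    then show ?thesis using True 3(4) by (auto simp: represents_def address_def)
  next
    case False
    have "address (size_of s) k (ev s e) \<noteq> j" if "j < 2 * size_of s" for j
      using address_ge[OF False, of "size_of s" "ev s e"] that by simp
    then show ?thesis using False 3(4) address_inj[of _ k] by (auto simp: represents_def)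
  qed
  moreover have "values_below ?s (B + growth (Put k e f) * (0 + 1))"
    using 3(5) v2(2) by (auto simp: values_below_def trans_le_add1)
  moreover have "atime ?a + atime (compile_exp f) + 1 \<le> steps (Put k e f) * (0 + 1)" by simp
  moreover have "size_of ?s = size_of s" by simp
  ultimately show ?case by blast
next
  case (4 s e f)
  have v1: "aval w \<sigma> (compile_exp e) = ev s e"
    using compile_exp[OF 4(3,4,1)] 4(5) by auto
  have v2: "aval w \<sigma> (compile_exp f) = ev s f"
    using compile_exp[OF 4(3,4,2)] 4(5) by auto
  have S: "syms \<sigma> = sy s" using 4(3) by (simp add: represents_def)
  let ?\<sigma> = "\<sigma>\<lparr>syms := (sy s)(ev s e := sy s (ev s f))\<rparr>"
  have "exec w (compile (CopySym e f)) \<sigma> (atime (compile_exp e) + atime (compile_exp f) + 1) ?\<sigma>"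
    using exec.Copy[of w "compile_exp e" "compile_exp f" \<sigma>] v1 v2 S by simp
  moreover have "represents (s\<lparr>sy := (sy s)(ev s e := sy s (ev s f))\<rparr>) ?\<sigma>"
    using 4(3) by (auto simp: represents_def)
  moreover have "values_below (s\<lparr>sy := (sy s)(ev s e := sy s (ev s f))\<rparr>) (B + growth (CopySym e f) * (0 + 1))"
    using 4(4) by (auto simp: values_below_def trans_le_add1)
  ultimately show ?case by (intro exI[of _ "atime (compile_exp e) + atime (compile_exp f) + 1"] exI[of _ ?\<sigma>]) auto
next
  case (5 P s t s' Q u s'')
  let ?g = "growth P" and ?h = "growth Q"
  have le: "?g * (t + 1) + ?h * (u + 1) \<le> growth (P ;; Q) * (t + u + 1)"
    by (simp add: algebra_simps)
  have le1: "?g * (t + 1) \<le> growth (P ;; Q) * (t + u + 1)"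
    by (rule order_trans[OF le_add1 le])
  have "20 * (B + ?g * (t + 1) + size_of s) + 20 < 2 ^ w" by (rule fits_mono(1)[OF 5(7) le1])
  from 5(3)[OF 5(5,6) this] obtain k1 \<sigma>1 where 1: "exec w (compile P) \<sigma> k1 \<sigma>1"
    "k1 \<le> steps P * (t + 1)" "represents s' \<sigma>1" "values_below s' (B + ?g * (t + 1))"
    "size_of s' = size_of s" by auto
  have "20 * (B + ?g * (t + 1) + ?h * (u + 1) + size_of s') + 20 < 2 ^ w"
    unfolding 1(5) by (rule fits_mono(2)[OF 5(7) le])
  from 5(4)[OF 1(3,4) this] obtain k2 \<sigma>2 where 2: "exec w (compile Q) \<sigma>1 k2 \<sigma>2"
    "k2 \<le> steps Q * (u + 1)" "represents s'' \<sigma>2"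
    "values_below s'' (B + ?g * (t + 1) + ?h * (u + 1))" "size_of s'' = size_of s'" by auto
  have "exec w (compile (P ;; Q)) \<sigma> (k1 + k2) \<sigma>2" using exec.Seq[OF 1(1) 2(1)] by simp
  moreover have "steps P * (t + 1) + steps Q * (u + 1) \<le> steps (P ;; Q) * (t + u + 1)"
    by (simp add: algebra_simps)
  then have "k1 + k2 \<le> steps (P ;; Q) * (t + u + 1)" using 1(2) 2(2) by linarith
  moreover have "values_below s'' (B + growth (P ;; Q) * (t + u + 1))"
    using 2(4) by (rule values_below_mono) (use add_left_mono[OF le, of B] in \<open>simp only: add.assoc\<close>)
  ultimately show ?case using 2(3,5) 1(5) by metis
next
  case (6 s b P t s' Q)
  let ?G = "growth (If b P Q) * (t + 1)"
  have le: "growth P * (t + 1) \<le> ?G" "bexp_growth b \<le> ?G" by (auto simp: algebra_simps)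
  have "20 * (B + growth P * (t + 1) + size_of s) + 20 < 2 ^ w" by (rule fits_mono(1)[OF 6(7) le(1)])
  from 6(4)[OF 6(5,6) this] obtain k1 \<sigma>1 where 1: "exec w (compile P) \<sigma> k1 \<sigma>1"
    "k1 \<le> steps P * (t + 1)" "represents s' \<sigma>1" "values_below s' (B + growth P * (t + 1))"
    "size_of s' = size_of s" by auto
  have "20 * (B + bexp_growth b + size_of s) + 20 < 2 ^ w" by (rule fits_mono(1)[OF 6(7) le(2)])
  from compile_bexp[OF 6(5,6,1) this] have "bval w \<sigma> (compile_bexp b)" using 6(2) by simp
  from exec.CondTrue[OF this 1(1)]
  have "exec w (compile (If b P Q)) \<sigma> (btime (compile_bexp b) + 1 + k1) \<sigma>1" by simp
  moreover have "btime (compile_bexp b) + 1 + steps P * (t + 1) \<le> steps (If b P Q) * (t + 1)"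
    by (simp add: algebra_simps)
  then have "btime (compile_bexp b) + 1 + k1 \<le> steps (If b P Q) * (t + 1)" using 1(2) by linarith
  moreover have "values_below s' (B + ?G)" using 1(4) by (rule values_below_mono) (intro add_left_mono le(1))
  ultimately show ?case using 1(3,5) by metis
next
  case (7 s b Q t s' P)
  let ?G = "growth (If b P Q) * (t + 1)"
  have le: "growth Q * (t + 1) \<le> ?G" "bexp_growth b \<le> ?G" by (auto simp: algebra_simps)
  have "20 * (B + growth Q * (t + 1) + size_of s) + 20 < 2 ^ w" by (rule fits_mono(1)[OF 7(7) le(1)])
  from 7(4)[OF 7(5,6) this] obtain k1 \<sigma>1 where 1: "exec w (compile Q) \<sigma> k1 \<sigma>1"
    "k1 \<le> steps Q * (t + 1)" "represents s' \<sigma>1" "values_below s' (B + growth Q * (t + 1))"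
    "size_of s' = size_of s" by auto
  have "20 * (B + bexp_growth b + size_of s) + 20 < 2 ^ w" by (rule fits_mono(1)[OF 7(7) le(2)])
  from compile_bexp[OF 7(5,6,1) this] have "\<not> bval w \<sigma> (compile_bexp b)" using 7(2) by simp
  from exec.CondFalse[OF this 1(1)]
  have "exec w (compile (If b P Q)) \<sigma> (btime (compile_bexp b) + 1 + k1) \<sigma>1" by simp
  moreover have "btime (compile_bexp b) + 1 + steps Q * (t + 1) \<le> steps (If b P Q) * (t + 1)"
    by (simp add: algebra_simps)
  then have "btime (compile_bexp b) + 1 + k1 \<le> steps (If b P Q) * (t + 1)" using 1(2) by linarith
  moreover have "values_below s' (B + ?G)" using 1(4) by (rule values_below_mono) (intro add_left_mono le(1))
  ultimately show ?case using 1(3,5) by metis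
next
  case (8 s b P)
  have "20 * (B + bexp_growth b + size_of s) + 20 < 2 ^ w" using 8(5) by (simp add: algebra_simps)
  from compile_bexp[OF 8(3,4,1) this] have "\<not> bval w \<sigma> (compile_bexp b)" using 8(2) by simp
  from exec.WhileFalse[OF this]
  have "exec w (compile (Loop b P)) \<sigma> (btime (compile_bexp b) + 1) \<sigma>" by simp
  moreover have "values_below s (B + growth (Loop b P) * (0 + 1))"
    using 8(4) by (rule values_below_mono) simp
  ultimately show ?case using 8(3) by (intro exI[of _ "btime (compile_bexp b) + 1"] exI[of _ \<sigma>]) auto
next
  case (9 s b P t s' u s'')
  let ?G = "growth (Loop b P)"
  have le: "growth P * (t + 1) \<le> ?G * (t + 1)" "bexp_growth b \<le> ?G * (t + 1)" 
    "?G * (t + 1) + ?G * (u + 1) = ?G * (Suc (t + u) + 1)"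
    "?G * (t + 1) \<le> ?G * (Suc (t + u) + 1)" by (auto simp: algebra_simps)
  note le = le order_trans[OF le(1,4)] order_trans[OF le(2,4)]
  have "20 * (B + growth P * (t + 1) + size_of s) + 20 < 2 ^ w" by (rule fits_mono(1)[OF 9(9) le(5)])
  from 9(5)[OF 9(7,8) this] obtain k1 \<sigma>1 where 1: "exec w (compile P) \<sigma> k1 \<sigma>1"
    "k1 \<le> steps P * (t + 1)" "represents s' \<sigma>1" "values_below s' (B + growth P * (t + 1))"
    "size_of s' = size_of s" by auto
  have 14: "values_below s' (B + ?G * (t + 1))" using 1(4) by (rule values_below_mono) (intro add_left_mono le(1))
  have "20 * (B + ?G * (t + 1) + ?G * (u + 1) + size_of s') + 20 < 2 ^ w" unfolding 1(5) by (rule fits_mono(2)[OF 9(9) eq_imp_le[OF le(3)]])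
  from 9(6)[OF 1(3) 14 this] obtain k2 \<sigma>2 where 2: "exec w (compile (Loop b P)) \<sigma>1 k2 \<sigma>2"
    "k2 \<le> steps (Loop b P) * (u + 1)" "represents s'' \<sigma>2"
    "values_below s'' (B + ?G * (t + 1) + ?G * (u + 1))" "size_of s'' = size_of s'" by auto
  have "20 * (B + bexp_growth b + size_of s) + 20 < 2 ^ w" by (rule fits_mono(1)[OF 9(9) le(6)])
  from compile_bexp[OF 9(7,8,1) this] have "bval w \<sigma> (compile_bexp b)" using 9(2) by simp
  from exec.WhileTrue[OF this 1(1)] 2(1)
  have "exec w (compile (Loop b P)) \<sigma> (btime (compile_bexp b) + 1 + k1 + k2) \<sigma>2" by simp
  moreover have "btime (compile_bexp b) + 1 + steps P * (t + 1) + steps (Loop b P) * (u + 1)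
      \<le> steps (Loop b P) * (Suc (t + u) + 1)"
    by (simp add: algebra_simps)
  then have "btime (compile_bexp b) + 1 + k1 + k2 \<le> steps (Loop b P) * (Suc (t + u) + 1)"
    using 1(2) 2(2) by linarith
  moreover have "values_below s'' (B + ?G * (Suc (t + u) + 1))"
    using 2(4) unfolding le(3)[symmetric] by (simp only: add.assoc)
  ultimately show ?case using 2(3,5) 1(5) by metis
qed

section \<open>Weakest preconditions with time credits\<close>

text \<open>The postcondition receives the unspent credits, so that an invariant can trade them
  against a potential of the state.\<close>

definition wp :: "hcom \<Rightarrow> ('a::linorder hstate \<Rightarrow> nat \<Rightarrow> bool) \<Rightarrow> 'a hstate \<Rightarrow> nat \<Rightarrow> bool" where
  "wp P Q s n \<longleftrightarrow> (\<exists>t s'. hexec P s t s' \<and> t \<le> n \<and> Q s' (n - t))"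

primrec mod_regs :: "hcom \<Rightarrow> reg set" where
  "mod_regs Nop = {}"
| "mod_regs (x ::= e) = {x}"
| "mod_regs (Put k e f) = {}"
| "mod_regs (CopySym e f) = {}"
| "mod_regs (P ;; Q) = mod_regs P \<union> mod_regs Q"
| "mod_regs (If b P Q) = mod_regs P \<union> mod_regs Q"
| "mod_regs (Loop b P) = mod_regs P"

primrec mod_arrs :: "hcom \<Rightarrow> arr set" where
  "mod_arrs Nop = {}"
| "mod_arrs (x ::= e) = {}"
| "mod_arrs (Put k e f) = {k}"
| "mod_arrs (CopySym e f) = {}"
| "mod_arrs (P ;; Q) = mod_arrs P \<union> mod_arrs Q"
| "mod_arrs (If b P Q) = mod_arrs P \<union> mod_arrs Q"
| "mod_arrs (Loop b P) = mod_arrs P"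

primrec mod_syms :: "hcom \<Rightarrow> bool" where
  "mod_syms Nop = False"
| "mod_syms (x ::= e) = False"
| "mod_syms (Put k e f) = False"
| "mod_syms (CopySym e f) = True"
| "mod_syms (P ;; Q) = (mod_syms P \<or> mod_syms Q)"
| "mod_syms (If b P Q) = (mod_syms P \<or> mod_syms Q)"
| "mod_syms (Loop b P) = mod_syms P"

definition frame :: "hcom \<Rightarrow> 'a hstate \<Rightarrow> 'a hstate \<Rightarrow> bool" where
  "frame P s s' \<longleftrightarrow> (\<forall>x. x \<notin> mod_regs P \<longrightarrow> rg s' x = rg s x) \<and>
     (\<forall>k. k \<notin> mod_arrs P \<longrightarrow> ar s' k = ar s k) \<and> (\<not> mod_syms P \<longrightarrow> sy s' = sy s) \<and>
     size_of s' = size_of s"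

lemma frame_refl: "frame P s s"
  by (simp add: frame_def)

lemma frame_trans: "frame P s s' \<Longrightarrow> frame P s' s'' \<Longrightarrow> frame P s s''"
  by (simp add: frame_def)

lemma hexec_frame: "hexec P s t s' \<Longrightarrow> frame P s s'"
  by (induction rule: hexec.induct) (auto simp: frame_def)

inductive_cases hexec_elims: "hexec Nop s t s'" "hexec (x ::= e) s t s'" "hexec (Put k e f) s t s'"
  "hexec (CopySym e f) s t s'" "hexec (P ;; Q) s t s'" "hexec (If b P Q) s t s'"

lemma wp_Nop [simp]: "wp Nop Q s n \<longleftrightarrow> Q s n"
  unfolding wp_def using hexec.intros(1)[of s] by (force elim: hexec_elims)

lemma wp_Set [simp]:
  "wp (x ::= e) Q s n \<longleftrightarrow> eok s e \<and> Q (s\<lparr>rg := (rg s)(x := ev s e)\<rparr>) n"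
  unfolding wp_def using hexec.intros(2)[of s e x] by (force elim: hexec_elims)

lemma wp_Put [simp]:
  "wp (Put k e f) Q s n \<longleftrightarrow> eok s e \<and> eok s f \<and> (k = Out \<longrightarrow> ev s e < 2 * size_of s) \<and>
   Q (s\<lparr>ar := (ar s)(k := (ar s k)(ev s e := ev s f))\<rparr>) n"
  unfolding wp_def using hexec.intros(3)[of s e f k] by (force elim: hexec_elims)

lemma wp_CopySym [simp]:
  "wp (CopySym e f) Q s n \<longleftrightarrow>
   eok s e \<and> eok s f \<and> Q (s\<lparr>sy := (sy s)(ev s e := sy s (ev s f))\<rparr>) n"
  unfolding wp_def using hexec.intros(4)[of s e f] by (force elim: hexec_elims)

lemma wp_Then [simp]: "wp (P ;; R) Q s n \<longleftrightarrow> wp P (wp R Q) s n"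
proof
  assume "wp P (wp R Q) s n"
  then obtain t s' u s'' where "hexec P s t s'" "t \<le> n" "hexec R s' u s''" "u \<le> n - t" "Q s'' (n - t - u)"
    unfolding wp_def by blast
  then show "wp (P ;; R) Q s n" unfolding wp_def
    by (intro exI[of _ "t + u"] exI[of _ s'']) (auto intro: hexec.intros(5))
next
  assume "wp (P ;; R) Q s n"
  then obtain t s' u s'' where "hexec P s t s'" "hexec R s' u s''" "t + u \<le> n" "Q s'' (n - (t + u))"
    unfolding wp_def by (auto elim: hexec_elims)
  then show "wp P (wp R Q) s n" unfolding wp_def
    by (intro exI[of _ t] exI[of _ s'] conjI exI[of _ u] exI[of _ s'']) auto
qed

lemma wp_If [simp]:
  "wp (If b P R) Q s n \<longleftrightarrow>
   bok s b \<and> (bv s b \<longrightarrow> wp P Q s n) \<and> (\<not> bv s b \<longrightarrow> wp R Q s n)"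
  unfolding wp_def by (cases "bv s b") (auto intro: hexec.intros(6,7) elim: hexec_elims)

text \<open>The frame is computed from the program text, so a specification has to mention only what
  changes.\<close>

lemma wp_use:
  assumes "wp P R s n" "\<And>s' n'. R s' n' \<Longrightarrow> frame P s s' \<Longrightarrow> Q s' n'"
  shows "wp P Q s n"
  using assms unfolding wp_def by (meson hexec_frame)

text \<open>Each iteration consumes one credit, so the credits themselves are the termination
  measure.\<close>

lemma wp_Loop:
  assumes "I s n"
    and "\<And>s' n'. I s' n' \<Longrightarrow> frame P s s' \<Longrightarrow>
      bok s' b \<and> (bv s' b \<longrightarrow> 0 < n' \<and> wp P I s' (n' - 1)) \<and> (\<not> bv s' b \<longrightarrow> Q s' n')"
  shows "wp (Loop b P) Q s n"
proof -
  have "I s' n' \<Longrightarrow> frame P s s' \<Longrightarrow> wp (Loop b P) Q s' n'" for s' n'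
  proof (induction n' arbitrary: s' rule: less_induct)
    case (less n')
    note * = assms(2)[OF less.prems]
    show ?case
    proof (cases "bv s' b")
      case False
      then show ?thesis using * unfolding wp_def by (intro exI[of _ 0] exI[of _ s']) (auto intro: hexec.intros(8))
    next
      case True
      then obtain t s'' where 1: "0 < n'" "hexec P s' t s''" "t \<le> n' - 1" "I s'' (n' - 1 - t)"
        using * unfolding wp_def by auto
      have "frame P s s''" using frame_trans[OF less.prems(2) hexec_frame[OF 1(2)]] .
      then have "wp (Loop b P) Q s'' (n' - 1 - t)" using less.IH[of "n' - 1 - t" s''] 1 by auto
      then obtain u s''' where 2: "hexec (Loop b P) s'' u s'''" "u \<le> n' - 1 - t" "Q s''' (n' - 1 - t - u)"
        unfolding wp_def by auto
      have "hexec (Loop b P) s' (Suc (t + u)) s'''" using hexec.intros(9)[OF _ True 1(2) 2(1)] * by simp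
      moreover have "Suc (t + u) \<le> n'" "n' - Suc (t + u) = n' - 1 - t - u" using 1 2 by auto
      ultimately show ?thesis using 2(3) unfolding wp_def by metis
    qed
  qed
  then show ?thesis using assms(1) frame_refl by blast
qed

definition For :: "reg \<Rightarrow> hexp \<Rightarrow> hcom \<Rightarrow> hcom" where
  "For x e P = (x ::= Lit 0 ;; Loop (Lt (V x) e) (P ;; x ::= Inc (V x) 1))"

lemma mod_For [simp]:
  "mod_regs (For x e P) = insert x (mod_regs P)"
  "mod_arrs (For x e P) = mod_arrs P"
  "mod_syms (For x e P) = mod_syms P"
  by (auto simp: For_def)

text \<open>The body has to return its credits untouched, that is, execute no iteration of its own;
  the whole loop then costs exactly \<open>m\<close>.\<close>

lemma wp_For:
  assumes e: "\<And>s'. frame (For x e P) s s' \<Longrightarrow> eok s' e \<and> ev s' e = m"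
    and I0: "I 0 (s\<lparr>rg := (rg s)(x := 0)\<rparr>)"
    and IS: "\<And>j s' n'. j < m \<Longrightarrow> rg s' x = j \<Longrightarrow> I j s' \<Longrightarrow> frame (For x e P) s s' \<Longrightarrow>
      wp P (\<lambda>s'' n''. n'' = n' \<and> rg s'' x = j \<and> I (Suc j) (s''\<lparr>rg := (rg s'')(x := Suc j)\<rparr>)) s' n'"
    and n: "m \<le> n"
    and Q: "\<And>s'. I m s' \<Longrightarrow> rg s' x = m \<Longrightarrow> frame (For x e P) s s' \<Longrightarrow> Q s' (n - m)"
  shows "wp (For x e P) Q s n"
  unfolding For_def
proof (subst wp_Then, subst wp_Set, intro conjI)
  let ?s = "s\<lparr>rg := (rg s)(x := ev s (Lit 0))\<rparr>"
  have fr0: "frame (For x e P) s ?s" by (simp add: frame_def)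
  have fr: "frame (For x e P) s s'" if "frame (P ;; x ::= Inc (V x) 1) ?s s'" for s'
    using frame_trans[OF fr0, of s'] that by (simp add: frame_def)
  show "eok s (Lit 0)" by simp
  show "wp (Loop (Lt (V x) e) (P ;; x ::= Inc (V x) 1)) Q ?s n"
  proof (rule wp_Loop[where I = "\<lambda>s' n'. \<exists>j\<le>m. rg s' x = j \<and> I j s' \<and> n' = n - j \<and> frame (For x e P) s s'"], goal_cases)
    case 1
    then show ?case using I0 fr0 by auto
  next
    case (2 s' n')
    from 2(1) obtain j where j: "j \<le> m" "rg s' x = j" "I j s'" "n' = n - j" "frame (For x e P) s s'" by blast
    have E: "eok s' e" "ev s' e = m" using e[OF j(5)] by auto
    show ?case
    proof (cases "j < m")
      case False
      then show ?thesis using j E Q[of s'] by auto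
    next
      case True
      have "wp P (wp (x ::= Inc (V x) 1) (\<lambda>s' n'. \<exists>j\<le>m. rg s' x = j \<and> I j s' \<and> n' = n - j \<and> frame (For x e P) s s')) s' (n' - 1)"
      proof (rule wp_use[OF IS[OF True j(2,3,5), of "n' - 1"]], goal_cases)
        case (1 s'' n'')
        have "frame (For x e P) s (s''\<lparr>rg := (rg s'')(x := Suc j)\<rparr>)"
          using j(5) 1(2) by (auto simp: frame_def)
        then show ?case using 1 j True by auto
      qed
      then show ?thesis using True j E n by auto
    qed
  qed
qed

section \<open>Suffixes and ranks\<close>

lemma text_suffix_Cons:
  "1 \<le> p \<Longrightarrow> p \<le> length T \<Longrightarrow> text_suffix T p = text_symbol T p # text_suffix T (Suc p)"
  by (cases p) (auto simp: text_suffix_def text_symbol_def Cons_nth_drop_Suc)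

lemma text_suffix_inj:
  "p \<in> {1..Suc (length T)} \<Longrightarrow> q \<in> {1..Suc (length T)} \<Longrightarrow> text_suffix T p = text_suffix T q \<Longrightarrow> p = q"
  by (drule arg_cong[of _ _ length]) (auto simp: text_suffix_def)

lemma text_suffix_less_iff:
  fixes T :: "'a::linorder list"
  shows "p \<in> {1..length T} \<Longrightarrow> q \<in> {1..length T} \<Longrightarrow> text_suffix T p < text_suffix T q \<longleftrightarrow>
    text_symbol T p < text_symbol T q \<or>
    text_symbol T p = text_symbol T q \<and> text_suffix T (Suc p) < text_suffix T (Suc q)"
  by (simp add: text_suffix_Cons)

text \<open>The shared stretch may end at \<open>Suc (length T)\<close>, where the suffix is empty
  and precedes all others.\<close>

lemma text_suffix_strip:
  fixes T :: "'a::linorder list"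
  assumes "\<And>d. d < l \<Longrightarrow> text_symbol T (p + d) = text_symbol T (q + d)"
    "1 \<le> p" "1 \<le> q" "p + l \<le> Suc (length T)" "q + l \<le> Suc (length T)"
  shows "text_suffix T p < text_suffix T q \<longleftrightarrow> text_suffix T (p + l) < text_suffix T (q + l)"
  using assms
proof (induction l)
  case (Suc l)
  have "text_suffix T p < text_suffix T q \<longleftrightarrow> text_suffix T (p + l) < text_suffix T (q + l)"
    using Suc by simp
  also have "\<dots> \<longleftrightarrow> text_suffix T (p + Suc l) < text_suffix T (q + Suc l)"
    using Suc.prems Suc.prems(1)[of l] by (subst text_suffix_less_iff) auto
  finally show ?case .
qed simp

text \<open>If one of the agreeing stretches used the last symbol, the other would show the
  endmarker at an earlier position. This keeps later accesses to symbols within the text.\<close>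

lemma agree_inside:
  assumes "endmarked T" "p \<in> {1..length T}" "q \<in> {1..length T}" "p \<noteq> q"
    "\<And>d. d < l \<Longrightarrow> text_symbol T (p + d) = text_symbol T (q + d)"
    "p + l \<le> Suc (length T)" "q + l \<le> Suc (length T)"
  shows "p + l \<le> length T" "q + l \<le> length T"
proof -
  have *: "a + l \<le> length T" if "a \<noteq> b" "1 \<le> a" "1 \<le> b" "a + l \<le> Suc (length T)" "b + l \<le> Suc (length T)"
    "\<And>d. d < l \<Longrightarrow> text_symbol T (a + d) = text_symbol T (b + d)" "a \<le> length T" for a b
  proof (rule ccontr)
    assume "\<not> ?thesis"
    then have a: "a + l = Suc (length T)" "0 < l" using that by auto
    then have "text_symbol T (b + (l - 1)) = text_symbol T (length T)"
      using that(6)[of "l - 1"] by (metis Suc_pred add_Suc_right diff_Suc_1 diff_less zero_less_one)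
    moreover have "1 \<le> b + (l - 1)" "b + (l - 1) < length T" using a that by auto
    ultimately show False using assms(1) unfolding endmarked_def by (metis less_irrefl)
  qed
  show "p + l \<le> length T" using *[of p q] assms by auto
  show "q + l \<le> length T" using *[of q p] assms by auto
qed

text \<open>Its cardinality is the rank minus one. Ranks are handled through this count, so
  \<open>suffix_array\<close> has to be unfolded in a single lemma only.\<close>

definition below :: "'a::linorder list \<Rightarrow> nat \<Rightarrow> nat set" where
  "below T p = {q \<in> {1..length T}. text_suffix T q < text_suffix T p}"

lemma finite_below [simp]: "finite (below T p)"
  by (simp add: below_def)

lemma suffix_of_rank:
  assumes "1 \<le> r" "r \<le> length T"
  shows "suffix_of_rank T r \<in> {1..length T}" "card (below T (suffix_of_rank T r)) = r - 1"
proof -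
  let ?N = "length T" and ?f = "text_suffix T" and ?sa = "suffix_array T"
  have set: "set ?sa = {1..?N}" "length ?sa = ?N" "distinct ?sa"
    unfolding suffix_array_def by (auto simp del: upt_Suc)
  have inj: "inj_on ?f {1..?N}" using text_suffix_inj[of _ T] by (intro inj_onI) auto
  have "distinct (map ?f ?sa)" unfolding distinct_map set(1) using set(3) inj by simp
  moreover have "sorted (map ?f ?sa)" unfolding suffix_array_def by simp
  ultimately have "sorted_wrt (<) (map ?f ?sa)" by (simp add: strict_sorted_iff)
  then have less: "j < k \<Longrightarrow> k < ?N \<Longrightarrow> ?f (?sa ! j) < ?f (?sa ! k)" for j k
    using sorted_wrt_nth_less[of "(<)" "map ?f ?sa" j k] set(2) by simp
  have less_iff: "j < ?N \<Longrightarrow> k < ?N \<Longrightarrow> ?f (?sa ! j) < ?f (?sa ! k) \<longleftrightarrow> j < k" for j k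
    using less[of j k] less[of k j] by (cases j k rule: linorder_cases) auto
  have r: "r - 1 < ?N" using assms by simp
  show "suffix_of_rank T r \<in> {1..?N}"
    unfolding suffix_of_rank_def using r set(2) nth_mem[of "r - 1" ?sa] by (simp only: set(1))
  have "below T (suffix_of_rank T r) = (\<lambda>j. ?sa ! j) ` {..<r - 1}"
  proof (intro equalityI subsetI)
    fix q assume q: "q \<in> below T (suffix_of_rank T r)"
    then have "q \<in> set ?sa" unfolding below_def set(1) by simp
    then obtain j where "j < ?N" "q = ?sa ! j" unfolding in_set_conv_nth using set(2) by auto
    then show "q \<in> (\<lambda>j. ?sa ! j) ` {..<r - 1}"
      using q less_iff[of j "r - 1"] r by (auto simp: below_def suffix_of_rank_def)
  next
    fix q assume "q \<in> (\<lambda>j. ?sa ! j) ` {..<r - 1}"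
    then obtain j where j: "j < r - 1" "q = ?sa ! j" by auto
    then have "q \<in> set ?sa" using r set(2) by auto
    then have "q \<in> {1..?N}" by (simp only: set(1))
    then show "q \<in> below T (suffix_of_rank T r)"
      using j less_iff[of j "r - 1"] r by (auto simp: below_def suffix_of_rank_def)
  qed
  moreover have "inj_on (\<lambda>j. ?sa ! j) {..<r - 1}"
    using set(2,3) r by (intro inj_onI) (auto simp: nth_eq_iff_index_eq)
  ultimately show "card (below T (suffix_of_rank T r)) = r - 1" by (simp add: card_image)
qed

lemma below_mono:
  "p \<in> {1..length T} \<Longrightarrow> text_suffix T p < text_suffix T q \<Longrightarrow> card (below T p) < card (below T q)"
  by (rule psubset_card_mono) (auto simp: below_def)

lemma suffix_less_iff_below:
  assumes "p \<in> {1..length T}" "q \<in> {1..length T}"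
  shows "text_suffix T p < text_suffix T q \<longleftrightarrow> card (below T p) < card (below T q)"
  using below_mono[of p T q] below_mono[of q T p] text_suffix_inj[of p T q] assms
  by (cases "text_suffix T p" "text_suffix T q" rule: linorder_cases) auto

lemma suffix_of_rank_eqI:
  assumes "p \<in> {1..length T}" "card (below T p) = R"
  shows "suffix_of_rank T (Suc R) = p"
proof -
  have "p \<notin> below T p" "below T p \<subseteq> {1..length T}" by (auto simp: below_def)
  then have "below T p \<subset> {1..length T}" using assms(1) by blast
  then have "R < length T" using psubset_card_mono[of "{1..length T}" "below T p"] assms(2) by simp
  then have *: "suffix_of_rank T (Suc R) \<in> {1..length T}" "card (below T (suffix_of_rank T (Suc R))) = R"
    using suffix_of_rank[of "Suc R" T] by auto
  then have "\<not> text_suffix T (suffix_of_rank T (Suc R)) < text_suffix T p"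
      "\<not> text_suffix T p < text_suffix T (suffix_of_rank T (Suc R))"
    unfolding suffix_less_iff_below[OF *(1) assms(1)] suffix_less_iff_below[OF assms(1) *(1)]
    using assms(2) by simp_all
  then have "text_suffix T (suffix_of_rank T (Suc R)) = text_suffix T p" by (simp add: not_less)
  then show ?thesis using text_suffix_inj[of _ T p] * assms(1) by auto
qed

section \<open>Merging runs of strings\<close>

definition key :: "'a hstate \<Rightarrow> nat \<Rightarrow> 'a \<times> nat" where
  "key s q = (sy s q, ar s Lab q)"

definition KeyLt :: "hexp \<Rightarrow> hexp \<Rightarrow> hbexp" where
  "KeyLt e f = Not (And (Not (SymLt e f)) (Not (And (Not (SymLt f e)) (Lt (Arr Lab e) (Arr Lab f)))))"

definition Eq :: "hexp \<Rightarrow> hexp \<Rightarrow> hbexp" where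
  "Eq e f = And (Not (Lt e f)) (Not (Lt f e))"

lemma bv_KeyLt [simp]: "bv s (KeyLt e f) \<longleftrightarrow> key s (ev s e) < key s (ev s f)"
  "bok s (KeyLt e f) \<longleftrightarrow> eok s e \<and> eok s f"
  by (auto simp: KeyLt_def key_def)

lemma bv_Eq [simp]: "bv s (Eq e f) \<longleftrightarrow> ev s e = ev s f" "bok s (Eq e f) \<longleftrightarrow> eok s e \<and> eok s f"
  by (auto simp: Eq_def)

text \<open>A position stands for a string of keys. In flat mode this is a single key; otherwise it extends
  to the next position (after the first) carrying the label \<open>N + 1\<close>, inclusively.\<close>

definition stops :: "'a hstate \<Rightarrow> nat \<Rightarrow> nat \<Rightarrow> bool" where
  "stops s u d \<longleftrightarrow> rg s Rflat \<noteq> 0 \<or> 0 < d \<and> ar s Lab (u + d) = Suc (size_of s)"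

definition strings :: "'a hstate \<Rightarrow> (nat \<Rightarrow> ('a \<times> nat) list) \<Rightarrow> nat set \<Rightarrow> bool" where
  "strings s S U \<longleftrightarrow> (\<forall>u\<in>U. S u \<noteq> [] \<and> u + length (S u) \<le> 2 * size_of s + 2 \<and>
     (\<forall>d<length (S u). S u ! d = key s (u + d) \<and> (stops s u d \<longleftrightarrow> Suc d = length (S u))))"

text \<open>\<open>S u \<le> S v\<close> is witnessed at offset \<open>l\<close>: there the first mismatch occurs, or both strings
  end without one.\<close>

definition le_at :: "(nat \<Rightarrow> 'b::linorder list) \<Rightarrow> nat \<Rightarrow> nat \<Rightarrow> nat \<Rightarrow> bool" where
  "le_at S u v l \<longleftrightarrow> l < length (S u) \<and> l < length (S v) \<and> take l (S u) = take l (S v) \<and>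
     (S u ! l < S v ! l \<or> S u ! l = S v ! l \<and> Suc l = length (S u) \<and> Suc l = length (S v))"

lemma append_less_append: "xs @ ys < xs @ zs \<longleftrightarrow> ys < (zs :: 'b::linorder list)"
  by (induction xs) auto

lemma le_at_le:
  assumes "le_at S u v l"
  shows "S u \<le> S v"
proof -
  have u: "S u = take l (S v) @ S u ! l # drop (Suc l) (S u)"
    using id_take_nth_drop[of l "S u"] assms by (simp add: le_at_def)
  have v: "S v = take l (S v) @ S v ! l # drop (Suc l) (S v)"
    using id_take_nth_drop[of l "S v"] assms by (simp add: le_at_def)
  show ?thesis
  proof (cases "S u ! l < S v ! l")
    case True
    then have "S u < S v" by (subst u, subst v) (simp add: append_less_append)
    then show ?thesis by simp
  next
    case False
    then have *: "S u ! l = S v ! l" "Suc l = length (S u)" "Suc l = length (S v)"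
      using assms by (auto simp: le_at_def)
    have "S u = S v" by (subst u, subst v) (use * in simp)
    then show ?thesis by simp
  qed
qed

text \<open>\<open>S u\<close> still agrees with \<open>S w\<close> at offset \<open>l < k\<close>,
  so \<open>S v\<close> departs from \<open>S u\<close> exactly where it departs from
  \<open>S w\<close>; they cannot both end there, as \<open>S w\<close> reaches beyond
  \<open>l\<close>. Hence two heads with different offsets against the last output are ordered
  without reading a key.\<close>

lemma le_at_jump:
  assumes "le_at S w u k" "le_at S w v l" "l < k"
  shows "le_at S u v l"
proof -
  have "S u ! l = S w ! l" using assms by (metis le_at_def nth_take)
  moreover have "take l (S u) = take l (S w)" using assms by (metis le_at_def min.absorb3 take_take)
  moreover have "Suc l \<noteq> length (S w)" using assms by (auto simp: le_at_def)
  ultimately show ?thesis using assms unfolding le_at_def by auto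
qed

definition merge_scan :: hcom where
  "merge_scan = Loop (And (Lt (V Rflat) (Lit 1))
     (And (Not (KeyLt (Plus (V Ru) (V Rl)) (Plus (V Rv) (V Rl))))
     (And (Not (KeyLt (Plus (V Rv) (V Rl)) (Plus (V Ru) (V Rl))))
       (Not (And (Lt (Lit 0) (V Rl)) (Eq (Arr Lab (Plus (V Ru) (V Rl))) (Lin 1 1)))))))
     (Rl ::= Inc (V Rl) 1)"

text \<open>\<open>Lc\<close> holds the offset of each head against the last element output. The
  head with the larger offset follows that element longer and is the smaller one; keys are scanned
  only on a tie, from the common offset on.\<close>

definition merge_pick :: hcom where
  "merge_pick = If (Lt (V Rli) (V Rie)) (If (Lt (V Rj) (V Rje))
     (Ru ::= Arr Buf (V Rli) ;; Rv ::= Arr Buf (V Rj) ;;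
      If (Lt (Arr Lc (V Rv)) (Arr Lc (V Ru))) (Rtk ::= Lit 1)
       (If (Lt (Arr Lc (V Ru)) (Arr Lc (V Rv))) (Rtk ::= Lit 0)
         (Rl ::= Arr Lc (V Ru) ;; merge_scan ;;
          If (KeyLt (Plus (V Rv) (V Rl)) (Plus (V Ru) (V Rl)))
            (Rtk ::= Lit 0 ;; Put Lc (V Ru) (V Rl))
            (Rtk ::= Lit 1 ;; Put Lc (V Rv) (V Rl)))))
     (Rtk ::= Lit 1)) (Rtk ::= Lit 0)"

definition merge_pair :: hcom where
  "merge_pair = Loop (Lt (V Ro) (V Rje)) (merge_pick ;;
     If (Lt (Lit 0) (V Rtk)) (Put Buf2 (V Ro) (Arr Buf (V Rli)) ;; Rli ::= Inc (V Rli) 1)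
       (Put Buf2 (V Ro) (Arr Buf (V Rj)) ;; Rj ::= Inc (V Rj) 1) ;;
     Ro ::= Inc (V Ro) 1)"

definition merge_pass :: hcom where
  "merge_pass = (Ro ::= Lit 0 ;; Loop (Lt (V Ro) (V Rlen))
     (Rli ::= V Ro ;;
      Rie ::= Plus (V Ro) (V Rs) ;; When (Lt (V Rlen) (V Rie)) (Rie ::= V Rlen) ;;
      Rj ::= V Rie ;;
      Rje ::= Plus (V Rie) (V Rs) ;; When (Lt (V Rlen) (V Rje)) (Rje ::= V Rlen) ;;
      merge_pair))"

text \<open>Every iteration raises the offset by one, which \<open>n' + l' = n + l\<close> records.
  The budget has to reach the end of only one of the strings, because strings that agree so far end
  together.\<close>

lemma wp_merge_scan:
  assumes S: "strings s S {u, v}" and uv: "rg s Ru = u" "rg s Rv = v" "rg s Rl = l"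
    and l: "l < length (S u)" "l < length (S v)" "take l (S u) = take l (S v)"
    and n: "length (S u) \<le> n + l + 1 \<or> length (S v) \<le> n + l + 1"
  shows "wp merge_scan (\<lambda>s' n'. \<exists>l'. rg s' Rl = l' \<and> l \<le> l' \<and> n' + l' = n + l \<and>
    (le_at S u v l' \<and> \<not> key s (v + l') < key s (u + l') \<or>
     le_at S v u l' \<and> key s (v + l') < key s (u + l'))) s n"
  unfolding merge_scan_def
proof (rule wp_Loop[where I = "\<lambda>s' n'. \<exists>l'. rg s' Rl = l' \<and> l \<le> l' \<and> n' + l' = n + l \<and>
    l' < length (S u) \<and> l' < length (S v) \<and> take l' (S u) = take l' (S v)"], goal_cases)
  case 1
  then show ?case using uv l by simp
next
  case (2 s' n')
  then obtain l' where l': "rg s' Rl = l'" "l \<le> l'" "n' + l' = n + l"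
    "l' < length (S u)" "l' < length (S v)" "take l' (S u) = take l' (S v)" by blast
  have fr [simp]: "rg s' Ru = u" "rg s' Rv = v" "rg s' Rflat = rg s Rflat" "ar s' = ar s" "sy s' = sy s"
    "size_of s' = size_of s" using 2(2) uv by (auto simp: frame_def)
  have [simp]: "key s' = key s" by (auto simp: key_def)
  have k: "S u ! l' = key s (u + l')" "S v ! l' = key s (v + l')"
    "stops s u l' \<longleftrightarrow> Suc l' = length (S u)" "stops s v l' \<longleftrightarrow> Suc l' = length (S v)"
    "u + length (S u) \<le> 2 * size_of s + 2" "v + length (S v) \<le> 2 * size_of s + 2"
    using S l' by (auto simp: strings_def)
  \<comment> \<open>A key contains the label, and the label decides whether the string stops there;
    so neither string can be a proper prefix of the other.\<close>
  have st: "key s (u + l') = key s (v + l') \<Longrightarrow> stops s u l' \<longleftrightarrow> stops s v l'"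
    by (auto simp: stops_def key_def)
  show ?case
  proof (cases "key s (u + l') = key s (v + l') \<and> \<not> stops s u l'")
    case True
    then have "Suc l' < length (S u)" "Suc l' < length (S v)" using st k l' by (auto simp: Suc_lessI)
    moreover have "take (Suc l') (S u) = take (Suc l') (S v)"
      using True k l' by (simp add: take_Suc_conv_app_nth)
    ultimately show ?thesis using True l' k n by (auto simp: stops_def)
  next
    case False
    then have "\<not> bv s' (And (Lt (V Rflat) (Lit 1))
     (And (Not (KeyLt (Plus (V Ru) (V Rl)) (Plus (V Rv) (V Rl))))
     (And (Not (KeyLt (Plus (V Rv) (V Rl)) (Plus (V Ru) (V Rl))))
       (Not (And (Lt (Lit 0) (V Rl)) (Eq (Arr Lab (Plus (V Ru) (V Rl))) (Lin 1 1)))))))"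
      using l'(1) by (auto simp: stops_def)
    moreover have "le_at S u v l' \<and> \<not> key s (v + l') < key s (u + l') \<or>
       le_at S v u l' \<and> key s (v + l') < key s (u + l')"
      using False k l' st by (auto simp: le_at_def)
    ultimately show ?thesis using l' k by auto
  qed
qed

text \<open>The loser's offset is updated to its offset against the winner. When the recorded
  offsets alone decide, the witness \<open>l\<close> is the loser's old offset, so that
  \<open>c(v := l)\<close> changes nothing and no credit is spent; this puts all cases into one
  form.\<close>

lemma wp_merge_pick:
  assumes S: "strings s S (ar s Buf ` {rg s Rli..<rg s Rie} \<union> ar s Buf ` {rg s Rj..<rg s Rje})"
    and i: "i = rg s Rli" "ie = rg s Rie" and j: "j = rg s Rj" "je = rg s Rje"
    and u: "u = ar s Buf i" and v: "v = ar s Buf j" and c: "c = ar s Lc"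
    and ne: "i < ie \<or> j < je"
    and cmp: "i < ie \<Longrightarrow> j < je \<Longrightarrow> u \<noteq> v \<and> (c v < c u \<longrightarrow> le_at S u v (c v)) \<and>
      (c u < c v \<longrightarrow> le_at S v u (c u)) \<and> (c u = c v \<longrightarrow> c u < length (S u) \<and> c u < length (S v) \<and>
        take (c u) (S u) = take (c u) (S v))"
    and n: "i < ie \<Longrightarrow> j < je \<Longrightarrow> length (S v) \<le> n + c v + 1"
  shows "wp merge_pick (\<lambda>s' n'.
    rg s' Rtk > 0 \<and> i < ie \<and> (\<exists>l. c v \<le> l \<and> (j < je \<longrightarrow> le_at S u v l) \<and>
       (j < je \<and> ar s' Lc = c(v := l) \<and> n' + l = n + c v \<or> \<not> j < je \<and> ar s' Lc = c \<and> n' = n)) \<or>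
    rg s' Rtk = 0 \<and> j < je \<and> (\<exists>l. c u \<le> l \<and> (i < ie \<longrightarrow> le_at S v u l) \<and>
       (i < ie \<and> ar s' Lc = c(u := l) \<and> n' + l = n + c u \<or> \<not> i < ie \<and> ar s' Lc = c \<and> n' = n))) s n"
proof (cases "i < ie \<and> j < je \<and> c u = c v")
  case True
  then have T: "i < ie" "j < je" "c u = c v" by auto
  have "strings s S {u, v}" using S T u v unfolding i j strings_def by auto
  then have S': "strings (s\<lparr>rg := (rg s)(Ru := u, Rv := v, Rl := c v)\<rparr>) S {u, v}"
    by (auto simp: strings_def stops_def key_def)
  have l: "c v < length (S u)" "c v < length (S v)" "take (c v) (S u) = take (c v) (S v)"
    using cmp T by auto
  note scan = wp_merge_scan[OF S' _ _ _ l, of n]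
  have lens: "u + length (S u) \<le> 2 * size_of s + 2" "v + length (S v) \<le> 2 * size_of s + 2"
    using \<open>strings s S {u, v}\<close> by (auto simp: strings_def)
  have "wp merge_scan (wp (If (KeyLt (Plus (V Rv) (V Rl)) (Plus (V Ru) (V Rl)))
            (Rtk ::= Lit 0 ;; Put Lc (V Ru) (V Rl))
            (Rtk ::= Lit 1 ;; Put Lc (V Rv) (V Rl))) (\<lambda>s' n'.
    rg s' Rtk > 0 \<and> i < ie \<and> (\<exists>l. c v \<le> l \<and> (j < je \<longrightarrow> le_at S u v l) \<and>
       (j < je \<and> ar s' Lc = c(v := l) \<and> n' + l = n + c v \<or> \<not> j < je \<and> ar s' Lc = c \<and> n' = n)) \<or>
    rg s' Rtk = 0 \<and> j < je \<and> (\<exists>l. c u \<le> l \<and> (i < ie \<longrightarrow> le_at S v u l) \<and>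
       (i < ie \<and> ar s' Lc = c(u := l) \<and> n' + l = n + c u \<or> \<not> i < ie \<and> ar s' Lc = c \<and> n' = n))))
     (s\<lparr>rg := (rg s)(Ru := u, Rv := v, Rl := c v)\<rparr>) n"
  proof (rule wp_use[OF scan], goal_cases)
    case (5 s' n')
    from 5(1) obtain l' where l': "rg s' Rl = l'" "c v \<le> l'" "n' + l' = n + c v"
      "le_at S u v l' \<and> \<not> key s (v + l') < key s (u + l') \<or>
       le_at S v u l' \<and> key s (v + l') < key s (u + l')" by (auto simp: key_def)
    have fr: "rg s' Ru = u" "rg s' Rv = v" "ar s' = ar s" "sy s' = sy s" "size_of s' = size_of s"
      using 5(2) by (auto simp: frame_def merge_scan_def)
    have k: "key s' = key s" using fr by (auto simp: key_def)
    have "l' < length (S u)" "l' < length (S v)" using l'(4) by (auto simp: le_at_def)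
    then show ?case using l' T fr k lens c by auto
  qed (use n T in auto)
  then show ?thesis using True u v c unfolding merge_pick_def i j by (simp add: fun_upd_twist)
next
  case False
  then consider "i < ie" "j < je" "c v < c u" | "i < ie" "j < je" "c u < c v" | "i < ie" "\<not> j < je"
    | "\<not> i < ie" "j < je" using ne by linarith
  then show ?thesis
  proof cases
    case 1
    then show ?thesis using cmp u v c unfolding merge_pick_def i j
      by (auto intro!: exI[of _ "c v"])
  next
    case 2
    then show ?thesis using cmp u v c unfolding merge_pick_def i j
      by (auto intro!: exI[of _ "c u"])
  next
    case 3
    then show ?thesis using c unfolding merge_pick_def i j by auto
  next
    case 4
    then show ?thesis using c unfolding merge_pick_def i j by auto
  qed
qed

text \<open>Positions \<open>B 0, \<dots>, B (n - 1)\<close> fall into sorted runs of length \<open>m\<close>; inside a run,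
  \<open>c\<close> records for each position where it exceeds its predecessor.\<close>

definition run_ok :: "(nat \<Rightarrow> 'b::linorder list) \<Rightarrow> nat \<Rightarrow> (nat \<Rightarrow> nat) \<Rightarrow> (nat \<Rightarrow> nat) \<Rightarrow> nat \<Rightarrow> bool" where
  "run_ok S m B c x \<longleftrightarrow> (if x mod m = 0 then c (B x) = 0 else le_at S (B (x - 1)) (B x) (c (B x)))"

lemma run_ok_cong:
  "B x = B' x \<Longrightarrow> B (x - 1) = B' (x - 1) \<Longrightarrow> c (B x) = c' (B' x) \<Longrightarrow> run_ok S m B c x = run_ok S m B' c' x"
  by (simp add: run_ok_def)

lemma mod_eq_0_iff_start:
  assumes "b mod k = 0" "b \<le> p" "p < b + k"
  shows "p mod k = 0 \<longleftrightarrow> p = (b::nat)"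
proof -
  obtain d where d: "p = b + d" "d < k" using assms(2,3) by (metis le_iff_add nat_add_left_cancel_less)
  have "p mod k = (b mod k + d) mod k" unfolding d(1) by (rule mod_add_left_eq[symmetric])
  then have "p mod k = d" using assms(1) d(2) by simp
  then show ?thesis using d by simp
qed

text \<open>\<open>w\<close> is the last element output for the current pair of runs. Before the
  first output the offset must be 0, which is what \<open>run_ok\<close> demands at the start of a
  run.\<close>

definition heads_ok :: "(nat \<Rightarrow> 'b::linorder list) \<Rightarrow> bool \<Rightarrow> nat \<Rightarrow> nat \<Rightarrow> nat \<Rightarrow> bool" where
  "heads_ok S first w u l \<longleftrightarrow> (if first then l = 0 else le_at S w u l)"

text \<open>The left run occupies the indices from \<open>b\<close> to \<open>ie - 1\<close>, the
  right run those from \<open>ie\<close> to \<open>je - 1\<close>; \<open>i\<close> and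
  \<open>j\<close> are the cursors and \<open>C\<close> below \<open>p\<close> is the output.
  Offsets are stored per text position, not per buffer index, so a single \<open>c\<close> describes
  the output, the rests of both runs and the later runs at the same time.\<close>

definition pair_inv :: "(nat \<Rightarrow> 'b::linorder list) \<Rightarrow> (nat \<Rightarrow> nat) \<Rightarrow> nat \<Rightarrow> nat \<Rightarrow> nat \<Rightarrow> nat \<Rightarrow>
    nat \<Rightarrow> nat \<Rightarrow> nat \<Rightarrow> nat \<Rightarrow> (nat \<Rightarrow> nat) \<Rightarrow> (nat \<Rightarrow> nat) \<Rightarrow> bool" where
  "pair_inv S B m b ie je len i j p C c \<longleftrightarrow> 
     b \<le> i \<and> i \<le> ie \<and> ie \<le> j \<and> j \<le> je \<and> je \<le> len \<and> p = i + (j - ie) \<and> je \<le> b + 2 * m \<and> b mod (2 * m) = 0 \<and>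
     C ` {..<p} = B ` ({..<i} \<union> {ie..<j}) \<and>
     (\<forall>x<p. run_ok S (2 * m) C c x) \<and>
     (\<forall>x. i < x \<and> x < ie \<or> j < x \<and> x < je \<longrightarrow> le_at S (B (x - 1)) (B x) (c (B x))) \<and>
     (\<forall>x. je \<le> x \<and> x < len \<longrightarrow> run_ok S m B c x) \<and>
     (i < ie \<longrightarrow> heads_ok S (p = b) (C (p - 1)) (B i) (c (B i))) \<and>
     (j < je \<longrightarrow> heads_ok S (p = b) (C (p - 1)) (B j) (c (B j)))"

text \<open>Only the offset of the other head changes, and it now refers to the new last output
  \<open>B i\<close>. The successor of \<open>B i\<close> in its own run already carries its offset
  against \<open>B i\<close>.\<close>

lemma pair_inv_left:
  assumes inv: "pair_inv S B m b ie je len i j p C c" and inj: "inj_on B {..<len}" and i: "i < ie"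
    and c': "j < je \<longrightarrow> le_at S (B i) (B j) l \<and> c' = c(B j := l)" "\<not> j < je \<longrightarrow> c' = c"
  shows "pair_inv S B m b ie je len (Suc i) j (Suc p) (C(p := B i)) c'"
proof -
  have B: "x < len \<Longrightarrow> y < len \<Longrightarrow> B x = B y \<longleftrightarrow> x = y" for x y using inj by (auto dest: inj_onD)
  from inv have I: "b \<le> i" "i \<le> ie" "ie \<le> j" "j \<le> je" "je \<le> len" "p = i + (j - ie)" "je \<le> b + 2 * m"
    "b mod (2 * m) = 0" "C ` {..<p} = B ` ({..<i} \<union> {ie..<j})"
    and runs: "\<And>x. x < p \<Longrightarrow> run_ok S (2 * m) C c x"
    and rest: "\<And>x. i < x \<and> x < ie \<or> j < x \<and> x < je \<Longrightarrow> le_at S (B (x - 1)) (B x) (c (B x))"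
    and later: "\<And>x. je \<le> x \<and> x < len \<Longrightarrow> run_ok S m B c x"
    and hi: "heads_ok S (p = b) (C (p - 1)) (B i) (c (B i))"
    using i unfolding pair_inv_def by auto
  have c'_eq: "c' (B x) = c (B x)" if "x < len" "x \<noteq> j" for x
    using that c' B[of x j] I(1-7) by (cases "j < je") auto
  have c'_C: "c' (C x) = c (C x)" if "x < p" for x
  proof -
    have "C x \<in> B ` ({..<i} \<union> {ie..<j})" using that I(9) by blast
    then obtain y where y: "y \<in> {..<i} \<union> {ie..<j}" "C x = B y" by blast
    then have "y < len" "y \<noteq> j" using I(1-7) i by auto
    with y(2) show ?thesis using c'_eq by simp
  qed
  have p: "p mod (2 * m) = 0 \<longleftrightarrow> p = b"
    by (rule mod_eq_0_iff_start) (use I(1-8) i in auto)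
  have "(C(p := B i)) ` {..<Suc p} = insert (B i) (C ` {..<p})"
    by (auto simp: lessThan_Suc image_iff)
  also have "\<dots> = B ` ({..<Suc i} \<union> {ie..<j})" unfolding I(9) by (auto simp: lessThan_Suc)
  finally have img: "(C(p := B i)) ` {..<Suc p} = B ` ({..<Suc i} \<union> {ie..<j})" .
  have "run_ok S (2 * m) (C(p := B i)) c' x" if "x < Suc p" for x
  proof (cases "x = p")
    case True
    have "c' (B i) = c (B i)" using c'_eq[of i] I(1-7) i by simp
    moreover have "p \<noteq> b \<Longrightarrow> p - 1 \<noteq> p" using I(1,6) by simp
    ultimately show ?thesis using True hi p by (auto simp: run_ok_def heads_ok_def)
  next
    case False
    then have "x < p" using that by simp
    then have "run_ok S (2 * m) (C(p := B i)) c' x = run_ok S (2 * m) C c x"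
      by (intro run_ok_cong) (auto simp: c'_C)
    then show ?thesis using runs \<open>x < p\<close> by simp
  qed
  moreover have "le_at S (B (x - 1)) (B x) (c' (B x))" if "Suc i < x \<and> x < ie \<or> j < x \<and> x < je" for x
    using rest[of x] c'_eq[of x] that I(1-7) by auto
  moreover have "run_ok S m B c' x" if "je \<le> x \<and> x < len" for x
    using later[OF that] that c'_eq[of x] I(1-7) c' by (cases "j = x") (auto simp: run_ok_def)
  moreover have "heads_ok S (Suc p = b) ((C(p := B i)) (Suc p - 1)) (B (Suc i)) (c' (B (Suc i)))" if "Suc i < ie"
    using rest[of "Suc i"] that c'_eq[of "Suc i"] I(1-7) by (auto simp: heads_ok_def)
  moreover have "heads_ok S (Suc p = b) ((C(p := B i)) (Suc p - 1)) (B j) (c' (B j))" if "j < je"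
    using that c' I(1-7) by (auto simp: heads_ok_def)
  ultimately show ?thesis unfolding pair_inv_def using I(1-8) i img by auto
qed

lemma pair_inv_right:
  assumes inv: "pair_inv S B m b ie je len i j p C c" and inj: "inj_on B {..<len}" and j: "j < je"
    and c': "i < ie \<longrightarrow> le_at S (B j) (B i) l \<and> c' = c(B i := l)" "\<not> i < ie \<longrightarrow> c' = c"
  shows "pair_inv S B m b ie je len i (Suc j) (Suc p) (C(p := B j)) c'"
proof -
  have B: "x < len \<Longrightarrow> y < len \<Longrightarrow> B x = B y \<longleftrightarrow> x = y" for x y using inj by (auto dest: inj_onD)
  from inv have I: "b \<le> i" "i \<le> ie" "ie \<le> j" "j \<le> je" "je \<le> len" "p = i + (j - ie)" "je \<le> b + 2 * m"
    "b mod (2 * m) = 0" "C ` {..<p} = B ` ({..<i} \<union> {ie..<j})"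
    and runs: "\<And>x. x < p \<Longrightarrow> run_ok S (2 * m) C c x"
    and rest: "\<And>x. i < x \<and> x < ie \<or> j < x \<and> x < je \<Longrightarrow> le_at S (B (x - 1)) (B x) (c (B x))"
    and later: "\<And>x. je \<le> x \<and> x < len \<Longrightarrow> run_ok S m B c x"
    and hj: "heads_ok S (p = b) (C (p - 1)) (B j) (c (B j))"
    using j unfolding pair_inv_def by auto
  have c'_eq: "c' (B x) = c (B x)" if "x < len" "x \<noteq> i \<or> i = ie" for x
    using that c' B[of x i] I(1-7) j by (cases "i < ie") auto
  have c'_C: "c' (C x) = c (C x)" if "x < p" for x
  proof -
    have "C x \<in> B ` ({..<i} \<union> {ie..<j})" using that I(9) by blast
    then obtain y where y: "y \<in> {..<i} \<union> {ie..<j}" "C x = B y" by blast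
    then have "y < len" "y \<noteq> i \<or> i = ie" using I(1-7) j by auto
    with y(2) show ?thesis using c'_eq by simp
  qed
  have p: "p mod (2 * m) = 0 \<longleftrightarrow> p = b"
    by (rule mod_eq_0_iff_start) (use I(1-8) j in auto)
  have "(C(p := B j)) ` {..<Suc p} = insert (B j) (C ` {..<p})"
    by (auto simp: lessThan_Suc image_iff)
  also have "\<dots> = B ` ({..<i} \<union> {ie..<Suc j})" unfolding I(9) using I(3) by (auto simp: atLeastLessThanSuc)
  finally have img: "(C(p := B j)) ` {..<Suc p} = B ` ({..<i} \<union> {ie..<Suc j})" .
  have "run_ok S (2 * m) (C(p := B j)) c' x" if "x < Suc p" for x
  proof (cases "x = p")
    case True
    have "c' (B j) = c (B j)" using c'_eq[of j] I(1-7) j by auto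
    moreover have "p \<noteq> b \<Longrightarrow> p - 1 \<noteq> p" using I(1-3,6) by simp
    ultimately show ?thesis using True hj p by (auto simp: run_ok_def heads_ok_def)
  next
    case False
    then have "x < p" using that by simp
    then have "run_ok S (2 * m) (C(p := B j)) c' x = run_ok S (2 * m) C c x"
      by (intro run_ok_cong) (auto simp: c'_C)
    then show ?thesis using runs \<open>x < p\<close> by simp
  qed
  moreover have "le_at S (B (x - 1)) (B x) (c' (B x))" if "i < x \<and> x < ie \<or> Suc j < x \<and> x < je" for x
    using rest[of x] c'_eq[of x] that I(1-7) by auto
  moreover have "run_ok S m B c' x" if "je \<le> x \<and> x < len" for x
    using later[OF that] that c'_eq[of x] I(1-7) c' by (auto simp: run_ok_def)
  moreover have "heads_ok S (Suc p = b) ((C(p := B j)) (Suc p - 1)) (B (Suc j)) (c' (B (Suc j)))" if "Suc j < je"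
    using rest[of "Suc j"] that c'_eq[of "Suc j"] I(1-7) by (auto simp: heads_ok_def)
  moreover have "heads_ok S (Suc p = b) ((C(p := B j)) (Suc p - 1)) (B i) (c' (B i))" if "i < ie"
    using that c' I(1-7) by (auto simp: heads_ok_def)
  ultimately show ?thesis unfolding pair_inv_def using I(1-8) j img by auto
qed

text \<open>Every matching comparison raises some recorded offset, so the credits plus the sum of the
  offsets pay for the scans.\<close>

lemma wp_merge_pair:
  fixes s :: "'a::linorder hstate"
  defines "B \<equiv> ar s Buf"
  assumes S: "strings s S (B ` {..<len})" and inj: "inj_on B {..<len}"
    and inv: "pair_inv S B m b (rg s Rie) (rg s Rje) len (rg s Rli) (rg s Rj) (rg s Ro) (ar s Buf2) (ar s Lc)"
    and lc: "\<forall>u\<in>B ` {..<len}. ar s Lc u < length (S u)"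
    and n: "(\<Sum>u\<in>B ` {..<len}. length (S u)) + len \<le> n + (\<Sum>u\<in>B ` {..<len}. ar s Lc u) + rg s Ro"
  shows "wp merge_pair (\<lambda>s' n'.
     pair_inv S B m b (rg s Rie) (rg s Rje) len (rg s Rie) (rg s Rje) (rg s Rje) (ar s' Buf2) (ar s' Lc) \<and>
     rg s' Ro = rg s Rje \<and> (\<forall>u\<in>B ` {..<len}. ar s' Lc u < length (S u)) \<and>
     (\<forall>u. u \<notin> B ` {..<len} \<longrightarrow> ar s' Lc u = ar s Lc u) \<and>
     n' + (\<Sum>u\<in>B ` {..<len}. ar s' Lc u) + rg s' Ro = n + (\<Sum>u\<in>B ` {..<len}. ar s Lc u) + rg s Ro) s n"
  unfolding merge_pair_def
proof (rule wp_Loop[where I = "\<lambda>s' n'.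
     pair_inv S B m b (rg s Rie) (rg s Rje) len (rg s' Rli) (rg s' Rj) (rg s' Ro) (ar s' Buf2) (ar s' Lc) \<and>
     (\<forall>u\<in>B ` {..<len}. ar s' Lc u < length (S u)) \<and>
     (\<forall>u. u \<notin> B ` {..<len} \<longrightarrow> ar s' Lc u = ar s Lc u) \<and>
     n' + (\<Sum>u\<in>B ` {..<len}. ar s' Lc u) + rg s' Ro = n + (\<Sum>u\<in>B ` {..<len}. ar s Lc u) + rg s Ro"], goal_cases)
  case 1
  then show ?case using inv lc by simp
next
  case (2 s' n')
  let ?U = "B ` {..<len}" and ?ie = "rg s Rie" and ?je = "rg s Rje"
  define i where "i = rg s' Rli" 
  define j where "j = rg s' Rj"
  define p where "p = rg s' Ro"
  define C where "C = ar s' Buf2"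
  define c where "c = ar s' Lc"
  from 2(1) have inv: "pair_inv S B m b ?ie ?je len i j p C c" and lc: "\<forall>u\<in>?U. c u < length (S u)"
    and un: "\<forall>u. u \<notin> ?U \<longrightarrow> c u = ar s Lc u"
    and cr: "n' + (\<Sum>u\<in>?U. c u) + p = n + (\<Sum>u\<in>?U. ar s Lc u) + rg s Ro"
    unfolding i_def j_def p_def C_def c_def by auto
  have fr: "rg s' Rie = ?ie" "rg s' Rje = ?je" "ar s' Buf = B" "ar s' Lab = ar s Lab" "sy s' = sy s"
    "size_of s' = size_of s" "rg s' Rflat = rg s Rflat"
    using 2(2) by (auto simp: frame_def merge_pick_def merge_scan_def B_def)
  have S': "strings s' S ?U" using S fr by (simp add: strings_def stops_def key_def)
  have I: "b \<le> i" "i \<le> ?ie" "?ie \<le> j" "j \<le> ?je" "?je \<le> len" "p = i + (j - ?ie)"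
    using inv by (auto simp: pair_inv_def)
  show ?case
  proof (cases "p < ?je")
    case False
    then have "i = ?ie" "j = ?je" "p = ?je" using I by auto
    moreover have "rg s' Rli = i" "rg s' Rj = j" "rg s' Ro = p" "ar s' Buf2 = C" "ar s' Lc = c"
      by (simp_all add: i_def j_def p_def C_def c_def)
    ultimately show ?thesis using inv lc un cr fr by simp
  next
    case True
    let ?u = "B i" and ?v = "B j"
    have hi: "i < ?ie \<Longrightarrow> heads_ok S (p = b) (C (p - 1)) ?u (c ?u)"
      and hj: "j < ?je \<Longrightarrow> heads_ok S (p = b) (C (p - 1)) ?v (c ?v)"
      using inv by (auto simp: pair_inv_def)
    have cap: "(\<Sum>u\<in>?U. length (S u)) + len \<le> n' + (\<Sum>u\<in>?U. c u) + p" using n cr by linarith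
    \<comment> \<open>All other offsets stay below their string lengths, so the capacity left in the
      total is at least the capacity left in the one string about to be scanned.\<close>
    have bud: "length (S v) + len \<le> n' + c v + p" if "v \<in> ?U" for v
    proof -
      have "(\<Sum>u\<in>?U. c u) = c v + (\<Sum>u\<in>?U - {v}. c u)" 
        "(\<Sum>u\<in>?U. length (S u)) = length (S v) + (\<Sum>u\<in>?U - {v}. length (S u))"
        using that by (auto simp: sum.remove)
      moreover have "(\<Sum>u\<in>?U - {v}. c u) \<le> (\<Sum>u\<in>?U - {v}. length (S u))"
        using lc by (intro sum_mono) (auto intro: less_imp_le)
      ultimately show ?thesis using cap by linarith
    qed
    have n0: "0 < n'"
    proof -
      have "(\<Sum>u\<in>?U. c u) \<le> (\<Sum>u\<in>?U. length (S u))" using lc by (intro sum_mono) (auto intro: less_imp_le)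
      then show ?thesis using cap True I by linarith
    qed
    have cmp: "?u \<noteq> ?v \<and> (c ?v < c ?u \<longrightarrow> le_at S ?u ?v (c ?v)) \<and>
      (c ?u < c ?v \<longrightarrow> le_at S ?v ?u (c ?u)) \<and> (c ?u = c ?v \<longrightarrow> c ?u < length (S ?u) \<and> c ?u < length (S ?v) \<and>
        take (c ?u) (S ?u) = take (c ?u) (S ?v))" if ij: "i < ?ie" "j < ?je"
    proof (intro conjI impI)
      show "?u \<noteq> ?v" using inj ij I by (auto dest: inj_onD)
      assume *: "c ?v < c ?u"
      then show "le_at S ?u ?v (c ?v)"
        using hi[OF ij(1)] hj[OF ij(2)] le_at_jump by (auto simp: heads_ok_def split: if_splits)
    next
      assume *: "c ?u < c ?v"
      then show "le_at S ?v ?u (c ?u)"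
        using hi[OF ij(1)] hj[OF ij(2)] le_at_jump by (auto simp: heads_ok_def split: if_splits)
    next
      show "c ?u < length (S ?u)" using lc I ij by auto
      assume "c ?u = c ?v"
      then show "take (c ?u) (S ?u) = take (c ?u) (S ?v)" "c ?u < length (S ?v)"
        using hi[OF ij(1)] hj[OF ij(2)] lc I ij by (auto simp: heads_ok_def le_at_def split: if_splits)
    qed
    have S'': "strings s' S (ar s' Buf ` {rg s' Rli..<rg s' Rie} \<union> ar s' Buf ` {rg s' Rj..<rg s' Rje})"
      using S' I unfolding strings_def fr i_def j_def by auto
    have U: "i < ?ie \<Longrightarrow> ?u \<in> ?U" "j < ?je \<Longrightarrow> ?v \<in> ?U" using I by auto
    have pick: "wp merge_pick (wp (If (Lt (Lit 0) (V Rtk)) (Put Buf2 (V Ro) (Arr Buf (V Rli)) ;; Rli ::= Inc (V Rli) 1)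
       (Put Buf2 (V Ro) (Arr Buf (V Rj)) ;; Rj ::= Inc (V Rj) 1) ;;
     Ro ::= Inc (V Ro) 1) (\<lambda>s' n'.
     pair_inv S B m b (rg s Rie) (rg s Rje) len (rg s' Rli) (rg s' Rj) (rg s' Ro) (ar s' Buf2) (ar s' Lc) \<and>
     (\<forall>u\<in>B ` {..<len}. ar s' Lc u < length (S u)) \<and>
     (\<forall>u. u \<notin> B ` {..<len} \<longrightarrow> ar s' Lc u = ar s Lc u) \<and>
     n' + (\<Sum>u\<in>B ` {..<len}. ar s' Lc u) + rg s' Ro = n + (\<Sum>u\<in>B ` {..<len}. ar s Lc u) + rg s Ro)) s' (n' - 1)"
    proof (rule wp_use[OF wp_merge_pick[OF S'', of i ?ie j ?je ?u ?v c]], goal_cases)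
      case (11 s'' n'')
      have fr'': "rg s'' Rli = i" "rg s'' Rj = j" "rg s'' Ro = p" "ar s'' Buf = B" "ar s'' Buf2 = C"
        using 11(2) fr by (auto simp: frame_def merge_pick_def merge_scan_def i_def j_def p_def C_def)
      have sums: "(\<Sum>u\<in>?U. (c(w := l)) u) + c w = (\<Sum>u\<in>?U. c u) + l" if "w \<in> ?U" for w l
        using that by (simp add: sum.remove[of ?U w])
      from 11(1) show ?case
      proof
        assume *: "rg s'' Rtk > 0 \<and> i < ?ie \<and> (\<exists>l. c ?v \<le> l \<and> (j < ?je \<longrightarrow> le_at S ?u ?v l) \<and>
          (j < ?je \<and> ar s'' Lc = c(?v := l) \<and> n'' + l = n' - 1 + c ?v \<or> \<not> j < ?je \<and> ar s'' Lc = c \<and> n'' = n' - 1))"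
        then obtain l where l: "(j < ?je \<longrightarrow> le_at S ?u ?v l)"
          "(j < ?je \<and> ar s'' Lc = c(?v := l) \<and> n'' + l = n' - 1 + c ?v \<or> \<not> j < ?je \<and> ar s'' Lc = c \<and> n'' = n' - 1)"
          by blast
        have "pair_inv S B m b ?ie ?je len (Suc i) j (Suc p) (C(p := B i)) (ar s'' Lc)"
          by (rule pair_inv_left[OF inv inj, where l = l]) (use * l in auto)
        moreover have "\<forall>u\<in>?U. ar s'' Lc u < length (S u)" using lc l by (auto simp: le_at_def)
        moreover have "\<forall>u. u \<notin> ?U \<longrightarrow> ar s'' Lc u = ar s Lc u" using un l U by auto
        moreover have "n'' + (\<Sum>u\<in>?U. ar s'' Lc u) + Suc p = n + (\<Sum>u\<in>?U. ar s Lc u) + rg s Ro"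
          using l sums[of ?v l] U cr n0 by auto
        ultimately show ?case using * fr'' by simp
      next
        assume *: "rg s'' Rtk = 0 \<and> j < ?je \<and> (\<exists>l. c ?u \<le> l \<and> (i < ?ie \<longrightarrow> le_at S ?v ?u l) \<and>
          (i < ?ie \<and> ar s'' Lc = c(?u := l) \<and> n'' + l = n' - 1 + c ?u \<or> \<not> i < ?ie \<and> ar s'' Lc = c \<and> n'' = n' - 1))"
        then obtain l where l: "(i < ?ie \<longrightarrow> le_at S ?v ?u l)"
          "(i < ?ie \<and> ar s'' Lc = c(?u := l) \<and> n'' + l = n' - 1 + c ?u \<or> \<not> i < ?ie \<and> ar s'' Lc = c \<and> n'' = n' - 1)"
          by blast
        have "pair_inv S B m b ?ie ?je len i (Suc j) (Suc p) (C(p := B j)) (ar s'' Lc)"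
          by (rule pair_inv_right[OF inv inj, where l = l]) (use * l in auto)
        moreover have "\<forall>u\<in>?U. ar s'' Lc u < length (S u)" using lc l by (auto simp: le_at_def)
        moreover have "\<forall>u. u \<notin> ?U \<longrightarrow> ar s'' Lc u = ar s Lc u" using un l U by auto
        moreover have "n'' + (\<Sum>u\<in>?U. ar s'' Lc u) + Suc p = n + (\<Sum>u\<in>?U. ar s Lc u) + rg s Ro"
          using l sums[of ?u l] U cr n0 by auto
        ultimately show ?case using * fr'' by simp
      qed
    qed (use fr i_def j_def c_def I True cmp bud[of ?v] U n0 in \<open>auto simp: B_def\<close>)
    then show ?thesis using True n0 fr p_def by simp
  qed
qed

text \<open>Besides the scans, which are paid by rising offsets, there is one credit per element
  written and one per pair of runs; the latter is charged to the pair's output, which is nonempty.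
  This gives \<open>2 * len\<close>.\<close>

lemma wp_merge_pass:
  fixes s :: "'a::linorder hstate"
  defines "B \<equiv> ar s Buf" and "len \<equiv> rg s Rlen" and "m \<equiv> rg s Rs"
  assumes S: "strings s S (B ` {..<len})" and inj: "inj_on B {..<len}"
    and m: "0 < m" "m \<le> size_of s + 1" "len \<le> size_of s + 1"
    and runs: "\<forall>x<len. run_ok S m B (ar s Lc) x"
    and lc: "\<forall>u\<in>B ` {..<len}. ar s Lc u < length (S u)"
    and n: "(\<Sum>u\<in>B ` {..<len}. length (S u)) + 2 * len \<le> n + (\<Sum>u\<in>B ` {..<len}. ar s Lc u)"
  shows "wp merge_pass (\<lambda>s' n'. ar s' Buf2 ` {..<len} = B ` {..<len} \<and>
     (\<forall>x<len. run_ok S (2 * m) (ar s' Buf2) (ar s' Lc) x) \<and>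
     (\<forall>u\<in>B ` {..<len}. ar s' Lc u < length (S u)) \<and>
     (\<forall>u. u \<notin> B ` {..<len} \<longrightarrow> ar s' Lc u = ar s Lc u) \<and>
     n + (\<Sum>u\<in>B ` {..<len}. ar s Lc u) \<le> n' + (\<Sum>u\<in>B ` {..<len}. ar s' Lc u) + 2 * len) s n"
proof -
  let ?U = "B ` {..<len}"
  let ?I = "\<lambda>s' n'. rg s' Ro \<le> len \<and> (rg s' Ro mod (2 * m) = 0 \<or> rg s' Ro = len) \<and>
     ar s' Buf2 ` {..<rg s' Ro} = B ` {..<rg s' Ro} \<and>
     (\<forall>x<rg s' Ro. run_ok S (2 * m) (ar s' Buf2) (ar s' Lc) x) \<and>
     (\<forall>x. rg s' Ro \<le> x \<and> x < len \<longrightarrow> run_ok S m B (ar s' Lc) x) \<and>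
     (\<forall>u\<in>?U. ar s' Lc u < length (S u)) \<and>
     (\<forall>u. u \<notin> ?U \<longrightarrow> ar s' Lc u = ar s Lc u) \<and>
     n + (\<Sum>u\<in>?U. ar s Lc u) \<le> n' + (\<Sum>u\<in>?U. ar s' Lc u) + 2 * rg s' Ro"
  have "wp (Loop (Lt (V Ro) (V Rlen))
     (Rli ::= V Ro ;;
      Rie ::= Plus (V Ro) (V Rs) ;; When (Lt (V Rlen) (V Rie)) (Rie ::= V Rlen) ;;
      Rj ::= V Rie ;;
      Rje ::= Plus (V Rie) (V Rs) ;; When (Lt (V Rlen) (V Rje)) (Rje ::= V Rlen) ;;
      merge_pair)) (\<lambda>s' n'. ar s' Buf2 ` {..<len} = B ` {..<len} \<and>
     (\<forall>x<len. run_ok S (2 * m) (ar s' Buf2) (ar s' Lc) x) \<and>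
     (\<forall>u\<in>B ` {..<len}. ar s' Lc u < length (S u)) \<and>
     (\<forall>u. u \<notin> B ` {..<len} \<longrightarrow> ar s' Lc u = ar s Lc u) \<and>
     n + (\<Sum>u\<in>B ` {..<len}. ar s Lc u) \<le> n' + (\<Sum>u\<in>B ` {..<len}. ar s' Lc u) + 2 * len)
     (s\<lparr>rg := (rg s)(Ro := 0)\<rparr>) n"
  proof (rule wp_Loop[where I = ?I], goal_cases)
    case 1
    then show ?case using runs lc by simp
  next
    case (2 s' n')
    have fr: "rg s' Rlen = len" "rg s' Rs = m" "ar s' Buf = B" "ar s' Lab = ar s Lab" "sy s' = sy s"
      "size_of s' = size_of s" "rg s' Rflat = rg s Rflat"
      using 2(2) by (auto simp: frame_def merge_pair_def merge_pick_def merge_scan_def B_def len_def m_def)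
    define b where "b = rg s' Ro"
    from 2(1) have I: "b \<le> len" "b mod (2 * m) = 0 \<or> b = len" "ar s' Buf2 ` {..<b} = B ` {..<b}"
      "\<forall>x<b. run_ok S (2 * m) (ar s' Buf2) (ar s' Lc) x"
      "\<forall>x. b \<le> x \<and> x < len \<longrightarrow> run_ok S m B (ar s' Lc) x"
      "\<forall>u\<in>?U. ar s' Lc u < length (S u)"
      "\<forall>u. u \<notin> ?U \<longrightarrow> ar s' Lc u = ar s Lc u"
      "n + (\<Sum>u\<in>?U. ar s Lc u) \<le> n' + (\<Sum>u\<in>?U. ar s' Lc u) + 2 * b"
      unfolding b_def by auto
    show ?case
    proof (cases "b < len")
      case False
      then have "b = len" using I(1) by simp
      then show ?thesis using I fr unfolding b_def by simp
    next
      case True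
      have n0: "0 < n'"
      proof -
        have "(\<Sum>u\<in>?U. ar s' Lc u) \<le> (\<Sum>u\<in>?U. length (S u))" using I(6) by (intro sum_mono) (auto intro: less_imp_le)
        then show ?thesis using I(8) n True by linarith
      qed
      define ie where "ie = min (b + m) len"
      define je where "je = min (ie + m) len"
      have b0: "b mod (2 * m) = 0" using I(2) True by simp
      \<comment> \<open>As \<open>b\<close> is a multiple of \<open>2 * m\<close>, runs start within
        the window only at \<open>b\<close> and \<open>b + m\<close>.\<close>
      have runs_mod: "x mod m = 0 \<longleftrightarrow> x = b \<or> x = b + m" if "b \<le> x" "x < b + 2 * m" for x
      proof -
        have bm: "b mod m = 0" using b0 by (metis mod_mod_cancel dvd_triv_right mod_0)
        obtain d where d: "x = b + d" "d < 2 * m" using \<open>b \<le> x\<close> \<open>x < b + 2 * m\<close> by (metis le_iff_add nat_add_left_cancel_less)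
        have "x mod m = d mod m" using bm d(1) by (metis add_0 mod_add_left_eq)
        also have "\<dots> = 0 \<longleftrightarrow> d = 0 \<or> d = m"
          using d(2) m(1) by (cases "d < m") (auto simp: mod_if)
        finally show ?thesis using d(1) by auto
      qed
      have order: "b < ie" "ie \<le> je" "je \<le> len" "je \<le> b + 2 * m" "ie \<le> b + m" "ie < je \<Longrightarrow> ie = b + m"
        using True m(1) by (auto simp: ie_def je_def)
      define s1 where "s1 = s'\<lparr>rg := (rg s')(Rli := b, Rie := ie, Rj := ie, Rje := je)\<rparr>"
      have s1: "ar s1 = ar s'" "sy s1 = sy s'" "size_of s1 = size_of s'" "rg s1 Rie = ie" "rg s1 Rje = je"
        "rg s1 Rli = b" "rg s1 Rj = ie" "rg s1 Ro = b" "rg s1 Rflat = rg s' Rflat"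
        by (auto simp: s1_def b_def)
      have S1: "strings s1 S (ar s1 Buf ` {..<len})"
        using S fr s1 by (simp add: strings_def stops_def key_def)
      have inv: "pair_inv S (ar s1 Buf) m b (rg s1 Rie) (rg s1 Rje) len (rg s1 Rli) (rg s1 Rj) (rg s1 Ro) (ar s1 Buf2) (ar s1 Lc)"
        unfolding pair_inv_def s1 fr
      proof (intro conjI allI impI)
        fix x assume "b < x \<and> x < ie \<or> ie < x \<and> x < je"
        then have "x mod m \<noteq> 0" "b \<le> x" "x < len" using order runs_mod[of x] by auto
        then show "le_at S (B (x - 1)) (B x) (ar s' Lc (B x))" using I(5) by (auto simp: run_ok_def)
      next
        assume "ie < je"
        then have "ie mod m = 0" "b \<le> ie" "ie < len" using order runs_mod[of ie] m by auto
        then show "heads_ok S (b = b) (ar s' Buf2 (b - 1)) (B ie) (ar s' Lc (B ie))"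
          using I(5) by (auto simp: run_ok_def heads_ok_def)
      next
        have "b mod m = 0" using runs_mod[of b] m by auto
        then show "heads_ok S (b = b) (ar s' Buf2 (b - 1)) (B b) (ar s' Lc (B b))"
          using I(5) True by (auto simp: run_ok_def heads_ok_def)
      qed (use I order b0 in auto)
      have "wp merge_pair ?I s1 (n' - 1)"
      proof (rule wp_use[OF wp_merge_pair[OF S1 _ inv]], goal_cases)
        case 1
        then show ?case using inj s1 fr by simp
      next
        case 2
        then show ?case using I s1 fr by simp
      next
        case 3
        have "(\<Sum>u\<in>?U. length (S u)) + 2 * len \<le> n' + (\<Sum>u\<in>?U. ar s' Lc u) + 2 * b" using n I(8) by linarith
        then show ?case using s1 fr True by simp
      next
        case (4 s2 n2)
        have P: "ar s2 Buf2 ` {..<je} = B ` ({..<ie} \<union> {ie..<je})" "\<forall>x<je. run_ok S (2 * m) (ar s2 Buf2) (ar s2 Lc) x"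
          "\<forall>x. je \<le> x \<and> x < len \<longrightarrow> run_ok S m B (ar s2 Lc) x" "rg s2 Ro = je"
          using 4(1) unfolding pair_inv_def s1 fr by auto
        have "{..<ie} \<union> {ie..<je} = {..<je}" using order by auto
        moreover have "je mod (2 * m) = 0 \<or> je = len"
        proof (cases "je = len")
          case False
          then have "je = b + 2 * m" using order unfolding ie_def je_def by auto
          then show ?thesis using b0 by simp
        qed simp
        moreover have "n + (\<Sum>u\<in>?U. ar s Lc u) \<le> n2 + (\<Sum>u\<in>?U. ar s2 Lc u) + 2 * je"
          using 4(1) I(8) order(1,2) n0 unfolding s1 fr by linarith
        ultimately show ?case using P order 4(1) I(7) unfolding s1 fr by simp
      qed
      then have "wp merge_pair ?I (s'\<lparr>rg := (rg s')(Rli := b, Rie := ie, Rj := ie, Rje := je)\<rparr>) (n' - 1)"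
        by (simp add: s1_def)
      then show ?thesis using True n0 fr m unfolding b_def[symmetric]
        by (auto simp: ie_def je_def min_def b_def[symmetric] fun_upd_twist split: if_splits)
    qed
  qed
  then show ?thesis unfolding merge_pass_def by simp
qed

section \<open>Sorting the buffer\<close>

definition copy_back :: hcom where
  "copy_back = For Rx (V Rlen) (Put Buf (V Rx) (Arr Buf2 (V Rx)))"

lemma wp_copy_back:
  assumes "rg s Rlen \<le> n"
    and "\<And>s'. \<forall>x<rg s Rlen. ar s' Buf x = ar s Buf2 x \<Longrightarrow> frame copy_back s s' \<Longrightarrow> Q s' (n - rg s Rlen)"
  shows "wp copy_back Q s n"
  unfolding copy_back_def
proof (rule wp_For[where I = "\<lambda>j s'. \<forall>x<j. ar s' Buf x = ar s Buf2 x" and m = "rg s Rlen"], goal_cases)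
  case (3 j s' n')
  have "ar s' Buf2 = ar s Buf2" using 3(4) by (auto simp: frame_def)
  then show ?case using 3 by (auto simp: less_Suc_eq)
next
  case (5 s')
  then show ?case using assms(2)[of s'] by (simp add: copy_back_def)
qed (use assms(1) in \<open>auto simp: frame_def\<close>)

definition sort_buffer :: hcom where
  "sort_buffer = (Rs ::= Lit 1 ;; Loop (Lt (V Rs) (V Rlen))
     (merge_pass ;; copy_back ;; Rs ::= Plus (V Rs) (V Rs)))"

lemma strings_frame:
  assumes "strings s S U" "sy s' = sy s" "ar s' Lab = ar s Lab" "rg s' Rflat = rg s Rflat" "size_of s' = size_of s"
  shows "strings s' S U"
  using assms by (simp add: strings_def stops_def key_def)

lemma run_ok_transfer:
  assumes "\<forall>x<len. run_ok S m B c x" "\<forall>x<len. B' x = B x"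
  shows "\<forall>x<len. run_ok S m B' c x"
  using assms by (auto simp: run_ok_def)

lemma merge_pass_frame:
  "frame merge_pass s s' \<Longrightarrow> rg s' Rlen = rg s Rlen \<and> rg s' Rs = rg s Rs \<and> rg s' Rflat = rg s Rflat \<and>
    rg s' Rth = rg s Rth \<and> rg s' Rn = rg s Rn \<and>
    ar s' Buf = ar s Buf \<and> ar s' Lab = ar s Lab \<and> ar s' Fr = ar s Fr \<and> ar s' Act = ar s Act \<and>
    sy s' = sy s \<and> size_of s' = size_of s"
  by (simp add: frame_def merge_pass_def merge_pair_def merge_pick_def merge_scan_def)

text \<open>The total string length is paid once, not once per pass: offsets survive from pass to
  pass, and the credits spent on scanning equal the rise of their sum. Each of the at most
  \<open>L\<close> passes adds \<open>2 * len\<close> for merging, \<open>len\<close> for copying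
  back and one loop credit.\<close>

lemma wp_sort_buffer:
  fixes s :: "'a::linorder hstate"
  defines "U \<equiv> ar s Buf ` {..<rg s Rlen}" and "len \<equiv> rg s Rlen"
  assumes S: "strings s S U" and inj: "inj_on (ar s Buf) {..<len}"
    and len: "len \<le> size_of s + 1" "len \<le> 2 ^ L"
    and lc: "\<forall>u\<in>U. ar s Lc u = 0"
    and n: "(\<Sum>u\<in>U. length (S u)) + (3 * len + 1) * L \<le> n"
  shows "wp sort_buffer (\<lambda>s' n'. ar s' Buf ` {..<len} = U \<and> inj_on (ar s' Buf) {..<len} \<and>
     (\<forall>x. 0 < x \<and> x < len \<longrightarrow> le_at S (ar s' Buf (x - 1)) (ar s' Buf x) (ar s' Lc (ar s' Buf x))) \<and>
     n \<le> n' + (\<Sum>u\<in>U. length (S u)) + (3 * len + 1) * L) s n"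
proof -
  let ?I = "\<lambda>s' n'. \<exists>j. rg s' Rs = 2 ^ j \<and> ar s' Buf ` {..<len} = U \<and> inj_on (ar s' Buf) {..<len} \<and>
     (\<forall>x<len. run_ok S (2 ^ j) (ar s' Buf) (ar s' Lc) x) \<and> (\<forall>u\<in>U. ar s' Lc u < length (S u)) \<and>
     n \<le> n' + (\<Sum>u\<in>U. ar s' Lc u) + (3 * len + 1) * j \<and> j \<le> L"
  let ?s = "s\<lparr>rg := (rg s)(Rs := 1)\<rparr>"
  have S0: "u \<in> U \<Longrightarrow> S u \<noteq> []" for u using S by (auto simp: strings_def)
  have "wp (Loop (Lt (V Rs) (V Rlen)) (merge_pass ;; copy_back ;; Rs ::= Plus (V Rs) (V Rs)))
    (\<lambda>s' n'. ar s' Buf ` {..<len} = U \<and> inj_on (ar s' Buf) {..<len} \<and>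
     (\<forall>x. 0 < x \<and> x < len \<longrightarrow> le_at S (ar s' Buf (x - 1)) (ar s' Buf x) (ar s' Lc (ar s' Buf x))) \<and>
     n \<le> n' + (\<Sum>u\<in>U. length (S u)) + (3 * len + 1) * L) ?s n"
  proof (rule wp_Loop[where I = ?I], goal_cases)
    case 1
    show ?case using inj lc S0 by (intro exI[of _ 0]) (auto simp: U_def len_def run_ok_def)
  next
    case (2 s' n')
    from 2(1) obtain j where j: "rg s' Rs = 2 ^ j" "ar s' Buf ` {..<len} = U" "inj_on (ar s' Buf) {..<len}"
     "\<forall>x<len. run_ok S (2 ^ j) (ar s' Buf) (ar s' Lc) x" "\<forall>u\<in>U. ar s' Lc u < length (S u)"
     "n \<le> n' + (\<Sum>u\<in>U. ar s' Lc u) + (3 * len + 1) * j" "j \<le> L" by blast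
    have fr: "rg s' Rlen = len" "ar s' Lab = ar s Lab" "sy s' = sy s"
      "size_of s' = size_of s" "rg s' Rflat = rg s Rflat"
      using 2(2) by (auto simp: frame_def copy_back_def merge_pass_def merge_pair_def merge_pick_def merge_scan_def len_def)
    have sum_le: "(\<Sum>u\<in>U. ar s' Lc u) \<le> (\<Sum>u\<in>U. length (S u))"
      using j(5) by (intro sum_mono) (auto intro: less_imp_le)
    show ?case
    proof (cases "2 ^ j < len")
      case False
      have "(3 * len + 1) * j \<le> (3 * len + 1) * L" using j(7) by (rule mult_le_mono2)
      moreover have "le_at S (ar s' Buf (x - 1)) (ar s' Buf x) (ar s' Lc (ar s' Buf x))" if "0 < x" "x < len" for x
      proof -
        have "x mod 2 ^ j = x" using that False by simp
        then show ?thesis using j(4) that by (auto simp: run_ok_def)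
      qed
      ultimately show ?thesis using j fr False sum_le by auto
    next
      case True
      have "j < L" using True len(2) by (meson less_le_trans nat_power_less_imp_less pos2)
      then have "(3 * len + 1) * j + (3 * len + 1) \<le> (3 * len + 1) * L"
        by (metis Suc_leI mult_Suc_right mult_le_mono2 add.commute)
      then have cr: "(\<Sum>u\<in>U. length (S u)) + 3 * len + 1 \<le> n' + (\<Sum>u\<in>U. ar s' Lc u)" using n j(6) by linarith
      have n0: "0 < n'" using cr sum_le by linarith
      have S': "strings s' S (ar s' Buf ` {..<rg s' Rlen})"
        using strings_frame[OF S] fr j(2) by simp
      have "wp merge_pass (wp (copy_back ;; Rs ::= Plus (V Rs) (V Rs)) ?I) s' (n' - 1)"
      proof (rule wp_use[OF wp_merge_pass[OF S']], goal_cases)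
        case (8 s2 n2)
        have fr2: "rg s2 Rlen = len" "rg s2 Rs = 2 ^ j" using merge_pass_frame[OF 8(2)] fr j by auto
        have P: "ar s2 Buf2 ` {..<len} = U" "\<forall>x<len. run_ok S (2 * 2 ^ j) (ar s2 Buf2) (ar s2 Lc) x"
          "\<forall>u\<in>U. ar s2 Lc u < length (S u)" 
          "n' - 1 + (\<Sum>u\<in>U. ar s' Lc u) \<le> n2 + (\<Sum>u\<in>U. ar s2 Lc u) + 2 * len"
          using 8(1) fr j by auto
        have inj2: "inj_on (ar s2 Buf2) {..<len}"
          using P(1) j(2,3) card_image[OF j(3)] by (intro eq_card_imp_inj_on) auto
        have sum2: "(\<Sum>u\<in>U. ar s2 Lc u) \<le> (\<Sum>u\<in>U. length (S u))"
          using P(3) by (intro sum_mono) (auto intro: less_imp_le)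
        have n2: "len \<le> n2" using P(4) sum2 cr n0 by linarith
        show ?case unfolding wp_Then
        proof (rule wp_copy_back, goal_cases)
          case 1
          then show ?case using n2 fr2 by simp
        next
          case (2 s3)
          have fr3: "rg s3 Rs = 2 ^ j" "ar s3 Lc = ar s2 Lc" "size_of s3 = size_of s"
            using 2(2) fr fr2 merge_pass_frame[OF 8(2)] by (auto simp: frame_def copy_back_def)
          have eq: "\<forall>x<len. ar s3 Buf x = ar s2 Buf2 x" using 2(1) fr2 by simp
          have "ar s3 Buf ` {..<len} = U" using P(1) eq by force
          moreover have "inj_on (ar s3 Buf) {..<len}" using inj2 eq by (auto simp: inj_on_def)
          moreover have "\<forall>x<len. run_ok S (2 ^ Suc j) (ar s3 Buf) (ar s3 Lc) x"
            using run_ok_transfer[OF P(2) eq] fr3 by simp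
          moreover have "n \<le> n2 - len + (\<Sum>u\<in>U. ar s2 Lc u) + (3 * len + 1) * Suc j"
            using j(6) P(4) n0 n2 by simp
          ultimately show ?case using fr3 fr2 P(3) \<open>j < L\<close> True len(1)
            by (auto intro!: exI[of _ "Suc j"])
        qed
      qed (use j fr len True cr n0 in auto)
      then show ?thesis using True n0 fr j by simp
    qed
  qed
  then show ?thesis unfolding sort_buffer_def by simp
qed

section \<open>An approximate median in linear time\<close>

text \<open>Keeping every second element of each sorted run of length \<open>2 m\<close> halves all rank counts up to
  an error of one per run.\<close>

definition sorted_runs :: "nat \<Rightarrow> (nat \<Rightarrow> 'k::linorder) \<Rightarrow> nat \<Rightarrow> bool" where
  "sorted_runs m f len \<longleftrightarrow> (\<forall>x<len. x mod m \<noteq> 0 \<longrightarrow> f (x - 1) \<le> f x)"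

lemma sorted_runs_mono:
  assumes "sorted_runs m f len" "x \<le> y" "y < len" "x div m = y div m"
  shows "f x \<le> f y"
  using assms(2-)
proof (induction rule: dec_induct)
  case (step y)
  have "x div m \<le> y div m" by (rule div_le_mono) (use step in simp)
  moreover have "y div m \<le> Suc y div m" by (rule div_le_mono) simp
  ultimately have eq: "y div m = Suc y div m" "x div m = y div m" using step by auto
  have "Suc y mod m \<noteq> 0"
  proof
    assume "Suc y mod m = 0"
    then have "Suc y div m = Suc (y div m)" by (simp add: div_Suc)
    then show False using eq by simp
  qed
  then have "f y \<le> f (Suc y)"
    using assms(1)[unfolded sorted_runs_def, rule_format, of "Suc y"] step by simp
  then show ?case using step eq by (meson Suc_lessD order_trans)
qed simp

lemma odd_mod_even: "(2 * x + 1) mod (2 * m) \<noteq> (0::nat)"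
proof
  assume "(2 * x + 1) mod (2 * m) = 0"
  then have "2 * m dvd 2 * x + 1" by (simp add: dvd_eq_mod_eq_0)
  then have "2 dvd 2 * x + 1" by (rule dvd_mult_left)
  then show False by simp
qed

lemma thinning_runs:
  assumes "sorted_runs (2 * m) f len"
  shows "sorted_runs m (\<lambda>x. f (2 * x + 1)) (len div 2)"
  unfolding sorted_runs_def
proof (intro allI impI)
  fix x assume x: "x < len div 2" "x mod m \<noteq> 0"
  have "(2 * x) mod (2 * m) \<noteq> 0" using x by (simp add: mult_mod_right[symmetric])
  then have 1: "f (2 * x - 1) \<le> f (2 * x)" using assms x by (simp add: sorted_runs_def)
  have "(2 * x + 1) mod (2 * m) \<noteq> 0" by (rule odd_mod_even)
  then have 2: "f (2 * x) \<le> f (2 * x + 1)"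
    using assms[unfolded sorted_runs_def, rule_format, of "2 * x + 1"] x by simp
  have "2 * (x - 1) + 1 = 2 * x - 1" using x by (cases x) auto
  then show "f (2 * (x - 1) + 1) \<le> f (2 * x + 1)" using 1 2 by simp
qed

text \<open>Pair the indices \<open>2 * x\<close> and \<open>2 * x + 1\<close>. Within a run the
  elements satisfying \<open>D\<close> form an initial segment, so an odd member of a pair satisfies
  \<open>D\<close> only if the even one does, and at most one pair per run is split. There are at
  most \<open>(len - 1) div (2 * m) + 1\<close> runs.\<close>

lemma thinning_count:
  assumes runs: "sorted_runs (2 * m) f len" and D: "\<And>a b. a \<le> b \<Longrightarrow> D b \<Longrightarrow> D a" and m: "0 < m"
  defines "c \<equiv> card {x. x < len \<and> D (f x)}" and "c' \<equiv> card {x. x < len div 2 \<and> D (f (2 * x + 1))}"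
  shows "2 * c' \<le> c" "c \<le> 2 * c' + ((len - 1) div (2 * m) + 1)"
proof -
  define Od where "Od = {x. x < len div 2 \<and> D (f (2 * x + 1))}"
  define Ev where "Ev = {x. 2 * x < len \<and> D (f (2 * x))}"
  have fin: "finite Od" "finite Ev"
    unfolding Od_def Ev_def by (auto intro: finite_subset[of _ "{..<len}"])
  have "{x. x < len \<and> D (f x)} = (\<lambda>x. 2 * x) ` Ev \<union> (\<lambda>x. 2 * x + 1) ` Od"
  proof (intro equalityI subsetI)
    fix x assume x: "x \<in> {x. x < len \<and> D (f x)}"
    show "x \<in> (\<lambda>x. 2 * x) ` Ev \<union> (\<lambda>x. 2 * x + 1) ` Od"
    proof (cases "even x")
      case True
      then show ?thesis using x unfolding Ev_def by (auto elim!: evenE)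
    next
      case False
      then obtain y where "x = 2 * y + 1" by (auto elim: oddE)
      then show ?thesis using x unfolding Od_def by auto
    qed
  qed (auto simp: Od_def Ev_def)
  moreover have "(\<lambda>x. 2 * x) ` Ev \<inter> (\<lambda>x. 2 * x + 1) ` Od = {}" by (auto) presburger
  ultimately have c: "c = card Ev + card Od"
    unfolding c_def using fin
    by (simp add: card_Un_disjoint card_image inj_on_def)
  have "Od \<subseteq> Ev"
  proof
    fix x assume "x \<in> Od"
    then have x: "x < len div 2" "D (f (2 * x + 1))" by (auto simp: Od_def)
    have "(2 * x + 1) mod (2 * m) \<noteq> 0" by (rule odd_mod_even)
    then have "f (2 * x) \<le> f (2 * x + 1)"
      using runs[unfolded sorted_runs_def, rule_format, of "2 * x + 1"] x by simp
    then show "x \<in> Ev" using x D by (auto simp: Ev_def)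
  qed
  then have le: "card Od \<le> card Ev" using fin by (simp add: card_mono)
  \<comment> \<open>\<open>x div m\<close> is the run of the pair; two split pairs in the same run
    would contradict sortedness.\<close>
  have "inj_on (\<lambda>x. x div m) (Ev - Od)"
  proof (rule linorder_inj_onI')
    fix x y assume xy: "x \<in> Ev - Od" "y \<in> Ev - Od" "x < y"
    show "x div m \<noteq> y div m"
    proof
      assume eq: "x div m = y div m"
      have "(2 * x + 1) div (2 * m) = x div m" by (simp add: div_mult2_eq)
      moreover have "(2 * y) div (2 * m) = y div m" by simp
      ultimately have "f (2 * x + 1) \<le> f (2 * y)"
        using sorted_runs_mono[OF runs, of "2 * x + 1" "2 * y"] xy eq by (auto simp: Ev_def)
      then have "D (f (2 * x + 1))" using D xy by (auto simp: Ev_def)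
      then show False using xy by (auto simp: Ev_def Od_def)
    qed
  qed
  moreover have "(\<lambda>x. x div m) ` (Ev - Od) \<subseteq> {..(len - 1) div (2 * m)}"
  proof
    fix z assume "z \<in> (\<lambda>x. x div m) ` (Ev - Od)"
    then obtain x where "2 * x < len" "z = x div m" by (auto simp: Ev_def)
    moreover have "(2 * x) div (2 * m) \<le> (len - 1) div (2 * m)" using calculation by (intro div_le_mono) simp
    ultimately show "z \<in> {..(len - 1) div (2 * m)}" by simp
  qed
  ultimately have "card (Ev - Od) \<le> (len - 1) div (2 * m) + 1"
    using card_inj_on_le[of _ "Ev - Od" "{..(len - 1) div (2 * m)}"] by simp
  then have "card Ev \<le> card Od + ((len - 1) div (2 * m) + 1)"
    using \<open>Od \<subseteq> Ev\<close> fin by (simp add: card_Diff_subset)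
  then show "2 * c' \<le> c" "c \<le> 2 * c' + ((len - 1) div (2 * m) + 1)"
    using c le unfolding c'_def Od_def[symmetric] by auto
qed

definition thin :: hcom where
  "thin = (Rx ::= Lit 0 ;; Ry ::= Lit 1 ;; Loop (Lt (V Ry) (V Rlen))
     (Put Buf (V Rx) (Arr Buf2 (V Ry)) ;; Rx ::= Inc (V Rx) 1 ;; Ry ::= Inc (V Ry) 2) ;; Rlen ::= V Rx)"

lemma wp_thin:
  assumes "rg s Rlen \<le> n"
    and "\<And>s' n'. \<forall>x<rg s Rlen div 2. ar s' Buf x = ar s Buf2 (2 * x + 1) \<Longrightarrow> rg s' Rlen = rg s Rlen div 2 \<Longrightarrow>
      n \<le> n' + rg s Rlen \<Longrightarrow> frame thin s s' \<Longrightarrow> Q s' n'"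
  shows "wp thin Q s n"
proof -
  let ?len = "rg s Rlen"
  have "wp thin (\<lambda>s' n'. (\<forall>x<rg s Rlen div 2. ar s' Buf x = ar s Buf2 (2 * x + 1)) \<and> rg s' Rlen = rg s Rlen div 2 \<and>
      n \<le> n' + rg s Rlen) s n"
    unfolding thin_def wp_Then wp_Set
  proof (intro conjI, simp, simp, rule wp_Loop[where I = "\<lambda>s' n'. \<exists>j. rg s' Rx = j \<and> rg s' Ry = 2 * j + 1 \<and>
      j \<le> ?len div 2 \<and> n' = n - j \<and> (\<forall>x<j. ar s' Buf x = ar s Buf2 (2 * x + 1))"], goal_cases)
    case (2 s' n')
    then obtain j where j: "rg s' Rx = j" "rg s' Ry = 2 * j + 1"
      "j \<le> ?len div 2" "n' = n - j" "\<forall>x<j. ar s' Buf x = ar s Buf2 (2 * x + 1)" by blast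
    have fr: "ar s' Buf2 = ar s Buf2" "rg s' Rlen = ?len" using 2(2) by (auto simp: frame_def)
    show ?case
    proof (cases "2 * j + 1 < ?len")
      case True
      then have "Suc j \<le> ?len div 2" "0 < n'" using j assms(1) by auto
      then show ?thesis using True j fr by (auto simp: less_Suc_eq)
    next
      case False
      then have "j = ?len div 2" using j by simp
      then show ?thesis using False j fr by auto
    qed
  qed simp
  then show ?thesis by (rule wp_use) (use assms(2) in auto)
qed

text \<open>From run length 8 on, passes alternate: one merges and thins, which halves the number of
  elements at unchanged run length, the next doubles the run length. Both the cost and the counting
  errors then form geometric series.\<close>

definition pivot_loop :: hcom where
  "pivot_loop = Loop (Lt (V Rs) (V Rlen))
     (merge_pass ;; If (Lt (Lit 0) (V Rth)) (thin ;; Rth ::= Lit 0)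
        (copy_back ;; Rs ::= Plus (V Rs) (V Rs) ;; When (Lt (Lit 7) (V Rs)) (Rth ::= Lit 1)))"

definition pivot :: hcom where
  "pivot = (Rlen ::= V Rn ;; For Rx (V Rn) (Put Buf (V Rx) (Arr Fr (Arr Act (V Rx)))) ;;
     Rs ::= Lit 1 ;; Rth ::= Lit 0 ;; pivot_loop ;;
     Rx ::= Lit 0 ;; Ry ::= Lit 1 ;; Loop (Lt (V Ry) (V Rlen)) (Rx ::= Inc (V Rx) 1 ;; Ry ::= Inc (V Ry) 2) ;;
     Rpv ::= Arr Buf (V Rx))"

text \<open>Each survivor stands for \<open>W\<close> original elements; counts are never
  overestimated and are underestimated by at most \<open>E\<close>. Quantifying over all downward
  closed predicates covers the strict and the weak comparison with the eventual pivot as well as the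
  total count.\<close>

definition approximates :: "('k::linorder \<Rightarrow> bool) set \<Rightarrow> nat \<Rightarrow> (nat \<Rightarrow> 'k) \<Rightarrow> nat \<Rightarrow> (nat \<Rightarrow> 'k) \<Rightarrow> nat \<Rightarrow> nat \<Rightarrow> bool" where
  "approximates \<D> n g W f len E \<longleftrightarrow> (\<forall>D\<in>\<D>. W * card {x. x < len \<and> D (f x)} \<le> card {x. x < n \<and> D (g x)} \<and>
     card {x. x < n \<and> D (g x)} \<le> W * card {x. x < len \<and> D (f x)} + E)"

definition lower_sets :: "('k::linorder \<Rightarrow> bool) set" where
  "lower_sets = {D. \<forall>a b. a \<le> b \<longrightarrow> D b \<longrightarrow> D a}"

lemma approximates_thin:
  fixes f :: "nat \<Rightarrow> 'k::linorder"
  assumes "approximates lower_sets n g W f len E" "sorted_runs (2 * m) f len" "0 < m"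
  shows "approximates lower_sets n g (2 * W) (\<lambda>x. f (2 * x + 1)) (len div 2) (E + W * ((len - 1) div (2 * m) + 1))"
  unfolding approximates_def
proof
  fix D :: "'k \<Rightarrow> bool" assume "D \<in> lower_sets"
  then have D: "\<And>a b. a \<le> b \<Longrightarrow> D b \<Longrightarrow> D a" by (auto simp: lower_sets_def)
  let ?c = "card {x. x < len \<and> D (f x)}" and ?c' = "card {x. x < len div 2 \<and> D (f (2 * x + 1))}"
  have t: "2 * ?c' \<le> ?c" "?c \<le> 2 * ?c' + ((len - 1) div (2 * m) + 1)"
    using thinning_count[where D = D, OF assms(2) _ assms(3)] D by blast+
  have "W * (2 * ?c') \<le> W * ?c" "W * ?c \<le> W * (2 * ?c' + ((len - 1) div (2 * m) + 1))"
    by (rule mult_le_mono2[OF t(1)], rule mult_le_mono2[OF t(2)])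
  then have "2 * W * ?c' \<le> W * ?c" "W * ?c \<le> 2 * W * ?c' + W * ((len - 1) div (2 * m) + 1)"
    by (simp_all add: algebra_simps)
  moreover have "W * ?c \<le> card {x. x < n \<and> D (g x)}" "card {x. x < n \<and> D (g x)} \<le> W * ?c + E"
    using assms(1) \<open>D \<in> lower_sets\<close> unfolding approximates_def by auto
  ultimately show "2 * W * ?c' \<le> card {x. x < n \<and> D (g x)} \<and>
     card {x. x < n \<and> D (g x)} \<le> 2 * W * ?c' + (E + W * ((len - 1) div (2 * m) + 1))" by linarith
qed

text \<open>At least half of the survivors lie at or below the median, and they stand for at least
  half of \<open>n - E\<close> elements. At most \<open>n / 2 + E\<close> elements lie strictly
  below it. With \<open>E\<close> up to \<open>3 * n / 8\<close> the second estimate leaves just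
  \<open>n / 8\<close> at or above the median, which is the origin of the constant 8.\<close>

lemma approximates_median:
  assumes "approximates lower_sets n g W f len E" "sorted_runs m f len" "len \<le> m" "0 < len" "8 * E \<le> 3 * n"
  shows "n \<le> 8 * card {x. x < n \<and> g x \<le> f (len div 2)}" "n \<le> 8 * card {x. x < n \<and> f (len div 2) \<le> g x}"
proof -
  let ?k = "f (len div 2)"
  have mono: "f x \<le> f y" if "x \<le> y" "y < len" for x y
    using sorted_runs_mono[OF assms(2) that] that assms(3) by simp
  have in1: "(\<lambda>_. True) \<in> lower_sets" "(\<lambda>a. a \<le> ?k) \<in> lower_sets" "(\<lambda>a. a < ?k) \<in> lower_sets"
    by (auto simp: lower_sets_def)
  have a1: "W * len \<le> n" "n \<le> W * len + E"
    using assms(1) in1(1) unfolding approximates_def by auto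
  let ?le = "card {x. x < n \<and> g x \<le> ?k}" and ?lt = "card {x. x < n \<and> g x < ?k}"
  have a2: "W * card {x. x < len \<and> f x \<le> ?k} \<le> ?le"
    using assms(1) in1(2) unfolding approximates_def by auto
  have a3: "?lt \<le> W * card {x. x < len \<and> f x < ?k} + E"
    using assms(1) in1(3) unfolding approximates_def by auto
  have mid: "len div 2 < len" using assms(4) by simp
  have "{..len div 2} \<subseteq> {x. x < len \<and> f x \<le> ?k}" using mono mid by auto
  then have "card {..len div 2} \<le> card {x. x < len \<and> f x \<le> ?k}" by (intro card_mono) auto
  then have "W * (len div 2 + 1) \<le> W * card {x. x < len \<and> f x \<le> ?k}" by (intro mult_le_mono2) simp
  then have "W * (len div 2 + 1) \<le> ?le" using a2 by (rule order_trans)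
  moreover have "W * len \<le> W * (2 * (len div 2 + 1))" by (intro mult_le_mono2) presburger
  ultimately have "W * len \<le> 2 * ?le" by (simp add: algebra_simps)
  then show "n \<le> 8 * ?le" using a1 assms(5) by linarith
  have "{x. x < len \<and> f x < ?k} \<subseteq> {..<len div 2}"
    using mono mid by (auto simp: not_le[symmetric])
  then have "card {x. x < len \<and> f x < ?k} \<le> card {..<len div 2}" by (intro card_mono) auto
  then have "W * card {x. x < len \<and> f x < ?k} \<le> W * (len div 2)" by simp
  moreover have "W * (2 * (len div 2)) \<le> W * len" by (intro mult_le_mono2) presburger
  moreover have "W * (2 * (len div 2)) = 2 * (W * (len div 2))" by simp
  ultimately have "2 * ?lt \<le> n + 2 * E" using a3 a1 by linarith
  moreover have "n = ?lt + card {x. x < n \<and> ?k \<le> g x}"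
  proof -
    have "n = card {x. x < n}" by simp
    also have "{x. x < n} = {x. x < n \<and> g x < ?k} \<union> {x. x < n \<and> ?k \<le> g x}" by auto
    also have "card \<dots> = ?lt + card {x. x < n \<and> ?k \<le> g x}" by (rule card_Un_disjoint) auto
    finally show ?thesis .
  qed
  ultimately show "n \<le> 8 * card {x. x < n \<and> ?k \<le> g x}" using assms(5) by linarith
qed

lemma le_at_single: "le_at (\<lambda>u. [k u]) u v l \<longleftrightarrow> l = 0 \<and> k u \<le> k v"
  by (auto simp: le_at_def)

lemma runs_flat:
  assumes "\<forall>u. c u = 0"
  shows "(\<forall>x<len. run_ok (\<lambda>u. [k u]) m B c x) \<longleftrightarrow> sorted_runs m (\<lambda>x. k (B x)) len"
  using assms by (auto simp: run_ok_def sorted_runs_def le_at_single)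

lemma strings_flat:
  assumes "rg s Rflat \<noteq> 0" "\<forall>u\<in>U. u \<le> 2 * size_of s + 1"
  shows "strings s (\<lambda>u. [key s u]) U"
  using assms by (simp add: strings_def stops_def)

lemma sorted_runs_cong: "\<forall>x<len. f x = g x \<Longrightarrow> sorted_runs m f len = sorted_runs m g len"
  by (simp add: sorted_runs_def)

lemma approximates_cong:
  assumes "\<forall>x<len. f x = f' x"
  shows "approximates \<D> n g W f len E = approximates \<D> n g W f' len E"
proof -
  have "{x. x < len \<and> D (f x)} = {x. x < len \<and> D (f' x)}" for D using assms by auto
  then show ?thesis by (simp add: approximates_def)
qed

lemma approximates_permute:
  assumes "inj_on B {..<len}" "inj_on C {..<len}" "B ` {..<len} = C ` {..<len}"
  shows "approximates \<D> n g W (\<lambda>x. k (B x)) len E = approximates \<D> n g W (\<lambda>x. k (C x)) len E"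
proof -
  have *: "card {x. x < len \<and> D (k (A x))} = card {u \<in> A ` {..<len}. D (k u)}" if "inj_on A {..<len}" for A D
  proof -
    have "{u \<in> A ` {..<len}. D (k u)} = A ` {x. x < len \<and> D (k (A x))}" by auto
    moreover have "inj_on A {x. x < len \<and> D (k (A x))}" using that by (rule inj_on_subset) auto
    ultimately show ?thesis by (simp add: card_image)
  qed
  show ?thesis by (simp add: approximates_def *[OF assms(1)] *[OF assms(2)] assms(3))
qed

text \<open>Read the first premise as \<open>E \<le> 3 * n / 8 - 3 * n / m\<close>: the reserve
  \<open>3 * n / m\<close> is set aside for all future thinnings. One thinning adds at most half of
  it, as \<open>2 * m * R \<le> 3 * len\<close>; the other half is exactly the reserve required for
  run length \<open>2 * m\<close>.\<close>

lemma thinning_error: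
  fixes n m E W R len :: nat
  assumes "8 * m * E + 24 * n \<le> 3 * n * m" "W * len \<le> n" "m < len" "R = (len - 1) div (2 * m) + 1"
  shows "16 * m * (E + W * R) + 24 * n \<le> 6 * n * m"
proof -
  have "2 * m * ((len - 1) div (2 * m)) \<le> len - 1" by (rule times_div_less_eq_dividend)
  then have "2 * m * R \<le> 3 * len" using assms(3,4) by (simp add: algebra_simps)
  then have "W * (2 * m * R) \<le> W * (3 * len)" by (rule mult_le_mono2)
  moreover have "2 * m * (W * R) = W * (2 * m * R)" "W * (3 * len) = 3 * (W * len)" by simp_all
  ultimately have "2 * m * (W * R) \<le> 3 * n" using assms(2) by linarith
  moreover have "16 * m * (E + W * R) = 2 * (8 * m * E) + 8 * (2 * m * (W * R))" "6 * n * m = 2 * (3 * n * m)"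
    by (simp_all add: algebra_simps)
  ultimately show ?thesis using assms(1) by linarith
qed

text \<open>A pass with its loop credit costs at most \<open>4 * len\<close>. The coefficients 24,
  20, 16, 12 drop by 4 with each doubling pass; a thinning pass goes from \<open>12 * len\<close> to
  16 per element of half as many elements, that is \<open>8 * len\<close>.\<close>

definition pivot_potential :: "nat \<Rightarrow> nat \<Rightarrow> nat \<Rightarrow> nat" where
  "pivot_potential th m len = (if th = 1 then 12 else if 4 \<le> m then 16 else if m = 2 then 20 else 24) * len"

text \<open>The disjunction lists the phases: initial passes with exact counts, the state before a
  doubling pass, the state before a thinning pass. In the second case the error bound is already
  stated for the run length that the doubling will produce.\<close>

definition pivot_inv :: "(nat \<Rightarrow> 'k::linorder) \<Rightarrow> (nat \<Rightarrow> nat) \<Rightarrow> nat \<Rightarrow> nat \<Rightarrow> 'a hstate \<Rightarrow> nat \<Rightarrow> bool" where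
  "pivot_inv k B0 n0 n s' n' \<longleftrightarrow> (\<exists>W E. 0 < rg s' Rlen \<and> ar s' Buf ` {..<rg s' Rlen} \<subseteq> B0 ` {..<n0} \<and>
     inj_on (ar s' Buf) {..<rg s' Rlen} \<and> rg s' Rlen \<le> n0 \<and>
     sorted_runs (rg s' Rs) (\<lambda>x. k (ar s' Buf x)) (rg s' Rlen) \<and> (\<forall>u. ar s' Lc u = 0) \<and>
     approximates lower_sets n0 (\<lambda>x. k (B0 x)) W (\<lambda>x. k (ar s' Buf x)) (rg s' Rlen) E \<and>
     (rg s' Rs \<in> {1, 2, 4} \<and> rg s' Rth = 0 \<and> E = 0 \<or>
      8 \<le> rg s' Rs \<and> rg s' Rth = 0 \<and> 16 * rg s' Rs * E + 24 * n0 \<le> 6 * n0 * rg s' Rs \<or>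
      8 \<le> rg s' Rs \<and> rg s' Rth = 1 \<and> 8 * rg s' Rs * E + 24 * n0 \<le> 3 * n0 * rg s' Rs) \<and>
     n + pivot_potential (rg s' Rth) (rg s' Rs) (rg s' Rlen) \<le> n' + 24 * n0)"

lemma wp_pivot_loop:
  fixes s :: "'a::linorder hstate"
  defines "n0 \<equiv> rg s Rlen" and "k \<equiv> key s" and "B0 \<equiv> ar s Buf"
  assumes flat: "rg s Rflat \<noteq> 0" and lc: "\<forall>u. ar s Lc u = 0" and init: "rg s Rs = 1" "rg s Rth = 0"
    and n0: "1 \<le> n0" "n0 \<le> size_of s + 1" and inj: "inj_on B0 {..<n0}"
    and bound: "\<forall>x<n0. B0 x \<le> size_of s + 1"
    and n: "24 * n0 \<le> n"
  shows "wp pivot_loop (\<lambda>s' n'. \<exists>W E. 0 < rg s' Rlen \<and> ar s' Buf ` {..<rg s' Rlen} \<subseteq> B0 ` {..<n0} \<and>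
     rg s' Rlen \<le> rg s' Rs \<and> rg s' Rlen \<le> n0 \<and>
     sorted_runs (rg s' Rs) (\<lambda>x. k (ar s' Buf x)) (rg s' Rlen) \<and> (\<forall>u. ar s' Lc u = 0) \<and>
     approximates lower_sets n0 (\<lambda>x. k (B0 x)) W (\<lambda>x. k (ar s' Buf x)) (rg s' Rlen) E \<and> 8 * E \<le> 3 * n0 \<and>
     n \<le> n' + 24 * n0) s n"
  unfolding pivot_loop_def
proof (rule wp_Loop[where I = "pivot_inv k B0 n0 n"], goal_cases)
  case 1
  have "approximates lower_sets n0 (\<lambda>x. k (B0 x)) 1 (\<lambda>x. k (B0 x)) n0 0" by (simp add: approximates_def)
  moreover have "sorted_runs 1 (\<lambda>x. k (B0 x)) n0" by (simp add: sorted_runs_def)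
  ultimately show ?case using init n0 inj lc unfolding pivot_inv_def
    by (intro exI[of _ 1] exI[of _ 0]) (auto simp: n0_def B0_def pivot_potential_def)
next
  case (2 s1 n1)
  define len where "len = rg s1 Rlen"
  define m where "m = rg s1 Rs"
  define th where "th = rg s1 Rth"
  from 2(1) obtain W E where I: "0 < len" "ar s1 Buf ` {..<len} \<subseteq> B0 ` {..<n0}"
     "inj_on (ar s1 Buf) {..<len}" "len \<le> n0"
     "sorted_runs m (\<lambda>x. k (ar s1 Buf x)) len" "\<forall>u. ar s1 Lc u = 0"
     "approximates lower_sets n0 (\<lambda>x. k (B0 x)) W (\<lambda>x. k (ar s1 Buf x)) len E"
     "m \<in> {1, 2, 4} \<and> th = 0 \<and> E = 0 \<or>
      8 \<le> m \<and> th = 0 \<and> 16 * m * E + 24 * n0 \<le> 6 * n0 * m \<or>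
      8 \<le> m \<and> th = 1 \<and> 8 * m * E + 24 * n0 \<le> 3 * n0 * m"
     "n + pivot_potential th m len \<le> n1 + 24 * n0" unfolding pivot_inv_def len_def m_def th_def by blast
  have regs1: "rg s1 Rlen = len" "rg s1 Rs = m" "rg s1 Rth = th" by (simp_all add: len_def m_def th_def)
  have fr: "ar s1 Lab = ar s Lab" "sy s1 = sy s" "size_of s1 = size_of s" "rg s1 Rflat = rg s Rflat"
    using 2(2) by (auto simp: frame_def copy_back_def merge_pass_def merge_pair_def merge_pick_def merge_scan_def thin_def)
  have k1: "key s1 = k" using fr by (auto simp: key_def k_def)
  have m0: "0 < m" using I(8) by auto
  show ?case
  proof (cases "m < len")
    case False
    have "8 * E \<le> 3 * n0"
    proof -
      have "16 * m * E = 2 * (m * (8 * E))" "6 * n0 * m = 2 * (m * (3 * n0))"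
        "8 * m * E = m * (8 * E)" "3 * n0 * m = m * (3 * n0)" by simp_all
      then have "m * (8 * E) \<le> m * (3 * n0)" using I(8) by (cases "E = 0") (simp, elim disjE conjE, linarith+)
      then show ?thesis using m0 by simp
    qed
    moreover have "n \<le> n1 + 24 * n0" using I(9) by linarith
    ultimately show ?thesis using I(1,2,4,5,6,7) False regs1 by (simp add: not_less) blast
  next
    case True
    have pot: "12 * len \<le> pivot_potential th m len" by (simp add: pivot_potential_def)
    have n1: "3 * len < n1" using pot I(9) n True by linarith
    let ?U = "ar s1 Buf ` {..<len}"
    let ?S = "\<lambda>u. [k u]"
    have "\<forall>u\<in>?U. u \<le> 2 * size_of s1 + 1" using I(2) bound fr by force
    then have S1: "strings s1 ?S (ar s1 Buf ` {..<rg s1 Rlen})" unfolding k1[symmetric] regs1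
      using strings_flat[of s1] flat fr by simp
    have "card ?U = len" using I(3) by (simp add: card_image)
    show ?thesis
    proof (intro conjI impI)
      have "wp merge_pass (wp (If (Lt (Lit 0) (V Rth)) (thin ;; Rth ::= Lit 0)
        (copy_back ;; Rs ::= Plus (V Rs) (V Rs) ;; When (Lt (Lit 7) (V Rs)) (Rth ::= Lit 1)))
        (pivot_inv k B0 n0 n)) s1 (n1 - 1)"
      proof (rule wp_use[OF wp_merge_pass[OF S1]], goal_cases)
        case 1
        show ?case using I(3) regs1 by simp
      next
        case 2
        show ?case using m0 regs1 by simp
      next
        case 3
        show ?case using True I(4) n0 fr regs1 by simp
      next
        case 4
        show ?case using I(4) n0 fr regs1 by simp
      next
        case 5
        show ?case unfolding regs1 by (rule runs_flat[THEN iffD2]) (use I(5,6) in auto)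
      next
        case 6
        show ?case using I(6) by simp
      next
        case 7
        show ?case using \<open>card ?U = len\<close> I(6) regs1 n1 by simp
      next
        case (8 s2 n2)
        note fr2 = merge_pass_frame[OF 8(2)]
        have lc2: "\<forall>u. ar s2 Lc u = 0" using 8(1) I(6) by (metis One_nat_def length_Cons less_Suc0 list.size(3))
        have P: "ar s2 Buf2 ` {..<len} = ?U" "\<forall>x<len. run_ok ?S (2 * m) (ar s2 Buf2) (ar s2 Lc) x"
          "n1 - 1 \<le> n2 + 2 * len" using 8(1) lc2 I(6) regs1 by auto
        have inj2: "inj_on (ar s2 Buf2) {..<len}"
          using P(1) \<open>card ?U = len\<close> by (intro eq_card_imp_inj_on) auto
        have srt: "sorted_runs (2 * m) (\<lambda>x. k (ar s2 Buf2 x)) len" by (rule runs_flat[OF lc2, THEN iffD1, OF P(2)])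
        have app: "approximates lower_sets n0 (\<lambda>x. k (B0 x)) W (\<lambda>x. k (ar s2 Buf2 x)) len E"
          by (rule approximates_permute[OF I(3) inj2 P(1)[symmetric], THEN iffD1, OF I(7)])
        have n2: "len \<le> n2" using P(3) n1 by linarith
        show ?case
        proof (cases "th = 1")
          case T: True
          then have e: "8 \<le> m" "8 * m * E + 24 * n0 \<le> 3 * n0 * m" using I(8) by auto
          have "wp thin (wp (Rth ::= Lit 0) (pivot_inv k B0 n0 n)) s2 n2"
          proof (rule wp_thin, goal_cases)
            case 1
            show ?case using n2 fr2 regs1 by simp
          next
            case (2 s3 n3)
            let ?len = "len div 2"
            have eq: "\<forall>x<?len. ar s3 Buf x = ar s2 Buf2 (2 * x + 1)" "rg s3 Rlen = ?len" "n2 \<le> n3 + len"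
              using 2(1-3) fr2 regs1 by auto
            have fr3: "rg s3 Rs = m" "ar s3 Lc = ar s2 Lc" using 2(4) fr2 regs1 by (auto simp: frame_def thin_def)
            have "ar s3 Buf ` {..<?len} \<subseteq> ar s2 Buf2 ` {..<len}" using eq(1) by force
            then have c1: "ar s3 Buf ` {..<?len} \<subseteq> B0 ` {..<n0}" using P(1) I(2) by blast
            have c2: "inj_on (ar s3 Buf) {..<?len}"
            proof (rule inj_onI)
              fix x y assume xy: "x \<in> {..<?len}" "y \<in> {..<?len}" "ar s3 Buf x = ar s3 Buf y"
              then have "ar s2 Buf2 (2 * x + 1) = ar s2 Buf2 (2 * y + 1)" using eq(1) by simp
              moreover have "2 * x + 1 \<in> {..<len}" "2 * y + 1 \<in> {..<len}" using xy by auto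
              ultimately have "2 * x + 1 = 2 * y + 1" by (rule inj_onD[OF inj2])
              then show "x = y" by simp
            qed
            have c3: "sorted_runs m (\<lambda>x. k (ar s3 Buf x)) ?len"
              by (rule sorted_runs_cong[THEN iffD2, OF _ thinning_runs[OF srt]]) (use eq(1) in simp)
            let ?E = "E + W * ((len - 1) div (2 * m) + 1)"
            have c4: "approximates lower_sets n0 (\<lambda>x. k (B0 x)) (2 * W) (\<lambda>x. k (ar s3 Buf x)) ?len ?E"
              by (rule approximates_cong[THEN iffD2, OF _ approximates_thin[OF app srt m0]]) (use eq(1) in simp)
            have "(\<lambda>_. True) \<in> lower_sets" by (simp add: lower_sets_def)
            from bspec[OF app[unfolded approximates_def] this]
            have "W * len \<le> n0" by simp
            then have c5: "16 * m * ?E + 24 * n0 \<le> 6 * n0 * m" using thinning_error[OF e(2) _ True] by simp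
            have "16 * ?len \<le> 8 * len" by simp
            then have "n + 16 * ?len \<le> n3 + 24 * n0"
              using I(9) P(3) eq(3) T True m0 n1 by (simp add: pivot_potential_def)
            then have c6: "n + pivot_potential 0 m ?len \<le> n3 + 24 * n0" using e(1) by (simp add: pivot_potential_def)
            have c7: "0 < ?len" "?len \<le> n0" using e(1) True I(4) by auto
            show ?case using c1 c2 c3 c4 c5 c6 c7 eq(2) fr3 lc2 e(1)
              unfolding pivot_inv_def
              by (intro wp_Set[THEN iffD2] conjI exI[of _ "2 * W"] exI[of _ ?E]) auto
          qed
          then show ?thesis using T fr2 regs1 by simp
        next
          case T: False
          then have th0: "th = 0" using I(8) by auto
          have "wp copy_back (wp (Rs ::= Plus (V Rs) (V Rs) ;; When (Lt (Lit 7) (V Rs)) (Rth ::= Lit 1)) (pivot_inv k B0 n0 n)) s2 n2"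
          proof (rule wp_copy_back, goal_cases)
            case 1
            show ?case using n2 fr2 regs1 by simp
          next
            case (2 s3)
            have eq: "\<forall>x<len. ar s3 Buf x = ar s2 Buf2 x" using 2(1) fr2 regs1 by auto
            have fr3: "rg s3 Rs = m" "rg s3 Rth = 0" "rg s3 Rlen = len" "ar s3 Lc = ar s2 Lc" "size_of s3 = size_of s"
              "rg s2 Rlen = len"
              using 2(2) fr2 regs1 th0 fr by (auto simp: frame_def copy_back_def)
            have c1: "ar s3 Buf ` {..<len} \<subseteq> B0 ` {..<n0}" using P(1) I(2) eq by force
            have c2: "inj_on (ar s3 Buf) {..<len}" using inj2 eq by (auto simp: inj_on_def)
            have c3: "sorted_runs (2 * m) (\<lambda>x. k (ar s3 Buf x)) len"
              by (rule sorted_runs_cong[THEN iffD2, OF _ srt]) (use eq in simp)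
            have c4: "approximates lower_sets n0 (\<lambda>x. k (B0 x)) W (\<lambda>x. k (ar s3 Buf x)) len E"
              by (rule approximates_cong[THEN iffD2, OF _ app]) (use eq in simp)
            define th' :: nat where "th' = (if 7 < 2 * m then 1 else 0)"
            \<comment> \<open>When the run length first reaches 8 the error is 0 and the bound
              \<open>24 * n0 \<le> 3 * n0 * 8\<close> holds with equality: 8 is the first run length
              at which thinning can be afforded.\<close>
            have c5: "2 * m \<in> {1, 2, 4} \<and> th' = 0 \<and> E = 0 \<or>
              8 \<le> 2 * m \<and> th' = 1 \<and> 8 * (2 * m) * E + 24 * n0 \<le> 3 * n0 * (2 * m)"
              using I(8) th0 by (auto simp: th'_def)
            have "pivot_potential th' (2 * m) len + 4 * len \<le> pivot_potential th m len"
              using I(8) th0 by (auto simp: pivot_potential_def th'_def)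
            then have c6: "n + pivot_potential th' (2 * m) len \<le> n2 - len + 24 * n0"
              using I(9) P(3) n1 n2 I(1) by linarith
            have ok: "m + m \<le> 4 * size_of s + 8" using True I(4) n0 by simp
            show ?case
            proof (cases "7 < 2 * m")
              case T7: True
              then have "th' = 1" by (simp add: th'_def)
              then show ?thesis using c1 c2 c3 c4 c5 c6 I(1,4) fr3 lc2 ok T7
                unfolding pivot_inv_def by (simp add: mult_2) blast
            next
              case F7: False
              then have "th' = 0" by (simp add: th'_def)
              then show ?thesis using c1 c2 c3 c4 c5 c6 I(1,4) fr3 lc2 ok F7
                unfolding pivot_inv_def by (simp add: mult_2) blast
            qed
          qed
          then show ?thesis using th0 fr2 regs1 by simp
        qed
      qed
      then show "wp (merge_pass ;; If (Lt (Lit 0) (V Rth)) (thin ;; Rth ::= Lit 0)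
        (copy_back ;; Rs ::= Plus (V Rs) (V Rs) ;; When (Lt (Lit 7) (V Rs)) (Rth ::= Lit 1)))
        (pivot_inv k B0 n0 n) s1 (n1 - 1)"
        unfolding wp_Then .
    qed (use True regs1 n1 in auto)
  qed
qed

text \<open>The 26 units per element are one for filling the buffer, 24 for the passes, and at most
  one for finding the middle index, which is done by counting because the array language has no
  division.\<close>

lemma wp_pivot:
  fixes s :: "'a::linorder hstate"
  defines "n0 \<equiv> rg s Rn" and "q \<equiv> \<lambda>x. ar s Fr (ar s Act x)"
  assumes flat: "rg s Rflat \<noteq> 0" and lc: "\<forall>u. ar s Lc u = 0"
    and n0: "1 \<le> n0" "n0 \<le> size_of s + 1" and inj: "inj_on q {..<n0}"
    and bound: "\<forall>x<n0. q x \<le> size_of s + 1"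
    and n: "26 * n0 \<le> n"
  shows "wp pivot (\<lambda>s' n'. rg s' Rpv \<in> q ` {..<n0} \<and> (\<forall>u. ar s' Lc u = 0) \<and>
     n0 \<le> 8 * card {x. x < n0 \<and> key s (q x) \<le> key s (rg s' Rpv)} \<and>
     n0 \<le> 8 * card {x. x < n0 \<and> key s (rg s' Rpv) \<le> key s (q x)} \<and> n \<le> n' + 26 * n0) s n"
proof -
  let ?k = "key s"
  let ?Q = "\<lambda>s' n'. rg s' Rpv \<in> q ` {..<n0} \<and> (\<forall>u. ar s' Lc u = 0) \<and>
     n0 \<le> 8 * card {x. x < n0 \<and> key s (q x) \<le> key s (rg s' Rpv)} \<and>
     n0 \<le> 8 * card {x. x < n0 \<and> key s (rg s' Rpv) \<le> key s (q x)} \<and> n \<le> n' + 26 * n0"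
  let ?mid = "Rx ::= Lit 0 ;; Ry ::= Lit 1 ;; Loop (Lt (V Ry) (V Rlen)) (Rx ::= Inc (V Rx) 1 ;; Ry ::= Inc (V Ry) 2) ;;
     Rpv ::= Arr Buf (V Rx)"
  have mid: "wp ?mid ?Q s1 n1" if s1: "rg s1 Rlen \<le> n1" "ar s1 Buf (rg s1 Rlen div 2) \<in> q ` {..<n0}"
    "\<forall>u. ar s1 Lc u = 0" "n + rg s1 Rlen \<le> n1 + 26 * n0"
    "n0 \<le> 8 * card {x. x < n0 \<and> key s (q x) \<le> key s (ar s1 Buf (rg s1 Rlen div 2))}"
    "n0 \<le> 8 * card {x. x < n0 \<and> key s (ar s1 Buf (rg s1 Rlen div 2)) \<le> key s (q x)}" for s1 n1
    unfolding wp_Then wp_Set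
  proof (intro conjI, simp, simp, rule wp_Loop[where I = "\<lambda>s' n'. \<exists>j. rg s' Rx = j \<and> rg s' Ry = 2 * j + 1 \<and>
      j \<le> rg s1 Rlen div 2 \<and> n' = n1 - j"], goal_cases)
    case (2 s' n')
    then obtain j where j: "rg s' Rx = j" "rg s' Ry = 2 * j + 1"
      "j \<le> rg s1 Rlen div 2" "n' = n1 - j" by blast
    have fr: "ar s' = ar s1" "rg s' Rlen = rg s1 Rlen" using 2(2) by (auto simp: frame_def)
    show ?case
    proof (cases "2 * j + 1 < rg s1 Rlen")
      case True
      then have "Suc j \<le> rg s1 Rlen div 2" "0 < n'" using j s1(1) by auto
      then show ?thesis using True j fr by auto
    next
      case False
      then have "j = rg s1 Rlen div 2" using j by simp
      then show ?thesis using False j fr s1 by auto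
    qed
  qed simp
  let ?s0 = "s\<lparr>rg := (rg s)(Rlen := n0)\<rparr>"
  have "wp (For Rx (V Rn) (Put Buf (V Rx) (Arr Fr (Arr Act (V Rx)))))
     (wp (Rs ::= Lit 1 ;; Rth ::= Lit 0 ;; pivot_loop ;; ?mid) ?Q) ?s0 n"
  proof (rule wp_For[where I = "\<lambda>j s'. \<forall>x<j. ar s' Buf x = q x" and m = n0], goal_cases)
    case (3 j s' n')
    have "ar s' Fr = ar s Fr" "ar s' Act = ar s Act" using 3(4) by (auto simp: frame_def)
    then show ?case using 3 by (auto simp: less_Suc_eq q_def)
  next
    case (5 s')
    have fr: "rg s' Rlen = n0" "ar s' Lc = ar s Lc" "ar s' Lab = ar s Lab" "sy s' = sy s" "size_of s' = size_of s"
      "rg s' Rflat = rg s Rflat" using 5(3) by (auto simp: frame_def)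
    let ?s1 = "s'\<lparr>rg := (rg s')(Rs := 1, Rth := 0)\<rparr>"
    have k: "key ?s1 = ?k" using fr by (auto simp: key_def)
    have B: "\<forall>x<n0. ar s' Buf x = q x" using 5(1) .
    have B': "ar s' Buf ` {..<n0} = q ` {..<n0}" "inj_on (ar s' Buf) {..<n0}"
      using B inj by (auto simp: inj_on_def)
    have "wp pivot_loop (wp ?mid ?Q) ?s1 (n - n0)"
    proof (rule wp_use[OF wp_pivot_loop], goal_cases)
      case (10 s2 n2)
      from 10(1) obtain W E where *: "0 < rg s2 Rlen" "ar s2 Buf ` {..<rg s2 Rlen} \<subseteq> q ` {..<n0}"
         "rg s2 Rlen \<le> rg s2 Rs" "rg s2 Rlen \<le> n0"
         "sorted_runs (rg s2 Rs) (\<lambda>x. ?k (ar s2 Buf x)) (rg s2 Rlen)" "\<forall>u. ar s2 Lc u = 0"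
         "approximates lower_sets n0 (\<lambda>x. ?k (ar s' Buf x)) W (\<lambda>x. ?k (ar s2 Buf x)) (rg s2 Rlen) E"
         "8 * E \<le> 3 * n0" "n - n0 \<le> n2 + 24 * n0" unfolding k using fr B' by auto
      have sets: "{x. x < n0 \<and> key s (ar s' Buf x) \<le> c} = {x. x < n0 \<and> key s (q x) \<le> c}"
        "{x. x < n0 \<and> c \<le> key s (ar s' Buf x)} = {x. x < n0 \<and> c \<le> key s (q x)}" for c
        using B by auto
      note med = approximates_median[OF *(7,5,3,1,8)]
      have "rg s2 Rlen div 2 < rg s2 Rlen" using *(1) by simp
      then have "ar s2 Buf (rg s2 Rlen div 2) \<in> q ` {..<n0}" using *(2) by blast
      then show ?case using * med n unfolding sets by (intro mid) auto
    qed (use flat lc fr n0 n B B' bound in auto)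
    then show ?case by simp
  qed (use n in \<open>auto simp: frame_def n0_def\<close>)
  then show ?thesis unfolding pivot_def by (simp add: n0_def)
qed

section \<open>The selection invariant\<close>

text \<open>Refining the order of the suffixes in \<open>A\<close>, which contains the wanted one.
  \<open>[p, en p)\<close> is the token starting at \<open>p\<close>: equal first symbols and labels imply equal tokens. \<open>fr a\<close>
  is where the common prefix of the active suffixes ends. In mode 1 the labels of active positions
  temporarily refine their order by the length and kind of the run of tokens following them. \<open>Al\<close> is
  the set of tokens not yet swallowed by another token, and \<open>st\<close> tells that no symbol has been matched.\<close>

definition flab :: "nat \<Rightarrow> (nat \<Rightarrow> nat) \<Rightarrow> nat set \<Rightarrow> nat \<Rightarrow> nat" where
  "flab N lab A p = (if p \<in> A then Suc N else lab p)"

definition tokens_ok :: "'a list \<Rightarrow> (nat \<Rightarrow> nat) \<Rightarrow> (nat \<Rightarrow> nat) \<Rightarrow> nat set \<Rightarrow> bool" where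
  "tokens_ok T lab en A \<longleftrightarrow> (\<forall>p\<in>{1..length T}. p < en p \<and> en p \<le> Suc (length T)) \<and>
     (\<forall>p\<in>{1..length T}. \<forall>q\<in>{1..length T}. text_symbol T p = text_symbol T q \<longrightarrow>
        flab (length T) lab A p = flab (length T) lab A q \<longrightarrow>
        en p - p = en q - q \<and> (\<forall>d<en p - p. text_symbol T (p + d) = text_symbol T (q + d)))"

text \<open>Low labels are at most \<open>low\<close> and high labels exceed
  \<open>2 * N + 2 - high\<close>. Since \<open>low + high + card A = N\<close>, both groups avoid
  \<open>N + 1\<close> while \<open>A\<close> is nonempty, and \<open>low + 1\<close> and
  \<open>2 * N + 2 - high\<close> are free for the next split. Position \<open>N + 1\<close>, the
  empty suffix, has label 0.\<close>

definition labels_ok :: "'a::linorder list \<Rightarrow> (nat \<Rightarrow> nat) \<Rightarrow> nat set \<Rightarrow> nat \<Rightarrow> nat \<Rightarrow> bool" where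
  "labels_ok T lab A low high \<longleftrightarrow>
     (\<forall>p\<in>{1..Suc (length T)}. \<forall>q\<in>{1..Suc (length T)}.
        flab (length T) lab A p < flab (length T) lab A q \<longrightarrow> text_suffix T p < text_suffix T q) \<and>
     lab (Suc (length T)) = 0 \<and>
     (\<forall>p\<in>{1..length T} - A. 1 \<le> lab p \<and> lab p \<le> low \<or> 2 * length T + 2 - high < lab p) \<and>
     low = card {p \<in> {1..length T} - A. lab p \<le> length T} \<and>
     low + high + card A = length T"

definition common_prefix :: "'a list \<Rightarrow> (nat \<Rightarrow> nat) \<Rightarrow> nat set \<Rightarrow> bool" where
  "common_prefix T fr A \<longleftrightarrow> (\<exists>l. \<forall>a\<in>A. fr a = a + l \<and> fr a \<le> Suc (length T) \<and>
     (\<forall>b\<in>A. \<forall>d<l. text_symbol T (a + d) = text_symbol T (b + d)))"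

text \<open>In mode 0 the frontier lies behind the token and is inactive, so the token found there
  can be swallowed; only before the first match is it the position itself. In mode 1 the frontier is
  the position again, compared by its run label. That an adjacent active token has a different label
  is what later makes the token ends of a class with one label inactive.\<close>

definition mode_ok :: "'a::linorder list \<Rightarrow> (nat \<Rightarrow> nat) \<Rightarrow> (nat \<Rightarrow> nat) \<Rightarrow> (nat \<Rightarrow> nat) \<Rightarrow> nat set \<Rightarrow> nat \<Rightarrow> bool \<Rightarrow> bool" where
  "mode_ok T lab fr en A mode st \<longleftrightarrow>
     (if mode = 0 then (\<forall>a\<in>A. lab a = Suc (length T) \<and> (if st then fr a = a else fr a = en a \<and> en a \<notin> A))
      else \<not> st \<and> (\<forall>a\<in>A. fr a = a \<and> (en a \<in> A \<longrightarrow> lab (en a) \<noteq> lab a) \<and>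
        (\<forall>b\<in>A. text_symbol T a = text_symbol T b \<and> (lab a < lab b \<longrightarrow> text_suffix T a < text_suffix T b))))"

text \<open>Alive tokens form chains: the end of one is the start of another or the end of the text,
  and injectivity of \<open>en\<close> gives each at most one alive predecessor. So tokens swallowed
  by different active suffixes are different.\<close>

definition alive_ok :: "nat \<Rightarrow> (nat \<Rightarrow> nat) \<Rightarrow> nat set \<Rightarrow> nat set \<Rightarrow> bool" where
  "alive_ok N en A Al \<longleftrightarrow> A \<subseteq> Al \<and> Al \<subseteq> {1..N} \<and> inj_on en Al \<and> en ` Al \<subseteq> insert (Suc N) Al"

definition sel_inv :: "'a::linorder list \<Rightarrow> nat \<Rightarrow> (nat \<Rightarrow> nat) \<Rightarrow> (nat \<Rightarrow> nat) \<Rightarrow> (nat \<Rightarrow> nat) \<Rightarrow> nat set \<Rightarrow>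
    nat \<Rightarrow> nat \<Rightarrow> nat \<Rightarrow> nat \<Rightarrow> nat set \<Rightarrow> bool \<Rightarrow> bool" where
  "sel_inv T R lab fr en A mode r low high Al st \<longleftrightarrow> A \<subseteq> {1..length T} \<and> r + low = R \<and> r < card A \<and>
     labels_ok T lab A low high \<and> tokens_ok T lab en A \<and> common_prefix T fr A \<and>
     mode_ok T lab fr en A mode st \<and> alive_ok (length T) en A Al"

lemma sel_inv_init:
  assumes "R < length T" "\<forall>p\<in>{1..length T}. lab p = Suc (length T) \<and> fr p = p \<and> en p = Suc p"
    "lab (Suc (length T)) = 0"
  shows "sel_inv T R lab fr en {1..length T} 0 R 0 0 {1..length T} True"
proof -
  have "text_suffix T (Suc (length T)) < text_suffix T p" if "p \<in> {1..length T}" for p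
    using that by (simp add: text_suffix_Cons) (simp add: text_suffix_def)
  then have "labels_ok T lab {1..length T} 0 0"
    using assms by (auto simp: labels_ok_def flab_def le_Suc_eq)
  moreover have "tokens_ok T lab en {1..length T}" using assms by (auto simp: tokens_ok_def)
  moreover have "common_prefix T fr {1..length T}"
    unfolding common_prefix_def using assms by (intro exI[of _ 0]) auto
  moreover have "mode_ok T lab fr en {1..length T} 0 True" using assms by (auto simp: mode_ok_def)
  moreover have "alive_ok (length T) en {1..length T} {1..length T}"
    using assms by (auto simp: alive_ok_def inj_on_def)
  ultimately show ?thesis using assms(1) by (auto simp: sel_inv_def)
qed

lemma two_elements:
  assumes "2 \<le> card A" "a \<in> A"
  obtains b where "b \<in> A" "b \<noteq> a"
proof -
  have "A \<noteq> {a}" using assms(1) by auto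
  then show ?thesis using assms(2) that by blast
qed

lemma frontier_inside:
  assumes "endmarked T" "sel_inv T R lab fr en A mode r low high Al st" "2 \<le> card A" "a \<in> A"
  shows "fr a \<in> {1..length T}"
proof -
  obtain b where b: "b \<in> A" "b \<noteq> a" by (rule two_elements[OF assms(3,4)])
  obtain l where l: "\<forall>a\<in>A. fr a = a + l \<and> fr a \<le> Suc (length T) \<and>
     (\<forall>b\<in>A. \<forall>d<l. text_symbol T (a + d) = text_symbol T (b + d))"
    using assms(2) unfolding sel_inv_def common_prefix_def by blast
  have A: "A \<subseteq> {1..length T}" using assms(2) by (simp add: sel_inv_def)
  have fr: "fr a = a + l" "a + l \<le> Suc (length T)" "b + l \<le> Suc (length T)"
    and agree: "\<And>d. d < l \<Longrightarrow> text_symbol T (a + d) = text_symbol T (b + d)"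
    using l assms(4) b(1) by (blast, metis+)
  have ab: "a \<in> {1..length T}" "b \<in> {1..length T}" using A assms(4) b(1) by auto
  have "a + l \<le> length T"
    by (rule agree_inside(1)[OF assms(1) ab b(2)[symmetric] agree fr(2,3)])
  then show ?thesis using fr(1) ab(1) by simp
qed

definition fkey :: "'a list \<Rightarrow> (nat \<Rightarrow> nat) \<Rightarrow> (nat \<Rightarrow> nat) \<Rightarrow> nat \<Rightarrow> 'a \<times> nat" where
  "fkey T lab fr a = (text_symbol T (fr a), lab (fr a))"

text \<open>After stripping the common prefix, a smaller symbol decides. On equal symbols the label
  decides: in mode 0 because active positions carry \<open>N + 1\<close>, so \<open>lab\<close>
  coincides with \<open>flab\<close>, in mode 1 by the order property of run labels in
  \<open>mode_ok\<close>.\<close>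

lemma fkey_less:
  assumes T: "endmarked T" and inv: "sel_inv T R lab fr en A mode r low high Al st" and two: "2 \<le> card A"
    and ab: "a \<in> A" "b \<in> A" and less: "fkey T lab fr a < fkey T lab fr b"
  shows "text_suffix T a < text_suffix T b"
proof -
  obtain l where l: "\<forall>a\<in>A. fr a = a + l \<and> fr a \<le> Suc (length T) \<and>
     (\<forall>b\<in>A. \<forall>d<l. text_symbol T (a + d) = text_symbol T (b + d))"
    using inv unfolding sel_inv_def common_prefix_def by blast
  have A: "A \<subseteq> {1..length T}" using inv by (simp add: sel_inv_def)
  have strip: "text_suffix T a < text_suffix T b \<longleftrightarrow> text_suffix T (fr a) < text_suffix T (fr b)"
    using text_suffix_strip[of l T a b] l A ab by (metis atLeastAtMost_iff subsetD)
  have fr: "fr a \<in> {1..length T}" "fr b \<in> {1..length T}"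
    using frontier_inside[OF T inv two] ab by auto
  consider "text_symbol T (fr a) < text_symbol T (fr b)"
    | "text_symbol T (fr a) = text_symbol T (fr b)" "lab (fr a) < lab (fr b)"
    using less by (auto simp: fkey_def order.order_iff_strict)
  then show ?thesis
  proof cases
    case 1
    then show ?thesis unfolding strip text_suffix_less_iff[OF fr] by simp
  next
    case 2
    show ?thesis
    proof (cases "mode = 0")
      case True
      have "flab (length T) lab A p = lab p" if "p \<in> {1..length T}" for p
        using that inv True by (simp add: flab_def sel_inv_def mode_ok_def)
      then have "flab (length T) lab A (fr a) < flab (length T) lab A (fr b)" using 2 fr by simp
      moreover have "fr a \<in> {1..Suc (length T)}" "fr b \<in> {1..Suc (length T)}" using fr by auto
      ultimately show ?thesis unfolding strip using inv unfolding sel_inv_def labels_ok_def by blast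
    next
      case False
      then have "\<forall>a\<in>A. fr a = a \<and> (\<forall>b\<in>A. lab a < lab b \<longrightarrow> text_suffix T a < text_suffix T b)"
        using inv unfolding sel_inv_def mode_ok_def by metis
      then show ?thesis using 2(2) ab by metis
    qed
  qed
qed

definition side :: "'k::linorder \<Rightarrow> 'k \<Rightarrow> nat" where
  "side k x = (if x < k then 0 else if k < x then 2 else 1)"

lemma side_less: "side k x < side k y \<Longrightarrow> x < y"
  by (auto simp: side_def split: if_splits)

text \<open>All positions dropped to one side in a round share one label, formed from the old
  counters; it is one step inside the labels given before, hence comparable with them.\<close>

definition split_labels :: "nat \<Rightarrow> nat set \<Rightarrow> (nat \<Rightarrow> nat) \<Rightarrow> nat \<Rightarrow> nat \<Rightarrow> nat \<Rightarrow> (nat \<Rightarrow> nat) \<Rightarrow> nat \<Rightarrow> nat" where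
  "split_labels N A cl ch low high lab p =
     (if p \<in> A \<and> cl p < ch then Suc low else if p \<in> A \<and> ch < cl p then 2 * N + 2 - high else lab p)"

text \<open>By \<open>fkey_less\<close> the three classes are consecutive in the suffix order, and
  the labels handed out lie strictly between all earlier low and all earlier high labels.\<close>

lemma sel_inv_split:
  fixes T :: "'a::linorder list" and kp :: "'a \<times> nat" and A :: "nat set" and ch :: nat
    and lab fr :: "nat \<Rightarrow> nat"
  assumes T: "endmarked T" and inv: "sel_inv T R lab fr en A mode r low high Al st" and two: "2 \<le> card A"
  defines "cl \<equiv> \<lambda>a. side kp (fkey T lab fr a)"
  defines "A' \<equiv> {a \<in> A. cl a = ch}" and "Lo \<equiv> {a \<in> A. cl a < ch}" and "Hi \<equiv> {a \<in> A. ch < cl a}"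
  assumes ch: "card Lo \<le> r" "r < card Lo + card A'"
  shows "sel_inv T R (split_labels (length T) A cl ch low high lab) fr en A' mode (r - card Lo)
    (low + card Lo) (high + card Hi) Al st"
proof -
  let ?N = "length T" and ?lab = "split_labels (length T) A cl ch low high lab"
  have A: "A \<subseteq> {1..?N}" and lok: "labels_ok T lab A low high" using inv by (auto simp: sel_inv_def)
  have finA: "finite A" using A by (rule finite_subset) simp
  have fin: "finite A'" "finite Lo" "finite Hi" using finA by (auto simp: A'_def Lo_def Hi_def)
  have part: "A = Lo \<union> A' \<union> Hi" by (auto simp: A'_def Lo_def Hi_def)
  have disj: "Lo \<inter> A' = {}" "(Lo \<union> A') \<inter> Hi = {}" by (auto simp: A'_def Lo_def Hi_def)
  have cardA: "card A = card Lo + card A' + card Hi"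
    unfolding part using disj fin by (simp add: card_Un_disjoint)
  have lab0: "lab (Suc ?N) = 0" and sum: "low + high + card A = ?N"
    and low: "low = card {p \<in> {1..?N} - A. lab p \<le> ?N}" using lok by (auto simp: labels_ok_def)
  have rng: "\<And>p. p \<in> {1..?N} - A \<Longrightarrow> 1 \<le> lab p \<and> lab p \<le> low \<or> 2 * ?N + 2 - high < lab p"
    and ord: "\<And>p q. p \<in> {1..Suc ?N} \<Longrightarrow> q \<in> {1..Suc ?N} \<Longrightarrow> flab ?N lab A p < flab ?N lab A q \<Longrightarrow>
        text_suffix T p < text_suffix T q" using lok unfolding labels_ok_def by blast+
  have num: "low < ?N" "?N + 2 < 2 * ?N + 2 - high" using sum two by auto
  have NA: "Suc ?N \<notin> A" using A by auto
  have lab'A: "p \<in> A' \<Longrightarrow> ?lab p = lab p" "p \<in> Lo \<Longrightarrow> ?lab p = Suc low" "p \<in> Hi \<Longrightarrow> ?lab p = 2 * ?N + 2 - high"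
    "p \<notin> A \<Longrightarrow> ?lab p = lab p" for p
    by (auto simp: split_labels_def A'_def Lo_def Hi_def)
  have rng': "lab p \<le> low \<or> 2 * ?N + 2 - high < lab p" if "p \<in> {1..Suc ?N}" "p \<notin> A" for p
  proof (cases "p = Suc ?N")
    case False
    then show ?thesis using rng[of p] that by auto
  qed (use lab0 in simp)
  have fl: "flab ?N ?lab A' p = (if p \<in> A' then Suc ?N else if p \<in> Lo then Suc low else if p \<in> Hi then 2 * ?N + 2 - high else lab p)" for p
    using part lab'A by (auto simp: flab_def)
  have "labels_ok T ?lab A' (low + card Lo) (high + card Hi)"
    unfolding labels_ok_def
  proof (intro conjI ballI impI)
    fix p q assume pq: "p \<in> {1..Suc ?N}" "q \<in> {1..Suc ?N}" "flab ?N ?lab A' p < flab ?N ?lab A' q"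
    have cl_less: "text_suffix T p < text_suffix T q" if "p \<in> A" "q \<in> A" "cl p < cl q"
      using fkey_less[OF T inv two that(1,2)] side_less that(3) unfolding cl_def by blast
    show "text_suffix T p < text_suffix T q"
    proof (cases "p \<in> A")
      case pA: True
      show ?thesis
      proof (cases "q \<in> A")
        case True
        have "cl p < cl q"
        proof (rule ccontr)
          assume "\<not> cl p < cl q"
          then have "q \<in> Hi \<longrightarrow> p \<in> Hi" "p \<in> Lo \<longrightarrow> q \<in> Lo" using pA True by (auto simp: Hi_def Lo_def)
          then show False using pq(3) pA True part disj num unfolding fl
            by (auto split: if_splits)
        qed
        then show ?thesis using cl_less pA True by simp
      next
        case False
        have "Suc low \<le> flab ?N ?lab A' p" unfolding fl using pA part num by auto
        moreover have "flab ?N ?lab A' q = lab q" unfolding fl using False part by auto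
        ultimately have "2 * ?N + 2 - high < lab q" using pq(3) rng'[OF pq(2) False] by linarith
        then show ?thesis using ord[OF pq(1,2)] pA False num by (auto simp: flab_def)
      qed
    next
      case pA: False
      then have p: "flab ?N ?lab A' p = lab p" unfolding fl using part by auto
      show ?thesis
      proof (cases "q \<in> A")
        case True
        have "flab ?N ?lab A' q \<le> 2 * ?N + 2 - high" unfolding fl using True part num by auto
        then have "lab p \<le> low" using pq(3) rng'[OF pq(1) pA] p by linarith
        then show ?thesis using ord[OF pq(1,2)] pA True num by (auto simp: flab_def)
      next
        case False
        then have "flab ?N ?lab A' q = lab q" unfolding fl using part by auto
        then show ?thesis using ord[OF pq(1,2)] pA pq(3) False p by (simp add: flab_def)
      qed
    qed
  next
    show "?lab (Suc ?N) = 0" using lab'A(4)[OF NA] lab0 by simp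
  next
    fix p assume p: "p \<in> {1..?N} - A'"
    have le: "card Lo \<ge> 1" if "p \<in> Lo" using that fin by (metis One_nat_def Suc_leI card_gt_0_iff empty_iff)
    have hi: "card Hi \<ge> 1" if "p \<in> Hi" using that fin by (metis One_nat_def Suc_leI card_gt_0_iff empty_iff)
    consider "p \<in> Lo" | "p \<in> Hi" | "p \<notin> A" using p part by blast
    then show "1 \<le> ?lab p \<and> ?lab p \<le> low + card Lo \<or> 2 * ?N + 2 - (high + card Hi) < ?lab p"
    proof cases
      case 1
      then show ?thesis using le lab'A(2) by simp
    next
      case 2
      then show ?thesis using hi lab'A(3)[OF 2] num by linarith
    next
      case 3
      then show ?thesis using rng[of p] p lab'A(4)[OF 3] by auto
    qed
  next
    have "{p \<in> {1..?N} - A'. ?lab p \<le> ?N} = {p \<in> {1..?N} - A. lab p \<le> ?N} \<union> Lo"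
    proof (intro equalityI subsetI)
      fix p assume "p \<in> {p \<in> {1..?N} - A'. ?lab p \<le> ?N}"
      then show "p \<in> {p \<in> {1..?N} - A. lab p \<le> ?N} \<union> Lo"
        using part lab'A(3)[of p] lab'A(4)[of p] num by auto
    next
      fix p assume "p \<in> {p \<in> {1..?N} - A. lab p \<le> ?N} \<union> Lo"
      then show "p \<in> {p \<in> {1..?N} - A'. ?lab p \<le> ?N}"
        using part lab'A(2)[of p] lab'A(4)[of p] num disj A by auto
    qed
    moreover have "{p \<in> {1..?N} - A. lab p \<le> ?N} \<inter> Lo = {}" using part by auto
    ultimately show "low + card Lo = card {p \<in> {1..?N} - A'. ?lab p \<le> ?N}"
      using low fin by (simp add: card_Un_disjoint)
  next
    show "low + card Lo + (high + card Hi) + card A' = ?N" using sum cardA by simp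
  qed
  moreover have "tokens_ok T ?lab en A'"
  proof -
    have tok: "tokens_ok T lab en A" using inv by (simp add: sel_inv_def)
    \<comment> \<open>Relabelling only separates positions that were active and shared the label
      \<open>N + 1\<close>; hence positions with equal new labels had equal old ones, and token
      equality carries over.\<close>
    have "flab ?N lab A p = flab ?N lab A q"
      if pq: "p \<in> {1..?N}" "q \<in> {1..?N}" "flab ?N ?lab A' p = flab ?N ?lab A' q" for p q
    proof -
      have bnd: "Suc low \<le> flab ?N ?lab A' x \<and> flab ?N ?lab A' x \<le> 2 * ?N + 2 - high" if "x \<in> A" for x
        unfolding fl using that part num by auto
      have out: "flab ?N ?lab A' x \<le> low \<or> 2 * ?N + 2 - high < flab ?N ?lab A' x" if "x \<notin> A" "x \<in> {1..?N}" for x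
        unfolding fl using rng'[of x] that part by auto
      have "p \<in> A \<longleftrightarrow> q \<in> A" using bnd[of p] bnd[of q] out[of p] out[of q] pq by fastforce
      moreover have "p \<notin> A \<Longrightarrow> q \<notin> A \<Longrightarrow> lab p = lab q" using pq(3) unfolding fl using part by auto
      ultimately show ?thesis by (auto simp: flab_def)
    qed
    then show ?thesis using tok unfolding tokens_ok_def by blast
  qed
  moreover have "common_prefix T fr A'"
    using inv part unfolding sel_inv_def common_prefix_def by blast
  moreover have "mode_ok T ?lab fr en A' mode st"
  proof -
    have m: "mode_ok T lab fr en A mode st" using inv by (simp add: sel_inv_def)
    have sub: "a \<in> A' \<Longrightarrow> a \<in> A" for a using part by blast
    show ?thesis
    proof (cases "mode = 0")
      case True
      then show ?thesis using m sub lab'A(1) unfolding mode_ok_def by (cases st) (simp_all, blast+)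
    next
      case False
      then show ?thesis using m sub lab'A(1) unfolding mode_ok_def by (simp; blast)
    qed
  qed
  moreover have "alive_ok ?N en A' Al" using inv part unfolding sel_inv_def alive_ok_def by blast
  moreover have "A' \<subseteq> {1..?N}" using A part by blast
  moreover have "r - card Lo + (low + card Lo) = R" "r - card Lo < card A'"
    using ch inv by (auto simp: sel_inv_def)
  ultimately show ?thesis unfolding sel_inv_def by blast
qed

section \<open>Ordering runs of equal tokens\<close>

definition run_label :: "nat \<Rightarrow> (nat \<Rightarrow> nat) \<Rightarrow> (nat \<Rightarrow> nat) \<Rightarrow> nat set \<Rightarrow> (nat \<Rightarrow> nat) \<Rightarrow> nat \<Rightarrow> bool" where
  "run_label N lab en A rl a \<longleftrightarrow> rl a = (if en a \<in> A then if N < rl (en a) then rl (en a) - 1 else rl (en a) + 1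
     else if lab (en a) < Suc N then 1 else 2 * N + 1)"

text \<open>A run of \<open>k\<close> equal tokens gets label \<open>k\<close> if a smaller token follows it, and \<open>2 N + 2 - k\<close> otherwise.\<close>

lemma run_label_range:
  assumes lbl: "\<forall>a\<in>A. run_label N lab en A rl a" and A: "A \<subseteq> {1..N}" and en: "\<forall>a\<in>A. a < en a \<and> en a \<le> Suc N"
  shows "a \<in> A \<Longrightarrow> 1 \<le> rl a \<and> rl a + a \<le> N + 1 \<or> N + 1 + a \<le> rl a \<and> rl a \<le> 2 * N + 1"
proof (induction "N - a" arbitrary: a rule: less_induct)
  case less
  have e: "a < en a" "en a \<le> Suc N" "1 \<le> a" "a \<le> N" using less.prems en A by auto
  have la: "run_label N lab en A rl a" using lbl less.prems by blast
  show ?case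
  proof (cases "en a \<in> A")
    case True
    then have "1 \<le> rl (en a) \<and> rl (en a) + en a \<le> N + 1 \<or> N + 1 + en a \<le> rl (en a) \<and> rl (en a) \<le> 2 * N + 1"
    proof -
      have "en a \<le> N" using True A by auto
      then have "N - en a < N - a" using e(1) by simp
      then show ?thesis using less.hyps[of "en a"] True by blast
    qed
    then show ?thesis using la True e by (auto simp: run_label_def split: if_splits)
  next
    case False
    then show ?thesis using la e by (auto simp: run_label_def split: if_splits)
  qed
qed

text \<open>If something smaller follows the run, a longer run is larger; if something larger
  follows, a longer run is smaller; and all runs of the first kind precede those of the second.
  Inductively, both positions are moved one token ahead, where either both are still active or a
  label compared with \<open>N + 1\<close> decides.\<close>

lemma run_label_less:
  assumes lbl: "\<forall>a\<in>A. run_label N lab en A rl a" and A: "A \<subseteq> {1..N}" and en: "\<forall>a\<in>A. a < en a \<and> en a \<le> Suc N"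
    and strip: "\<And>a b. a \<in> A \<Longrightarrow> b \<in> A \<Longrightarrow> f a < f b \<longleftrightarrow> f (en a) < f (en b)"
    and lab: "\<And>p q. p \<in> {1..Suc N} \<Longrightarrow> q \<in> {1..Suc N} \<Longrightarrow> flab N lab A p < flab N lab A q \<Longrightarrow> f p < f q"
    and nonA: "\<And>p. p \<in> {1..Suc N} \<Longrightarrow> p \<notin> A \<Longrightarrow> lab p \<noteq> Suc N"
  shows "a \<in> A \<Longrightarrow> b \<in> A \<Longrightarrow> rl a < rl b \<Longrightarrow> (f a :: 'b::ord) < f b"
proof (induction "N - a" arbitrary: a b rule: less_induct)
  case less
  note range = run_label_range[OF lbl A en]
  have e: "a < en a" "en a \<in> {1..Suc N}" "en b \<in> {1..Suc N}" "a \<le> N" using less.prems en A by auto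
  have la: "run_label N lab en A rl a" and lb: "run_label N lab en A rl b" using lbl less.prems by auto
  have "f (en a) < f (en b)"
  proof (cases "en a \<in> A")
    case aA: True
    show ?thesis
    proof (cases "en b \<in> A")
      case True
      have "en b \<le> N" "1 \<le> en b" "en a \<le> N" "1 \<le> en a" using aA True A by auto
      then have "rl (en a) < rl (en b)"
        using la lb aA True less.prems(3) range[OF aA] range[OF True] range[OF less.prems(1)] range[OF less.prems(2)]
        by (auto simp: run_label_def split: if_splits)
      moreover have "N - en a < N - a" using e(1) \<open>en a \<le> N\<close> by simp
      ultimately show ?thesis using less.hyps[of "en a" "en b"] aA True by blast
    next
      case False
      then have "lab (en b) > Suc N"
        using lb less.prems(3) range[OF less.prems(1)] nonA[OF e(3) False] by (auto simp: run_label_def split: if_splits)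
      then show ?thesis using lab[OF e(2,3)] aA False by (simp add: flab_def)
    qed
  next
    case False
    have la1: "lab (en a) < Suc N"
      using la False less.prems(3) range[OF less.prems(2)] less.prems(2) A by (auto simp: run_label_def split: if_splits)
    show ?thesis
    proof (cases "en b \<in> A")
      case True
      then show ?thesis using lab[OF e(2,3)] False la1 by (simp add: flab_def)
    next
      case bF: False
      then have "lab (en b) > Suc N"
        using lb la la1 False less.prems(3) nonA[OF e(3) bF] by (auto simp: run_label_def split: if_splits)
      then show ?thesis using lab[OF e(2,3)] False bF la1 by (simp add: flab_def)
    qed
  qed
  then show ?case using strip[OF less.prems(1,2)] by simp
qed

lemma labels_ok_cong:
  assumes "\<forall>p. p \<notin> A \<longrightarrow> lab' p = lab p" "A \<subseteq> {1..length T}" "labels_ok T lab A low high"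
  shows "labels_ok T lab' A low high"
proof -
  have "flab (length T) lab' A = flab (length T) lab A" using assms(1) by (auto simp: flab_def fun_eq_iff)
  moreover have "lab' (Suc (length T)) = lab (Suc (length T))" using assms(1,2) by auto
  moreover have "{p \<in> {1..length T} - A. lab' p \<le> length T} = {p \<in> {1..length T} - A. lab p \<le> length T}"
    using assms(1) by auto
  moreover have "\<forall>p\<in>{1..length T} - A. lab' p = lab p" using assms(1) by simp
  ultimately show ?thesis using assms(3) unfolding labels_ok_def by (elim conjE, intro conjI) simp_all
qed

text \<open>All active suffixes see the same key at the frontier, so by \<open>tokens_ok\<close>
  they find the same token there, of length \<open>t\<close>. Appending it to the common prefix of
  length \<open>l\<close> gives the new token \<open>[a, a + l + t)\<close> of every active
  \<open>a\<close>, and run labels order the suffixes by what follows it.\<close>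

lemma sel_inv_extend:
  assumes T: "endmarked T" and inv: "sel_inv T R lab fr en A 0 r low high Al st"
    and key: "\<forall>a\<in>A. fkey T lab fr a = kp" and fr: "\<forall>a\<in>A. fr a \<in> {1..length T}"
    and en': "\<forall>p. en' p = (if p \<in> A then en (fr p) else en p)"
    and lbl: "\<forall>a\<in>A. run_label (length T) lab en' A rl a"
    and lab': "\<forall>p. lab' p = (if p \<in> A then rl p else lab p)"
    and fr': "\<forall>a\<in>A. fr' a = a"
  shows "\<exists>Al'. sel_inv T R lab' fr' en' A 1 r low high Al' False \<and>
     (if st then Al' = Al else card Al' + card A = card Al)"
proof -
  let ?N = "length T"
  have A: "A \<subseteq> {1..?N}" and lok: "labels_ok T lab A low high" and tok: "tokens_ok T lab en A"
    and mode: "mode_ok T lab fr en A 0 st" and al: "alive_ok ?N en A Al" using inv by (auto simp: sel_inv_def)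
  obtain l where l: "\<And>a. a \<in> A \<Longrightarrow> fr a = a + l"
    and agree: "\<And>a b d. a \<in> A \<Longrightarrow> b \<in> A \<Longrightarrow> d < l \<Longrightarrow> text_symbol T (a + d) = text_symbol T (b + d)"
    using inv unfolding sel_inv_def common_prefix_def by blast
  have finA: "finite A" using A by (rule finite_subset) simp
  have "A \<noteq> {}" using inv by (auto simp: sel_inv_def)
  then obtain a0 where a0: "a0 \<in> A" by blast
  define t where "t = en (fr a0) - fr a0"
  have labA: "p \<in> A \<Longrightarrow> lab p = Suc ?N" for p using mode by (auto simp: mode_ok_def)
  then have fl: "flab ?N lab A p = lab p" for p by (auto simp: flab_def)
  have enr: "p < en p" "en p \<le> Suc ?N" if "p \<in> {1..?N}" for p using tok that by (auto simp: tokens_ok_def)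
  have t: "en (fr a) = a + (l + t)" "\<And>d. d < t \<Longrightarrow> text_symbol T (fr a + d) = text_symbol T (fr a0 + d)" if a: "a \<in> A" for a
  proof -
    have "text_symbol T (fr a) = text_symbol T (fr a0)" "lab (fr a) = lab (fr a0)"
    proof -
      have "fkey T lab fr a = fkey T lab fr a0" using key a a0 by simp
      then show "text_symbol T (fr a) = text_symbol T (fr a0)" "lab (fr a) = lab (fr a0)" by (simp_all add: fkey_def)
    qed
    then have *: "en (fr a) - fr a = t \<and> (\<forall>d<en (fr a) - fr a. text_symbol T (fr a + d) = text_symbol T (fr a0 + d))"
      using tok a a0 fr unfolding tokens_ok_def t_def fl by blast
    then show "\<And>d. d < t \<Longrightarrow> text_symbol T (fr a + d) = text_symbol T (fr a0 + d)" by simp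
    show "en (fr a) = a + (l + t)" using * l[OF a] enr(1)[of "fr a"] fr a by auto
  qed
  have t0: "0 < t" using enr(1)[of "fr a0"] fr a0 by (auto simp: t_def)
  have en'A: "en' a = a + (l + t)" if "a \<in> A" for a using t(1)[OF that] en' that by simp
  have agree': "text_symbol T (a + d) = text_symbol T (b + d)" if ab: "a \<in> A" "b \<in> A" and d: "d < l + t" for a b d
  proof (cases "d < l")
    case True
    then show ?thesis by (rule agree[OF ab])
  next
    case False
    then have "text_symbol T (fr a + (d - l)) = text_symbol T (fr b + (d - l))"
      using t(2)[OF ab(1), of "d - l"] t(2)[OF ab(2), of "d - l"] d by simp
    then show ?thesis using l[OF ab(1)] l[OF ab(2)] False by simp
  qed
  have enr': "a < en' a \<and> en' a \<le> Suc ?N" if "a \<in> A" for a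
    using en'A[OF that] t0 enr(2)[of "fr a"] fr that en' by auto
  have nonA: "lab p \<noteq> Suc ?N" if "p \<in> {1..Suc ?N}" "p \<notin> A" for p
  proof (cases "p = Suc ?N")
    case True
    then show ?thesis using lok by (simp add: labels_ok_def)
  next
    case False
    have "card A \<ge> 1" using a0 finA by (metis One_nat_def Suc_leI card_gt_0_iff empty_iff)
    moreover have "low + high + card A = ?N" using lok by (simp add: labels_ok_def)
    moreover have "1 \<le> lab p \<and> lab p \<le> low \<or> 2 * ?N + 2 - high < lab p"
      using lok that False unfolding labels_ok_def by auto
    ultimately show ?thesis by auto
  qed
  have tok': "tokens_ok T lab' en' A"
    unfolding tokens_ok_def
  proof (intro conjI ballI impI)
    fix p assume p: "p \<in> {1..?N}"
    show "p < en' p" "en' p \<le> Suc ?N" using enr'[of p] enr[OF p] en' by (cases "p \<in> A"; simp)+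
  next
    fix p q assume pq: "p \<in> {1..?N}" "q \<in> {1..?N}" "text_symbol T p = text_symbol T q"
      "flab ?N lab' A p = flab ?N lab' A q"
    \<comment> \<open>In mode 0 the active labels are \<open>N + 1\<close> anyway, so
      \<open>flab\<close> is the old labelling whatever run labels are written.\<close>
    have "flab ?N lab' A = lab" using lab' labA by (auto simp: flab_def fun_eq_iff)
    then have lpq: "lab p = lab q" using pq(4) by simp
    have "lab x \<noteq> Suc ?N" if "x \<in> {1..?N}" "x \<notin> A" for x using nonA[of x] that by simp
    then have iff: "p \<in> A \<longleftrightarrow> q \<in> A" using lpq labA pq(1,2) by metis
    have "en' p - p = en' q - q \<and> (\<forall>d<en' p - p. text_symbol T (p + d) = text_symbol T (q + d))"
    proof (cases "p \<in> A")
      case True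
      then have qA: "q \<in> A" using iff by simp
      show ?thesis using en'A[OF True] en'A[OF qA] agree'[OF True qA] by simp
    next
      case False
      then have e: "en' p = en p" "en' q = en q" using iff en' by auto
      have "en p - p = en q - q \<and> (\<forall>d<en p - p. text_symbol T (p + d) = text_symbol T (q + d))"
        using tok pq(1-3) lpq unfolding tokens_ok_def fl by blast
      then show ?thesis unfolding e .
    qed
    then show "en' p - p = en' q - q" "\<forall>d<en' p - p. text_symbol T (p + d) = text_symbol T (q + d)"
      by blast+
  qed
  have lok': "labels_ok T lab' A low high" by (rule labels_ok_cong[OF _ A lok]) (use lab' in auto)
  have strip: "text_suffix T a < text_suffix T b \<longleftrightarrow> text_suffix T (en' a) < text_suffix T (en' b)"
    if ab: "a \<in> A" "b \<in> A" for a b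
  proof -
    have "a + (l + t) \<le> Suc ?N" "b + (l + t) \<le> Suc ?N" using enr' en'A ab by metis+
    then show ?thesis unfolding en'A[OF ab(1)] en'A[OF ab(2)] using ab A agree'[OF ab]
      by (intro text_suffix_strip) auto
  qed
  have less: "text_suffix T a < text_suffix T b" if "a \<in> A" "b \<in> A" "rl a < rl b" for a b
  proof (rule run_label_less[where f = "text_suffix T", OF lbl A _ strip _ nonA that])
    show "\<forall>a\<in>A. a < en' a \<and> en' a \<le> Suc ?N" using enr' by blast
    show "text_suffix T p < text_suffix T q" if "p \<in> {1..Suc ?N}" "q \<in> {1..Suc ?N}" "flab ?N lab A p < flab ?N lab A q" for p q
      using lok that unfolding labels_ok_def by blast
  qed
  have mode': "mode_ok T lab' fr' en' A 1 False"
    unfolding mode_ok_def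
  proof (simp, intro ballI conjI impI)
    fix a assume a: "a \<in> A"
    show "fr' a = a" using fr' a by simp
    show "lab' (en' a) \<noteq> lab' a" if e: "en' a \<in> A"
    proof -
      have la: "run_label ?N lab en' A rl a" using lbl a by blast
      have "1 \<le> rl (en' a) \<and> rl (en' a) + en' a \<le> ?N + 1 \<or> ?N + 1 + en' a \<le> rl (en' a) \<and> rl (en' a) \<le> 2 * ?N + 1"
        by (rule run_label_range[OF lbl A _ e]) (use enr' in blast)
      then have "rl a \<noteq> rl (en' a)" using la e by (simp add: run_label_def split: if_splits)
      then show ?thesis using lab' a e by simp
    qed
    fix b assume b: "b \<in> A"
    show "text_symbol T a = text_symbol T b" using agree'[OF a b, of 0] t0 by simp
    show "text_suffix T a < text_suffix T b" if "lab' a < lab' b" using less[OF a b] that lab' a b by simp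
  qed
  have cp': "common_prefix T fr' A"
    unfolding common_prefix_def using fr' A by (intro exI[of _ 0]) auto
  have main: "sel_inv T R lab' fr' en' A 1 r low high Al' False" if "alive_ok ?N en' A Al'" for Al'
    using that inv tok' lok' mode' cp' unfolding sel_inv_def by simp
  show ?thesis
  proof (cases st)
    case True
    \<comment> \<open>Nothing has been matched yet: the token found is the suffix's own, so
      \<open>en\<close> is unchanged and no token is swallowed.\<close>
    then have "fr a = a" if "a \<in> A" for a using mode that by (auto simp: mode_ok_def)
    then have "en' = en" using en' by auto
    then show ?thesis using main al True by auto
  next
    case False
    then have frA: "fr a = en a" "fr a \<notin> A" if "a \<in> A" for a using mode that by (auto simp: mode_ok_def)
    have AlA: "A \<subseteq> Al" "Al \<subseteq> {1..?N}" "inj_on en Al" "en ` Al \<subseteq> insert (Suc ?N) Al" using al by (auto simp: alive_ok_def)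
    have frAl: "fr a \<in> Al" if "a \<in> A" for a
      using frA(1)[OF that] AlA that fr by (metis atLeastAtMost_iff image_subset_iff insertE not_less_eq_eq order_refl subsetD)
    have inj: "en x = en y \<Longrightarrow> x \<in> Al \<Longrightarrow> y \<in> Al \<Longrightarrow> x = y" for x y using AlA(3) by (auto dest: inj_onD)
    have injfr: "inj_on fr A" by (rule inj_onI) (use l in auto)
    \<comment> \<open>The swallowed tokens are alive, inactive and pairwise distinct, so exactly
      \<open>card A\<close> of them leave \<open>Al\<close>.\<close>
    let ?Al = "Al - fr ` A"
    have "alive_ok ?N en' A ?Al"
      unfolding alive_ok_def
    proof (intro conjI)
      show "A \<subseteq> ?Al" using AlA(1) frA by blast
      show "?Al \<subseteq> {1..?N}" using AlA by blast
      show "inj_on en' ?Al"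
      proof (rule inj_onI)
        fix x y assume xy: "x \<in> ?Al" "y \<in> ?Al" "en' x = en' y"
        show "x = y"
        proof (cases "x \<in> A"; cases "y \<in> A")
          assume "x \<in> A" "y \<in> A"
          then show ?thesis using xy(3) en'A by simp
        next
          assume "x \<in> A" "y \<notin> A"
          then have "fr x = y" using xy inj[of "fr x" y] frAl en' by auto
          then show ?thesis using xy(2) \<open>x \<in> A\<close> by blast
        next
          assume "x \<notin> A" "y \<in> A"
          then have "x = fr y" using xy inj[of x "fr y"] frAl en' by auto
          then show ?thesis using xy(1) \<open>y \<in> A\<close> by blast
        next
          assume "x \<notin> A" "y \<notin> A"
          then show ?thesis using xy inj[of x y] en' by auto
        qed
      qed
      show "en' ` ?Al \<subseteq> insert (Suc ?N) ?Al"
      proof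
        fix z assume "z \<in> en' ` ?Al"
        then obtain x where x: "x \<in> ?Al" "z = en' x" by blast
        have z: "z \<in> insert (Suc ?N) Al" using x AlA(4) frAl en' by auto
        moreover have "z \<notin> fr ` A"
        proof
          assume "z \<in> fr ` A"
          then obtain b where b: "b \<in> A" "z = en b" using frA by auto
          show False
          proof (cases "x \<in> A")
            case True
            then have "fr x = b" using x b inj[of "fr x" b] frAl AlA(1) en' by auto
            then show False using frA(2)[OF True] b by simp
          next
            case False
            then have "x = b" using x b inj[of x b] AlA(1) en' by auto
            then show False using False b by simp
          qed
        qed
        ultimately show "z \<in> insert (Suc ?N) ?Al" by blast
      qed
    qed
    moreover have "card ?Al + card A = card Al"
    proof -
      have "fr ` A \<subseteq> Al" using frAl by blast
      moreover have "finite Al" using AlA(2) by (rule finite_subset) simp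
      ultimately show ?thesis
        using card_Diff_subset[of "fr ` A" Al] card_mono[of Al "fr ` A"] injfr finA by (simp add: card_image)
    qed
    ultimately show ?thesis using main False by auto
  qed
qed

text \<open>The survivors share one run label, while adjacent active tokens have different labels;
  hence no survivor's token ends at a survivor. The shared token becomes the common prefix and the
  frontier moves behind it. No token is swallowed.\<close>

lemma sel_inv_settle:
  assumes inv: "sel_inv T R lab fr en A mode r low high Al st" and mode: "mode \<noteq> 0"
    and key: "\<forall>a\<in>A. fkey T lab fr a = kp"
    and lab': "\<forall>p. lab' p = (if p \<in> A then Suc (length T) else lab p)"
    and fr': "\<forall>a\<in>A. fr' a = en a"
  shows "sel_inv T R lab' fr' en A 0 r low high Al False"
proof -
  let ?N = "length T"
  have A: "A \<subseteq> {1..?N}" and lok: "labels_ok T lab A low high" and tok: "tokens_ok T lab en A"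
    and mo: "mode_ok T lab fr en A mode st" using inv by (auto simp: sel_inv_def)
  have fr: "fr a = a" if "a \<in> A" for a using mo mode that by (auto simp: mode_ok_def)
  have lab: "lab a = lab b" "text_symbol T a = text_symbol T b" if "a \<in> A" "b \<in> A" for a b
  proof -
    have "fkey T lab fr a = fkey T lab fr b" using key that by simp
    then show "lab a = lab b" "text_symbol T a = text_symbol T b" using fr that by (simp_all add: fkey_def)
  qed
  have "labels_ok T lab' A low high" by (rule labels_ok_cong[OF _ A lok]) (use lab' in auto)
  moreover have "flab ?N lab' A = flab ?N lab A" using lab' by (auto simp: flab_def)
  then have "tokens_ok T lab' en A" using tok unfolding tokens_ok_def by (simp only:)
  moreover have "mode_ok T lab' fr' en A 0 False"
  proof -
    have "en a \<notin> A" if "a \<in> A" for a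
    proof
      assume "en a \<in> A"
      then have "lab (en a) \<noteq> lab a" using mo mode that by (simp add: mode_ok_def)
      then show False using lab(1)[OF \<open>en a \<in> A\<close> that] by simp
    qed
    then show ?thesis using lab' fr' by (simp add: mode_ok_def)
  qed
  moreover have "common_prefix T fr' A"
  proof -
    have "A \<noteq> {}" using inv by (auto simp: sel_inv_def)
    then obtain a0 where a0: "a0 \<in> A" by blast
    have *: "en a - a = en b - b \<and> (\<forall>d<en a - a. text_symbol T (a + d) = text_symbol T (b + d))"
      "a < en a" "en a \<le> Suc ?N" if "a \<in> A" "b \<in> A" for a b
    proof -
      have "flab ?N lab A a = flab ?N lab A b" using that by (simp add: flab_def)
      then show "en a - a = en b - b \<and> (\<forall>d<en a - a. text_symbol T (a + d) = text_symbol T (b + d))"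
        "a < en a" "en a \<le> Suc ?N" using tok lab(2)[OF that] A that unfolding tokens_ok_def by blast+
    qed
    show ?thesis unfolding common_prefix_def
    proof (intro exI[of _ "en a0 - a0"] ballI conjI allI impI)
      fix a assume a: "a \<in> A"
      show "fr' a = a + (en a0 - a0)" using fr' a *(1)[OF a a0] *(2)[OF a a] by auto
      show "fr' a \<le> Suc ?N" using fr' a *(3)[OF a a] by simp
      fix b d assume "b \<in> A" "d < en a0 - a0"
      then show "text_symbol T (a + d) = text_symbol T (b + d)" using *(1)[OF a a0] *(1)[OF a] by simp
    qed
  qed
  ultimately show ?thesis using inv unfolding sel_inv_def by simp
qed

lemma sel_inv_final:
  assumes inv: "sel_inv T R lab fr en A mode r low high Al st" and one: "card A = 1" and g: "g \<in> A"
  shows "suffix_of_rank T (Suc R) = g" "g \<in> {1..length T}"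
    "\<And>p. p \<in> {1..length T} \<Longrightarrow> p \<noteq> g \<Longrightarrow> lab p < Suc (length T) \<longleftrightarrow> text_suffix T p < text_suffix T g"
    "\<And>p. p \<in> {1..length T} \<Longrightarrow> p \<noteq> g \<Longrightarrow> lab p \<noteq> Suc (length T)"
proof -
  let ?N = "length T"
  have A: "A \<subseteq> {1..?N}" and lok: "labels_ok T lab A low high" using inv by (auto simp: sel_inv_def)
  have A1: "A = {g}" using one g by (metis card_1_singletonE singletonD)
  show gN: "g \<in> {1..?N}" using A g by blast
  have ord: "\<And>p q. p \<in> {1..Suc ?N} \<Longrightarrow> q \<in> {1..Suc ?N} \<Longrightarrow> flab ?N lab A p < flab ?N lab A q \<Longrightarrow>
        text_suffix T p < text_suffix T q" using lok unfolding labels_ok_def by blast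
  have sum: "low + high + 1 = ?N" using lok one by (simp add: labels_ok_def)
  show ne: "lab p \<noteq> Suc ?N" if "p \<in> {1..?N}" "p \<noteq> g" for p
  proof -
    have "1 \<le> lab p \<and> lab p \<le> low \<or> 2 * ?N + 2 - high < lab p"
      using lok that A1 unfolding labels_ok_def by auto
    then show ?thesis using sum by auto
  qed
  show iff: "lab p < Suc ?N \<longleftrightarrow> text_suffix T p < text_suffix T g" if p: "p \<in> {1..?N}" "p \<noteq> g" for p
  proof
    assume "lab p < Suc ?N"
    then show "text_suffix T p < text_suffix T g" using ord[of p g] p gN A1 by (simp add: flab_def)
  next
    assume *: "text_suffix T p < text_suffix T g"
    show "lab p < Suc ?N"
    proof (rule ccontr)
      assume "\<not> lab p < Suc ?N"
      then have "Suc ?N < lab p" using ne[OF p] by simp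
      then have "text_suffix T g < text_suffix T p" using ord[of g p] p gN A1 by (simp add: flab_def)
      then show False using * by simp
    qed
  qed
  have "below T g = {p \<in> {1..?N} - A. lab p \<le> ?N}"
    unfolding below_def A1 using iff by (auto simp: less_Suc_eq_le)
  then have "card (below T g) = low" using lok by (simp add: labels_ok_def)
  moreover have "low = R" using inv one by (simp add: sel_inv_def)
  ultimately show "suffix_of_rank T (Suc R) = g" using suffix_of_rank_eqI[OF gN] by simp
qed

section \<open>Selecting a suffix of given rank\<close>

definition holds_text :: "'a::linorder list \<Rightarrow> 'a hstate \<Rightarrow> bool" where
  "holds_text T s \<longleftrightarrow> endmarked T \<and> size_of s = length T \<and> (\<forall>j\<in>{1..length T}. sy s j = text_symbol T j)"

definition seg :: "(nat \<Rightarrow> 'b) \<Rightarrow> nat \<Rightarrow> 'b list" where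
  "seg f n = map f [0..<n]"

lemma seg_simps [simp]: "seg f 0 = []" "seg f (Suc n) = seg f n @ [f n]" "length (seg f n) = n"
  "x < n \<Longrightarrow> seg f n ! x = f x" "set (seg f n) = f ` {..<n}"
  by (auto simp: seg_def)

lemma seg_cong: "\<forall>x<n. f x = g x \<Longrightarrow> seg f n = seg g n"
  by (simp add: seg_def)

lemma card_seg_filter: "card {x. x < n \<and> P (f x)} = length (filter P (seg f n))"
  unfolding length_filter_conv_card by (rule arg_cong[of _ _ card]) auto

lemma distinct_seg: "distinct (seg f n) \<longleftrightarrow> inj_on f {..<n}"
  by (auto simp: seg_def distinct_map atLeast0LessThan)

lemma distinct_segD: "distinct (seg f n) \<Longrightarrow> j < n \<Longrightarrow> f j \<notin> f ` {..<j}"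
proof
  assume d: "distinct (seg f n)" "j < n" and "f j \<in> f ` {..<j}"
  then obtain x where x: "x < j" "f j = f x" by auto
  have "j = x" by (rule inj_onD[OF d(1)[unfolded distinct_seg] x(2)]) (use d x in auto)
  then show False using x by simp
qed

section \<open>The linear passes of a selection round\<close>

definition classify :: hcom where
  "classify = (Rlt ::= Lit 0 ;; Reqc ::= Lit 0 ;; For Rx (V Rn) (Rq ::= Arr Fr (Arr Act (V Rx)) ;;
     If (KeyLt (V Rq) (V Rpv)) (Put Cls (V Rx) (Lit 0) ;; Rlt ::= Inc (V Rlt) 1)
       (If (KeyLt (V Rpv) (V Rq)) (Put Cls (V Rx) (Lit 2))
          (Put Cls (V Rx) (Lit 1) ;; Reqc ::= Inc (V Reqc) 1))))"

lemma key_frame: "ar s' Lab = ar s Lab \<Longrightarrow> sy s' = sy s \<Longrightarrow> key s' = key s"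
  by (auto simp: key_def)

lemma key_upd [simp]: "key (s\<lparr>rg := f\<rparr>) = key s"
  "k \<noteq> Lab \<Longrightarrow> key (s\<lparr>ar := (ar s)(k := g)\<rparr>) = key s"
  by (auto simp: key_def)

lemma wp_classify:
  fixes s :: "'a::linorder hstate"
  defines "cl \<equiv> \<lambda>a. side (key s (rg s Rpv)) (key s (ar s Fr a))" and "xs \<equiv> seg (ar s Act) (rg s Rn)"
  assumes n: "rg s Rn \<le> n"
    and Q: "\<And>s'. \<forall>x<rg s Rn. ar s' Cls x = cl (ar s Act x) \<Longrightarrow>
      rg s' Rlt = length (filter (\<lambda>a. cl a = 0) xs) \<Longrightarrow> rg s' Reqc = length (filter (\<lambda>a. cl a = 1) xs) \<Longrightarrow>
      frame classify s s' \<Longrightarrow> Q s' (n - rg s Rn)"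
  shows "wp classify Q s n"
proof -
  let ?s = "s\<lparr>rg := (rg s)(Rlt := 0, Reqc := 0)\<rparr>"
  have "wp (For Rx (V Rn) (Rq ::= Arr Fr (Arr Act (V Rx)) ;;
     If (KeyLt (V Rq) (V Rpv)) (Put Cls (V Rx) (Lit 0) ;; Rlt ::= Inc (V Rlt) 1)
       (If (KeyLt (V Rpv) (V Rq)) (Put Cls (V Rx) (Lit 2))
          (Put Cls (V Rx) (Lit 1) ;; Reqc ::= Inc (V Reqc) 1)))) Q ?s n"
  proof (rule wp_For[where m = "rg s Rn" and I = "\<lambda>j s'. (\<forall>x<j. ar s' Cls x = cl (ar s Act x)) \<and>
      rg s' Rlt = length (filter (\<lambda>a. cl a = 0) (seg (ar s Act) j)) \<and>
      rg s' Reqc = length (filter (\<lambda>a. cl a = 1) (seg (ar s Act) j))"], goal_cases)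
    case (3 j s' n')
    have fr: "ar s' Fr = ar s Fr" "ar s' Act = ar s Act" "rg s' Rpv = rg s Rpv" "ar s' Lab = ar s Lab" "sy s' = sy s"
      using 3(4) by (auto simp: frame_def)
    have k: "key s' = key s" using fr(4,5) by (rule key_frame)
    show ?case using 3(1-3) by (auto simp: fr k cl_def side_def less_Suc_eq)
  next
    case (5 s')
    have "frame classify s s'" using 5(3) by (simp add: frame_def classify_def)
    then show ?case using 5 Q[of s'] by (simp add: xs_def)
  qed (use n in \<open>auto simp: frame_def\<close>)
  then show ?thesis unfolding classify_def by simp
qed

definition choose_part :: hcom where
  "choose_part = If (Lt (V Rr) (V Rlt)) (Rch ::= Lit 0)
     (If (Lt (V Rr) (Plus (V Rlt) (V Reqc))) (Rch ::= Lit 1) (Rch ::= Lit 2))"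

text \<open>\<open>RL\<close> and \<open>RH\<close> freeze the two labels before the counters move.
  The survivors are compacted in place, which keeps \<open>Act\<close> sorted.\<close>

definition keep_part :: hcom where
  "keep_part = (RL ::= Inc (V Rlow) 1 ;; RH ::= Minus (Lin 2 2) (V Rhigh) ;; Rm ::= Lit 0 ;;
     For Rx (V Rn) (Ra ::= Arr Act (V Rx) ;;
       If (Lt (Arr Cls (V Rx)) (V Rch))
         (Put Lab (V Ra) (V RL) ;; Rlow ::= Inc (V Rlow) 1 ;; Rr ::= Minus (V Rr) (Lit 1))
       (If (Lt (V Rch) (Arr Cls (V Rx)))
         (Put Lab (V Ra) (V RH) ;; Rhigh ::= Inc (V Rhigh) 1)
         (Put Act (V Rm) (V Ra) ;; Rm ::= Inc (V Rm) 1))) ;;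
     Rn ::= V Rm)"

lemma wp_keep_part:
  fixes s :: "'a::linorder hstate"
  defines "xs \<equiv> seg (ar s Act) (rg s Rn)" and "ch \<equiv> rg s Rch"
  assumes cl: "\<forall>x<rg s Rn. ar s Cls x = cl (ar s Act x)" and dist: "distinct xs"
    and n: "rg s Rn \<le> n"
    and Q: "\<And>s'. rg s' Rn = length (filter (\<lambda>a. cl a = ch) xs) \<Longrightarrow>
      seg (ar s' Act) (rg s' Rn) = filter (\<lambda>a. cl a = ch) xs \<Longrightarrow>
      ar s' Lab = split_labels (size_of s) (set xs) cl ch (rg s Rlow) (rg s Rhigh) (ar s Lab) \<Longrightarrow>
      rg s' Rlow = rg s Rlow + length (filter (\<lambda>a. cl a < ch) xs) \<Longrightarrow>
      rg s' Rhigh = rg s Rhigh + length (filter (\<lambda>a. ch < cl a) xs) \<Longrightarrow>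
      rg s' Rr = rg s Rr - length (filter (\<lambda>a. cl a < ch) xs) \<Longrightarrow> frame keep_part s s' \<Longrightarrow> Q s' (n - rg s Rn)"
  shows "wp keep_part Q s n"
proof -
  let ?s = "s\<lparr>rg := (rg s)(RL := Suc (rg s Rlow), RH := 2 * size_of s + 2 - rg s Rhigh, Rm := 0)\<rparr>"
  let ?xs = "seg (ar s Act)"
  have "wp (For Rx (V Rn) (Ra ::= Arr Act (V Rx) ;;
       If (Lt (Arr Cls (V Rx)) (V Rch))
         (Put Lab (V Ra) (V RL) ;; Rlow ::= Inc (V Rlow) 1 ;; Rr ::= Minus (V Rr) (Lit 1))
       (If (Lt (V Rch) (Arr Cls (V Rx)))
         (Put Lab (V Ra) (V RH) ;; Rhigh ::= Inc (V Rhigh) 1)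
         (Put Act (V Rm) (V Ra) ;; Rm ::= Inc (V Rm) 1)))) (wp (Rn ::= V Rm) Q) ?s n"
  proof (rule wp_For[where m = "rg s Rn" and I = "\<lambda>j s'.
      rg s' Rm = length (filter (\<lambda>a. cl a = ch) (?xs j)) \<and> rg s' Rm \<le> j \<and>
      seg (ar s' Act) (rg s' Rm) = filter (\<lambda>a. cl a = ch) (?xs j) \<and> (\<forall>x\<ge>j. ar s' Act x = ar s Act x) \<and>
      ar s' Lab = split_labels (size_of s) (set (?xs j)) cl ch (rg s Rlow) (rg s Rhigh) (ar s Lab) \<and>
      rg s' Rlow = rg s Rlow + length (filter (\<lambda>a. cl a < ch) (?xs j)) \<and>
      rg s' Rhigh = rg s Rhigh + length (filter (\<lambda>a. ch < cl a) (?xs j)) \<and>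
      rg s' Rr = rg s Rr - length (filter (\<lambda>a. cl a < ch) (?xs j))"], goal_cases)
    case 2
    show ?case by (auto simp: split_labels_def fun_eq_iff)
  next
    case (3 j s' n')
    let ?a = "ar s Act j"
    have fr: "ar s' Cls = ar s Cls" "rg s' RL = Suc (rg s Rlow)" "rg s' RH = 2 * size_of s + 2 - rg s Rhigh"
      "rg s' Rch = ch"
      using 3(4) by (auto simp: frame_def ch_def)
    have a: "?a \<notin> ar s Act ` {..<j}" by (rule distinct_segD[OF dist[unfolded xs_def] 3(1)])
    have c: "ar s Cls j = cl ?a" using cl 3(1) by simp
    have sl: "(split_labels N (ar s Act ` {..<j}) cl ch low high lab)(?a := Suc low) =
        split_labels N (insert ?a (ar s Act ` {..<j})) cl ch low high lab" if "cl ?a < ch" for N low high lab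
      using that a by (auto simp: split_labels_def fun_eq_iff)
    have sh: "(split_labels N (ar s Act ` {..<j}) cl ch low high lab)(?a := 2 * N + 2 - high) =
        split_labels N (insert ?a (ar s Act ` {..<j})) cl ch low high lab" if "ch < cl ?a" for N low high lab
      using that a by (auto simp: split_labels_def fun_eq_iff)
    have se: "split_labels N (ar s Act ` {..<j}) cl ch low high lab =
        split_labels N (insert ?a (ar s Act ` {..<j})) cl ch low high lab" if "cl ?a = ch" for N low high lab
      using that a by (auto simp: split_labels_def fun_eq_iff)
    have sg: "seg ((ar s' Act)(m := ?a)) m = seg (ar s' Act) m" for m by (rule seg_cong) simp
    define F where "F = filter (\<lambda>a. cl a = ch) (?xs j)"
    have I: "rg s' Rx = j" "rg s' Rm = length F" "rg s' Rm \<le> j" "seg (ar s' Act) (rg s' Rm) = F"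
      "\<forall>x\<ge>j. ar s' Act x = ar s Act x"
      "ar s' Lab = split_labels (size_of s) (ar s Act ` {..<j}) cl ch (rg s Rlow) (rg s Rhigh) (ar s Lab)"
      "rg s' Rlow = rg s Rlow + length (filter (\<lambda>a. cl a < ch) (?xs j))"
      "rg s' Rhigh = rg s Rhigh + length (filter (\<lambda>a. ch < cl a) (?xs j))"
      "rg s' Rr = rg s Rr - length (filter (\<lambda>a. cl a < ch) (?xs j))"
      using 3(2) 3(3)[unfolded seg_simps(5)] unfolding F_def by blast+
    note I = I(1) I(2)[symmetric] I(3-)
    have F: "filter (\<lambda>a. cl a = ch) (?xs (Suc j)) = (if cl ?a = ch then F @ [?a] else F)" by (simp add: F_def)
    have sets: "set (?xs (Suc j)) = insert ?a (ar s Act ` {..<j})" by (simp add: lessThan_Suc)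
    consider "cl ?a < ch" | "ch < cl ?a" | "cl ?a = ch" by linarith
    then show ?case
    proof cases
      case 1
      then show ?thesis unfolding F sets using I fr c sl[OF 1] by simp
    next
      case 2
      then show ?thesis unfolding F sets using I fr c sh[OF 2] by simp
    next
      case 3
      have "split_labels (size_of s) (insert ?a (ar s Act ` {..<j})) cl ch (rg s Rlow) (rg s Rhigh) (ar s Lab) = ar s' Lab"
        using se[OF 3] I(6) by simp
      then show ?thesis unfolding F sets using I(1-5,7-9) fr c 3 sg by simp
    qed
  next
    case (5 s')
    let ?s'' = "s'\<lparr>rg := (rg s')(Rn := rg s' Rm)\<rparr>"
    have "frame keep_part s ?s''" using 5(3) by (simp add: frame_def keep_part_def)
    moreover have "rg s' Rm = length (filter (\<lambda>a. cl a = ch) xs)" "seg (ar s' Act) (rg s' Rm) = filter (\<lambda>a. cl a = ch) xs"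
      "ar s' Lab = split_labels (size_of s) (set xs) cl ch (rg s Rlow) (rg s Rhigh) (ar s Lab)"
      "rg s' Rlow = rg s Rlow + length (filter (\<lambda>a. cl a < ch) xs)"
      "rg s' Rhigh = rg s Rhigh + length (filter (\<lambda>a. ch < cl a) xs)"
      "rg s' Rr = rg s Rr - length (filter (\<lambda>a. cl a < ch) xs)"
      using 5(1) unfolding xs_def by blast+
    ultimately have "Q ?s'' (n - rg s Rn)" by (intro Q) (simp_all del: seg_simps)
    then show ?case by simp
  qed (use n in \<open>auto simp: frame_def\<close>)
  then show ?thesis unfolding keep_part_def by simp
qed

definition extend_tokens :: hcom where
  "extend_tokens = For Rx (V Rn) (Ra ::= Arr Act (V Rx) ;; Put En (V Ra) (Arr En (Arr Fr (V Ra))))"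

text \<open>Updating \<open>En\<close> in place is safe: the entry read belongs to an inactive
  position or to the position being updated, so it has not been overwritten.\<close>

lemma wp_extend_tokens:
  fixes s :: "'a::linorder hstate"
  defines "A \<equiv> ar s Act ` {..<rg s Rn}"
  assumes dist: "distinct (seg (ar s Act) (rg s Rn))" and fr: "\<forall>a\<in>A. ar s Fr a \<notin> A \<or> ar s Fr a = a"
    and n: "rg s Rn \<le> n"
    and Q: "\<And>s'. \<forall>p. ar s' En p = (if p \<in> A then ar s En (ar s Fr p) else ar s En p) \<Longrightarrow>
       frame extend_tokens s s' \<Longrightarrow> Q s' (n - rg s Rn)"
  shows "wp extend_tokens Q s n"
  unfolding extend_tokens_def
proof (rule wp_For[where m = "rg s Rn" and
    I = "\<lambda>j s'. \<forall>p. ar s' En p = (if p \<in> ar s Act ` {..<j} then ar s En (ar s Fr p) else ar s En p)"], goal_cases)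
  case (3 j s' n')
  let ?a = "ar s Act j"
  have f: "ar s' Fr = ar s Fr" "ar s' Act = ar s Act" using 3(4) by (auto simp: frame_def)
  have a: "?a \<notin> ar s Act ` {..<j}" by (rule distinct_segD[OF dist 3(1)])
  have "?a \<in> A" using 3(1) by (auto simp: A_def)
  moreover have "ar s Act ` {..<j} \<subseteq> A" using 3(1) by (auto simp: A_def)
  moreover have "ar s Fr ?a \<notin> A \<or> ar s Fr ?a = ?a" using fr calculation(1) by blast
  ultimately have "ar s Fr ?a \<notin> ar s Act ` {..<j}" using a by (elim disjE) auto
  then have "ar s' En (ar s Fr ?a) = ar s En (ar s Fr ?a)" using 3(3) by simp
  then show ?case using 3(1-3) f by (simp add: lessThan_Suc)
next
  case (5 s')
  then show ?case using Q[of s'] by (simp add: A_def extend_tokens_def)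
qed (use n in \<open>auto simp: frame_def\<close>)

text \<open>\<open>Act\<close> is traversed from right to left, so that the run label at the end of
  a token is known when needed. The results go to \<open>Tl\<close>, because \<open>Lab\<close>
  still serves as the membership test for active positions.\<close>

definition label_runs :: hcom where
  "label_runs = For Rx (V Rn) (Ra ::= Arr Act (Minus (V Rn) (Inc (V Rx) 1)) ;; Rq ::= Arr En (V Ra) ;;
     If (Eq (Arr Lab (V Rq)) (Lin 1 1))
       (If (Lt (Lin 1 0) (Arr Tl (V Rq))) (Put Tl (V Ra) (Minus (Arr Tl (V Rq)) (Lit 1)))
          (Put Tl (V Ra) (Inc (Arr Tl (V Rq)) 1)))
       (If (Lt (Arr Lab (V Rq)) (Lin 1 1)) (Put Tl (V Ra) (Lit 1)) (Put Tl (V Ra) (Lin 2 1))))"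

lemma sorted_segD:
  fixes f :: "nat \<Rightarrow> nat"
  assumes "sorted_wrt (<) (seg f n)" "x < n" "y < n"
  shows "f x < f y \<longleftrightarrow> x < y" "f x = f y \<longleftrightarrow> x = (y::nat)"
proof -
  have *: "i < j \<Longrightarrow> j < n \<Longrightarrow> f i < f j" for i j
    using sorted_wrt_nth_less[OF assms(1), of i j] by simp
  show "f x < f y \<longleftrightarrow> x < y"
    using *[of x y] *[of y x] assms(2,3) by (cases x y rule: linorder_cases) auto
  show "f x = f y \<longleftrightarrow> x = y"
    using *[of x y] *[of y x] assms(2,3) by (cases x y rule: linorder_cases) auto
qed

lemma wp_label_runs:
  fixes s :: "'a::linorder hstate"
  defines "A \<equiv> ar s Act ` {..<rg s Rn}" and "N \<equiv> size_of s"
  assumes srt: "sorted_wrt (<) (seg (ar s Act) (rg s Rn))"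
    and lab: "\<forall>a\<in>A. ar s Lab (ar s En a) = Suc N \<longleftrightarrow> ar s En a \<in> A" and en: "\<forall>a\<in>A. a < ar s En a"
    and n: "rg s Rn \<le> n"
    and Q: "\<And>s'. \<forall>a\<in>A. run_label N (ar s Lab) (ar s En) A (ar s' Tl) a \<Longrightarrow>
       frame label_runs s s' \<Longrightarrow> Q s' (n - rg s Rn)"
  shows "wp label_runs Q s n"
  unfolding label_runs_def
proof (rule wp_For[where m = "rg s Rn" and
    I = "\<lambda>j s'. \<forall>y. rg s Rn - j \<le> y \<and> y < rg s Rn \<longrightarrow> run_label N (ar s Lab) (ar s En) A (ar s' Tl) (ar s Act y)"], goal_cases)
  case (3 j s' n')
  let ?n = "rg s Rn" and ?act = "ar s Act"
  define x where "x = ?n - Suc j"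
  let ?a = "?act x"
  have x: "x < ?n" "?n - j = Suc x" using 3(1) by (auto simp: x_def)
  have f: "ar s' Lab = ar s Lab" "ar s' Act = ar s Act" "ar s' En = ar s En" "rg s' Rn = ?n" "size_of s' = N"
    using 3(4) by (auto simp: frame_def N_def)
  have old: "run_label N (ar s Lab) (ar s En) A ((ar s' Tl)(?a := v)) (?act y)" if y: "Suc x \<le> y" "y < ?n" for y v
  proof -
    have "?act y \<noteq> ?a" "?a < ?act y" using sorted_segD[OF srt] x y by auto
    moreover have "?act y < ar s En (?act y)" using en y by (auto simp: A_def)
    ultimately have "?act y \<noteq> ?a" "ar s En (?act y) \<noteq> ?a" by auto
    moreover have "run_label N (ar s Lab) (ar s En) A (ar s' Tl) (?act y)" using 3(3) x y by simp
    ultimately show ?thesis by (simp add: run_label_def)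
  qed
  have aA: "?a \<in> A" using x by (auto simp: A_def)
  have ena: "ar s En ?a \<noteq> ?a" using en aA by force
  have new: "run_label N (ar s Lab) (ar s En) A ((ar s' Tl)(?a := v)) ?a"
    if "v = (if ar s Lab (ar s En ?a) = Suc N then if N < ar s' Tl (ar s En ?a) then ar s' Tl (ar s En ?a) - 1 else ar s' Tl (ar s En ?a) + 1
     else if ar s Lab (ar s En ?a) < Suc N then 1 else 2 * N + 1)" for v
    using that lab aA ena by (simp add: run_label_def)
  have all: "\<forall>y. ?n - Suc j \<le> y \<and> y < ?n \<longrightarrow> run_label N (ar s Lab) (ar s En) A ((ar s' Tl)(?a := v)) (?act y)"
    if "v = (if ar s Lab (ar s En ?a) = Suc N then if N < ar s' Tl (ar s En ?a) then ar s' Tl (ar s En ?a) - 1 else ar s' Tl (ar s En ?a) + 1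
     else if ar s Lab (ar s En ?a) < Suc N then 1 else 2 * N + 1)" for v
  proof (intro allI impI)
    fix y assume y: "?n - Suc j \<le> y \<and> y < ?n"
    show "run_label N (ar s Lab) (ar s En) A ((ar s' Tl)(?a := v)) (?act y)"
    proof (cases "y = x")
      case True
      then show ?thesis using new[OF that] by simp
    next
      case False
      then show ?thesis using old[of y v] y by (simp add: x_def)
    qed
  qed
  show ?case
  proof (cases "ar s Lab (ar s En ?a) = Suc N")
    case True
    then show ?thesis using 3(2) all[OF refl] by (cases "N < ar s' Tl (ar s En ?a)") (simp_all add: f x_def[symmetric])
  next
    case False
    then show ?thesis using 3(2) all[OF refl] by (cases "ar s Lab (ar s En ?a) < Suc N") (simp_all add: f x_def[symmetric])
  qed
next
  case (5 s')
  have "\<forall>a\<in>A. run_label N (ar s Lab) (ar s En) A (ar s' Tl) a" using 5(1) by (auto simp: A_def)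
  then show ?case using Q[of s'] 5 by (simp add: label_runs_def)
qed (use n in \<open>auto simp: frame_def\<close>)

definition apply_labels :: hcom where
  "apply_labels = For Rx (V Rn) (Ra ::= Arr Act (V Rx) ;; Put Lab (V Ra) (Arr Tl (V Ra)) ;; Put Fr (V Ra) (V Ra))"

lemma wp_apply_labels:
  fixes s :: "'a::linorder hstate"
  defines "A \<equiv> ar s Act ` {..<rg s Rn}"
  assumes n: "rg s Rn \<le> n"
    and Q: "\<And>s'. \<forall>p. ar s' Lab p = (if p \<in> A then ar s Tl p else ar s Lab p) \<Longrightarrow>
       \<forall>a\<in>A. ar s' Fr a = a \<Longrightarrow> frame apply_labels s s' \<Longrightarrow> Q s' (n - rg s Rn)"
  shows "wp apply_labels Q s n"
  unfolding apply_labels_def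
proof (rule wp_For[where m = "rg s Rn" and
    I = "\<lambda>j s'. (\<forall>p. ar s' Lab p = (if p \<in> ar s Act ` {..<j} then ar s Tl p else ar s Lab p)) \<and>
      (\<forall>a\<in>ar s Act ` {..<j}. ar s' Fr a = a)"], goal_cases)
  case (3 j s' n')
  have f: "ar s' Tl = ar s Tl" "ar s' Act = ar s Act" using 3(4) by (auto simp: frame_def)
  then show ?case using 3(1-3) by (simp add: lessThan_Suc)
next
  case (5 s')
  then show ?case using Q[of s'] by (simp add: A_def apply_labels_def)
qed (use n in \<open>auto simp: frame_def\<close>)

definition settle :: hcom where
  "settle = For Rx (V Rn) (Ra ::= Arr Act (V Rx) ;; Put Lab (V Ra) (Lin 1 1) ;; Put Fr (V Ra) (Arr En (V Ra)))"

lemma wp_settle: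
  fixes s :: "'a::linorder hstate"
  defines "A \<equiv> ar s Act ` {..<rg s Rn}"
  assumes n: "rg s Rn \<le> n"
    and Q: "\<And>s'. \<forall>p. ar s' Lab p = (if p \<in> A then Suc (size_of s) else ar s Lab p) \<Longrightarrow>
       \<forall>a\<in>A. ar s' Fr a = ar s En a \<Longrightarrow> frame settle s s' \<Longrightarrow> Q s' (n - rg s Rn)"
  shows "wp settle Q s n"
  unfolding settle_def
proof (rule wp_For[where m = "rg s Rn" and
    I = "\<lambda>j s'. (\<forall>p. ar s' Lab p = (if p \<in> ar s Act ` {..<j} then Suc (size_of s) else ar s Lab p)) \<and>
      (\<forall>a\<in>ar s Act ` {..<j}. ar s' Fr a = ar s En a)"], goal_cases)
  case (3 j s' n')
  have f: "ar s' En = ar s En" "ar s' Act = ar s Act" "size_of s' = size_of s" using 3(4) by (auto simp: frame_def)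
  then show ?case using 3(1-3) by (simp add: lessThan_Suc)
next
  case (5 s')
  then show ?case using Q[of s'] by (simp add: A_def settle_def)
qed (use n in \<open>auto simp: frame_def\<close>)

definition advance :: hcom where
  "advance = If (Eq (V Rmode) (Lit 0))
     (extend_tokens ;; label_runs ;; apply_labels ;; Rmode ::= Lit 1)
     (settle ;; Rmode ::= Lit 0)"

definition select_round :: hcom where
  "select_round = (pivot ;; classify ;; choose_part ;; keep_part ;; When (Eq (V Rch) (Lit 1)) advance)"

section \<open>Amortised cost of the selection\<close>

definition sel_state :: "'a::linorder list \<Rightarrow> nat \<Rightarrow> nat set \<Rightarrow> bool \<Rightarrow> 'a hstate \<Rightarrow> bool" where
  "sel_state T R Al st s \<longleftrightarrow> holds_text T s \<and> rg s Rflat \<noteq> 0 \<and> (\<forall>u. ar s Lc u = 0) \<and>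
     sorted_wrt (<) (seg (ar s Act) (rg s Rn)) \<and>
     sel_inv T R (ar s Lab) (ar s Fr) (ar s En) (set (seg (ar s Act) (rg s Rn))) (rg s Rmode) (rg s Rr)
       (rg s Rlow) (rg s Rhigh) Al st"

text \<open>A round on \<open>m\<close> suffixes costs \<open>28 * m\<close> plus a loop credit,
  without \<open>advance\<close>. Dropping an outer part removes at least \<open>m / 8\<close>
  suffixes, paid by \<open>232 = 8 * 29\<close>. Otherwise an extension swallows one token per
  survivor: \<open>62 = 3 + 30 + 29\<close>, namely 3 for the passes, 30 stored for the later
  settling (\<open>1 + 29\<close>) and 29 for the round. The first extension swallows nothing and is
  paid by the extra \<open>62 * size_of s\<close>.\<close>

definition sel_potential :: "nat set \<Rightarrow> bool \<Rightarrow> 'a hstate \<Rightarrow> nat" where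
  "sel_potential Al st s = 232 * rg s Rn + 62 * card Al + (if st then 62 * size_of s else 0) +
     (if rg s Rmode = 0 then 0 else 30 * rg s Rn)"

lemma sorted_wrt_less_distinct: "sorted_wrt (<) (xs :: nat list) \<Longrightarrow> distinct xs"
  using strict_sorted_iff by blast

lemma wp_advance:
  assumes st: "sel_state T R Al st s" and key: "\<forall>a\<in>set (seg (ar s Act) (rg s Rn)). fkey T (ar s Lab) (ar s Fr) a = kp"
    and fr: "\<forall>a\<in>set (seg (ar s Act) (rg s Rn)). ar s Fr a \<in> {1..length T}"
    and n: "3 * rg s Rn \<le> n"
  shows "wp advance (\<lambda>s' n'. \<exists>Al' st'. sel_state T R Al' st' s' \<and>
     n + sel_potential Al' st' s' + 29 * rg s Rn \<le> n' + sel_potential Al st s \<and> rg s' Rn = rg s Rn) s n"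
proof -
  let ?xs = "seg (ar s Act) (rg s Rn)"
  let ?A = "set ?xs"
  have hold: "holds_text T s" and flat: "rg s Rflat \<noteq> 0" and lc: "\<forall>u. ar s Lc u = 0"
    and srt: "sorted_wrt (<) ?xs"
    and inv: "sel_inv T R (ar s Lab) (ar s Fr) (ar s En) ?A (rg s Rmode) (rg s Rr) (rg s Rlow) (rg s Rhigh) Al st"
    using st by (auto simp: sel_state_def)
  have dist: "distinct ?xs" using srt by (rule sorted_wrt_less_distinct)
  have cardA: "card ?A = rg s Rn" using distinct_card[OF dist] by simp
  have N: "size_of s = length T" using hold by (simp add: holds_text_def)
  have A: "?A \<subseteq> {1..length T}" using inv by (simp add: sel_inv_def)
  have nN: "rg s Rn \<le> length T" using card_mono[OF _ A] cardA by simp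
  show ?thesis
  proof (cases "rg s Rmode = 0")
    case True
    have mode: "mode_ok T (ar s Lab) (ar s Fr) (ar s En) ?A 0 st" using inv True by (simp add: sel_inv_def)
    have frA: "\<forall>a\<in>?A. ar s Fr a \<notin> ?A \<or> ar s Fr a = a" using mode by (auto simp: mode_ok_def split: if_splits)
    have labA: "\<forall>a\<in>?A. ar s Lab a = Suc (length T)" using mode by (auto simp: mode_ok_def)
    have lok: "labels_ok T (ar s Lab) ?A (rg s Rlow) (rg s Rhigh)" using inv by (simp add: sel_inv_def)
    have r: "rg s Rr < card ?A" using inv by (simp add: sel_inv_def)
    have nonA: "ar s Lab p \<noteq> Suc (length T)" if "p \<in> {1..Suc (length T)}" "p \<notin> ?A" for p
    proof (cases "p = Suc (length T)")
      case True
      then show ?thesis using lok by (simp add: labels_ok_def)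
    next
      case False
      have "rg s Rlow + rg s Rhigh + card ?A = length T" using lok by (simp add: labels_ok_def)
      moreover have "p \<in> {1..length T} - ?A" using that False by auto
      then have "1 \<le> ar s Lab p \<and> ar s Lab p \<le> rg s Rlow \<or> 2 * length T + 2 - rg s Rhigh < ar s Lab p"
        using lok unfolding labels_ok_def by blast
      ultimately show ?thesis using r by linarith
    qed
    have tok: "tokens_ok T (ar s Lab) (ar s En) ?A" using inv by (simp add: sel_inv_def)
    have "wp extend_tokens (wp (label_runs ;; apply_labels ;; Rmode ::= Lit 1) (\<lambda>s' n'. \<exists>Al' st'. sel_state T R Al' st' s' \<and>
     n + sel_potential Al' st' s' + 29 * rg s Rn \<le> n' + sel_potential Al st s \<and> rg s' Rn = rg s Rn)) s n"
    proof (rule wp_extend_tokens[OF dist], goal_cases)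
      case 1
      then show ?case using frA by simp
    next
      case 2
      then show ?case using n by simp
    next
      case (3 s1)
      have f1: "ar s1 Act = ar s Act" "ar s1 Lab = ar s Lab" "ar s1 Fr = ar s Fr" "rg s1 Rn = rg s Rn" "size_of s1 = size_of s"
        "sy s1 = sy s" "ar s1 Lc = ar s Lc" "rg s1 Rflat = rg s Rflat" "rg s1 Rmode = rg s Rmode" "rg s1 Rr = rg s Rr"
        "rg s1 Rlow = rg s Rlow" "rg s1 Rhigh = rg s Rhigh"
        using 3(2) by (auto simp: frame_def extend_tokens_def)
      have en: "\<forall>p. ar s1 En p = (if p \<in> ?A then ar s En (ar s Fr p) else ar s En p)" using 3(1) by simp
      have en_gt: "a < ar s1 En a \<and> ar s1 En a \<le> Suc (length T)" if a: "a \<in> ?A" for a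
      proof -
        have "ar s Fr a < ar s En (ar s Fr a)" "ar s En (ar s Fr a) \<le> Suc (length T)"
          using tok fr a unfolding tokens_ok_def by blast+
        moreover have "a \<le> ar s Fr a" using inv a unfolding sel_inv_def common_prefix_def by force
        ultimately show ?thesis using en a by simp
      qed
      show ?case unfolding wp_Then
      proof (rule wp_label_runs, goal_cases)
        case 1
        then show ?case using srt f1 by simp
      next
        case 2
        show ?case
        proof
          fix a assume "a \<in> ar s1 Act ` {..<rg s1 Rn}"
          then have a: "a \<in> ?A" using f1 by simp
          have "ar s1 En a \<in> {1..Suc (length T)}" using en_gt[OF a] by auto
          then have "ar s Lab (ar s1 En a) = Suc (length T) \<longleftrightarrow> ar s1 En a \<in> ?A" using nonA labA by blast
          then show "ar s1 Lab (ar s1 En a) = Suc (size_of s1) \<longleftrightarrow> ar s1 En a \<in> ar s1 Act ` {..<rg s1 Rn}"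
            using f1 N by simp
        qed
      next
        case 3
        then show ?case using en_gt f1 by simp
      next
        case 4
        then show ?case using n f1 by simp
      next
        case (5 s2)
        have f2: "ar s2 Act = ar s Act" "ar s2 Lab = ar s Lab" "ar s2 Fr = ar s Fr" "ar s2 En = ar s1 En" "rg s2 Rn = rg s Rn" "size_of s2 = size_of s"
          "sy s2 = sy s" "ar s2 Lc = ar s Lc" "rg s2 Rflat = rg s Rflat" "rg s2 Rr = rg s Rr"
          "rg s2 Rlow = rg s Rlow" "rg s2 Rhigh = rg s Rhigh"
          using 5(2) f1 by (auto simp: frame_def label_runs_def)
        have rl: "\<forall>a\<in>?A. run_label (length T) (ar s Lab) (ar s1 En) ?A (ar s2 Tl) a" using 5(1) f1 N by simp
        show ?case unfolding wp_Then
        proof (rule wp_apply_labels, goal_cases)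
          case 1
          then show ?case using n f1 f2 by simp
        next
          case (2 s3)
          have f3: "ar s3 Act = ar s Act" "ar s3 En = ar s1 En" "rg s3 Rn = rg s Rn" "size_of s3 = size_of s"
            "sy s3 = sy s" "ar s3 Lc = ar s Lc" "rg s3 Rflat = rg s Rflat" "rg s3 Rr = rg s Rr"
            "rg s3 Rlow = rg s Rlow" "rg s3 Rhigh = rg s Rhigh"
            using 2(3) f2 by (auto simp: frame_def apply_labels_def)
          have lab3: "\<forall>p. ar s3 Lab p = (if p \<in> ?A then ar s2 Tl p else ar s Lab p)" using 2(1) f2 by simp
          have fr3: "\<forall>a\<in>?A. ar s3 Fr a = a" using 2(2) f2 by simp
          have inv0: "sel_inv T R (ar s Lab) (ar s Fr) (ar s En) ?A 0 (rg s Rr) (rg s Rlow) (rg s Rhigh) Al st"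
            using inv True by simp
          have T: "endmarked T" using hold by (simp add: holds_text_def)
          obtain Al' where Al': "sel_inv T R (ar s3 Lab) (ar s3 Fr) (ar s1 En) ?A 1 (rg s Rr) (rg s Rlow) (rg s Rhigh) Al' False"
            "if st then Al' = Al else card Al' + card ?A = card Al"
            using sel_inv_extend[OF T inv0 key fr en rl lab3 fr3] by blast
          let ?s4 = "s3\<lparr>rg := (rg s3)(Rmode := 1)\<rparr>"
          have "sel_state T R Al' False ?s4"
            using Al'(1) f3 hold flat lc srt by (simp add: sel_state_def holds_text_def)
          moreover have "n + sel_potential Al' False ?s4 + 29 * rg s Rn \<le> n - 3 * rg s Rn + sel_potential Al st s"
            using Al'(2) cardA n nN True N f3 by (auto simp: sel_potential_def split: if_splits)
          ultimately have "\<exists>Al' st'. sel_state T R Al' st' ?s4 \<and>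
              n + sel_potential Al' st' ?s4 + 29 * rg s Rn \<le> n - 3 * rg s Rn + sel_potential Al st s \<and> rg ?s4 Rn = rg s Rn"
            using f3 by (intro exI conjI) auto
          moreover have "n - rg s Rn - rg s1 Rn - rg s2 Rn = n - 3 * rg s Rn" using f1 f2 by simp
          ultimately show ?case by simp
        qed
      qed
    qed
    then show ?thesis using True by (simp add: advance_def)
  next
    case False
    have "wp settle (wp (Rmode ::= Lit 0) (\<lambda>s' n'. \<exists>Al' st'. sel_state T R Al' st' s' \<and>
     n + sel_potential Al' st' s' + 29 * rg s Rn \<le> n' + sel_potential Al st s \<and> rg s' Rn = rg s Rn)) s n"
    proof (rule wp_settle, goal_cases)
      case 1
      then show ?case using n by simp
    next
      case (2 s1)
      have f1: "ar s1 Act = ar s Act" "ar s1 En = ar s En" "rg s1 Rn = rg s Rn" "size_of s1 = size_of s"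
            "sy s1 = sy s" "ar s1 Lc = ar s Lc" "rg s1 Rflat = rg s Rflat" "rg s1 Rr = rg s Rr"
            "rg s1 Rlow = rg s Rlow" "rg s1 Rhigh = rg s Rhigh"
            using 2(3) by (auto simp: frame_def settle_def)
      have "sel_inv T R (ar s1 Lab) (ar s1 Fr) (ar s En) ?A 0 (rg s Rr) (rg s Rlow) (rg s Rhigh) Al False"
        by (rule sel_inv_settle[OF inv False key]) (use 2(1,2) N in auto)
      then have "sel_state T R Al False (s1\<lparr>rg := (rg s1)(Rmode := 0)\<rparr>)"
        using f1 hold flat lc srt by (simp add: sel_state_def holds_text_def)
      moreover have "n + sel_potential Al False (s1\<lparr>rg := (rg s1)(Rmode := 0)\<rparr>) + 29 * rg s Rn \<le> n - rg s Rn + sel_potential Al st s"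
        using n False f1 by (auto simp: sel_potential_def)
      ultimately show ?case using f1 by auto
    qed
    then show ?thesis using False by (simp add: advance_def)
  qed
qed

lemma pivot_frame:
  "frame pivot s s' \<Longrightarrow> rg s' Rn = rg s Rn \<and> rg s' Rr = rg s Rr \<and> rg s' Rflat = rg s Rflat \<and>
    rg s' Rmode = rg s Rmode \<and> rg s' Rlow = rg s Rlow \<and> rg s' Rhigh = rg s Rhigh \<and>
    ar s' Lab = ar s Lab \<and> ar s' Fr = ar s Fr \<and> ar s' En = ar s En \<and> ar s' Act = ar s Act \<and>
    sy s' = sy s \<and> size_of s' = size_of s"
  by (simp add: frame_def pivot_def pivot_loop_def copy_back_def thin_def merge_pass_def merge_pair_def
      merge_pick_def merge_scan_def)

lemma side_cases: "side k x = 0 \<or> side k x = 1 \<or> side k x = 2"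
  by (simp add: side_def)

lemma filter_partition:
  assumes "\<forall>a. cl a = (0::nat) \<or> cl a = 1 \<or> cl a = 2"
  shows "length (filter (\<lambda>a. cl a < 2) xs) = length (filter (\<lambda>a. cl a = 0) xs) + length (filter (\<lambda>a. cl a = 1) xs)"
    "length xs = length (filter (\<lambda>a. cl a < 2) xs) + length (filter (\<lambda>a. cl a = 2) xs)"
    "length xs = length (filter (\<lambda>a. cl a = 0) xs) + length (filter (\<lambda>a. 1 \<le> cl a) xs)"
proof -
  have c: "cl a = 0 \<or> cl a = 1 \<or> cl a = 2" for a using assms by blast
  show "length (filter (\<lambda>a. cl a < 2) xs) = length (filter (\<lambda>a. cl a = 0) xs) + length (filter (\<lambda>a. cl a = 1) xs)"
  proof (induction xs)
    case (Cons a xs)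
    then show ?case using c[of a] by auto
  qed simp
  show "length xs = length (filter (\<lambda>a. cl a < 2) xs) + length (filter (\<lambda>a. cl a = 2) xs)"
  proof (induction xs)
    case (Cons a xs)
    then show ?case using c[of a] by auto
  qed simp
  show "length xs = length (filter (\<lambda>a. cl a = 0) xs) + length (filter (\<lambda>a. 1 \<le> cl a) xs)"
  proof (induction xs)
    case (Cons a xs)
    then show ?case using c[of a] by auto
  qed simp
qed

lemma wp_choose_part:
  assumes cl: "\<forall>a. cl a = (0::nat) \<or> cl a = 1 \<or> cl a = 2"
    and s: "rg s Rlt = length (filter (\<lambda>a. cl a = 0) xs)" "rg s Reqc = length (filter (\<lambda>a. cl a = 1) xs)"
    and r: "rg s Rr < length xs" "length xs \<le> size_of s"
    and Q: "\<And>s' ch. s' = s\<lparr>rg := (rg s)(Rch := ch)\<rparr> \<Longrightarrow> ch \<in> {0, 1, 2} \<Longrightarrow>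
      length (filter (\<lambda>a. cl a < ch) xs) \<le> rg s Rr \<Longrightarrow>
      rg s Rr < length (filter (\<lambda>a. cl a < ch) xs) + length (filter (\<lambda>a. cl a = ch) xs) \<Longrightarrow> Q s' n"
  shows "wp choose_part Q s n"
proof -
  note p = filter_partition[OF cl, of xs]
  have one: "length (filter (\<lambda>a. cl a < 1) xs) = length (filter (\<lambda>a. cl a = 0) xs)" by simp
  have le: "rg s Rlt + rg s Reqc \<le> 4 * size_of s + 8" using p r s by linarith
  consider "rg s Rr < rg s Rlt" | "\<not> rg s Rr < rg s Rlt" "rg s Rr < rg s Rlt + rg s Reqc"
    | "\<not> rg s Rr < rg s Rlt" "\<not> rg s Rr < rg s Rlt + rg s Reqc" by blast
  then show ?thesis
  proof cases
    case 1
    have "Q (s\<lparr>rg := (rg s)(Rch := 0)\<rparr>) n" by (rule Q[of _ 0]) (use 1 s in auto)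
    then show ?thesis using 1 by (simp add: choose_part_def)
  next
    case 2
    have "Q (s\<lparr>rg := (rg s)(Rch := 1)\<rparr>) n" by (rule Q[of _ 1]) (use 2 s one in auto)
    then show ?thesis using 2 le by (simp add: choose_part_def)
  next
    case 3
    have "Q (s\<lparr>rg := (rg s)(Rch := 2)\<rparr>) n" by (rule Q[of _ 2]) (use 3 s p r in linarith | simp)+
    then show ?thesis using 3 le by (simp add: choose_part_def numeral_2_eq_2)
  qed
qed

lemma wp_select_round:
  fixes s :: "'a::linorder hstate"
  assumes st: "sel_state T R Al st s" and two: "2 \<le> rg s Rn" and n: "31 * rg s Rn \<le> n"
  shows "wp select_round (\<lambda>s' n'. \<exists>Al' st'. sel_state T R Al' st' s' \<and>
     n + sel_potential Al' st' s' + 1 \<le> n' + sel_potential Al st s) s n"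
proof -
  let ?Q = "\<lambda>s' n'. \<exists>Al' st'. sel_state T R Al' st' s' \<and>
     n + sel_potential Al' st' s' + 1 \<le> n' + sel_potential Al st s"
  define m where "m = rg s Rn"
  define xs where "xs = seg (ar s Act) m"
  define A where "A = set xs"
  have hold: "holds_text T s" and flat: "rg s Rflat \<noteq> 0" and lc: "\<forall>u. ar s Lc u = 0"
    and srt: "sorted_wrt (<) xs"
    and inv: "sel_inv T R (ar s Lab) (ar s Fr) (ar s En) A (rg s Rmode) (rg s Rr) (rg s Rlow) (rg s Rhigh) Al st"
    using st by (auto simp: sel_state_def A_def xs_def m_def)
  have dist: "distinct xs" using srt by (rule sorted_wrt_less_distinct)
  have len: "length xs = m" by (simp add: xs_def)
  have cardA: "card A = m" using distinct_card[OF dist] by (simp add: A_def len)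
  have N: "size_of s = length T" and T: "endmarked T" using hold by (simp_all add: holds_text_def)
  have A: "A \<subseteq> {1..length T}" using inv by (simp add: sel_inv_def)
  have mN: "m \<le> length T" using card_mono[OF _ A] cardA by simp
  have two': "2 \<le> card A" using two cardA by (simp add: m_def)
  have fin: "ar s Fr a \<in> {1..length T}" if "a \<in> A" for a by (rule frontier_inside[OF T inv two' that])
  have key: "key s (ar s Fr a) = fkey T (ar s Lab) (ar s Fr) a" if "a \<in> A" for a
    using fin[OF that] hold by (simp add: key_def fkey_def holds_text_def)
  have actA: "x < m \<Longrightarrow> ar s Act x \<in> A" for x by (simp add: A_def xs_def)
  have inj: "inj_on (\<lambda>x. ar s Fr (ar s Act x)) {..<m}"
  proof (rule inj_onI)
    fix x y assume xy: "x \<in> {..<m}" "y \<in> {..<m}" "ar s Fr (ar s Act x) = ar s Fr (ar s Act y)"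
    obtain l where l: "\<forall>a\<in>A. ar s Fr a = a + l" using inv unfolding sel_inv_def common_prefix_def by blast
    then have "ar s Act x = ar s Act y" using xy actA by simp
    moreover have "inj_on (ar s Act) {..<m}" using dist by (simp add: xs_def distinct_seg)
    ultimately show "x = y" using xy by (auto dest: inj_onD)
  qed
  have r: "rg s Rr < m" using inv cardA by (simp add: sel_inv_def)
  have bound: "ar s Fr (ar s Act x) \<le> Suc (length T)" if "x < m" for x
    using fin[OF actA[OF that]] by simp
  have "wp pivot (wp (classify ;; choose_part ;; keep_part ;; When (Eq (V Rch) (Lit 1)) advance) ?Q) s n"
  proof (rule wp_use[OF wp_pivot], goal_cases)
    case (8 s1 n1)
    note f1 = pivot_frame[OF 8(2)]
    have lc1: "\<forall>u. ar s1 Lc u = 0" and n1: "n \<le> n1 + 26 * m"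
      and half: "m \<le> 8 * card {x. x < m \<and> key s (ar s Fr (ar s Act x)) \<le> key s (rg s1 Rpv)}"
        "m \<le> 8 * card {x. x < m \<and> key s (rg s1 Rpv) \<le> key s (ar s Fr (ar s Act x))}"
      using 8(1) by (auto simp: m_def)
    define kp where "kp = key s (rg s1 Rpv)"
    define cl where "cl = (\<lambda>a. side kp (key s (ar s Fr a)))"
    have k1: "key s1 = key s" by (rule key_frame) (use f1 in auto)
    have xs1: "seg (ar s1 Act) (rg s1 Rn) = xs" using f1 by (simp add: xs_def m_def)
    have cl3: "\<forall>a. cl a = 0 \<or> cl a = 1 \<or> cl a = 2" unfolding cl_def using side_cases by blast
    have half': "m \<le> 8 * length (filter (\<lambda>a. cl a < 2) xs)" "m \<le> 8 * length (filter (\<lambda>a. 1 \<le> cl a) xs)"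
    proof -
      have "card {x. x < m \<and> key s (ar s Fr (ar s Act x)) \<le> kp} = length (filter (\<lambda>a. key s (ar s Fr a) \<le> kp) xs)"
        "card {x. x < m \<and> kp \<le> key s (ar s Fr (ar s Act x))} = length (filter (\<lambda>a. kp \<le> key s (ar s Fr a)) xs)"
        unfolding xs_def by (rule card_seg_filter)+
      moreover have "(\<lambda>a. key s (ar s Fr a) \<le> kp) = (\<lambda>a. cl a < 2)" "(\<lambda>a. kp \<le> key s (ar s Fr a)) = (\<lambda>a. 1 \<le> cl a)"
        by (auto simp: cl_def side_def fun_eq_iff)
      ultimately show "m \<le> 8 * length (filter (\<lambda>a. cl a < 2) xs)" "m \<le> 8 * length (filter (\<lambda>a. 1 \<le> cl a) xs)"
        using half by (simp_all add: kp_def)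
    qed
    show ?case unfolding wp_Then
    proof (rule wp_classify, goal_cases)
      case 1
      then show ?case using n n1 f1 by (simp add: m_def)
    next
      case (2 s2)
      have f2: "rg s2 Rn = m" "rg s2 Rr = rg s Rr" "rg s2 Rflat = rg s Rflat" "rg s2 Rmode = rg s Rmode"
        "rg s2 Rlow = rg s Rlow" "rg s2 Rhigh = rg s Rhigh" "ar s2 Lab = ar s Lab" "ar s2 Fr = ar s Fr" "ar s2 En = ar s En"
        "ar s2 Act = ar s Act" "ar s2 Lc = ar s1 Lc" "sy s2 = sy s" "size_of s2 = size_of s"
        using 2(4) f1 by (auto simp: frame_def classify_def m_def)
      have c2: "\<forall>x<m. ar s2 Cls x = cl (ar s Act x)" "rg s2 Rlt = length (filter (\<lambda>a. cl a = 0) xs)"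
        "rg s2 Reqc = length (filter (\<lambda>a. cl a = 1) xs)"
        using 2(1-3) f1 unfolding xs1 k1 kp_def[symmetric] by (auto simp: cl_def m_def)
      show ?case
      proof (rule wp_choose_part[OF cl3 c2(2,3)], goal_cases)
        case 1
        then show ?case using r f2 len by simp
      next
        case 2
        then show ?case using mN N f2 len by simp
      next
        case (3 s3 ch)
        have xs3: "seg (ar s3 Act) (rg s3 Rn) = xs" using 3(1) f2 by (simp add: xs_def)
        show ?case
        proof (rule wp_keep_part[where cl = cl], goal_cases)
          case 1
          then show ?case using 3(1) c2(1) f2 by simp
        next
          case 2
          then show ?case using xs3 dist by simp
        next
          case 3
          then show ?case using \<open>s3 = _\<close> f1 f2 n n1 by (simp add: m_def)
        next
          case (4 s4)
          have ch3: "rg s3 Rch = ch" using 3(1) by simp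
          define ys where "ys = filter (\<lambda>a. cl a = ch) xs"
          have s4: "rg s4 Rn = length ys" "seg (ar s4 Act) (rg s4 Rn) = ys"
            "ar s4 Lab = split_labels (length T) A cl ch (rg s Rlow) (rg s Rhigh) (ar s Lab)"
            "rg s4 Rlow = rg s Rlow + length (filter (\<lambda>a. cl a < ch) xs)"
            "rg s4 Rhigh = rg s Rhigh + length (filter (\<lambda>a. ch < cl a) xs)"
            "rg s4 Rr = rg s Rr - length (filter (\<lambda>a. cl a < ch) xs)"
            using 4(1-6) unfolding xs3 ch3 ys_def A_def using 3(1) f2 N by simp_all
          have f4: "rg s4 Rflat = rg s Rflat" "rg s4 Rmode = rg s Rmode" "ar s4 Fr = ar s Fr" "ar s4 En = ar s En"
            "ar s4 Lc = ar s1 Lc" "sy s4 = sy s" "size_of s4 = size_of s" "rg s4 Rch = ch" "rg s3 Rn = m"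
            using 4(7) 3(1) f2 by (auto simp: frame_def keep_part_def)
          define cl' where "cl' = (\<lambda>a. side kp (fkey T (ar s Lab) (ar s Fr) a))"
          have cl'_app: "side kp (fkey T (ar s Lab) (ar s Fr) a) = cl' a" for a by (simp add: cl'_def)
          have cl': "a \<in> A \<Longrightarrow> cl' a = cl a" for a using key by (simp add: cl_def cl'_def)
          have count: "card {a \<in> A. P (cl' a)} = length (filter (\<lambda>a. P (cl a)) xs)" for P
          proof -
            have "{a \<in> A. P (cl' a)} = set (filter (\<lambda>a. P (cl a)) xs)" using cl' by (auto simp: A_def)
            then show ?thesis using distinct_card[OF distinct_filter[OF dist]] by simp
          qed
          have setys: "{a \<in> A. cl' a = ch} = set ys" using cl' by (auto simp: A_def ys_def)
          have lab4: "split_labels (length T) A cl' ch (rg s Rlow) (rg s Rhigh) (ar s Lab) = ar s4 Lab"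
            unfolding s4(3) by (auto simp: split_labels_def fun_eq_iff cl')
          have inv4: "sel_inv T R (ar s4 Lab) (ar s Fr) (ar s En) (set ys) (rg s Rmode) (rg s4 Rr) (rg s4 Rlow) (rg s4 Rhigh) Al st"
            using sel_inv_split[OF T inv two', where ch = ch and kp = kp] 3(3,4)
            f2(2) 3(1) unfolding cl'_app setys lab4
            using count[of "\<lambda>x. x < ch"] count[of "\<lambda>x. ch < x"] count[of "\<lambda>x. x = ch"] s4 setys by (simp add: ys_def[symmetric])
          have st4: "sel_state T R Al st s4"
            using inv4 s4 f4 hold flat lc1 srt by (auto simp: sel_state_def holds_text_def ys_def intro: sorted_wrt_filter)
          have m4: "rg s4 Rn \<le> m" "1 \<le> rg s4 Rn"
            using inv4 card_length[of ys] unfolding s4(1) by (auto simp: ys_def len[symmetric] sel_inv_def)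
          have n4: "n \<le> n1 - m - m + 28 * m" "3 * m \<le> n1 - m - m" using n1 n by (simp_all add: m_def)
          have pot: "sel_potential Al st s4 + 232 * (m - rg s4 Rn) \<le> sel_potential Al st s"
          proof -
            obtain d where "rg s Rn = rg s4 Rn + d" using m4(1) le_Suc_ex unfolding m_def by blast
            then show ?thesis using f4 by (simp add: sel_potential_def m_def)
          qed
          show ?case
          proof (cases "ch = 1")
            case False
            \<comment> \<open>When an outer part is kept, the pivot's class and the opposite part
              are dropped, which is at least an eighth by the choice of the pivot.\<close>
            have "m \<le> 8 * (m - rg s4 Rn)"
            proof -
              note fp = filter_partition[OF cl3, of xs]
              have "ch = 0 \<or> ch = 2" using False 3(2) by auto
              then show ?thesis
              proof
                assume "ch = 0"
                then have "m = rg s4 Rn + length (filter (\<lambda>a. 1 \<le> cl a) xs)" using fp(3) s4(1) len by (simp add: ys_def)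
                then show ?thesis using half'(2) by simp
              next
                assume "ch = 2"
                then have "m = length (filter (\<lambda>a. cl a < 2) xs) + rg s4 Rn" using fp(2) s4(1) len by (simp add: ys_def)
                then show ?thesis using half'(1) by simp
              qed
            qed
            then have "n + sel_potential Al st s4 + 1 \<le> n1 - m - m + sel_potential Al st s"
              using pot n4 two by (simp add: m_def)
            then show ?thesis using False f4 f1 st4 by (auto simp: m_def)
          next
            case True
            have mode: "mode_ok T (ar s Lab) (ar s Fr) (ar s En) A (rg s Rmode) st" using inv by (simp add: sel_inv_def)
            have frA: "ar s Fr a \<notin> A \<or> ar s Fr a = a" if "a \<in> A" for a
              using mode that by (auto simp: mode_ok_def split: if_splits)
            have ysA: "a \<in> A" "cl a = 1" if "a \<in> set ys" for a using that True by (auto simp: ys_def A_def)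
            \<comment> \<open>The key of a survivor is still its old one: its frontier is inactive
              or the survivor itself, and neither was relabelled by the split.\<close>
            have key4: "fkey T (ar s4 Lab) (ar s4 Fr) a = kp" if a: "a \<in> set ys" for a
            proof -
              have "ar s4 Lab (ar s Fr a) = ar s Lab (ar s Fr a)"
                unfolding s4(3) using frA[OF ysA(1)[OF a]] ysA(2)[OF a] True by (auto simp: split_labels_def)
              then have "fkey T (ar s4 Lab) (ar s4 Fr) a = key s (ar s Fr a)"
                using key[OF ysA(1)[OF a]] f4 by (simp add: fkey_def)
              moreover have "key s (ar s Fr a) = kp" using ysA(2)[OF a] by (auto simp: cl_def side_def split: if_splits)
              ultimately show ?thesis by simp
            qed
            have "wp advance ?Q s4 (n1 - m - m)"
            proof (rule wp_use[OF wp_advance[OF st4, where kp = kp]], goal_cases)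
              case 1
              then show ?case using key4 s4(2) by simp
            next
              case 2
              then show ?case using fin ysA f4 s4(2) by simp
            next
              case 3
              then show ?case using n4 m4 by simp
            next
              case (4 s5 n5)
              then obtain Al' st' where *: "sel_state T R Al' st' s5"
                "n1 - m - m + sel_potential Al' st' s5 + 29 * rg s4 Rn \<le> n5 + sel_potential Al st s4" by blast
              \<comment> \<open>Each survivor contributes 29 units from \<open>advance\<close> and
                each dropped suffix 232, together at least \<open>29 * m\<close>.\<close>
              have "n + sel_potential Al' st' s5 + 1 \<le> n5 + sel_potential Al st s"
                using *(2) n4 pot m4 by linarith
              then show ?case using *(1) by blast
            qed
            then show ?thesis using True f4 f1 by (simp add: m_def)
          qed
        qed
      qed
    qed
  qed (use flat lc mN N two n inj bound in \<open>auto simp: m_def\<close>)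
  then show ?thesis unfolding select_round_def by simp
qed

definition init_select :: hcom where
  "init_select = (For Rx (Lin 1 0) (Put Lab (Inc (V Rx) 1) (Lin 1 1) ;; Put Fr (Inc (V Rx) 1) (Inc (V Rx) 1) ;;
       Put En (Inc (V Rx) 1) (Inc (V Rx) 2) ;; Put Act (V Rx) (Inc (V Rx) 1)) ;;
     Put Lab (Lin 1 1) (Lit 0) ;; Rn ::= Lin 1 0 ;; Rlow ::= Lit 0 ;; Rhigh ::= Lit 0 ;; Rmode ::= Lit 0 ;; Rflat ::= Lit 1)"

text \<open>If the loop ends in mode 1, the last active position carries a run label; the final
  assignment restores \<open>N + 1\<close>, so that the selected suffix can be recognised by its
  label.\<close>

definition select :: hcom where
  "select = (init_select ;; Loop (Lt (Lit 1) (V Rn)) select_round ;; Put Lab (Arr Act (Lit 0)) (Lin 1 1))"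

lemma wp_init_select:
  fixes s :: "'a::linorder hstate"
  assumes hold: "holds_text T s" and lc: "\<forall>u. ar s Lc u = 0" and R: "rg s Rr < length T" and n: "length T \<le> n"
    and Q: "\<And>s'. sel_state T (rg s Rr) {1..length T} True s' \<Longrightarrow> rg s' Rn = length T \<Longrightarrow> rg s' Rmode = 0 \<Longrightarrow> 
       Q s' (n - length T)"
  shows "wp init_select Q s n"
proof -
  let ?N = "length T"
  have N: "size_of s = ?N" using hold by (simp add: holds_text_def)
  have "wp (For Rx (Lin 1 0) (Put Lab (Inc (V Rx) 1) (Lin 1 1) ;; Put Fr (Inc (V Rx) 1) (Inc (V Rx) 1) ;;
       Put En (Inc (V Rx) 1) (Inc (V Rx) 2) ;; Put Act (V Rx) (Inc (V Rx) 1)))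
     (wp (Put Lab (Lin 1 1) (Lit 0) ;; Rn ::= Lin 1 0 ;; Rlow ::= Lit 0 ;; Rhigh ::= Lit 0 ;; Rmode ::= Lit 0 ;; Rflat ::= Lit 1) Q) s n"
  proof (rule wp_For[where m = ?N and I = "\<lambda>j s'. (\<forall>p\<in>{1..j}. ar s' Lab p = Suc ?N \<and> ar s' Fr p = p \<and> ar s' En p = Suc p) \<and>
      (\<forall>x<j. ar s' Act x = Suc x)"], goal_cases)
    case (3 j s' n')
    have f: "size_of s' = ?N" using 3(4) N by (auto simp: frame_def)
    show ?case using 3(1-3) f by (auto simp: le_Suc_eq less_Suc_eq)
  next
    case (5 s')
    let ?s = "s'\<lparr>ar := (ar s')(Lab := (ar s' Lab)(Suc ?N := 0)), rg := (rg s')(Rn := ?N, Rlow := 0, Rhigh := 0, Rmode := 0, Rflat := 1)\<rparr>"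
    have f: "size_of s' = ?N" "sy s' = sy s" "rg s' Rr = rg s Rr" "ar s' Lc = ar s Lc" using 5(3) N by (auto simp: frame_def)
    have seg: "seg (ar s' Act) ?N = [1..<Suc ?N]"
    proof -
      have "seg (ar s' Act) ?N = map Suc [0..<?N]" using 5(1) by (auto simp: seg_def)
      then show ?thesis by (simp add: map_Suc_upt)
    qed
    have set: "set (seg (ar s' Act) ?N) = {1..?N}" unfolding seg by auto
    have inv: "sel_inv T (rg s Rr) (ar ?s Lab) (ar ?s Fr) (ar ?s En) {1..?N} 0 (rg s Rr) 0 0 {1..?N} True"
      by (rule sel_inv_init[OF R]) (use 5(1) in auto)
    have "sorted_wrt (<) (seg (ar ?s Act) ?N)"
    proof -
      have "seg (ar ?s Act) ?N = seg (ar s' Act) ?N" by simp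
      then show ?thesis unfolding seg by (metis sorted_wrt_upt)
    qed
    then have "sel_state T (rg s Rr) {1..?N} True ?s"
      using inv set f hold lc unfolding sel_state_def holds_text_def by (simp del: seg_simps(5))
    then have "Q ?s (n - ?N)" by (rule Q) simp_all
    then show ?case using f by simp
  qed (use n N in \<open>auto simp: frame_def\<close>)
  then show ?thesis unfolding init_select_def by simp
qed

text \<open>The constant is \<open>357 = 1 + 232 + 62 + 62\<close>: the initialisation and the
  initial potential, from which all rounds are paid.\<close>

lemma wp_select:
  fixes s :: "'a::linorder hstate"
  assumes hold: "holds_text T s" and lc: "\<forall>u. ar s Lc u = 0" and R: "rg s Rr < length T" and n: "357 * length T \<le> n"
  shows "wp select (\<lambda>s' n'. holds_text T s' \<and> (\<forall>u. ar s' Lc u = 0) \<and>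
    (\<forall>p\<in>{1..length T}. (ar s' Lab p < Suc (length T) \<longleftrightarrow> text_suffix T p < text_suffix T (suffix_of_rank T (Suc (rg s Rr)))) \<and>
       (ar s' Lab p = Suc (length T) \<longleftrightarrow> p = suffix_of_rank T (Suc (rg s Rr)))) \<and>
    n \<le> n' + 357 * length T) s n"
  unfolding select_def wp_Then
proof (rule wp_init_select[OF hold lc R], goal_cases)
  case 1
  then show ?case using n by simp
next
  case (2 s1)
  let ?N = "length T" and ?R = "rg s Rr"
  have N1: "size_of s1 = ?N" using 2(1) by (simp add: sel_state_def holds_text_def)
  show ?case
  proof (rule wp_Loop[where I = "\<lambda>s' n'. \<exists>Al st. sel_state T ?R Al st s' \<and> n - ?N + sel_potential Al st s' \<le> n' + 356 * ?N"], goal_cases)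
    case 1
    have "sel_potential {1..?N} True s1 = 356 * ?N" using 2 N1 by (simp add: sel_potential_def)
    then show ?case using 2(1) by (intro exI[of _ "{1..?N}"] exI[of _ True]) simp
  next
    case (2 s' n')
    then obtain Al st where *: "sel_state T ?R Al st s'" "n - ?N + sel_potential Al st s' \<le> n' + 356 * ?N" by blast
    show ?case
    proof (cases "1 < rg s' Rn")
      case True
      have "232 * rg s' Rn \<le> sel_potential Al st s'" by (simp add: sel_potential_def)
      then have n': "232 * rg s' Rn \<le> n'" using *(2) n by linarith
      have "wp select_round (\<lambda>s' n'. \<exists>Al st. sel_state T ?R Al st s' \<and> n - ?N + sel_potential Al st s' \<le> n' + 356 * ?N) s' (n' - 1)"
      proof (rule wp_use[OF wp_select_round[OF *(1)]], goal_cases)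
        case (3 s2 n2)
        then obtain Al' st' where "sel_state T ?R Al' st' s2" "n' - 1 + sel_potential Al' st' s2 + 1 \<le> n2 + sel_potential Al st s'" by blast
        then show ?case using *(2) n' True by (intro exI[of _ Al'] exI[of _ st']) linarith
      qed (use True n' in auto)
      then show ?thesis using True n' by simp
    next
      case False
      let ?xs = "seg (ar s' Act) (rg s' Rn)"
      have hold': "holds_text T s'" and lc': "\<forall>u. ar s' Lc u = 0" and srt: "sorted_wrt (<) ?xs"
        and inv: "sel_inv T ?R (ar s' Lab) (ar s' Fr) (ar s' En) (set ?xs) (rg s' Rmode) (rg s' Rr) (rg s' Rlow) (rg s' Rhigh) Al st"
        using *(1) by (auto simp: sel_state_def)
      have "rg s' Rr < card (set ?xs)" using inv by (simp add: sel_inv_def)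
      then have "0 < rg s' Rn" using card_length[of ?xs] by simp
      then have one: "rg s' Rn = 1" using False by simp
      have set: "set ?xs = {ar s' Act 0}" using one by simp
      have card1: "card (set ?xs) = 1" unfolding set by simp
      have mem: "ar s' Act 0 \<in> set ?xs" unfolding set by simp
      note fin = sel_inv_final[OF inv card1 mem]
      have N': "size_of s' = ?N" using hold' by (simp add: holds_text_def)
      have "n \<le> n' + 357 * ?N" using *(2) n by linarith
      then show ?thesis using False fin hold' lc' N' by (auto simp: holds_text_def)
    qed
  qed
qed

section \<open>Collecting and naming the blocks\<close>

definition targets :: "'a::linorder list \<Rightarrow> nat \<Rightarrow> nat \<Rightarrow> nat set" where
  "targets T i K = {p \<in> {1..length T}. i \<le> Suc (card (below T p)) \<and> Suc (card (below T p)) < i + K}"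

lemma below_eqD:
  assumes "p \<in> {1..length T}" "q \<in> {1..length T}" "card (below T p) = card (below T q)"
  shows "p = q"
  using suffix_of_rank_eqI[OF assms(1,3)] suffix_of_rank_eqI[OF assms(2) refl] by simp

lemma targets_image:
  assumes "1 \<le> i" "i + K \<le> Suc (length T)"
  shows "targets T i K = suffix_of_rank T ` {i..<i + K}" "inj_on (suffix_of_rank T) {i..<i + K}"
proof -
  have r: "suffix_of_rank T r \<in> {1..length T}" "card (below T (suffix_of_rank T r)) = r - 1" if "r \<in> {i..<i + K}" for r
    using suffix_of_rank[of r T] that assms by auto
  show "targets T i K = suffix_of_rank T ` {i..<i + K}"
  proof (intro equalityI subsetI)
    fix p assume p: "p \<in> targets T i K"
    then have "p = suffix_of_rank T (Suc (card (below T p)))"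
      using suffix_of_rank_eqI[of p T, OF _ refl, symmetric] by (simp add: targets_def)
    then show "p \<in> suffix_of_rank T ` {i..<i + K}" using p by (auto simp: targets_def)
  next
    fix p assume "p \<in> suffix_of_rank T ` {i..<i + K}"
    then obtain k where k: "k \<in> {i..<i + K}" "p = suffix_of_rank T k" by blast
    then show "p \<in> targets T i K" using r[OF k(1)] assms(1) by (simp add: targets_def)
  qed
  show "inj_on (suffix_of_rank T) {i..<i + K}"
  proof (rule inj_onI)
    fix x y assume xy: "x \<in> {i..<i + K}" "y \<in> {i..<i + K}" "suffix_of_rank T x = suffix_of_rank T y"
    then have "x - 1 = y - 1" using r(2)[OF xy(1)] r(2)[OF xy(2)] by simp
    then show "x = y" using xy assms(1) by auto
  qed
qed

lemma card_targets: "1 \<le> i \<Longrightarrow> i + K \<le> Suc (length T) \<Longrightarrow> card (targets T i K) = K"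
  using targets_image[of i K T] by (simp add: card_image)

text \<open>Only three labels remain: below, in and above the range of ranks. The position after the
  text counts as a target so that the last block has an end.\<close>

definition side_label :: "'a::linorder list \<Rightarrow> nat \<Rightarrow> nat \<Rightarrow> nat \<Rightarrow> nat" where
  "side_label T i K p = (if p \<in> targets T i K \<or> p = Suc (length T) then Suc (length T)
     else if Suc (card (below T p)) < i then 0 else 2 * length T + 2)"

lemma side_label_less:
  assumes "p \<in> {1..length T}" "q \<in> {1..length T}" "side_label T i K p < side_label T i K q"
  shows "text_suffix T p < text_suffix T q"
proof -
  have "card (below T p) < card (below T q)"
    using assms by (auto simp: side_label_def targets_def split: if_splits)
  then show ?thesis using suffix_less_iff_below[OF assms(1,2)] by simp
qed

text \<open>The second selection overwrites \<open>Lab\<close>, so the comparison with the suffix of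
  the lowest rank is saved in \<open>Sd\<close>.\<close>

definition mark_lower :: hcom where
  "mark_lower = For Rx (Lin 1 0) (If (Lt (Arr Lab (Inc (V Rx) 1)) (Lin 1 1))
     (Put Sd (Inc (V Rx) 1) (Lit 1)) (Put Sd (Inc (V Rx) 1) (Lit 0)))"

definition collect :: hcom where
  "collect = (Rk ::= Lit 0 ;; For Rx (Lin 1 0)
     (Rq ::= Inc (V Rx) 1 ;;
      If (Lt (Lit 0) (Arr Sd (V Rq))) (Put Lab (V Rq) (Lit 0))
       (If (Lt (Lin 1 1) (Arr Lab (V Rq))) (Put Lab (V Rq) (Lin 2 2))
         (Put Lab (V Rq) (Lin 1 1) ;; Put Tg (V Rk) (V Rq) ;; Put Ix (V Rq) (V Rk) ;; Rk ::= Inc (V Rk) 1))) ;;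
     Put Tg (V Rk) (Lin 1 1) ;; Put Lab (Lin 1 1) (Lin 1 1))"

text \<open>\<open>Tg\<close> lists the targets in text order with the sentinel \<open>Tg K\<close>
  behind the text; \<open>Ix\<close> is its inverse on the targets.\<close>

definition target_state :: "'a::linorder list \<Rightarrow> nat \<Rightarrow> nat \<Rightarrow> 'a hstate \<Rightarrow> bool" where
  "target_state T i K s \<longleftrightarrow> holds_text T s \<and> rg s Rk = K \<and> sorted_wrt (<) (seg (ar s Tg) K) \<and>
     set (seg (ar s Tg) K) = targets T i K \<and> ar s Tg K = Suc (length T) \<and> (\<forall>j<K. ar s Ix (ar s Tg j) = j) \<and>
     (\<forall>p\<in>{1..Suc (length T)}. ar s Lab p = side_label T i K p)"

lemma wp_mark_lower:
  assumes N: "size_of s = N" and n: "N \<le> n"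
    and Q: "\<And>s'. \<forall>p\<in>{1..N}. 0 < ar s' Sd p \<longleftrightarrow> ar s Lab p < Suc N \<Longrightarrow> frame mark_lower s s' \<Longrightarrow> Q s' (n - N)"
  shows "wp mark_lower Q s n"
  unfolding mark_lower_def
proof (rule wp_For[where m = N and I = "\<lambda>j s'. \<forall>p\<in>{1..j}. 0 < ar s' Sd p \<longleftrightarrow> ar s Lab p < Suc N"], goal_cases)
  case (3 j s' n')
  have f: "ar s' Lab = ar s Lab" "size_of s' = N" using 3(4) N by (auto simp: frame_def)
  show ?case using 3(1-3) f by (auto simp: le_Suc_eq)
next
  case (5 s')
  then show ?case using Q[of s'] by (simp add: mark_lower_def)
qed (use N n in \<open>auto simp: frame_def\<close>)

lemma wp_collect:
  fixes s :: "'a::linorder hstate"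
  assumes hold: "holds_text T s" and iK: "1 \<le> i" "1 \<le> K" "i + K \<le> Suc (length T)"
    and lower: "\<forall>p\<in>{1..length T}. 0 < ar s Sd p \<longleftrightarrow> text_suffix T p < text_suffix T (suffix_of_rank T i)"
    and upper: "\<forall>p\<in>{1..length T}. (ar s Lab p < Suc (length T) \<longleftrightarrow> text_suffix T p < text_suffix T (suffix_of_rank T (i + K - 1))) \<and>
       (ar s Lab p = Suc (length T) \<longleftrightarrow> p = suffix_of_rank T (i + K - 1))"
    and n: "length T \<le> n"
    and Q: "\<And>s'. target_state T i K s' \<Longrightarrow> frame collect s s' \<Longrightarrow> Q s' (n - length T)"
  shows "wp collect Q s n"
proof -
  let ?N = "length T" and ?Z = "targets T i K"
  have N: "size_of s = ?N" using hold by (simp add: holds_text_def)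
  have lo: "suffix_of_rank T i \<in> {1..?N}" "card (below T (suffix_of_rank T i)) = i - 1"
    using suffix_of_rank[of i T] iK by auto
  have hi: "suffix_of_rank T (i + K - 1) \<in> {1..?N}" "card (below T (suffix_of_rank T (i + K - 1))) = i + K - 2"
    using suffix_of_rank[of "i + K - 1" T] iK by auto
  have low: "0 < ar s Sd p \<longleftrightarrow> Suc (card (below T p)) < i" if "p \<in> {1..?N}" for p
    using lower that suffix_less_iff_below[OF that lo(1)] lo(2) by auto
  have high: "Suc ?N < ar s Lab p \<longleftrightarrow> i + K \<le> Suc (card (below T p))" if p: "p \<in> {1..?N}" for p
  proof -
    have 1: "ar s Lab p < Suc ?N \<longleftrightarrow> card (below T p) < i + K - 2"
      using upper p suffix_less_iff_below[OF p hi(1)] hi(2) by auto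
    have 2: "ar s Lab p = Suc ?N \<longleftrightarrow> card (below T p) = i + K - 2"
    proof -
      have "ar s Lab p = Suc ?N \<longleftrightarrow> p = suffix_of_rank T (i + K - 1)" using upper p by blast
      also have "\<dots> \<longleftrightarrow> card (below T p) = i + K - 2" using below_eqD[OF p hi(1)] hi(2) by metis
      finally show ?thesis .
    qed
    show ?thesis using 1 2 iK by linarith
  qed
  let ?f = "\<lambda>j. filter (\<lambda>p. p \<in> ?Z) [1..<Suc j]"
  have "wp (For Rx (Lin 1 0)
     (Rq ::= Inc (V Rx) 1 ;;
      If (Lt (Lit 0) (Arr Sd (V Rq))) (Put Lab (V Rq) (Lit 0))
       (If (Lt (Lin 1 1) (Arr Lab (V Rq))) (Put Lab (V Rq) (Lin 2 2))
         (Put Lab (V Rq) (Lin 1 1) ;; Put Tg (V Rk) (V Rq) ;; Put Ix (V Rq) (V Rk) ;; Rk ::= Inc (V Rk) 1))))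
     (wp (Put Tg (V Rk) (Lin 1 1) ;; Put Lab (Lin 1 1) (Lin 1 1)) Q) (s\<lparr>rg := (rg s)(Rk := 0)\<rparr>) n"
  proof (rule wp_For[where m = ?N and I = "\<lambda>j s'. length (?f j) = rg s' Rk \<and> seg (ar s' Tg) (rg s' Rk) = ?f j \<and>
      (\<forall>x<rg s' Rk. ar s' Ix (ar s' Tg x) = x) \<and>
      (\<forall>p\<in>{1..?N}. ar s' Lab p = (if p \<le> j then side_label T i K p else ar s Lab p))"], goal_cases)
    case (3 j s' n')
    have f: "ar s' Sd = ar s Sd" "size_of s' = ?N" using 3(4) N by (auto simp: frame_def)
    have p: "Suc j \<in> {1..?N}" using 3(1) by simp
    have I: "length (?f j) = rg s' Rk" "seg (ar s' Tg) (rg s' Rk) = ?f j"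
      "\<forall>x<rg s' Rk. ar s' Ix (ar s' Tg x) = x"
      "\<forall>p\<in>{1..?N}. ar s' Lab p = (if p \<le> j then side_label T i K p else ar s Lab p)" using 3(3) by blast+
    have labj: "ar s' Lab (Suc j) = ar s Lab (Suc j)" using I(4) p by simp
    have lab': "\<forall>p\<in>{1..?N}. ((ar s' Lab)(Suc j := v)) p = (if p \<le> Suc j then side_label T i K p else ar s Lab p)"
      if "v = side_label T i K (Suc j)" for v
      using I(4) that by (auto simp: le_Suc_eq)
    consider "Suc (card (below T (Suc j))) < i" | "i + K \<le> Suc (card (below T (Suc j)))" | "Suc j \<in> ?Z"
      using p by (force simp: targets_def)
    then show ?case
    proof cases
      case 1
      then have "Suc j \<notin> ?Z" "side_label T i K (Suc j) = 0" using p by (auto simp: targets_def side_label_def)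
      then show ?thesis using 1 3(2) I(1-3) low[OF p] lab'[of 0] f by simp
    next
      case 2
      then have "Suc j \<notin> ?Z" "side_label T i K (Suc j) = 2 * ?N + 2" using p iK by (auto simp: targets_def side_label_def)
      then show ?thesis using 2 3(2) I(1-3) low[OF p] high[OF p] labj lab'[of "2 * ?N + 2"] f iK by simp
    next
      case 3
      then have r: "\<not> Suc (card (below T (Suc j))) < i" "\<not> i + K \<le> Suc (card (below T (Suc j)))"
        "side_label T i K (Suc j) = Suc ?N" by (auto simp: targets_def side_label_def)
      let ?k = "rg s' Rk"
      have tg: "ar s' Tg x \<le> j" if "x < ?k" for x
      proof -
        have "ar s' Tg x \<in> set (?f j)" unfolding I(2)[symmetric] using that by simp
        then show ?thesis by auto
      qed
      have "seg ((ar s' Tg)(?k := Suc j)) ?k = seg (ar s' Tg) ?k" by (rule seg_cong) simp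
      moreover have "\<forall>x<Suc ?k. ((ar s' Ix)(Suc j := ?k)) (((ar s' Tg)(?k := Suc j)) x) = x"
        using I(3) tg by (force simp: less_Suc_eq)
      ultimately show ?thesis using 3 r \<open>rg s' Rx = j\<close> I(1,2) low[OF p] high[OF p] labj lab'[of "Suc ?N"] f by simp
    qed
  next
    case (5 s')
    have f: "size_of s' = ?N" "sy s' = sy s" using 5(3) N by (auto simp: frame_def)
    let ?s = "s'\<lparr>ar := (ar s')(Tg := (ar s' Tg)(rg s' Rk := Suc ?N), Lab := (ar s' Lab)(Suc ?N := Suc ?N))\<rparr>"
    have I: "length (?f ?N) = rg s' Rk" "seg (ar s' Tg) (rg s' Rk) = ?f ?N"
      "\<forall>x<rg s' Rk. ar s' Ix (ar s' Tg x) = x"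
      "\<forall>p\<in>{1..?N}. ar s' Lab p = side_label T i K p" using 5(1) by auto
    have setf: "set (?f ?N) = ?Z" by (auto simp: targets_def)
    have "distinct (?f ?N)" by simp
    then have "length (?f ?N) = K" using card_targets[OF iK(1,3)] distinct_card[of "?f ?N"] setf by simp
    then have k: "rg s' Rk = K" using I(1) by simp
    have sg: "seg (ar ?s Tg) K = ?f ?N"
    proof -
      have "seg (ar ?s Tg) K = seg (ar s' Tg) K" by (rule seg_cong) (simp add: k)
      then show ?thesis using I(2) k by simp
    qed
    have "sorted_wrt (<) (?f ?N)" by (rule sorted_wrt_filter) (simp only: sorted_wrt_upt)
    then have "target_state T i K ?s"
      unfolding target_state_def sg setf
      using k I(3,4) f hold by (auto simp: holds_text_def side_label_def le_Suc_eq)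
    moreover have "frame collect s ?s" using 5(3) by (auto simp: frame_def collect_def)
    ultimately show ?case using Q[of ?s] f by simp
  qed (use n N in \<open>auto simp: frame_def\<close>)
  then show ?thesis unfolding collect_def by simp
qed

section \<open>Block comparison and the order of the targets\<close>

lemma list_less_cases:
  fixes xs ys :: "'b::linorder list"
  assumes "xs < ys"
  obtains d where "d < length xs" "d < length ys" "take d xs = take d ys" "xs ! d < ys ! d"
  | zs where "zs \<noteq> []" "ys = xs @ zs"
proof -
  have "(\<exists>d<length xs. d < length ys \<and> take d xs = take d ys \<and> xs ! d < ys ! d) \<or> (\<exists>zs. zs \<noteq> [] \<and> ys = xs @ zs)"
    using assms
  proof (induction xs arbitrary: ys)
    case Nil
    then show ?case by (cases ys) auto
  next
    case (Cons x xs)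
    then obtain y ys' where ys: "ys = y # ys'" by (cases ys) auto
    show ?case
    proof (cases "x < y")
      case True
      then show ?thesis using ys by (intro disjI1 exI[of _ 0]) simp
    next
      case False
      then have xy: "x = y" "xs < ys'" using Cons.prems ys by auto
      from Cons.IH[OF xy(2)] show ?thesis
      proof
        assume "\<exists>d<length xs. d < length ys' \<and> take d xs = take d ys' \<and> xs ! d < ys' ! d"
        then obtain d where "d < length xs" "d < length ys'" "take d xs = take d ys'" "xs ! d < ys' ! d" by blast
        then show ?thesis using ys xy by (intro disjI1 exI[of _ "Suc d"]) simp
      next
        assume "\<exists>zs. zs \<noteq> [] \<and> ys' = xs @ zs"
        then show ?thesis using ys xy by auto
      qed
    qed
  qed
  then show ?thesis using that by blast
qed

text \<open>The block of the \<open>j\<close>-th target, up to and including the key at the next target. Positions between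
  targets are outside the range of ranks, so their labels decide comparisons with targets.\<close>

definition block :: "'a hstate \<Rightarrow> nat \<Rightarrow> ('a \<times> nat) list" where
  "block s u = map (key s) [u..<Suc (ar s Tg (Suc (ar s Ix u)))]"

context
  fixes T :: "'a::linorder list" and i K :: nat and s :: "'a hstate"
  assumes ts: "target_state T i K s" and flat: "rg s Rflat = 0"
begin

lemma tg_less: "x < y \<Longrightarrow> y \<le> K \<Longrightarrow> ar s Tg x < ar s Tg y"
proof (cases "y = K")
  case True
  assume xy: "x < y" "y \<le> K"
  then have "ar s Tg x \<in> set (seg (ar s Tg) K)" using True by simp
  then have "ar s Tg x \<in> targets T i K" using ts by (simp add: target_state_def)
  then show ?thesis using ts True by (auto simp: target_state_def targets_def)
next
  case False
  assume "x < y" "y \<le> K"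
  then show ?thesis using ts False sorted_segD(1)[of "ar s Tg" K x y] by (simp add: target_state_def)
qed

lemma tg_target: "j < K \<Longrightarrow> ar s Tg j \<in> targets T i K"
proof -
  assume "j < K"
  then have "ar s Tg j \<in> set (seg (ar s Tg) K)" by simp
  then show ?thesis using ts by (simp add: target_state_def)
qed

lemma tg_range: "j < K \<Longrightarrow> ar s Tg j \<in> {1..length T}"
  using tg_target by (simp add: targets_def)

lemma tg_bound: "j \<le> K \<Longrightarrow> ar s Tg j \<le> Suc (length T)"
  using tg_range[of j] ts by (cases "j = K") (auto simp: target_state_def)

lemma target_tg: "u \<in> targets T i K \<Longrightarrow> \<exists>j<K. u = ar s Tg j"
  using ts by (auto simp: target_state_def)

lemma tg_gap:
  assumes "j < K" "ar s Tg j < p" "p < ar s Tg (Suc j)"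
  shows "p \<notin> targets T i K" "p \<noteq> Suc (length T)"
proof
  assume "p \<in> targets T i K"
  then obtain k where k: "k < K" "p = ar s Tg k" using target_tg by blast
  have "j < k" using tg_less[of k j] assms k by (cases j k rule: linorder_cases) auto
  moreover have "k < Suc j" using tg_less[of "Suc j" k] assms k by (cases k "Suc j" rule: linorder_cases) auto
  ultimately show False by simp
next
  show "p \<noteq> Suc (length T)" using assms tg_bound[of "Suc j"] by auto
qed

lemma ix_tg: "j < K \<Longrightarrow> ar s Ix (ar s Tg j) = j"
  using ts by (simp add: target_state_def)

lemma block_tg: "j < K \<Longrightarrow> block s (ar s Tg j) = map (key s) [ar s Tg j..<Suc (ar s Tg (Suc j))]"
  by (simp only: block_def ix_tg)

lemma block_props:
  assumes "j < K"
  defines "u \<equiv> ar s Tg j" and "D \<equiv> ar s Tg (Suc j) - ar s Tg j"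
  shows "length (block s u) = Suc D" "0 < D" "u + D = ar s Tg (Suc j)"
    "d \<le> D \<Longrightarrow> block s u ! d = key s (u + d)"
    "d \<le> D \<Longrightarrow> stops s u d \<longleftrightarrow> d = D"
proof -
  have less: "u < ar s Tg (Suc j)" using tg_less[of j "Suc j"] assms by simp
  then show D: "0 < D" "u + D = ar s Tg (Suc j)" by (simp_all add: D_def u_def)
  show len: "length (block s u) = Suc D" using block_tg[OF assms(1)] D less by (simp add: u_def[symmetric] D_def)
  show "block s u ! d = key s (u + d)" if "d \<le> D"
  proof -
    have "u + d < Suc (ar s Tg (Suc j))" using that D(2) by simp
    then have "[u..<Suc (ar s Tg (Suc j))] ! d = u + d" by (rule nth_upt)
    then show ?thesis using block_tg[OF assms(1)] that D len unfolding u_def[symmetric] by (simp del: upt_Suc)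
  qed
  show "stops s u d \<longleftrightarrow> d = D" if d: "d \<le> D"
  proof -
    have N: "size_of s = length T" using ts by (simp add: target_state_def holds_text_def)
    have rng: "u + d \<in> {1..Suc (length T)}"
      using tg_range[OF assms(1)] tg_bound[of "Suc j"] assms(1) d D(2) by (simp add: u_def)
    then have lab: "ar s Lab (u + d) = side_label T i K (u + d)" using ts by (simp add: target_state_def)
    show ?thesis
    proof (cases "d = D")
      case True
      have "side_label T i K (ar s Tg (Suc j)) = Suc (length T)"
      proof (cases "Suc j < K")
        case True
        then show ?thesis using tg_target by (simp add: side_label_def)
      next
        case False
        then have "ar s Tg (Suc j) = Suc (length T)" using ts assms(1) by (simp add: target_state_def less_SucI Suc_lessI) (metis Suc_lessI)
        then show ?thesis by (simp add: side_label_def)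
      qed
      then show ?thesis using True D lab N flat by (simp add: stops_def)
    next
      case False
      show ?thesis
      proof (cases "d = 0")
        case True
        then show ?thesis using False flat by (simp add: stops_def)
      next
        case d0: False
        then have "u < u + d" "u + d < ar s Tg (Suc j)" using D False d by auto
        then have "u + d \<notin> targets T i K" "u + d \<noteq> Suc (length T)"
          using tg_gap[OF assms(1), of "u + d"] by (simp_all add: u_def)
        then have "side_label T i K (u + d) \<noteq> Suc (length T)" by (simp add: side_label_def)
        then show ?thesis using False lab N flat by (simp add: stops_def)
      qed
    qed
  qed
qed

lemma block_strings: "strings s (block s) (targets T i K)"
  unfolding strings_def
proof
  fix u assume "u \<in> targets T i K"
  then obtain j where j: "j < K" "u = ar s Tg j" using target_tg by blast
  define D where "D = ar s Tg (Suc j) - ar s Tg j"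
  have N: "size_of s = length T" using ts by (simp add: target_state_def holds_text_def)
  have D: "length (block s u) = Suc D" "0 < D" "u + D = ar s Tg (Suc j)"
    using block_props(1-3)[OF j(1)] by (simp_all add: j(2) D_def)
  have P4: "d \<le> D \<Longrightarrow> block s u ! d = key s (u + d)" "d \<le> D \<Longrightarrow> stops s u d \<longleftrightarrow> d = D" for d
    using block_props(4,5)[OF j(1), of d] by (simp_all add: j(2) D_def)
  have "1 \<le> length T" using tg_range[OF j(1)] by auto
  then have "u + length (block s u) \<le> 2 * size_of s + 2" using D N tg_bound[of "Suc j"] j(1) by simp
  then show "block s u \<noteq> [] \<and> u + length (block s u) \<le> 2 * size_of s + 2 \<and>
     (\<forall>d<length (block s u). block s u ! d = key s (u + d) \<and> (stops s u d \<longleftrightarrow> Suc d = length (block s u)))"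
    using D P4 by (auto simp: less_Suc_eq_le)
qed

text \<open>A block has the length of the gap to the next target plus one, since it includes the key
  there; the gaps telescope.\<close>

lemma block_lengths: "(\<Sum>u\<in>targets T i K. length (block s u)) \<le> length T + K"
proof -
  have inj: "inj_on (ar s Tg) {..<K}"
    by (rule linorder_inj_onI') (use tg_less in \<open>force\<close>)
  have "targets T i K = ar s Tg ` {..<K}" using ts by (simp add: target_state_def)
  then have "(\<Sum>u\<in>targets T i K. length (block s u)) = (\<Sum>j<K. length (block s (ar s Tg j)))"
    using inj by (simp add: sum.reindex)
  also have "\<dots> = (\<Sum>j<K. Suc (ar s Tg (Suc j) - ar s Tg j))"
    using block_props(1) by (intro sum.cong) auto
  finally have 1: "(\<Sum>u\<in>targets T i K. length (block s u)) = (\<Sum>j<K. Suc (ar s Tg (Suc j) - ar s Tg j))" .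
  have 2: "k \<le> K \<Longrightarrow> (\<Sum>j<k. Suc (ar s Tg (Suc j) - ar s Tg j)) + ar s Tg 0 = ar s Tg k + k" for k
  proof (induction k)
    case (Suc k)
    then show ?case using tg_less[of k "Suc k"] by simp
  qed simp
  show ?thesis
  proof (cases "K = 0")
    case False
    then have "1 \<le> ar s Tg 0" using tg_range[of 0] by simp
    then show ?thesis using 1 2[of K] ts by (simp add: target_state_def)
  next
    case True
    then have "targets T i K = {}" using target_tg by blast
    then show ?thesis by simp
  qed
qed

lemma key_sym:
  "p \<in> {1..length T} \<Longrightarrow> q \<in> {1..length T} \<Longrightarrow> key s p = key s q \<Longrightarrow> text_symbol T p = text_symbol T q"
  using ts by (simp add: target_state_def holds_text_def key_def)

text \<open>A smaller symbol decides at once, and a smaller label means a smaller rank by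
  \<open>side_label_less\<close>. So labels settle comparisons between positions whose suffixes were
  never compared directly.\<close>

lemma key_less_suffix:
  assumes "p \<in> {1..length T}" "q \<in> {1..length T}" "key s p < key s q"
  shows "text_suffix T p < text_suffix T q"
proof -
  have k: "key s p = (text_symbol T p, side_label T i K p)" "key s q = (text_symbol T q, side_label T i K q)"
    using assms(1,2) ts by (auto simp: target_state_def holds_text_def key_def)
  then consider "text_symbol T p < text_symbol T q" | "side_label T i K p < side_label T i K q"
    using assms(3) by (auto simp: order.order_iff_strict)
  then show ?thesis
  proof cases
    case 1
    then show ?thesis using text_suffix_less_iff[OF assms(1,2)] by simp
  next
    case 2
    then show ?thesis by (rule side_label_less[OF assms(1,2)])
  qed
qed

lemma blocks_agree:
  assumes j: "j < K" "k < K" "j \<noteq> k" and l: "l \<le> ar s Tg (Suc j) - ar s Tg j" "l \<le> ar s Tg (Suc k) - ar s Tg k"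
    and eq: "\<And>d. d < l \<Longrightarrow> block s (ar s Tg j) ! d = block s (ar s Tg k) ! d"
  shows "ar s Tg j + l \<le> length T" "ar s Tg k + l \<le> length T"
    "text_suffix T (ar s Tg j) < text_suffix T (ar s Tg k) \<longleftrightarrow>
     text_suffix T (ar s Tg j + l) < text_suffix T (ar s Tg k + l)"
proof -
  let ?u = "ar s Tg j" and ?v = "ar s Tg k"
  have T: "endmarked T" using ts by (simp add: target_state_def holds_text_def)
  have b: "?u + l \<le> Suc (length T)" "?v + l \<le> Suc (length T)"
    using l tg_bound[of "Suc j"] tg_bound[of "Suc k"] block_props(3)[OF j(1)] block_props(3)[OF j(2)] j by linarith+
  have agree: "text_symbol T (?u + d) = text_symbol T (?v + d)" if d: "d < l" for d
  proof (rule key_sym)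
    show "key s (?u + d) = key s (?v + d)"
      using eq[OF d] block_props(4)[OF j(1), of d] block_props(4)[OF j(2), of d] d l by simp
    show "?u + d \<in> {1..length T}" "?v + d \<in> {1..length T}" using b d tg_range[OF j(1)] tg_range[OF j(2)] by auto
  qed
  have uv: "?u \<noteq> ?v" using tg_less[of j k] tg_less[of k j] j by (cases j k rule: linorder_cases) auto
  show "?u + l \<le> length T" "?v + l \<le> length T"
    using agree_inside[OF T tg_range[OF j(1)] tg_range[OF j(2)] uv agree b] by auto
  show "text_suffix T ?u < text_suffix T ?v \<longleftrightarrow> text_suffix T (?u + l) < text_suffix T (?v + l)"
    using text_suffix_strip[OF agree _ _ b] tg_range[OF j(1)] tg_range[OF j(2)] by auto
qed

text \<open>At the first mismatch the smaller key gives the smaller suffix, and the agreement before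
  it carries this back to the targets. A proper prefix cannot occur: where the shorter block ends,
  the longer one has the same key, hence the same label, and would end too.\<close>

lemma block_less:
  assumes j: "j < K" "k < K" and less: "block s (ar s Tg j) < block s (ar s Tg k)"
  shows "text_suffix T (ar s Tg j) < text_suffix T (ar s Tg k)"
proof -
  let ?u = "ar s Tg j" and ?v = "ar s Tg k"
  let ?D = "ar s Tg (Suc j) - ar s Tg j" and ?E = "ar s Tg (Suc k) - ar s Tg k"
  note P = block_props[OF j(1)] and R = block_props[OF j(2)]
  have jk: "j \<noteq> k" using less by auto
  show ?thesis using less
  proof (cases rule: list_less_cases)
    case (1 d)
    have d: "d \<le> ?D" "d \<le> ?E" using 1(1,2) P(1) R(1) by auto
    have eq: "block s ?u ! e = block s ?v ! e" if "e < d" for e using 1(3) that by (metis nth_take)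
    note B = blocks_agree[OF j jk d eq]
    have "key s (?u + d) < key s (?v + d)" using 1(4) P(4)[OF d(1)] R(4)[OF d(2)] by simp
    then have "text_suffix T (?u + d) < text_suffix T (?v + d)"
      by (rule key_less_suffix[rotated 2]) (use B(1,2) tg_range[OF j(1)] tg_range[OF j(2)] in auto)
    then show ?thesis using B(3) by simp
  next
    case (2 zs)
    then have "?D < ?E" using P(1) R(1) by (cases zs) auto
    moreover have "block s ?v ! ?D = block s ?u ! ?D" using 2 P(1) by (simp add: nth_append)
    then have "key s (?v + ?D) = key s (?u + ?D)" using P(4)[of ?D] R(4)[of ?D] calculation by simp
    then have "stops s ?v ?D \<longleftrightarrow> stops s ?u ?D" by (simp add: stops_def key_def)
    ultimately have False using P(5)[of ?D] R(5)[of ?D] by simp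
    then show ?thesis ..
  qed
qed

text \<open>Because of the endmarker neither of two equal blocks of different targets can reach the
  end of the text. Both end at genuine targets, to which the comparison is handed on.\<close>

lemma block_eq:
  assumes j: "j < K" "k < K" "j \<noteq> k" and eq: "block s (ar s Tg j) = block s (ar s Tg k)"
  shows "Suc j < K" "Suc k < K" "text_suffix T (ar s Tg j) < text_suffix T (ar s Tg k) \<longleftrightarrow>
     text_suffix T (ar s Tg (Suc j)) < text_suffix T (ar s Tg (Suc k))"
proof -
  let ?D = "ar s Tg (Suc j) - ar s Tg j" and ?E = "ar s Tg (Suc k) - ar s Tg k"
  note P = block_props[OF j(1)] and R = block_props[OF j(2)]
  have D: "?D = ?E" using P(1) R(1) eq by simp
  have B': "ar s Tg j + ?D \<le> length T" "ar s Tg k + ?D \<le> length T"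
     "text_suffix T (ar s Tg j) < text_suffix T (ar s Tg k) \<longleftrightarrow>
     text_suffix T (ar s Tg j + ?D) < text_suffix T (ar s Tg k + ?D)"
    using blocks_agree[OF j, of ?D] D eq by auto
  show 1: "Suc j < K" using B'(1) P(3) j(1) ts by (cases "Suc j = K") (auto simp: target_state_def)
  show 2: "Suc k < K" using B'(2) R(3) D j(2) ts by (cases "Suc k = K") (auto simp: target_state_def)
  show "text_suffix T (ar s Tg j) < text_suffix T (ar s Tg k) \<longleftrightarrow>
     text_suffix T (ar s Tg (Suc j)) < text_suffix T (ar s Tg (Suc k))"
    using B'(3) P(3) R(3) D by simp
qed

end

text \<open>Ranks are read off a sorted sequence: the rank of a class is the first index of the class.\<close>

definition first_index_ranks :: "nat \<Rightarrow> (nat \<Rightarrow> nat) \<Rightarrow> (nat \<Rightarrow> nat) \<Rightarrow> bool" where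
  "first_index_ranks K sa rk \<longleftrightarrow> sa ` {..<K} = {..<K} \<and>
     (\<forall>x<K. rk (sa x) = x \<or> 0 < x \<and> rk (sa x) = rk (sa (x - 1)))"

lemma first_index_le: "first_index_ranks K sa rk \<Longrightarrow> x < K \<Longrightarrow> rk (sa x) \<le> x"
proof (induction x)
  case (Suc x)
  then show ?case unfolding first_index_ranks_def by (metis Suc_lessD diff_Suc_1 le_SucI order_refl)
qed (auto simp: first_index_ranks_def)

lemma ranks_from_sorted:
  fixes f :: "nat \<Rightarrow> 'b::linorder"
  assumes sa: "sa ` {..<K} = {..<K}"
    and srt: "\<And>x. 0 < x \<Longrightarrow> x < K \<Longrightarrow> f (sa (x - 1)) \<le> f (sa x)"
    and rk: "\<And>x. x < K \<Longrightarrow> rk (sa x) = (if 0 < x \<and> f (sa x) = f (sa (x - 1)) then rk (sa (x - 1)) else x)"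
  shows "first_index_ranks K sa rk" "j < K \<Longrightarrow> k < K \<Longrightarrow> rk j < rk k \<longleftrightarrow> f j < f k"
    "j < K \<Longrightarrow> k < K \<Longrightarrow> rk j = rk k \<longleftrightarrow> f j = f k"
proof -
  show fi: "first_index_ranks K sa rk" using sa rk by (auto simp: first_index_ranks_def)
  have main: "f (sa x) \<le> f (sa y) \<and> (if f (sa x) = f (sa y) then rk (sa x) = rk (sa y) else rk (sa x) < rk (sa y))"
    if "x \<le> y" "y < K" for x y
    using that
  proof (induction rule: dec_induct)
    case (step y)
    then have IH: "f (sa x) \<le> f (sa y)" "if f (sa x) = f (sa y) then rk (sa x) = rk (sa y) else rk (sa x) < rk (sa y)"
      by auto
    have le: "f (sa y) \<le> f (sa (Suc y))" using srt[of "Suc y"] step by simp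
    \<comment> \<open>A class that starts at \<open>Suc y\<close> gets a rank above every rank
      assigned so far; this is the source of strictness.\<close>
    have "rk (sa y) \<le> y" using first_index_le[OF fi] step by simp
    then have "if f (sa y) = f (sa (Suc y)) then rk (sa y) = rk (sa (Suc y)) else rk (sa y) < rk (sa (Suc y))"
      using rk[of "Suc y"] step by (auto split: if_splits)
    then show ?case using IH le by (auto split: if_splits)
  qed simp
  show "rk j < rk k \<longleftrightarrow> f j < f k" "rk j = rk k \<longleftrightarrow> f j = f k" if "j < K" "k < K"
  proof -
    have "j \<in> sa ` {..<K}" "k \<in> sa ` {..<K}" unfolding sa using that by simp_all
    then obtain x y where xy: "x < K" "y < K" "j = sa x" "k = sa y" by blast
    have "(rk (sa x) < rk (sa y) \<longleftrightarrow> f (sa x) < f (sa y)) \<and> (rk (sa x) = rk (sa y) \<longleftrightarrow> f (sa x) = f (sa y))"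
    proof (cases "x \<le> y")
      case True
      show ?thesis using main[OF True xy(2)] by (cases "f (sa x) = f (sa y)") auto
    next
      case False
      then have "y \<le> x" by simp
      show ?thesis using main[OF \<open>y \<le> x\<close> xy(1)] by (cases "f (sa x) = f (sa y)") auto
    qed
    then show "rk j < rk k \<longleftrightarrow> f j < f k" "rk j = rk k \<longleftrightarrow> f j = f k" using xy by auto
  qed
qed

lemma key_upd_ar [simp]: "f Lab = ar s Lab \<Longrightarrow> key (s\<lparr>ar := f\<rparr>) = key s"
  by (auto simp: key_def)

section \<open>Sorting and naming the blocks\<close>

definition sort_blocks :: hcom where
  "sort_blocks = (Rflat ::= Lit 0 ;; For Rx (V Rk) (Put Buf (V Rx) (Arr Tg (V Rx))) ;; Rlen ::= V Rk ;; sort_buffer)"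

text \<open>The offset recorded by the sort is the first mismatch of neighbouring blocks or the last
  index of equal ones. One comparison of keys at that offset therefore tells whether they are equal,
  without rescanning.\<close>

definition name_blocks :: hcom where
  "name_blocks = For Rx (V Rk) (Rv ::= Arr Buf (V Rx) ;; Ra ::= Arr Ix (V Rv) ;;
     Put Sa (V Rx) (V Ra) ;; Put Rnk (V Ra) (V Rx) ;;
     When (Lt (Lit 0) (V Rx)) (Ru ::= Arr Buf (Minus (V Rx) (Lit 1)) ;; Rl ::= Arr Lc (V Rv) ;;
       When (And (Not (KeyLt (Plus (V Ru) (V Rl)) (Plus (V Rv) (V Rl))))
                 (Not (KeyLt (Plus (V Rv) (V Rl)) (Plus (V Ru) (V Rl)))))
         (Put Rnk (V Ra) (Arr Rnk (Arr Ix (V Ru))))))"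

lemma sort_buffer_frame:
  "frame sort_buffer s s' \<Longrightarrow> rg s' Rk = rg s Rk \<and> rg s' Rflat = rg s Rflat \<and> rg s' Rlen = rg s Rlen \<and>
    rg s' RK = rg s RK \<and> rg s' Ri = rg s Ri \<and> 
    ar s' Lab = ar s Lab \<and> ar s' Tg = ar s Tg \<and> ar s' Ix = ar s Ix \<and> sy s' = sy s \<and> size_of s' = size_of s"
  by (simp add: frame_def sort_buffer_def copy_back_def merge_pass_def merge_pair_def merge_pick_def merge_scan_def)

lemma wp_sort_blocks:
  fixes s :: "'a::linorder hstate"
  assumes ts: "target_state T i K s" and lc: "\<forall>u. ar s Lc u = 0" and K: "K \<le> length T" "K \<le> 2 ^ L"
    and n: "length T + 2 * K + (3 * K + 1) * L \<le> n"
    and Q: "\<And>s' n'. target_state T i K s' \<Longrightarrow> rg s' Rflat = 0 \<Longrightarrow> ar s' Buf ` {..<K} = targets T i K \<Longrightarrow>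
       inj_on (ar s' Buf) {..<K} \<Longrightarrow>
       \<forall>x. 0 < x \<and> x < K \<longrightarrow> le_at (block s') (ar s' Buf (x - 1)) (ar s' Buf x) (ar s' Lc (ar s' Buf x)) \<Longrightarrow>
       n \<le> n' + length T + 2 * K + (3 * K + 1) * L \<Longrightarrow> frame sort_blocks s s' \<Longrightarrow> Q s' n'"
  shows "wp sort_blocks Q s n"
proof -
  let ?N = "length T" and ?Z = "targets T i K"
  have N: "size_of s = ?N" and Rk: "rg s Rk = K" using ts by (auto simp: target_state_def holds_text_def)
  have "wp (For Rx (V Rk) (Put Buf (V Rx) (Arr Tg (V Rx)))) (wp (Rlen ::= V Rk ;; sort_buffer) Q) (s\<lparr>rg := (rg s)(Rflat := 0)\<rparr>) n"
  proof (rule wp_For[where m = K and I = "\<lambda>j s'. \<forall>x<j. ar s' Buf x = ar s Tg x"], goal_cases)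
    case (3 j s' n')
    have "ar s' Tg = ar s Tg" using 3(4) by (auto simp: frame_def)
    then show ?case using 3(1-3) by (auto simp: less_Suc_eq)
  next
    case (5 s')
    let ?s = "s'\<lparr>rg := (rg s')(Rlen := K)\<rparr>"
    have f: "rg s' Rk = K" "rg s' Rflat = 0" "ar s' Lab = ar s Lab" "ar s' Tg = ar s Tg" "ar s' Ix = ar s Ix"
      "ar s' Lc = ar s Lc" "sy s' = sy s" "size_of s' = ?N"
      using 5(3) N Rk by (auto simp: frame_def)
    have ts1: "target_state T i K ?s" using ts f by (simp add: target_state_def holds_text_def)
    have flat1: "rg ?s Rflat = 0" using f by simp
    have B: "\<forall>x<K. ar ?s Buf x = ar s Tg x" using 5(1) by simp
    then have U: "ar ?s Buf ` {..<rg ?s Rlen} = ?Z" using ts by (simp add: target_state_def) 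
    have inj: "inj_on (ar ?s Buf) {..<K}"
    proof -
      have "inj_on (ar s Tg) {..<K}" 
        using sorted_wrt_less_distinct[of "seg (ar s Tg) K"] ts by (simp add: target_state_def distinct_seg)
      then show ?thesis using B by (simp add: inj_on_def)
    qed
    have "wp sort_buffer Q ?s (n - K)"
    proof (rule wp_use[OF wp_sort_buffer[where S = "block ?s" and L = L]], goal_cases)
      case 1
      show ?case unfolding U by (rule block_strings[OF ts1 flat1])
    next
      case 2
      show ?case using inj by simp
    next
      case 3
      show ?case using K f by simp
    next
      case 4
      show ?case using K by simp
    next
      case 5
      show ?case using lc f by simp
    next
      case 6
      show ?case unfolding U using block_lengths[OF ts1 flat1] n by simp
    next
      case (7 s2 n2)
      note f2 = sort_buffer_frame[OF 7(2)]
      have ts2: "target_state T i K s2" using ts1 f2 by (simp add: target_state_def holds_text_def)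
      have b2: "block s2 = block ?s" using f2 by (simp add: block_def fun_eq_iff key_def)
      have c2: "n - K \<le> n2 + (\<Sum>u\<in>?Z. length (block ?s u)) + (3 * K + 1) * L" using 7(1) unfolding U by simp
      show ?case
      proof (rule Q[OF ts2])
        show "rg s2 Rflat = 0" using f2 f by simp
        show "ar s2 Buf ` {..<K} = ?Z" "inj_on (ar s2 Buf) {..<K}" using 7(1) unfolding U by auto
        show "\<forall>x. 0 < x \<and> x < K \<longrightarrow> le_at (block s2) (ar s2 Buf (x - 1)) (ar s2 Buf x) (ar s2 Lc (ar s2 Buf x))"
          using 7(1) unfolding b2 by simp
        show "n \<le> n2 + ?N + 2 * K + (3 * K + 1) * L" using c2 block_lengths[OF ts1 flat1] n by linarith
        show "frame sort_blocks s s2" using 7(2) 5(3) by (auto simp: frame_def sort_blocks_def)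
      qed
    qed
    then show ?case using f by simp
  qed (use n N Rk K in \<open>auto simp: frame_def\<close>)
  then show ?thesis unfolding sort_blocks_def by simp
qed

text \<open>Ranks are names for \<open>h\<close> consecutive blocks. Different names already give
  the order; equal names mean that the comparison may be moved \<open>h\<close> targets ahead, and
  then \<open>h\<close> further targets exist on both sides.\<close>

definition doubling_inv :: "nat \<Rightarrow> (nat \<Rightarrow> nat \<Rightarrow> bool) \<Rightarrow> nat \<Rightarrow> (nat \<Rightarrow> nat) \<Rightarrow> (nat \<Rightarrow> nat) \<Rightarrow> bool" where
  "doubling_inv K lt h sa rk \<longleftrightarrow> first_index_ranks K sa rk \<and>
     (\<forall>j<K. \<forall>k<K. rk j < rk k \<longrightarrow> lt j k) \<and>
     (\<forall>j<K. \<forall>k<K. j \<noteq> k \<longrightarrow> rk j = rk k \<longrightarrow> j + h < K \<and> k + h < K \<and> (lt j k \<longleftrightarrow> lt (j + h) (k + h)))"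

definition target_less :: "'a::linorder list \<Rightarrow> (nat \<Rightarrow> nat) \<Rightarrow> nat \<Rightarrow> nat \<Rightarrow> bool" where
  "target_less T tg j k \<longleftrightarrow> text_suffix T (tg j) < text_suffix T (tg k)"

lemma le_at_eq_iff:
  assumes "le_at S u v l"
  shows "S u ! l = S v ! l \<longleftrightarrow> S u = S v"
proof
  assume eq: "S u ! l = S v ! l"
  then have l: "Suc l = length (S u)" "Suc l = length (S v)" "take l (S u) = take l (S v)"
    using assms by (auto simp: le_at_def)
  have "S u = take l (S u) @ [S u ! l]" using l(1) by (metis lessI order_refl take_Suc_conv_app_nth take_all)
  also have "\<dots> = S v" using l(2,3) eq by (metis lessI order_refl take_Suc_conv_app_nth take_all)
  finally show "S u = S v" .
qed simp

definition naming_inv :: "'a::linorder hstate \<Rightarrow> nat \<Rightarrow> (nat \<Rightarrow> nat) \<Rightarrow> (nat \<Rightarrow> nat) \<Rightarrow> bool" where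
  "naming_inv s j sa rk \<longleftrightarrow> (\<forall>x<j. sa x = ar s Ix (ar s Buf x) \<and> rk (ar s Ix (ar s Buf x)) =
     (if 0 < x \<and> block s (ar s Buf x) = block s (ar s Buf (x - 1)) then rk (ar s Ix (ar s Buf (x - 1))) else x))"

lemma wp_name_blocks:
  fixes s :: "'a::linorder hstate"
  assumes ts: "target_state T i K s" and flat: "rg s Rflat = 0" and buf: "ar s Buf ` {..<K} = targets T i K"
    and inj: "inj_on (ar s Buf) {..<K}" and K: "K \<le> length T"
    and srt: "\<forall>x. 0 < x \<and> x < K \<longrightarrow> le_at (block s) (ar s Buf (x - 1)) (ar s Buf x) (ar s Lc (ar s Buf x))"
    and n: "K \<le> n"
    and Q: "\<And>s'. doubling_inv K (target_less T (ar s Tg)) 1 (ar s' Sa) (ar s' Rnk) \<Longrightarrow> frame name_blocks s s' \<Longrightarrow> Q s' (n - K)"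
  shows "wp name_blocks Q s n"
proof -
  let ?N = "length T" and ?B = "ar s Buf" and ?ix = "ar s Ix"
  have N: "size_of s = ?N" and Rk: "rg s Rk = K" using ts by (auto simp: target_state_def holds_text_def)
  have bt: "?B x \<in> targets T i K" if "x < K" for x using buf that by blast
  have ixB: "?ix (?B x) < K" "ar s Tg (?ix (?B x)) = ?B x" if x: "x < K" for x
  proof -
    obtain j where "j < K" "?B x = ar s Tg j" using target_tg[OF ts flat bt[OF x]] by blast
    then show "?ix (?B x) < K" "ar s Tg (?ix (?B x)) = ?B x" using ix_tg[OF ts flat] by auto
  qed
  have ix_inj: "?ix (?B x) = ?ix (?B y) \<longleftrightarrow> x = y" if "x < K" "y < K" for x y
    using ixB(2)[OF that(1)] ixB(2)[OF that(2)] inj that by (metis inj_onD lessThan_iff)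
  have bnd: "?B x + ar s Lc (?B y) \<le> 4 * ?N + 8" if "0 < y" "y < K" "x = y \<or> x = y - 1" for x y
  proof -
    have "ar s Lc (?B y) < length (block s (?B x))" using srt that by (auto simp: le_at_def)
    moreover have "?B x + length (block s (?B x)) \<le> 2 * ?N + 2"
      using block_strings[OF ts flat] bt[of x] that N by (auto simp: strings_def)
    ultimately show ?thesis by simp
  qed
  have eq_iff: "key s (?B (x - 1) + ar s Lc (?B x)) = key s (?B x + ar s Lc (?B x)) \<longleftrightarrow> block s (?B x) = block s (?B (x - 1))"
    if "0 < x" "x < K" for x
  proof -
    let ?u = "?B (x - 1)" and ?v = "?B x"
    have le: "le_at (block s) ?u ?v (ar s Lc ?v)" using srt that by simp
    then have "ar s Lc ?v < length (block s ?u)" "ar s Lc ?v < length (block s ?v)" by (auto simp: le_at_def)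
    then have "block s ?u ! ar s Lc ?v = key s (?u + ar s Lc ?v)" "block s ?v ! ar s Lc ?v = key s (?v + ar s Lc ?v)"
      using block_strings[OF ts flat] bt[of x] bt[of "x - 1"] that by (auto simp: strings_def)
    then show ?thesis using le_at_eq_iff[OF le] by auto
  qed
  show ?thesis
    unfolding name_blocks_def
  proof (rule wp_For[where m = K and I = "\<lambda>j s'. naming_inv s j (ar s' Sa) (ar s' Rnk)"], goal_cases)
    case (3 j s' n')
    have f: "ar s' Buf = ?B" "ar s' Ix = ?ix" "ar s' Lc = ar s Lc" "ar s' Lab = ar s Lab" "sy s' = sy s" "size_of s' = ?N"
      using 3(4) N by (auto simp: frame_def)
    have k: "key s' = key s" using f(4,5) by (rule key_frame)
    let ?a = "?ix (?B j)"
    have old: "x < j \<Longrightarrow> ?ix (?B x) \<noteq> ?a" "x < j \<Longrightarrow> ?ix (?B (x - 1)) \<noteq> ?a" for x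
      using ix_inj[of x j] ix_inj[of "x - 1" j] 3(1) by auto
    have step: "naming_inv s (Suc j) ((ar s' Sa)(j := ?a)) ((ar s' Rnk)(?a := v))"
      if v: "v = (if 0 < j \<and> block s (?B j) = block s (?B (j - 1)) then ar s' Rnk (?ix (?B (j - 1))) else j)" for v
      unfolding naming_inv_def
    proof (intro allI impI)
      fix x assume x: "x < Suc j"
      show "((ar s' Sa)(j := ?a)) x = ?ix (?B x) \<and> ((ar s' Rnk)(?a := v)) (?ix (?B x)) =
       (if 0 < x \<and> block s (?B x) = block s (?B (x - 1)) then ((ar s' Rnk)(?a := v)) (?ix (?B (x - 1))) else x)"
      proof (cases "x = j")
        case True
        have "0 < j \<Longrightarrow> ?ix (?B (j - 1)) \<noteq> ?a" using ix_inj[of "j - 1" j] 3(1) by auto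
        then show ?thesis using True v by auto
      next
        case False
        then have "x < j" using x by simp
        then show ?thesis using 3(3)[unfolded naming_inv_def, rule_format, of x] old[of x] False by simp
      qed
    qed
    show ?case
    proof (cases "0 < j")
      case False
      then show ?thesis using 3(2) f step[of j] by simp
    next
      case True
      have ne: "?ix (?B (j - 1)) \<noteq> ?a" using ix_inj[of "j - 1" j] 3(1) True by auto
      note b = bnd[OF True 3(1), of j] bnd[OF True 3(1), of "j - 1"]
      show ?thesis
      proof (cases "block s (?B j) = block s (?B (j - 1))")
        case eq: True
        then have "key s (?B (j - 1) + ar s Lc (?B j)) = key s (?B j + ar s Lc (?B j))" using eq_iff[OF True 3(1)] by simp
        then show ?thesis using True 3(2) f k b ne eq step[of "ar s' Rnk (?ix (?B (j - 1)))"] by simp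
      next
        case neq: False
        then have "key s (?B (j - 1) + ar s Lc (?B j)) \<noteq> key s (?B j + ar s Lc (?B j))" using eq_iff[OF True 3(1)] by simp
        then have "key s (?B (j - 1) + ar s Lc (?B j)) < key s (?B j + ar s Lc (?B j)) \<or>
          key s (?B j + ar s Lc (?B j)) < key s (?B (j - 1) + ar s Lc (?B j))" by (metis neqE)
        then show ?thesis using True 3(2) f k b neq step[of j] by auto
      qed
    qed
  next
    case (5 s')
    let ?sa = "ar s' Sa" and ?rk = "ar s' Rnk" and ?f = "\<lambda>j. block s (ar s Tg j)"
    have sa: "?sa x = ?ix (?B x)" if "x < K" for x using 5(1) that by (simp add: naming_inv_def)
    have "?sa ` {..<K} \<subseteq> {..<K}" using sa ixB by auto
    moreover have "inj_on ?sa {..<K}" using sa ix_inj by (auto intro!: inj_onI)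
    ultimately have perm: "?sa ` {..<K} = {..<K}" by (simp add: endo_inj_surj)
    have fs: "?f (?sa x) = block s (?B x)" if "x < K" for x using sa ixB that by simp
    have le: "?f (?sa (x - 1)) \<le> ?f (?sa x)" if "0 < x" "x < K" for x
      using le_at_le[of "block s"] srt that fs[of x] fs[of "x - 1"] by (metis less_imp_diff_less)
    have rk: "?rk (?sa x) = (if 0 < x \<and> ?f (?sa x) = ?f (?sa (x - 1)) then ?rk (?sa (x - 1)) else x)" if "x < K" for x
      using 5(1)[unfolded naming_inv_def, rule_format, OF that] that sa[of x] sa[of "x - 1"] fs[of x] fs[of "x - 1"] by auto
    note R = ranks_from_sorted[where f = ?f, OF perm le rk]
    have "doubling_inv K (target_less T (ar s Tg)) 1 ?sa ?rk"
      unfolding doubling_inv_def target_less_def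
    proof (intro conjI allI impI)
      show "first_index_ranks K ?sa ?rk" by (rule R(1))
    next
      fix j k assume "j < K" "k < K" "?rk j < ?rk k"
      then show "text_suffix T (ar s Tg j) < text_suffix T (ar s Tg k)"
        using R(2)[of j k] block_less[OF ts flat] by blast
    next
      fix j k assume jk: "j < K" "k < K" "j \<noteq> k" "?rk j = ?rk k"
      then have eq: "?f j = ?f k" using R(3)[of j k] by blast
      show "j + 1 < K" "k + 1 < K" "text_suffix T (ar s Tg j) < text_suffix T (ar s Tg k) \<longleftrightarrow>
         text_suffix T (ar s Tg (j + 1)) < text_suffix T (ar s Tg (k + 1))"
        using block_eq[OF ts flat jk(1-3) eq] by simp_all
    qed
    then show ?case using Q[of s'] 5(3) by (simp add: name_blocks_def)
  qed (use n N Rk in \<open>auto simp: frame_def naming_inv_def\<close>)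
qed

section \<open>Prefix doubling\<close>

lemma first_index_mono:
  assumes "first_index_ranks K sa rk" "x \<le> y" "y < K"
  shows "rk (sa x) \<le> rk (sa y)"
  using assms(2,3)
proof (induction rule: dec_induct)
  case (step y)
  have "rk (sa (Suc y)) = Suc y \<or> rk (sa (Suc y)) = rk (sa y)"
    using assms(1) step unfolding first_index_ranks_def by (metis diff_Suc_1)
  moreover have "rk (sa y) \<le> y" using first_index_le[OF assms(1)] step by simp
  ultimately show ?case using step by auto
qed simp

lemma first_index_start:
  assumes "first_index_ranks K sa rk" "x < K"
  shows "rk (sa (rk (sa x))) = rk (sa x)"
  using assms(2)
proof (induction x)
  case 0
  then show ?case using assms(1) by (auto simp: first_index_ranks_def)
next
  case (Suc x)
  have "rk (sa (Suc x)) = Suc x \<or> rk (sa (Suc x)) = rk (sa x)"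
    using assms(1) Suc.prems unfolding first_index_ranks_def by (metis diff_Suc_1)
  then show ?case using Suc by auto
qed

lemma first_index_card:
  assumes fi: "first_index_ranks K sa rk" and a: "a < K"
  shows "rk a = card {b. b < K \<and> rk b < rk a}"
proof -
  have sa: "sa ` {..<K} = {..<K}" using fi by (simp add: first_index_ranks_def)
  have inj: "inj_on sa {..<K}" using sa by (simp add: eq_card_imp_inj_on)
  have "a \<in> sa ` {..<K}" unfolding sa using a by simp
  then obtain x where x: "x < K" "a = sa x" by blast
  have le: "rk a \<le> x" using first_index_le[OF fi x(1)] x by simp
  have "{b. b < K \<and> rk b < rk a} = sa ` {..<rk a}"
  proof (intro equalityI subsetI)
    fix b assume b: "b \<in> {b. b < K \<and> rk b < rk a}"
    then have "b \<in> sa ` {..<K}" unfolding sa by simp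
    then obtain y where y: "y < K" "b = sa y" by blast
    have "y < rk a"
    proof (rule ccontr)
      assume "\<not> y < rk a"
      then have "rk (sa (rk a)) \<le> rk (sa y)" using first_index_mono[OF fi, of "rk a" y] y by simp
      then show False using first_index_start[OF fi x(1)] x b y by simp
    qed
    then show "b \<in> sa ` {..<rk a}" using y by simp
  next
    fix b assume "b \<in> sa ` {..<rk a}"
    then obtain y where y: "y < rk a" "b = sa y" by blast
    have "sa y \<in> sa ` {..<K}" using y le x by simp
    then have "b < K" unfolding sa using y by simp
    moreover have "rk b \<le> y" using first_index_le[OF fi, of y] y le x by simp
    ultimately show "b \<in> {b. b < K \<and> rk b < rk a}" using y by simp
  qed
  moreover have "inj_on sa {..<rk a}" using inj by (rule inj_on_subset) (use le x in auto)
  ultimately show ?thesis by (simp add: card_image)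
qed

definition position :: "nat \<Rightarrow> (nat \<Rightarrow> 'b::linorder) \<Rightarrow> nat \<Rightarrow> nat" where
  "position K f x = card {y. y < K \<and> f y < f x}"

lemma position_less: "x < K \<Longrightarrow> f x < f y \<Longrightarrow> position K f x < position K f y"
  unfolding position_def by (rule psubset_card_mono) auto

lemma position_image:
  assumes "inj_on f {..<K}"
  shows "position K f ` {..<K} = {..<K}" "inj_on (position K f) {..<K}"
proof -
  show inj: "inj_on (position K f) {..<K}"
  proof (rule inj_onI)
    fix x y assume xy: "x \<in> {..<K}" "y \<in> {..<K}" "position K f x = position K f y"
    then have "f x = f y" using position_less[of x K f y] position_less[of y K f x]
      by (cases "f x" "f y" rule: linorder_cases) auto
    then show "x = y" using assms xy by (auto dest: inj_onD)
  qed
  have "position K f x < K" if "x < K" for x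
  proof -
    have "x \<notin> {y. y < K \<and> f y < f x}" "{y. y < K \<and> f y < f x} \<subseteq> {..<K}" by auto
    then have "{y. y < K \<and> f y < f x} \<subset> {..<K}" using that by blast
    from psubset_card_mono[OF _ this] show ?thesis by (simp add: position_def)
  qed
  then have "position K f ` {..<K} \<subseteq> {..<K}" by auto
  then show "position K f ` {..<K} = {..<K}" using inj by (simp add: endo_inj_surj)
qed

text \<open>The second component orders positions \<open>h\<close> further on; positions within \<open>h\<close> of the end come first.\<close>

definition second_key :: "nat \<Rightarrow> nat \<Rightarrow> (nat \<Rightarrow> nat) \<Rightarrow> nat \<Rightarrow> nat" where
  "second_key K h rk a = (if a + h < K then Suc (rk (a + h)) else 0)"

text \<open>Sorting by pairs of names decides \<open>2 * h\<close> blocks: ties in the first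
  component hand the comparison to the names \<open>h\<close> targets ahead, ties in both hand it
  \<open>2 * h\<close> ahead.\<close>

lemma doubling_step:
  assumes inv: "doubling_inv K lt h sa rk" and perm: "sa2 ` {..<K} = {..<K}"
    and srt: "\<And>x. 0 < x \<Longrightarrow> x < K \<Longrightarrow> (rk (sa2 (x - 1)), second_key K h rk (sa2 (x - 1))) \<le> (rk (sa2 x), second_key K h rk (sa2 x))"
    and rk2: "\<And>x. x < K \<Longrightarrow> rk2 (sa2 x) = (if 0 < x \<and> rk (sa2 x) = rk (sa2 (x - 1)) \<and> rk (sa2 x + h) = rk (sa2 (x - 1) + h)
       then rk2 (sa2 (x - 1)) else x)"
  shows "doubling_inv K lt (h + h) sa2 rk2"
proof -
  let ?p = "\<lambda>a. (rk a, second_key K h rk a)"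
  have R1: "\<And>j k. j < K \<Longrightarrow> k < K \<Longrightarrow> rk j < rk k \<Longrightarrow> lt j k"
    and R2: "\<And>j k. j < K \<Longrightarrow> k < K \<Longrightarrow> j \<noteq> k \<Longrightarrow> rk j = rk k \<Longrightarrow> j + h < K \<and> k + h < K \<and> (lt j k \<longleftrightarrow> lt (j + h) (k + h))"
    using inv unfolding doubling_inv_def by blast+
  have inj: "inj_on sa2 {..<K}" using perm by (simp add: eq_card_imp_inj_on)
  have sa2: "sa2 x < K" if "x < K" for x
  proof -
    have "sa2 x \<in> sa2 ` {..<K}" using that by simp
    then show ?thesis unfolding perm by simp
  qed
  \<comment> \<open>The test on the right reads ranks at \<open>j + h\<close> and
    \<open>k + h\<close> without a bounds check. For distinct indices with equal ranks the invariant
    guarantees that both lie below \<open>K\<close>; with different ranks the value read there is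
    irrelevant.\<close>
  have peq: "?p j = ?p k \<longleftrightarrow> rk j = rk k \<and> rk (j + h) = rk (k + h)" if "j < K" "k < K" "j \<noteq> k" for j k
    using R2[OF that] by (auto simp: second_key_def)
  have rk2': "rk2 (sa2 x) = (if 0 < x \<and> ?p (sa2 x) = ?p (sa2 (x - 1)) then rk2 (sa2 (x - 1)) else x)" if "x < K" for x
  proof (cases "0 < x")
    case True
    have "sa2 x \<noteq> sa2 (x - 1)"
    proof
      assume "sa2 x = sa2 (x - 1)"
      then have "x = x - 1" using inj that by (auto dest: inj_onD)
      then show False using True by simp
    qed
    then have "?p (sa2 x) = ?p (sa2 (x - 1)) \<longleftrightarrow> rk (sa2 x) = rk (sa2 (x - 1)) \<and> rk (sa2 x + h) = rk (sa2 (x - 1) + h)"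
      using that by (intro peq sa2) auto
    then show ?thesis using rk2[OF that] by presburger
  qed (use rk2[OF that] in simp)
  note R = ranks_from_sorted[where f = ?p, OF perm srt rk2']
  show ?thesis unfolding doubling_inv_def
  proof (intro conjI allI impI)
    show "first_index_ranks K sa2 rk2" by (rule R(1))
  next
    fix j k assume jk: "j < K" "k < K" "rk2 j < rk2 k"
    then have "?p j < ?p k" using R(2) by blast
    then consider "rk j < rk k" | "rk j = rk k" "second_key K h rk j < second_key K h rk k" "j \<noteq> k" by (auto simp: order.order_iff_strict)
    then show "lt j k"
    proof cases
      case 1
      then show ?thesis using R1 jk by blast
    next
      case 2
      note r = R2[OF jk(1,2) 2(3,1)]
      then have "rk (j + h) < rk (k + h)" using 2(2) by (simp add: second_key_def)
      then show ?thesis using R1[of "j + h" "k + h"] r by blast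
    qed
  next
    fix j k assume jk: "j < K" "k < K" "j \<noteq> k" "rk2 j = rk2 k"
    then have "?p j = ?p k" using R(3) by blast
    then have e: "rk j = rk k" "rk (j + h) = rk (k + h)" using peq[OF jk(1-3)] by blast+
    note r = R2[OF jk(1-3) e(1)]
    have "j + h \<noteq> k + h" using jk(3) by simp
    note r2 = R2[OF _ _ this e(2)]
    show "j + (h + h) < K" "k + (h + h) < K" "lt j k \<longleftrightarrow> lt (j + (h + h)) (k + (h + h))"
      using r r2 by (simp_all add: add.assoc)
  qed
qed

definition order_by_second :: hcom where
  "order_by_second = (For Rx (V Rh) (Put Tmp (V Rx) (Minus (Plus (V Rk) (V Rx)) (V Rh))) ;;
     Rm ::= V Rh ;; For Rx (V Rk) (Ra ::= Arr Sa (V Rx) ;;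
       When (Not (Lt (V Ra) (V Rh))) (Put Tmp (V Rm) (Minus (V Ra) (V Rh)) ;; Rm ::= Inc (V Rm) 1)))"

lemma wp_order_by_second:
  fixes s :: "'a::linorder hstate"
  defines "K \<equiv> rg s Rk" and "h \<equiv> rg s Rh" and "sa \<equiv> ar s Sa" and "rk \<equiv> ar s Rnk"
  assumes h: "h < K" and K: "K \<le> size_of s" and fi: "first_index_ranks K sa rk" and n: "2 * K \<le> n"
    and Q: "\<And>s' n'. ar s' Tmp ` {..<K} = {..<K} \<Longrightarrow>
      (\<And>x y. x < y \<Longrightarrow> y < K \<Longrightarrow> second_key K h rk (ar s' Tmp x) \<le> second_key K h rk (ar s' Tmp y)) \<Longrightarrow>
      n \<le> n' + 2 * K \<Longrightarrow> frame order_by_second s s' \<Longrightarrow> Q s' n'"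
  shows "wp order_by_second Q s n"
proof -
  define g where "g = (\<lambda>j. [K - h..<K] @ map (\<lambda>a. a - h) (filter (\<lambda>a. h \<le> a) (seg sa j)))"
  have sa: "sa ` {..<K} = {..<K}" using fi by (simp add: first_index_ranks_def)
  have "wp (For Rx (V Rh) (Put Tmp (V Rx) (Minus (Plus (V Rk) (V Rx)) (V Rh))))
     (wp (Rm ::= V Rh ;; For Rx (V Rk) (Ra ::= Arr Sa (V Rx) ;;
       When (Not (Lt (V Ra) (V Rh))) (Put Tmp (V Rm) (Minus (V Ra) (V Rh)) ;; Rm ::= Inc (V Rm) 1))) Q) s n"
  proof (rule wp_For[where m = h and I = "\<lambda>j s'. \<forall>x<j. ar s' Tmp x = x + (K - h)"], goal_cases)
    case (3 j s' n')
    have "rg s' Rk = K" "rg s' Rh = h" "size_of s' = size_of s" using 3(4) by (auto simp: frame_def K_def h_def)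
    then show ?case using 3(1-3) h K by (auto simp: less_Suc_eq)
  next
    case (5 s')
    have f: "rg s' Rk = K" "rg s' Rh = h" "ar s' Sa = sa" "ar s' Rnk = rk" using 5(3) by (auto simp: frame_def K_def h_def sa_def rk_def)
    have first: "seg (ar s' Tmp) h = [K - h..<K]"
    proof -
      have "seg (ar s' Tmp) h = map (\<lambda>x. x + (K - h)) [0..<h]" using 5(1) by (simp add: seg_def)
      also have "\<dots> = [K - h..<h + (K - h)]" by (rule map_add_upt)
      finally show ?thesis using h by simp
    qed
    let ?s = "s'\<lparr>rg := (rg s')(Rm := h)\<rparr>"
    have "wp (For Rx (V Rk) (Ra ::= Arr Sa (V Rx) ;;
       When (Not (Lt (V Ra) (V Rh))) (Put Tmp (V Rm) (Minus (V Ra) (V Rh)) ;; Rm ::= Inc (V Rm) 1))) Q ?s (n - h)"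
    proof (rule wp_For[where m = K and I = "\<lambda>j s'. length (g j) = rg s' Rm \<and> seg (ar s' Tmp) (rg s' Rm) = g j"], goal_cases)
      case 2
      then show ?case using first h by (simp add: g_def)
    next
      case (3 j s2 n2)
      have f2: "rg s2 Rh = h" "ar s2 Sa = sa" using 3(4) f by (auto simp: frame_def)
      have sg: "seg ((ar s2 Tmp)(rg s2 Rm := v)) (rg s2 Rm) = seg (ar s2 Tmp) (rg s2 Rm)" for v by (rule seg_cong) simp
      have I: "length (g j) = rg s2 Rm" "seg (ar s2 Tmp) (rg s2 Rm) = g j" using 3(3) by blast+
      show ?case
      proof (cases "h \<le> sa j")
        case True
        then have "g (Suc j) = g j @ [sa j - h]" by (simp add: g_def)
        then show ?thesis using True 3(2) f2 sg I by simp
      next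
        case False
        then have "g (Suc j) = g j" by (simp add: g_def)
        then show ?thesis using False 3(2) f2 I by simp
      qed
    next
      case (5 s2)
      let ?t = "ar s2 Tmp"
      have I: "length (g K) = rg s2 Rm" "seg ?t (rg s2 Rm) = g K" using 5(1) by blast+
      have inj: "inj_on sa {..<K}" using sa by (simp add: eq_card_imp_inj_on)
      have setg: "set (g K) = {..<K}"
      proof (intro equalityI subsetI)
        fix x assume "x \<in> set (g K)"
        then show "x \<in> {..<K}" using h sa by (auto simp: g_def)
      next
        fix x assume x: "x \<in> {..<K}"
        show "x \<in> set (g K)"
        proof (cases "x < K - h")
          case True
          then have "x + h \<in> sa ` {..<K}" unfolding sa by simp
          then have "x \<in> (\<lambda>a. a - h) ` {a \<in> sa ` {..<K}. h \<le> a}" by (intro image_eqI[of _ _ "x + h"]) auto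
          then show ?thesis by (simp add: g_def)
        next
          case False
          then show ?thesis using x by (simp add: g_def)
        qed
      qed
      have len: "length (g K) = K"
      proof -
        have "distinct (seg sa K)" using inj by (simp add: distinct_seg)
        then have "length (filter (\<lambda>a. h \<le> a) (seg sa K)) = card {a \<in> sa ` {..<K}. h \<le> a}"
          using distinct_card[OF distinct_filter[of "seg sa K" "\<lambda>a. h \<le> a"]] by simp
        also have "{a \<in> sa ` {..<K}. h \<le> a} = {h..<K}" unfolding sa by auto
        finally show ?thesis using h by (simp add: g_def)
      qed
      have tk: "seg ?t K = g K" using I len by simp
      have perm: "?t ` {..<K} = {..<K}" using setg tk by (metis seg_simps(5))
      have "sorted (map (second_key K h rk) (g K))"
      proof -
        have "sorted (map (\<lambda>a. Suc (rk a)) (seg sa K))"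
          using first_index_mono[OF fi] by (auto simp: sorted_iff_nth_mono)
        then have 1: "sorted (map (\<lambda>a. Suc (rk a)) (filter (\<lambda>a. h \<le> a) (seg sa K)))" by (rule sorted_filter)
        have sub: "a < K" if "a \<in> sa ` {..<K}" for a using that unfolding sa by simp
        have 2: "map (second_key K h rk) (map (\<lambda>a. a - h) (filter (\<lambda>a. h \<le> a) (seg sa K))) = map (\<lambda>a. Suc (rk a)) (filter (\<lambda>a. h \<le> a) (seg sa K))"
          using sub by (auto simp: second_key_def)
        have 3: "map (second_key K h rk) [K - h..<K] = replicate h 0"
          using h by (intro nth_equalityI) (auto simp: second_key_def)
        show ?thesis unfolding g_def map_append 2 3 sorted_append using 1 by auto
      qed
      then have mono: "second_key K h rk (?t x) \<le> second_key K h rk (?t y)" if "x < y" "y < K" for x y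
        using that unfolding tk[symmetric] by (simp add: sorted_iff_nth_mono)
      have "frame order_by_second s s2" using 5(3) \<open>frame _ s s'\<close> by (auto simp: frame_def order_by_second_def)
      then show ?case using Q[OF perm mono] n h by simp
    qed (use f n h in \<open>auto simp: frame_def\<close>)
    then show ?case using f by simp
  qed (use n h in \<open>auto simp: frame_def h_def\<close>)
  then show ?thesis unfolding order_by_second_def by simp
qed

text \<open>A rank is the first index of its class, so it is itself the start of the bucket and no
  counting pass is required. Inserting in the order of \<open>Tmp\<close> makes the sort stable,
  hence lexicographic in the pair.\<close>

definition bucket_sort :: hcom where
  "bucket_sort = (For Rx (V Rk) (Put Cnt (V Rx) (V Rx)) ;;
     For Rx (V Rk) (Ra ::= Arr Tmp (V Rx) ;; Rq ::= Arr Cnt (Arr Rnk (V Ra)) ;;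
       Put Sa2 (V Rq) (V Ra) ;; Put Cnt (Arr Rnk (V Ra)) (Inc (V Rq) 1)))"

lemma wp_bucket_sort:
  fixes s :: "'a::linorder hstate"
  defines "K \<equiv> rg s Rk" and "rk \<equiv> ar s Rnk" and "t \<equiv> ar s Tmp"
  assumes fi: "first_index_ranks K (ar s Sa) rk" and perm: "t ` {..<K} = {..<K}" and n: "2 * K \<le> n"
    and Q: "\<And>s' n'. (\<And>x. x < K \<Longrightarrow> ar s' Sa2 (position K (\<lambda>x. (rk (t x), x)) x) = t x) \<Longrightarrow>
      n \<le> n' + 2 * K \<Longrightarrow> frame bucket_sort s s' \<Longrightarrow> Q s' n'"
  shows "wp bucket_sort Q s n"
proof -
  let ?pos = "position K (\<lambda>x. (rk (t x), x))"
  have inj: "inj_on t {..<K}" using perm by (simp add: eq_card_imp_inj_on)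
  have tK: "t x < K" if "x < K" for x
  proof -
    have "t x \<in> t ` {..<K}" using that by simp
    then show ?thesis unfolding perm by simp
  qed
  have sa: "ar s Sa ` {..<K} = {..<K}" using fi by (simp add: first_index_ranks_def)
  have rkK: "rk a < K" if "a < K" for a
  proof -
    have "a \<in> ar s Sa ` {..<K}" unfolding sa using that by simp
    then obtain x where "x < K" "a = ar s Sa x" by blast
    then show ?thesis using first_index_le[OF fi, of x] by simp
  qed
  \<comment> \<open>The lexicographic position splits into the elements of smaller rank, whose
    number is the rank itself by \<open>first_index_card\<close>, and the earlier elements of the
    same bucket.\<close>
  have pos: "?pos j = rk (t j) + card {y. y < j \<and> rk (t y) = rk (t j)}" if j: "j < K" for j
  proof -
    have "{y. y < K \<and> (rk (t y), y) < (rk (t j), j)} = {y. y < K \<and> rk (t y) < rk (t j)} \<union> {y. y < j \<and> rk (t y) = rk (t j)}"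
      using j by auto
    then have "?pos j = card ({y. y < K \<and> rk (t y) < rk (t j)} \<union> {y. y < j \<and> rk (t y) = rk (t j)})"
      unfolding position_def by (rule arg_cong)
    also have "\<dots> = card {y. y < K \<and> rk (t y) < rk (t j)} + card {y. y < j \<and> rk (t y) = rk (t j)}"
      by (rule card_Un_disjoint) auto
    finally have "?pos j = card {y. y < K \<and> rk (t y) < rk (t j)} + card {y. y < j \<and> rk (t y) = rk (t j)}" .
    moreover have "card {y. y < K \<and> rk (t y) < rk (t j)} = card {b. b < K \<and> rk b < rk (t j)}"
    proof -
      have "{b. b < K \<and> rk b < rk (t j)} = t ` {y. y < K \<and> rk (t y) < rk (t j)}"
      proof (intro equalityI subsetI)
        fix b assume b: "b \<in> {b. b < K \<and> rk b < rk (t j)}"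
        then have "b \<in> t ` {..<K}" unfolding perm by simp
        then show "b \<in> t ` {y. y < K \<and> rk (t y) < rk (t j)}" using b by auto
      qed (use tK in auto)
      moreover have "inj_on t {y. y < K \<and> rk (t y) < rk (t j)}" using inj by (rule inj_on_subset) auto
      ultimately show ?thesis by (simp add: card_image)
    qed
    ultimately show ?thesis using first_index_card[OF fi tK[OF j]] by simp
  qed
  have pos_inj: "?pos x \<noteq> ?pos j" if "x < j" "j < K" for x j
    using position_image(2)[of "\<lambda>x. (rk (t x), x)" K] that by (auto simp: inj_on_def)
  have "wp (For Rx (V Rk) (Put Cnt (V Rx) (V Rx)))
     (wp (For Rx (V Rk) (Ra ::= Arr Tmp (V Rx) ;; Rq ::= Arr Cnt (Arr Rnk (V Ra)) ;;
       Put Sa2 (V Rq) (V Ra) ;; Put Cnt (Arr Rnk (V Ra)) (Inc (V Rq) 1))) Q) s n"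
  proof (rule wp_For[where m = K and I = "\<lambda>j s'. \<forall>x<j. ar s' Cnt x = x"], goal_cases)
    case (5 s')
    have f: "rg s' Rk = K" "ar s' Rnk = rk" "ar s' Tmp = t" using 5(3) by (auto simp: frame_def K_def rk_def t_def)
    show ?case
    proof (rule wp_For[where m = K and I = "\<lambda>j s'. (\<forall>c<K. ar s' Cnt c = c + card {y. y < j \<and> rk (t y) = c}) \<and>
        (\<forall>x<j. ar s' Sa2 (?pos x) = t x)"], goal_cases)
      case 2
      then show ?case using 5(1) by simp
    next
      case (3 j s2 n2)
      have f2: "ar s2 Rnk = rk" "ar s2 Tmp = t" using 3(4) f by (auto simp: frame_def)
      have c: "ar s2 Cnt (rk (t j)) = ?pos j" using 3(3) rkK[OF tK[OF 3(1)]] pos[OF 3(1)] by simp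
      have cnt: "card {y. y < Suc j \<and> rk (t y) = c} = (if c = rk (t j) then Suc (card {y. y < j \<and> rk (t y) = c}) else card {y. y < j \<and> rk (t y) = c})" for c
      proof -
        have "{y. y < Suc j \<and> rk (t y) = c} = (if c = rk (t j) then insert j {y. y < j \<and> rk (t y) = c} else {y. y < j \<and> rk (t y) = c})"
          by (auto simp: less_Suc_eq)
        then show ?thesis by simp
      qed
      have 1: "\<forall>c<K. ((ar s2 Cnt)(rk (t j) := Suc (?pos j))) c = c + card {y. y < Suc j \<and> rk (t y) = c}"
        using 3(3) pos[OF 3(1)] by (simp add: cnt)
      have 2: "\<forall>x<Suc j. ((ar s2 Sa2)(?pos j := t j)) (?pos x) = t x"
        using 3(3) pos_inj[OF _ 3(1)] by (auto simp: less_Suc_eq)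
      show ?case using 3(2) f2 c 1 2 by simp
    next
      case (5 s2)
      have "frame bucket_sort s s2" using 5(3) \<open>frame _ s s'\<close> by (auto simp: frame_def bucket_sort_def)
      then show ?case using Q[of s2] 5(1) n by simp
    qed (use f n in \<open>auto simp: frame_def\<close>)
  qed (use n in \<open>auto simp: frame_def K_def less_Suc_eq\<close>)
  then show ?thesis unfolding bucket_sort_def by simp
qed

definition rerank :: hcom where
  "rerank = For Rx (V Rk) (Ra ::= Arr Sa2 (V Rx) ;; Put Rnk2 (V Ra) (V Rx) ;;
     When (Lt (Lit 0) (V Rx)) (Rq ::= Arr Sa2 (Minus (V Rx) (Lit 1)) ;;
       When (And (Eq (Arr Rnk (V Ra)) (Arr Rnk (V Rq)))
              (Eq (Arr Rnk (Plus (V Ra) (V Rh))) (Arr Rnk (Plus (V Rq) (V Rh)))))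
         (Put Rnk2 (V Ra) (Arr Rnk2 (V Rq)))))"

definition rerank_inv :: "nat \<Rightarrow> (nat \<Rightarrow> nat) \<Rightarrow> (nat \<Rightarrow> nat) \<Rightarrow> nat \<Rightarrow> (nat \<Rightarrow> nat) \<Rightarrow> bool" where
  "rerank_inv h sa2 rk j rk2 \<longleftrightarrow> (\<forall>x<j. rk2 (sa2 x) =
     (if 0 < x \<and> rk (sa2 x) = rk (sa2 (x - 1)) \<and> rk (sa2 x + h) = rk (sa2 (x - 1) + h) then rk2 (sa2 (x - 1)) else x))"

lemma wp_rerank:
  fixes s :: "'a::linorder hstate"
  defines "K \<equiv> rg s Rk" and "h \<equiv> rg s Rh"
  assumes perm: "ar s Sa2 ` {..<K} = {..<K}" and K: "h < K" "K \<le> size_of s" and n: "K \<le> n"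
    and Q: "\<And>s'. rerank_inv h (ar s Sa2) (ar s Rnk) K (ar s' Rnk2) \<Longrightarrow> frame rerank s s' \<Longrightarrow> Q s' (n - K)"
  shows "wp rerank Q s n"
  unfolding rerank_def
proof (rule wp_For[where m = K and I = "\<lambda>j s'. rerank_inv h (ar s Sa2) (ar s Rnk) j (ar s' Rnk2)"], goal_cases)
  case (3 j s' n')
  let ?sa2 = "ar s Sa2" and ?rk = "ar s Rnk" and ?a = "ar s Sa2 j"
  have f: "ar s' Sa2 = ?sa2" "ar s' Rnk = ?rk" "rg s' Rh = h" "size_of s' = size_of s" using 3(4) by (auto simp: frame_def h_def)
  have inj: "inj_on ?sa2 {..<K}" using perm by (simp add: eq_card_imp_inj_on)
  have ne: "?sa2 x \<noteq> ?a" if "x < j" for x using inj that 3(1) by (auto simp: inj_on_def)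
  have lt: "?sa2 x < K" if "x < K" for x
  proof -
    have "?sa2 x \<in> ?sa2 ` {..<K}" using that by simp
    then show ?thesis unfolding perm by simp
  qed
  have step: "rerank_inv h ?sa2 ?rk (Suc j) ((ar s' Rnk2)(?a := v))"
    if v: "v = (if 0 < j \<and> ?rk ?a = ?rk (?sa2 (j - 1)) \<and> ?rk (?a + h) = ?rk (?sa2 (j - 1) + h) then ar s' Rnk2 (?sa2 (j - 1)) else j)" for v
    unfolding rerank_inv_def
  proof (intro allI impI)
    fix x assume x: "x < Suc j"
    show "((ar s' Rnk2)(?a := v)) (?sa2 x) = (if 0 < x \<and> ?rk (?sa2 x) = ?rk (?sa2 (x - 1)) \<and> ?rk (?sa2 x + h) = ?rk (?sa2 (x - 1) + h) then ((ar s' Rnk2)(?a := v)) (?sa2 (x - 1)) else x)"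
    proof (cases "x = j")
      case True
      have "0 < j \<Longrightarrow> ?sa2 (j - 1) \<noteq> ?a" by (rule ne) simp
      then show ?thesis using True v by auto
    next
      case False
      then have xj: "x < j" using x by simp
      moreover have "?sa2 (x - 1) \<noteq> ?a" by (rule ne) (use xj in simp)
      ultimately show ?thesis using 3(3)[unfolded rerank_inv_def, rule_format, OF xj] ne[OF xj] by simp
    qed
  qed
  have bnd: "?a + h \<le> 4 * size_of s + 8" "?sa2 (j - 1) + h \<le> 4 * size_of s + 8"
    using lt[OF 3(1)] lt[of "j - 1", OF less_imp_diff_less[OF 3(1)]] K by linarith+
  have ne1: "0 < j \<Longrightarrow> ?sa2 (j - 1) \<noteq> ?a" by (rule ne) simp
  show ?case
  proof (cases "0 < j \<and> ?rk ?a = ?rk (?sa2 (j - 1)) \<and> ?rk (?a + h) = ?rk (?sa2 (j - 1) + h)")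
    case True
    then show ?thesis using 3(2) f bnd ne1 step[of "ar s' Rnk2 (?sa2 (j - 1))"] by simp
  next
    case False
    then show ?thesis using 3(2) f bnd step[of j] by auto
  qed
next
  case (5 s')
  then show ?case using Q[of s'] by (simp add: rerank_def)
qed (use n in \<open>auto simp: frame_def K_def rerank_inv_def\<close>)

definition copy_ranks :: hcom where
  "copy_ranks = For Rx (V Rk) (Put Sa (V Rx) (Arr Sa2 (V Rx)) ;; Put Rnk (V Rx) (Arr Rnk2 (V Rx)))"

lemma wp_copy_ranks:
  fixes s :: "'a::linorder hstate"
  defines "K \<equiv> rg s Rk"
  assumes n: "K \<le> n"
    and Q: "\<And>s'. \<forall>x<K. ar s' Sa x = ar s Sa2 x \<and> ar s' Rnk x = ar s Rnk2 x \<Longrightarrow> frame copy_ranks s s' \<Longrightarrow> Q s' (n - K)"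
  shows "wp copy_ranks Q s n"
  unfolding copy_ranks_def
proof (rule wp_For[where m = K and I = "\<lambda>j s'. \<forall>x<j. ar s' Sa x = ar s Sa2 x \<and> ar s' Rnk x = ar s Rnk2 x"], goal_cases)
  case (3 j s' n')
  have "ar s' Sa2 = ar s Sa2" "ar s' Rnk2 = ar s Rnk2" using 3(4) by (auto simp: frame_def)
  then show ?case using 3(1-3) by (auto simp: less_Suc_eq)
next
  case (5 s')
  then show ?case using Q[of s'] by (simp add: copy_ranks_def)
qed (use n in \<open>auto simp: frame_def K_def\<close>)

definition double :: hcom where
  "double = (Rh ::= Lit 1 ;; Loop (Lt (V Rh) (V Rk))
     (order_by_second ;; bucket_sort ;; rerank ;; copy_ranks ;; Rh ::= Plus (V Rh) (V Rh)))"

lemma doubling_inv_cong: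
  assumes "\<forall>x<K. sa' x = sa x \<and> rk' x = rk x" "doubling_inv K lt h sa rk"
  shows "doubling_inv K lt h sa' rk'"
proof -
  have fi: "first_index_ranks K sa rk" using assms(2) by (simp add: doubling_inv_def)
  have sa: "sa ` {..<K} = {..<K}" using fi by (simp add: first_index_ranks_def)
  have lt: "sa x < K" if "x < K" for x
  proof -
    have "sa x \<in> sa ` {..<K}" using that by simp
    then show ?thesis unfolding sa by simp
  qed
  have e: "sa' x = sa x" "rk' x = rk x" if "x < K" for x using assms(1) that by auto
  have "first_index_ranks K sa' rk'"
    unfolding first_index_ranks_def
  proof (intro conjI allI impI)
    have "sa' ` {..<K} = sa ` {..<K}" using e by (intro image_cong) auto
    then show "sa' ` {..<K} = {..<K}" unfolding sa .
    fix x assume x: "x < K"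
    then have "rk (sa x) = x \<or> 0 < x \<and> rk (sa x) = rk (sa (x - 1))" using fi by (simp add: first_index_ranks_def)
    then show "rk' (sa' x) = x \<or> 0 < x \<and> rk' (sa' x) = rk' (sa' (x - 1))"
      using x e(1)[of x] e(1)[of "x - 1"] e(2)[OF lt, of x] e(2)[OF lt, of "x - 1"] by simp
  qed
  then show ?thesis using assms(2) e(2) unfolding doubling_inv_def by simp
qed

text \<open>Two units per target for each of \<open>order_by_second\<close> and
  \<open>bucket_sort\<close>, one for each of \<open>rerank\<close> and
  \<open>copy_ranks\<close>.\<close>

lemma wp_double_round:
  fixes s :: "'a::linorder hstate"
  assumes inv: "doubling_inv K lt h (ar s Sa) (ar s Rnk)" and regs: "rg s Rk = K" "rg s Rh = h"
    and h: "h < K" and K: "K \<le> size_of s" and n: "6 * K \<le> n"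
  shows "wp (order_by_second ;; bucket_sort ;; rerank ;; copy_ranks ;; Rh ::= Plus (V Rh) (V Rh))
    (\<lambda>s' n'. doubling_inv K lt (h + h) (ar s' Sa) (ar s' Rnk) \<and> rg s' Rh = h + h \<and> n \<le> n' + 6 * K) s n"
proof -
  let ?sa = "ar s Sa" and ?rk = "ar s Rnk"
  have fi: "first_index_ranks K ?sa ?rk" using inv by (simp add: doubling_inv_def)
  have e: "rg s Rk = K" "rg s Rh = h" using regs by auto
  show ?thesis unfolding wp_Then
  proof (rule wp_order_by_second, goal_cases)
    case 1
    then show ?case using h e by simp
  next
    case 2
    then show ?case using K e by simp
  next
    case 3
    then show ?case using fi e by simp
  next
    case 4
    then show ?case using n e by simp
  next
    case (5 s1 n1)
    let ?t = "ar s1 Tmp"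
    have f1: "rg s1 Rk = K" "rg s1 Rh = h" "ar s1 Sa = ?sa" "ar s1 Rnk = ?rk" "size_of s1 = size_of s"
      using 5(4) e by (auto simp: frame_def order_by_second_def)
    have perm: "?t ` {..<K} = {..<K}" using 5(1) e by simp
    have mono: "x < y \<Longrightarrow> y < K \<Longrightarrow> second_key K h ?rk (?t x) \<le> second_key K h ?rk (?t y)" for x y using 5(2) e by simp
    have n1: "n \<le> n1 + 2 * K" using 5(3) e by simp
    show ?case
    proof (rule wp_bucket_sort, goal_cases)
      case 1
      then show ?case using fi f1 by simp
    next
      case 2
      then show ?case using perm f1 by simp
    next
      case 3
      then show ?case using n n1 f1 by simp
    next
      case (4 s2 n2)
      let ?f = "\<lambda>x. (?rk (?t x), x)"
      let ?pos = "position K ?f" and ?sa2 = "ar s2 Sa2"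
      have f2: "rg s2 Rk = K" "rg s2 Rh = h" "ar s2 Sa = ?sa" "ar s2 Rnk = ?rk" "size_of s2 = size_of s"
        using 4(3) f1 by (auto simp: frame_def bucket_sort_def)
      have at: "?sa2 (?pos x) = ?t x" if "x < K" for x using 4(1) f1 that by simp
      have n2: "n1 \<le> n2 + 2 * K" using 4(2) f1 by simp
      have injf: "inj_on ?f {..<K}" by (auto simp: inj_on_def)
      note pim = position_image[OF injf]
      have perm2: "?sa2 ` {..<K} = {..<K}"
      proof -
        have "?sa2 ` {..<K} = ?sa2 ` ?pos ` {..<K}" using pim(1) by simp
        also have "\<dots> = ?t ` {..<K}" unfolding image_image using at by (intro image_cong) auto
        finally show ?thesis using perm by simp
      qed
      have srt2: "(?rk (?sa2 (x - 1)), second_key K h ?rk (?sa2 (x - 1))) \<le> (?rk (?sa2 x), second_key K h ?rk (?sa2 x))"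
        if x: "0 < x" "x < K" for x
      proof -
        have "x \<in> ?pos ` {..<K}" "x - 1 \<in> ?pos ` {..<K}" unfolding pim(1) using x by auto
        then obtain p q where pq: "p < K" "q < K" "x = ?pos p" "x - 1 = ?pos q" by blast
        have "?f q < ?f p"
        proof (rule ccontr)
          assume "\<not> ?f q < ?f p"
          then have "p = q \<or> ?f p < ?f q" by auto
          then show False using position_less[of p K ?f q] pq x by auto
        qed
        then have "?rk (?t q) < ?rk (?t p) \<or> ?rk (?t q) = ?rk (?t p) \<and> q < p" by auto
        then show ?thesis using at[OF pq(1)] at[OF pq(2)] mono[of q p] pq by auto
      qed
      show ?case
      proof (rule wp_rerank, goal_cases)
        case 1
        then show ?case using perm2 f2 by simp
      next
        case 2
        then show ?case using h f2 by simp
      next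
        case 3
        then show ?case using K f2 by simp
      next
        case 4
        then show ?case using n n1 n2 f2 by simp
      next
        case (5 s3)
        have f3: "rg s3 Rk = K" "rg s3 Rh = h" "ar s3 Sa2 = ?sa2" "size_of s3 = size_of s"
          using 5(2) f2 by (auto simp: frame_def rerank_def)
        have inv3: "doubling_inv K lt (h + h) ?sa2 (ar s3 Rnk2)"
          by (rule doubling_step[OF inv perm2 srt2]) (use 5(1) f2 in \<open>simp_all add: rerank_inv_def\<close>)
        show ?case
        proof (rule wp_copy_ranks, goal_cases)
          case 1
          then show ?case using n n1 n2 f2 f3 by simp
        next
          case (2 s4)
          have f4: "rg s4 Rh = h" "size_of s4 = size_of s" using 2(2) f3 by (auto simp: frame_def copy_ranks_def)
          have "doubling_inv K lt (h + h) (ar s4 Sa) (ar s4 Rnk)"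
            by (rule doubling_inv_cong[OF _ inv3]) (use 2(1) f3 in simp)
          then show ?case using f2 f3 f4 n n1 n2 h K by simp
        qed
      qed
    qed
  qed
qed

text \<open>Once \<open>h\<close> reaches \<open>K\<close>, equal ranks of different targets would
  need a target \<open>h\<close> further on, which does not exist; so the ranks are distinct and
  give the order.\<close>

lemma wp_double:
  fixes s :: "'a::linorder hstate"
  assumes inv: "doubling_inv K lt 1 (ar s Sa) (ar s Rnk)" and regs: "rg s Rk = K"
    and K: "K \<le> size_of s" "K \<le> 2 ^ L" and n: "(6 * K + 1) * L \<le> n"
  shows "wp double (\<lambda>s' n'. ar s' Sa ` {..<K} = {..<K} \<and> (\<forall>x<K. ar s' Rnk (ar s' Sa x) = x) \<and>
     (\<forall>x y. x < y \<longrightarrow> y < K \<longrightarrow> lt (ar s' Sa x) (ar s' Sa y)) \<and> n \<le> n' + (6 * K + 1) * L) s n"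
proof -
  have "wp (Loop (Lt (V Rh) (V Rk)) (order_by_second ;; bucket_sort ;; rerank ;; copy_ranks ;; Rh ::= Plus (V Rh) (V Rh)))
    (\<lambda>s' n'. ar s' Sa ` {..<K} = {..<K} \<and> (\<forall>x<K. ar s' Rnk (ar s' Sa x) = x) \<and>
     (\<forall>x y. x < y \<longrightarrow> y < K \<longrightarrow> lt (ar s' Sa x) (ar s' Sa y)) \<and> n \<le> n' + (6 * K + 1) * L) (s\<lparr>rg := (rg s)(Rh := 1)\<rparr>) n"
  proof (rule wp_Loop[where I = "\<lambda>s' n'. \<exists>j\<le>L. rg s' Rh = 2 ^ j \<and> doubling_inv K lt (2 ^ j) (ar s' Sa) (ar s' Rnk) \<and>
      n \<le> n' + (6 * K + 1) * j"], goal_cases)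
    case 1
    show ?case using inv by (intro exI[of _ 0]) simp
  next
    case (2 s' n')
    from 2(1) obtain j where j: "j \<le> L" "rg s' Rh = 2 ^ j" "doubling_inv K lt (2 ^ j) (ar s' Sa) (ar s' Rnk)"
      "n \<le> n' + (6 * K + 1) * j" by blast
    have f: "rg s' Rk = K" "size_of s' = size_of s"
      using 2(2) regs by (auto simp: frame_def order_by_second_def bucket_sort_def rerank_def copy_ranks_def)
    let ?sa = "ar s' Sa" and ?rk = "ar s' Rnk"
    have fi: "first_index_ranks K ?sa ?rk" and R1: "\<And>j k. j < K \<Longrightarrow> k < K \<Longrightarrow> ?rk j < ?rk k \<Longrightarrow> lt j k"
      using j(3) by (auto simp: doubling_inv_def)
    have sa: "?sa ` {..<K} = {..<K}" using fi by (simp add: first_index_ranks_def)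
    have saK: "?sa x < K" if "x < K" for x
    proof -
      have "?sa x \<in> ?sa ` {..<K}" using that by simp
      then show ?thesis unfolding sa by simp
    qed
    have inj: "inj_on ?sa {..<K}" using sa by (simp add: eq_card_imp_inj_on)
    show ?case
    proof (cases "2 ^ j < K")
      case False
      have R2: "a = b" if "a < K" "b < K" "?rk a = ?rk b" for a b
      proof (rule ccontr)
        assume "a \<noteq> b"
        then have "a + 2 ^ j < K" using j(3) that unfolding doubling_inv_def by blast
        then show False using False by simp
      qed
      have rk: "?rk (?sa x) = x" if x: "x < K" for x
      proof (rule ccontr)
        assume "?rk (?sa x) \<noteq> x"
        then have *: "0 < x" "?rk (?sa x) = ?rk (?sa (x - 1))" using fi x by (auto simp: first_index_ranks_def)
        have "?sa x = ?sa (x - 1)" by (rule R2[OF saK[OF x] saK *(2)]) (use x in simp)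
        then have "x = x - 1" using inj x by (auto dest: inj_onD)
        then show False using *(1) by simp
      qed
      have "lt (?sa x) (?sa y)" if "x < y" "y < K" for x y
        using R1[of "?sa x" "?sa y"] rk[of x] rk[of y] saK[of x] saK[of y] that by simp
      moreover have "(6 * K + 1) * j \<le> (6 * K + 1) * L" using j(1) by (rule mult_le_mono2)
      then have "n \<le> n' + (6 * K + 1) * L" using j(4) by linarith
      ultimately show ?thesis using False f j(2) sa rk by simp
    next
      case True
      have "j < L" using True K(2) by (meson less_le_trans nat_power_less_imp_less pos2)
      then have "(6 * K + 1) * Suc j \<le> (6 * K + 1) * L" by (intro mult_le_mono2) simp
      then have c: "6 * K + 1 \<le> n'" using n j(4) by simp
      have "wp (order_by_second ;; bucket_sort ;; rerank ;; copy_ranks ;; Rh ::= Plus (V Rh) (V Rh))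
        (\<lambda>s' n'. \<exists>j\<le>L. rg s' Rh = 2 ^ j \<and> doubling_inv K lt (2 ^ j) (ar s' Sa) (ar s' Rnk) \<and>
        n \<le> n' + (6 * K + 1) * j) s' (n' - 1)"
      proof (rule wp_use[OF wp_double_round[OF j(3) f(1) j(2) True]], goal_cases)
        case 1
        then show ?case using K f by simp
      next
        case 2
        then show ?case using c by simp
      next
        case (3 s2 n2)
        have "2 ^ j + 2 ^ j = (2::nat) ^ Suc j" by simp
        then have "rg s2 Rh = 2 ^ Suc j" "doubling_inv K lt (2 ^ Suc j) (ar s2 Sa) (ar s2 Rnk)" using 3(1) by metis+
        moreover have "(6 * K + 1) * Suc j = (6 * K + 1) * j + (6 * K + 1)" by simp
        then have "n \<le> n2 + (6 * K + 1) * Suc j" using 3(1) j(4) c by linarith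
        ultimately show ?case using \<open>j < L\<close> by (intro exI[of _ "Suc j"]) simp
      qed
      then show ?thesis using True f j(2) c by simp
    qed
  qed
  then show ?thesis unfolding double_def by simp
qed

section \<open>Common prefixes and output\<close>

definition ranked_state :: "'a::linorder list \<Rightarrow> nat \<Rightarrow> nat \<Rightarrow> 'a hstate \<Rightarrow> bool" where
  "ranked_state T i K s \<longleftrightarrow> target_state T i K s \<and> rg s Rflat = 0 \<and>
     (\<forall>x<K. ar s Sa x < K \<and> ar s Rnk (ar s Sa x) = x \<and> ar s Tg (ar s Sa x) = suffix_of_rank T (i + x)) \<and>
     (\<forall>j<K. ar s Rnk j < K \<and> ar s Sa (ar s Rnk j) = j)"

text \<open>A strictly increasing map of \<open>K\<close> indices into \<open>K\<close> consecutive
  numbers leaves no slack. It turns the relative order of the targets into their exact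
  ranks.\<close>

lemma strict_mono_interval:
  fixes g :: "nat \<Rightarrow> nat"
  assumes mono: "\<And>x y. x < y \<Longrightarrow> y < K \<Longrightarrow> g x < g y" and rng: "\<And>x. x < K \<Longrightarrow> a \<le> g x \<and> g x < a + K" and x: "x < K"
  shows "g x = a + x"
proof -
  have 1: "x < K \<Longrightarrow> a + x \<le> g x" for x
  proof (induction x)
    case 0
    then show ?case using rng by simp
  next
    case (Suc x)
    then show ?case using mono[of x "Suc x"] by simp
  qed
  have 2: "x + d < K \<Longrightarrow> g x + d \<le> g (x + d)" for d
  proof (induction d)
    case (Suc d)
    then show ?case using mono[of "x + d" "x + Suc d"] by simp
  qed simp
  have "g x + (K - 1 - x) \<le> g (x + (K - 1 - x))" by (rule 2) (use x in simp)
  also have "\<dots> < a + K" using rng[of "x + (K - 1 - x)"] x by simp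
  finally show ?thesis using 1[OF x] x by simp
qed

lemma ranked_stateI:
  assumes ts: "target_state T i K s" and flat: "rg s Rflat = 0" and i: "1 \<le> i"
    and sa: "ar s Sa ` {..<K} = {..<K}" and rk: "\<forall>x<K. ar s Rnk (ar s Sa x) = x"
    and lt: "\<forall>x y. x < y \<longrightarrow> y < K \<longrightarrow> target_less T (ar s Tg) (ar s Sa x) (ar s Sa y)"
  shows "ranked_state T i K s"
proof -
  have saK: "ar s Sa x < K" if "x < K" for x
  proof -
    have "ar s Sa x \<in> ar s Sa ` {..<K}" using that by simp
    then show ?thesis unfolding sa by simp
  qed
  let ?f = "\<lambda>x. ar s Tg (ar s Sa x)"
  have f: "?f x \<in> targets T i K" if "x < K" for x by (rule tg_target[OF ts flat saK[OF that]])
  have "card (below T (?f x)) = (i - 1) + x" if x: "x < K" for x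
  proof (rule strict_mono_interval[where g = "\<lambda>x. card (below T (?f x))", OF _ _ x])
    fix x y :: nat assume xy: "x < y" "y < K"
    then have "text_suffix T (?f x) < text_suffix T (?f y)" using lt by (simp add: target_less_def)
    then show "card (below T (?f x)) < card (below T (?f y))"
      by (rule below_mono[rotated]) (use f[of x] xy in \<open>simp add: targets_def\<close>)
  next
    fix x assume "x < K"
    then show "i - 1 \<le> card (below T (?f x)) \<and> card (below T (?f x)) < i - 1 + K" using f[of x] i by (auto simp: targets_def)
  qed
  then have "?f x = suffix_of_rank T (i + x)" if "x < K" for x
    using suffix_of_rank_eqI[of "?f x" T "i - 1 + x"] f[OF that] that i by (simp add: targets_def)
  moreover have "ar s Rnk j < K \<and> ar s Sa (ar s Rnk j) = j" if "j < K" for j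
  proof -
    have "j \<in> ar s Sa ` {..<K}" unfolding sa using that by simp
    then obtain x where "x < K" "j = ar s Sa x" by blast
    then show ?thesis using rk by simp
  qed
  ultimately show ?thesis using ts flat saK rk by (simp add: ranked_state_def)
qed

section \<open>Common prefixes by Kasai's amortisation over the targets\<close>

lemma take_le_take:
  fixes xs ys :: "'b::linorder list"
  shows "xs \<le> ys \<Longrightarrow> take l xs \<le> take l ys"
proof (induction l arbitrary: xs ys)
  case (Suc l)
  show ?case
  proof (cases xs)
    case (Cons x xs')
    then obtain y ys' where ys: "ys = y # ys'" using Suc.prems by (cases ys) auto
    show ?thesis
    proof (cases "x < y")
      case False
      then have "x = y" "xs' \<le> ys'" using Suc.prems Cons ys by (auto simp: list_le_def)
      then show ?thesis using Suc.IH[of xs' ys'] Cons ys by (auto simp: list_le_def)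
    qed (use Cons ys in \<open>auto simp: list_le_def\<close>)
  qed simp
qed simp

definition agree :: "'a list \<Rightarrow> nat \<Rightarrow> nat \<Rightarrow> nat \<Rightarrow> bool" where
  "agree T l p q \<longleftrightarrow> p + l \<le> Suc (length T) \<and> q + l \<le> Suc (length T) \<and>
     (\<forall>d<l. text_symbol T (p + d) = text_symbol T (q + d))"

lemma nth_text_suffix: "1 \<le> p \<Longrightarrow> p + d \<le> length T \<Longrightarrow> text_suffix T p ! d = text_symbol T (p + d)"
  by (simp add: text_suffix_def text_symbol_def)

lemma agree_iff_take:
  assumes "1 \<le> p" "p \<le> Suc (length T)" "1 \<le> q" "q + l \<le> Suc (length T)"
  shows "agree T l p q \<longleftrightarrow> take l (text_suffix T p) = take l (text_suffix T q)"
proof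
  assume a: "agree T l p q"
  show "take l (text_suffix T p) = take l (text_suffix T q)"
  proof (rule nth_equalityI)
    show "length (take l (text_suffix T p)) = length (take l (text_suffix T q))"
      using a assms by (auto simp: agree_def text_suffix_def)
  next
    fix d assume "d < length (take l (text_suffix T p))"
    then have "d < l" by simp
    then show "take l (text_suffix T p) ! d = take l (text_suffix T q) ! d"
      using a assms by (simp add: agree_def nth_text_suffix)
  qed
next
  assume e: "take l (text_suffix T p) = take l (text_suffix T q)"
  then have "length (take l (text_suffix T p)) = length (take l (text_suffix T q))" by simp
  then have p: "p + l \<le> Suc (length T)" using assms by (auto simp: text_suffix_def min_def split: if_splits)
  have "text_symbol T (p + d) = text_symbol T (q + d)" if "d < l" for d
    using arg_cong[OF e, of "\<lambda>xs. xs ! d"] that p assms by (simp add: nth_text_suffix)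
  then show "agree T l p q" using p assms by (simp add: agree_def)
qed

text \<open>Kasai's invariant: some smaller suffix, not necessarily a target, shares \<open>l\<close> symbols with the one
  at \<open>a\<close>. As the targets have consecutive ranks, the preceding target then shares them too.\<close>

definition carry :: "'a::linorder list \<Rightarrow> nat \<Rightarrow> nat \<Rightarrow> bool" where
  "carry T a l \<longleftrightarrow> a + l \<le> Suc (length T) \<and>
     (l = 0 \<or> (\<exists>q\<in>{1..length T}. text_suffix T q < text_suffix T a \<and> agree T l q a))"

text \<open>Move both suffixes ahead by the distance to the next target: the skipped symbols are
  shared, so the smaller suffix remains smaller and the rest of the agreement survives. Its new
  start need not be a target.\<close>

lemma carry_shift:
  assumes "carry T a l" "1 \<le> a" "a < a'" "a' \<le> Suc (length T)"
  shows "carry T a' (l - (a' - a))"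
proof (cases "l \<le> a' - a")
  case True
  then show ?thesis using assms by (simp add: carry_def)
next
  case False
  define e where "e = a' - a"
  have a': "a' = a + e" "e < l" using assms(3) False by (auto simp: e_def)
  obtain q where q: "q \<in> {1..length T}" "text_suffix T q < text_suffix T a" "agree T l q a"
    using assms(1) False by (auto simp: carry_def)
  have "text_suffix T (q + e) < text_suffix T (a + e)"
    using q a' assms(2) text_suffix_strip[where T = T and l = e and p = q and q = a] by (auto simp: agree_def)
  moreover have "agree T (l - e) (q + e) (a + e)"
    using q(3) a' unfolding agree_def by (auto simp: add.assoc)
  moreover have "q + e \<in> {1..length T}" using q a' by (auto simp: agree_def)
  ultimately show ?thesis using assms(1) a' unfolding carry_def e_def[symmetric] by auto
qed

text \<open>The predecessor \<open>u\<close> of \<open>a\<close> lies between the witness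
  \<open>q\<close> and \<open>a\<close> in the suffix order. Truncation to \<open>l\<close> symbols
  is monotone, and \<open>q\<close> and \<open>a\<close> have the same truncation, so that of
  \<open>u\<close> is squeezed between equal lists.\<close>

lemma carry_agree:
  assumes c: "carry T a l" and ua: "u \<in> {1..length T}" "a \<in> {1..length T}"
    and succ: "card (below T a) = Suc (card (below T u))"
  shows "agree T l u a"
proof (cases "l = 0")
  case True
  then show ?thesis using ua by (simp add: agree_def)
next
  case False
  then obtain q where q: "q \<in> {1..length T}" "text_suffix T q < text_suffix T a" "agree T l q a"
    using c by (auto simp: carry_def)
  have "card (below T q) \<le> card (below T u)" using below_mono[OF q(1,2)] succ by simp
  then have qu: "text_suffix T q \<le> text_suffix T u"
    using suffix_less_iff_below[OF ua(1) q(1)] by (simp add: not_less[symmetric])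
  have "text_suffix T u < text_suffix T a" using suffix_less_iff_below[OF ua] succ by simp
  then have "take l (text_suffix T u) \<le> take l (text_suffix T a)" by (intro take_le_take) simp
  moreover have al: "a + l \<le> Suc (length T)" using c by (simp add: carry_def)
  have "take l (text_suffix T q) = take l (text_suffix T a)"
    using agree_iff_take[of q T a l] q al ua by simp
  then have "take l (text_suffix T a) \<le> take l (text_suffix T u)" using take_le_take[OF qu, of l] by simp
  ultimately have "take l (text_suffix T u) = take l (text_suffix T a)" by (rule antisym)
  then show ?thesis using agree_iff_take[of u T a l] al ua by simp
qed

definition scan_prefix :: hcom where
  "scan_prefix = Loop (And (Not (SymLt (Plus (V Ru) (V Rl)) (Plus (V Rv) (V Rl))))
      (Not (SymLt (Plus (V Rv) (V Rl)) (Plus (V Ru) (V Rl))))) (Rl ::= Inc (V Rl) 1)"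

lemma wp_scan_prefix:
  fixes s :: "'a::linorder hstate"
  assumes hold: "holds_text T s" and uv: "rg s Ru = u" "rg s Rv = v" "u \<in> {1..length T}" "v \<in> {1..length T}" "u \<noteq> v"
    and a: "agree T (rg s Rl) u v" and n: "Suc (length T) \<le> n + rg s Rl + v"
  shows "wp scan_prefix (\<lambda>s' n'. rg s Rl \<le> rg s' Rl \<and> agree T (rg s' Rl) u v \<and> rg s' Rl = lcp T u v \<and>
    n' + rg s' Rl = n + rg s Rl) s n"
  unfolding scan_prefix_def
proof (rule wp_Loop[where I = "\<lambda>s' n'. rg s Rl \<le> rg s' Rl \<and> agree T (rg s' Rl) u v \<and> n' + rg s' Rl = n + rg s Rl"], goal_cases)
  case 1
  then show ?case using a by simp
next
  case (2 s' n')
  let ?N = "length T"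
  define l where "l = rg s' Rl"
  have I: "rg s Rl \<le> l" "agree T l u v" "n' + l = n + rg s Rl" using 2(1) by (auto simp: l_def)
  have T: "endmarked T" and N: "size_of s = ?N" and sym: "\<And>j. j \<in> {1..?N} \<Longrightarrow> sy s j = text_symbol T j"
    using hold by (auto simp: holds_text_def)
  have f: "rg s' Ru = u" "rg s' Rv = v" "sy s' = sy s" "size_of s' = ?N" using 2(2) uv N by (auto simp: frame_def)
  have inside: "u + l \<le> ?N" "v + l \<le> ?N"
    using agree_inside[OF T uv(3,4,5), of l] I(2) by (auto simp: agree_def)
  have sy: "sy s (u + l) = text_symbol T (u + l)" "sy s (v + l) = text_symbol T (v + l)"
    using sym inside uv by auto
  show ?case
  proof (cases "text_symbol T (u + l) = text_symbol T (v + l)")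
    case True
    then have "agree T (Suc l) u v" using I(2) inside by (auto simp: agree_def less_Suc_eq)
    moreover have "0 < n'" using I(3) n inside by linarith
    ultimately show ?thesis using True I f sy inside l_def by auto
  next
    case False
    have "lcp T u v = l" unfolding lcp_def
    proof (rule Least_equality)
      show "text_symbol T (u + l) \<noteq> text_symbol T (v + l)" by (rule False)
      fix y assume "text_symbol T (u + y) \<noteq> text_symbol T (v + y)"
      then show "l \<le> y" using I(2) by (auto simp: agree_def not_less[symmetric])
    qed
    moreover have "text_symbol T (u + l) < text_symbol T (v + l) \<or> text_symbol T (v + l) < text_symbol T (u + l)"
      using False by (metis neqE)
    ultimately show ?thesis using I f sy inside unfolding l_def by auto
  qed
qed

definition compute_lcps :: hcom where
  "compute_lcps = (Rl ::= Lit 0 ;; Ry ::= Lit 0 ;; Loop (Lt (V Ry) (V Rk))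
     (When (Lt (Lit 0) (Arr Rnk (V Ry)))
        (Rv ::= Arr Tg (V Ry) ;; Ru ::= Arr Tg (Arr Sa (Minus (Arr Rnk (V Ry)) (Lit 1))) ;; scan_prefix ;;
         Put Out (Minus (Plus (V Rk) (Arr Rnk (V Ry))) (Lit 1)) (V Rl)) ;;
      Rl ::= Minus (V Rl) (Minus (Arr Tg (Inc (V Ry) 1)) (Arr Tg (V Ry))) ;; Ry ::= Inc (V Ry) 1))"

definition lcps_inv :: "'a::linorder list \<Rightarrow> nat \<Rightarrow> nat \<Rightarrow> (nat \<Rightarrow> nat) \<Rightarrow> nat \<Rightarrow> (nat \<Rightarrow> nat) \<Rightarrow> bool" where
  "lcps_inv T i K rk j out \<longleftrightarrow> (\<forall>k<j. 0 < rk k \<longrightarrow>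
     out (K + rk k - 1) = lcp T (suffix_of_rank T (i + rk k - 1)) (suffix_of_rank T (i + rk k)))"

text \<open>The sum of the current target position and the carried length never decreases: the
  length is reduced by at most the distance moved, and each scan step raises it. It is bounded by
  \<open>Suc (length T)\<close>, so all scans together cost at most that, plus one credit per
  target.\<close>

lemma wp_compute_lcps:
  fixes s :: "'a::linorder hstate"
  assumes rs: "ranked_state T i K s" and iK: "1 \<le> i" "i + K \<le> Suc (length T)" and K: "K \<le> length T"
    and n: "2 * length T + K + 2 \<le> n"
  shows "wp compute_lcps (\<lambda>s' n'. (\<forall>x<K - 1. ar s' Out (K + x) =
      lcp T (suffix_of_rank T (i + x)) (suffix_of_rank T (i + x + 1))) \<and> n \<le> n' + length T + K + 1) s n"
proof -
  let ?N = "length T" and ?tg = "ar s Tg" and ?rk = "ar s Rnk"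
  have ts: "target_state T i K s" and flat: "rg s Rflat = 0"
    and sa: "\<And>x. x < K \<Longrightarrow> ar s Sa x < K \<and> ?rk (ar s Sa x) = x \<and> ?tg (ar s Sa x) = suffix_of_rank T (i + x)"
    and rk: "\<And>j. j < K \<Longrightarrow> ?rk j < K \<and> ar s Sa (?rk j) = j" using rs by (auto simp: ranked_state_def)
  have hold: "holds_text T s" and Rk: "rg s Rk = K" and tgK: "?tg K = Suc ?N" using ts by (auto simp: target_state_def)
  have N: "size_of s = ?N" using hold by (simp add: holds_text_def)
  have tg_at: "?tg j = suffix_of_rank T (i + ?rk j)" if "j < K" for j using sa[of "?rk j"] rk[OF that] by metis
  have rank: "card (below T (suffix_of_rank T (i + x))) = i + x - 1" "suffix_of_rank T (i + x) \<in> {1..?N}" if "x < K" for x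
    using suffix_of_rank[of "i + x" T] iK that by auto
  have tgN: "?tg j \<in> {1..?N}" if "j < K" for j by (rule tg_range[OF ts flat that])
  have tgS: "?tg j < ?tg (Suc j)" "?tg (Suc j) \<le> Suc ?N" if "j < K" for j
    using tg_less[OF ts flat, of j "Suc j"] tg_bound[OF ts flat, of "Suc j"] that by auto
  let ?Q = "\<lambda>s' n'. (\<forall>x<K - 1. ar s' Out (K + x) =
      lcp T (suffix_of_rank T (i + x)) (suffix_of_rank T (i + x + 1))) \<and> n \<le> n' + length T + K + 1"
  let ?step = "Rl ::= Minus (V Rl) (Minus (Arr Tg (Inc (V Ry) 1)) (Arr Tg (V Ry))) ;; Ry ::= Inc (V Ry) 1"
  let ?I = "\<lambda>s' n'. \<exists>j\<le>K. rg s' Ry = j \<and> carry T (?tg j) (rg s' Rl) \<and> lcps_inv T i K ?rk j (ar s' Out) \<and>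
      n \<le> n' + j + ?tg j + rg s' Rl"
  let ?s = "s\<lparr>rg := (rg s)(Rl := 0, Ry := 0)\<rparr>"
  have "wp (Loop (Lt (V Ry) (V Rk))
     (When (Lt (Lit 0) (Arr Rnk (V Ry)))
        (Rv ::= Arr Tg (V Ry) ;; Ru ::= Arr Tg (Arr Sa (Minus (Arr Rnk (V Ry)) (Lit 1))) ;; scan_prefix ;;
         Put Out (Minus (Plus (V Rk) (Arr Rnk (V Ry))) (Lit 1)) (V Rl)) ;; ?step)) ?Q ?s n"
  proof (rule wp_Loop[where I = ?I], goal_cases)
    case 1
    have "?tg 0 \<le> Suc ?N" using tg_bound[OF ts flat, of 0] by simp
    then show ?case by (intro exI[of _ 0]) (simp add: carry_def lcps_inv_def)
  next
    case (2 s' n')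
    from 2(1) obtain j where j: "j \<le> K" "rg s' Ry = j" "carry T (?tg j) (rg s' Rl)" "lcps_inv T i K ?rk j (ar s' Out)"
      "n \<le> n' + j + ?tg j + rg s' Rl" by blast
    have f: "rg s' Rk = K" "ar s' Rnk = ?rk" "ar s' Sa = ar s Sa" "ar s' Tg = ?tg" "sy s' = sy s" "size_of s' = ?N"
      using 2(2) N Rk by (auto simp: frame_def scan_prefix_def)
    have cl: "?tg j + rg s' Rl \<le> Suc ?N" using j(3) by (simp add: carry_def)
    \<comment> \<open>The premise grants one more \<open>length T\<close> than is consumed in total,
      because the rule for a single scan asks for a budget reaching the end of the text.\<close>
    have n': "?N + Suc (K - j) \<le> n'" using j(1,5) n cl by linarith
    show ?case
    proof (cases "j < K")
      case False
      have "ar s' Out (K + x) = lcp T (suffix_of_rank T (i + x)) (suffix_of_rank T (i + x + 1))" if x: "x < K - 1" for x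
      proof -
        define k where "k = ar s Sa (Suc x)"
        have k: "k < K" "?rk k = Suc x" using sa[of "Suc x"] x by (auto simp: k_def)
        have "j = K" using j(1) False by simp
        then have "ar s' Out (K + ?rk k - 1) = lcp T (suffix_of_rank T (i + ?rk k - 1)) (suffix_of_rank T (i + ?rk k))"
          using j(4)[unfolded lcps_inv_def, rule_format, of k] k by simp
        then show ?thesis unfolding k(2) by simp
      qed
      moreover have "n \<le> n' + ?N + K + 1" using j(1,5) False cl by simp
      ultimately show ?thesis using False f j(2) by simp
    next
      case True
      have after: "wp ?step ?I s2 n2" if s2: "rg s2 Ry = j" "ar s2 Tg = ?tg" "carry T (?tg j) (rg s2 Rl)"
        "lcps_inv T i K ?rk (Suc j) (ar s2 Out)" "n \<le> n2 + Suc j + ?tg j + rg s2 Rl" for s2 n2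
      proof -
        have "carry T (?tg (Suc j)) (rg s2 Rl - (?tg (Suc j) - ?tg j))"
          by (rule carry_shift[OF s2(3)]) (use tgN[OF True] tgS[OF True] in auto)
        moreover have "?tg j + rg s2 Rl \<le> ?tg (Suc j) + (rg s2 Rl - (?tg (Suc j) - ?tg j))" using tgS[OF True] by simp
        then have "n \<le> n2 + Suc j + ?tg (Suc j) + (rg s2 Rl - (?tg (Suc j) - ?tg j))" using s2(5) by linarith
        ultimately show ?thesis using s2 True by (auto intro!: exI[of _ "Suc j"])
      qed
      show ?thesis
      proof (cases "0 < ?rk j")
        case False
        have "lcps_inv T i K ?rk (Suc j) (ar s' Out)" using j(4) False by (auto simp: lcps_inv_def less_Suc_eq)
        then have "wp ?step ?I s' (n' - 1)" using j f n' by (intro after) auto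
        then show ?thesis using False True f j(2) n' by simp
      next
        case pos: True
        let ?x = "?rk j" and ?u = "suffix_of_rank T (i + ?rk j - 1)" and ?v = "?tg j"
        have x: "?x < K" using rk[OF True] by blast
        have u: "?u \<in> {1..?N}" "card (below T ?u) = i + ?x - 2" "ar s Tg (ar s Sa (?x - 1)) = ?u"
          using rank[of "?x - 1"] sa[of "?x - 1"] x pos by (simp_all add: numeral_2_eq_2)
        have v: "card (below T ?v) = i + ?x - 1" using rank(1)[OF x] tg_at[OF True] by simp
        have succ: "card (below T ?v) = Suc (card (below T ?u))" using u(2) v pos iK by simp
        have less: "text_suffix T ?u < text_suffix T ?v"
          using suffix_less_iff_below[OF u(1) tgN[OF True]] succ by simp
        have ag: "agree T (rg s' Rl) ?u ?v" by (rule carry_agree[OF j(3) u(1) tgN[OF True] succ])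
        let ?s1 = "s'\<lparr>rg := (rg s')(Rv := ?v, Ru := ?u)\<rparr>"
        have hold1: "holds_text T ?s1" using hold f by (simp add: holds_text_def)
        have "wp scan_prefix (wp (Put Out (Minus (Plus (V Rk) (Arr Rnk (V Ry))) (Lit 1)) (V Rl)) (wp ?step ?I)) ?s1 (n' - 1)"
        proof (rule wp_use[OF wp_scan_prefix[OF hold1, where u = ?u and v = ?v]], goal_cases)
          case 3
          show ?case using u(1) .
        next
          case 4
          show ?case using tgN[OF True] .
        next
          case 5
          show ?case using less by auto
        next
          case 6
          show ?case using ag by simp
        next
          case 7
          show ?case using n' True by simp
        next
          case (8 s2 n2)
          have f2: "rg s2 Rk = K" "ar s2 Rnk = ?rk" "rg s2 Ry = j" "ar s2 Tg = ?tg" "ar s2 Out = ar s' Out" "size_of s2 = ?N"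
            using 8(2) f j(2) by (auto simp: frame_def scan_prefix_def)
          have l2: "rg s' Rl \<le> rg s2 Rl" "agree T (rg s2 Rl) ?u ?v" "rg s2 Rl = lcp T ?u ?v" "n2 + rg s2 Rl = n' - 1 + rg s' Rl"
            using 8(1) by auto
          let ?s3 = "s2\<lparr>ar := (ar s2)(Out := (ar s2 Out)(K + ?x - 1 := rg s2 Rl))\<rparr>"
          have "lcps_inv T i K ?rk (Suc j) (ar ?s3 Out)"
            unfolding lcps_inv_def
          proof (intro allI impI)
            fix k assume k: "k < Suc j" "0 < ?rk k"
            show "ar ?s3 Out (K + ?rk k - 1) = lcp T (suffix_of_rank T (i + ?rk k - 1)) (suffix_of_rank T (i + ?rk k))"
            proof (cases "k = j")
              case True
              then show ?thesis using l2(3) tg_at[OF \<open>j < K\<close>] by simp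
            next
              case False
              then have kj: "k < j" using k by simp
              have "?rk k \<noteq> ?rk j" using rk[OF \<open>j < K\<close>] rk[of k] kj True by (metis less_trans nat_neq_iff)
              then have "K + ?rk k - 1 \<noteq> K + ?rk j - 1" using k(2) pos by simp
              then show ?thesis using j(4) kj k(2) f2 by (simp add: lcps_inv_def)
            qed
          qed
          moreover have "carry T ?v (rg s2 Rl)"
            using l2(2) u(1) less by (auto simp: carry_def agree_def)
          moreover have "n \<le> n2 + Suc j + ?tg j + rg s2 Rl" using l2(4) j(5) n' by linarith
          ultimately have "wp ?step ?I ?s3 n2" using f2 by (intro after) simp_all
          moreover have "K + ?x \<le> 4 * ?N + 8" "K + ?x - 1 < 2 * ?N" using x K by linarith+
          ultimately show ?case using f2 by simp
        qed simp_all
        then show ?thesis using pos True f j(2) n' u(3) by simp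
      qed
    qed
  qed
  then show ?thesis unfolding compute_lcps_def by simp
qed

definition emit :: hcom where
  "emit = (For Rx (V Rk) (Put Out (V Rx) (Arr Tg (Arr Sa (V Rx)))) ;;
     For Rx (V Rk) (Rq ::= Arr Tg (Arr Sa (V Rx)) ;;
       If (Lt (Lit 1) (V Rq)) (CopySym (Plus (Lin 1 1) (V Rx)) (Minus (V Rq) (Lit 1)))
         (CopySym (Plus (Lin 1 1) (V Rx)) (Lin 1 0))))"

lemma wp_emit:
  fixes s :: "'a::linorder hstate"
  assumes rs: "ranked_state T i K s" and iK: "1 \<le> i" "i + K \<le> Suc (length T)" and K: "K \<le> length T" and n: "2 * K \<le> n"
    and Q: "\<And>s' n'. \<forall>x<K. ar s' Out x = suffix_of_rank T (i + x) \<Longrightarrow> \<forall>x. ar s' Out (K + x) = ar s Out (K + x) \<Longrightarrow>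
      \<forall>x<K. sy s' (Suc (length T) + x) = bwt T (i + x) \<Longrightarrow> Q s' n'"
  shows "wp emit Q s n"
proof -
  let ?N = "length T"
  have ts: "target_state T i K s" and flat: "rg s Rflat = 0"
    and sa: "\<And>x. x < K \<Longrightarrow> ar s Tg (ar s Sa x) = suffix_of_rank T (i + x)" using rs by (auto simp: ranked_state_def)
  have hold: "holds_text T s" and Rk: "rg s Rk = K" using ts by (auto simp: target_state_def)
  have N: "size_of s = ?N" and sym: "\<forall>p\<in>{1..?N}. sy s p = text_symbol T p" using hold by (auto simp: holds_text_def)
  have rank: "suffix_of_rank T (i + x) \<in> {1..?N}" if "x < K" for x
    using suffix_of_rank(1)[of "i + x" T] iK that by auto
  show ?thesis unfolding emit_def wp_Then
  proof (rule wp_For[where m = K and I = "\<lambda>j s'. (\<forall>x<j. ar s' Out x = suffix_of_rank T (i + x)) \<and> (\<forall>x. ar s' Out (K + x) = ar s Out (K + x))"], goal_cases)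
    case (3 j s' n')
    have "ar s' Tg = ar s Tg" "ar s' Sa = ar s Sa" "size_of s' = ?N" using 3(4) N by (auto simp: frame_def)
    then show ?case using 3(1-3) sa K by (auto simp: less_Suc_eq)
  next
    case (5 s1)
    have f: "rg s1 Rk = K" "ar s1 Tg = ar s Tg" "ar s1 Sa = ar s Sa" "size_of s1 = ?N" "sy s1 = sy s"
      using 5(3) N Rk by (auto simp: frame_def)
    show ?case
    proof (rule wp_For[where m = K and I = "\<lambda>j s'. (\<forall>x<j. sy s' (Suc ?N + x) = bwt T (i + x)) \<and>
        (\<forall>p\<in>{1..?N}. sy s' p = text_symbol T p)"], goal_cases)
      case 2
      then show ?case using f sym by simp
    next
      case (3 j s' n')
      have f': "ar s' Tg = ar s Tg" "ar s' Sa = ar s Sa" "size_of s' = ?N" using 3(4) f by (auto simp: frame_def)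
      let ?q = "suffix_of_rank T (i + j)"
      have q: "?q \<in> {1..?N}" by (rule rank[OF 3(1)])
      have bwt: "sy s' (if 1 < ?q then ?q - 1 else ?N) = bwt T (i + j)"
      proof -
        have "(if 1 < ?q then ?q - 1 else ?N) \<in> {1..?N}" using q by auto
        then have "sy s' (if 1 < ?q then ?q - 1 else ?N) = text_symbol T (if 1 < ?q then ?q - 1 else ?N)"
          using 3(3) by blast
        then show ?thesis by (simp add: bwt_def Let_def)
      qed
      have j: "Suc ?N + j \<le> 4 * ?N + 8" using 3(1) K by simp
      show ?case
      proof (cases "1 < ?q")
        case True
        then show ?thesis using 3(1-3) f' sa[OF 3(1)] bwt j by (auto simp: less_Suc_eq)
      next
        case False
        then show ?thesis using 3(1-3) f' sa[OF 3(1)] bwt j by (auto simp: less_Suc_eq)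
      qed
    next
      case (5 s2)
      have "ar s2 Out = ar s1 Out" using 5(3) by (auto simp: frame_def)
      then show ?case using 5(1) \<open>_ \<and> (\<forall>x. ar s1 Out (K + x) = ar s Out (K + x))\<close> by (intro Q) auto
    qed (use f n in \<open>auto simp: frame_def\<close>)
  qed (use Rk n in \<open>auto simp: frame_def\<close>)
qed

section \<open>The program\<close>

definition main :: hcom where
  "main = (Rr ::= Minus (V Ri) (Lit 1) ;; select ;; mark_lower ;;
     Rr ::= Minus (Plus (V Ri) (V RK)) (Lit 2) ;; select ;; collect ;;
     sort_blocks ;; name_blocks ;; double ;; compute_lcps ;; emit)"

lemma select_frame:
  "frame select s s' \<Longrightarrow> rg s' RK = rg s RK \<and> rg s' Ri = rg s Ri \<and> ar s' Sd = ar s Sd \<and> sy s' = sy s \<and> size_of s' = size_of s"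
  by (simp add: frame_def select_def init_select_def select_round_def advance_def extend_tokens_def label_runs_def
      apply_labels_def settle_def keep_part_def choose_part_def classify_def pivot_def pivot_loop_def copy_back_def
      thin_def merge_pass_def merge_pair_def merge_pick_def merge_scan_def)

text \<open>The two selections take \<open>2 * 357 = 714\<close> units per symbol; the remaining
  linear passes fit generously into the rest of 800. The term with \<open>L\<close> covers the merge
  sort of the blocks and prefix doubling.\<close>

lemma wp_main:
  fixes s :: "'a::linorder hstate"
  assumes hold: "holds_text T s" and regs: "rg s RK = K" "rg s Ri = i" and lc: "\<forall>u. ar s Lc u = 0"
    and iK: "1 \<le> i" "1 \<le> K" "i + K \<le> Suc (length T)" and L: "K \<le> 2 ^ L"
    and n: "800 * length T + 11 * K * L \<le> n"
  shows "wp main (\<lambda>s' n'. (\<forall>x<K. ar s' Out x = suffix_of_rank T (i + x)) \<and>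
     (\<forall>x<K - 1. ar s' Out (K + x) = lcp T (suffix_of_rank T (i + x)) (suffix_of_rank T (i + x + 1))) \<and>
     (\<forall>x<K. sy s' (Suc (length T) + x) = bwt T (i + x))) s n"
proof -
  let ?N = "length T"
  let ?Q = "\<lambda>s' n'. (\<forall>x<K. ar s' Out x = suffix_of_rank T (i + x)) \<and>
     (\<forall>x<K - 1. ar s' Out (K + x) = lcp T (suffix_of_rank T (i + x)) (suffix_of_rank T (i + x + 1))) \<and>
     (\<forall>x<K. sy s' (Suc (length T) + x) = bwt T (i + x))"
  have K: "K \<le> ?N" using iK by simp
  have N: "size_of s = ?N" using hold by (simp add: holds_text_def)
  \<comment> \<open>The sum is \<open>(9 * K + 2) * L\<close>, and \<open>K \<ge> 1\<close> absorbs
    the 2.\<close>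
  have KL: "(3 * K + 1) * L + (6 * K + 1) * L \<le> 11 * K * L"
  proof -
    have "2 * L \<le> 2 * K * L" using iK(2) by simp
    then show ?thesis by (simp add: algebra_simps)
  qed
  let ?lo = "suffix_of_rank T i" and ?hi = "suffix_of_rank T (i + K - 1)"
  have last: "wp double (wp compute_lcps (wp emit ?Q)) s6 n6"
    if s6: "target_state T i K s6" "rg s6 Rflat = 0" "doubling_inv K (target_less T (ar s6 Tg)) 1 (ar s6 Sa) (ar s6 Rnk)"
      "20 * ?N + (6 * K + 1) * L \<le> n6" for s6 n6
  proof (rule wp_use[OF wp_double[OF s6(3), where L = L]], goal_cases)
    case 1
    then show ?case using s6(1) by (simp add: target_state_def)
  next
    case 2
    then show ?case using s6(1) K by (simp add: target_state_def holds_text_def)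
  next
    case 3
    then show ?case by (rule L)
  next
    case 4
    then show ?case using s6(4) by simp
  next
    case (5 s7 n7)
    have f: "rg s7 Rk = rg s6 Rk" "rg s7 Rflat = rg s6 Rflat" "ar s7 Tg = ar s6 Tg" "ar s7 Ix = ar s6 Ix" "ar s7 Lab = ar s6 Lab"
      "sy s7 = sy s6" "size_of s7 = size_of s6"
      using 5(2) by (auto simp: frame_def double_def order_by_second_def bucket_sort_def rerank_def copy_ranks_def)
    have ts: "target_state T i K s7" using s6(1) f by (simp add: target_state_def holds_text_def)
    have rs: "ranked_state T i K s7" by (rule ranked_stateI[OF ts]) (use 5(1) f s6(2) iK in auto)
    have n7: "20 * ?N \<le> n7" using 5(1) s6(4) by linarith
    show ?case
    proof (rule wp_use[OF wp_compute_lcps[OF rs iK(1,3) K]], goal_cases)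
      case 1
      then show ?case using n7 K iK by simp
    next
      case (2 s8 n8)
      have f8: "rg s8 Rk = rg s7 Rk" "rg s8 Rflat = rg s7 Rflat" "ar s8 Tg = ar s7 Tg" "ar s8 Ix = ar s7 Ix" "ar s8 Lab = ar s7 Lab"
        "ar s8 Sa = ar s7 Sa" "ar s8 Rnk = ar s7 Rnk" "sy s8 = sy s7" "size_of s8 = size_of s7"
        using 2(2) by (auto simp: frame_def compute_lcps_def scan_prefix_def)
      have rs8: "ranked_state T i K s8" using rs f8 by (simp add: ranked_state_def target_state_def holds_text_def)
      show ?case
      proof (rule wp_emit[OF rs8 iK(1,3) K], goal_cases)
        case 1
        then show ?case using 2(1) n7 K iK by simp
      next
        case (2 s9 n9)
        then show ?case using \<open>_ \<and> n7 \<le> n8 + _ + _ + _\<close> by simp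
      qed
    qed
  qed
  have middle: "wp sort_blocks (wp name_blocks (wp double (wp compute_lcps (wp emit ?Q)))) s4 n4"
    if s4: "target_state T i K s4" "\<forall>u. ar s4 Lc u = 0" "60 * ?N + 11 * K * L \<le> n4" for s4 n4
  proof (rule wp_sort_blocks[OF s4(1,2) K L], goal_cases)
    case 1
    then show ?case using s4(3) KL K by linarith
  next
    case (2 s5 n5)
    show ?case
    proof (rule wp_name_blocks[OF 2(1,2,3,4) K 2(5)], goal_cases)
      case 1
      then show ?case using 2(6) s4(3) KL K by linarith
    next
      case (2 s6)
      have f: "rg s6 Rk = rg s5 Rk" "rg s6 Rflat = rg s5 Rflat" "ar s6 Tg = ar s5 Tg" "ar s6 Ix = ar s5 Ix" "ar s6 Lab = ar s5 Lab"
        "sy s6 = sy s5" "size_of s6 = size_of s5"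
        using 2(2) by (auto simp: frame_def name_blocks_def)
      show ?case
      proof (rule last)
        show "target_state T i K s6" using \<open>target_state T i K s5\<close> f by (simp add: target_state_def holds_text_def)
        show "rg s6 Rflat = 0" using \<open>rg s5 Rflat = 0\<close> f by simp
        show "doubling_inv K (target_less T (ar s6 Tg)) 1 (ar s6 Sa) (ar s6 Rnk)" using 2(1) f by simp
        show "20 * ?N + (6 * K + 1) * L \<le> n5 - K" using \<open>n4 \<le> n5 + _ + _ + _\<close> s4(3) KL K by linarith
      qed
    qed
  qed
  let ?s0 = "s\<lparr>rg := (rg s)(Rr := i - 1)\<rparr>"
  have "wp select (wp mark_lower (wp (Rr ::= Minus (Plus (V Ri) (V RK)) (Lit 2)) (wp select (wp collect
     (wp sort_blocks (wp name_blocks (wp double (wp compute_lcps (wp emit ?Q))))))))) ?s0 n"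
  proof (rule wp_use[OF wp_select[of T]], goal_cases)
    case 1
    then show ?case using hold by (simp add: holds_text_def)
  next
    case 2
    then show ?case using lc by simp
  next
    case 3
    then show ?case using iK by simp
  next
    case 4
    then show ?case using n by simp
  next
    case (5 s1 n1)
    note f1 = select_frame[OF 5(2)]
    have hold1: "holds_text T s1" and lc1: "\<forall>u. ar s1 Lc u = 0" and n1: "n \<le> n1 + 357 * ?N"
      and lab1: "\<forall>p\<in>{1..?N}. ar s1 Lab p < Suc ?N \<longleftrightarrow> text_suffix T p < text_suffix T ?lo"
      using 5(1) iK by auto
    show ?case
    proof (rule wp_mark_lower[where N = ?N], goal_cases)
      case 1
      then show ?case using hold1 by (simp add: holds_text_def)
    next
      case 2
      then show ?case using n n1 by linarith
    next
      case (3 s2)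
      have f2: "rg s2 RK = K" "rg s2 Ri = i" "size_of s2 = ?N" "sy s2 = sy s1" "ar s2 Lc = ar s1 Lc"
        using 3(2) f1 regs N by (auto simp: frame_def mark_lower_def)
      have sd: "\<forall>p\<in>{1..?N}. 0 < ar s2 Sd p \<longleftrightarrow> text_suffix T p < text_suffix T ?lo" using 3(1) lab1 by blast
      let ?s2 = "s2\<lparr>rg := (rg s2)(Rr := i + K - 2)\<rparr>"
      have hold2: "holds_text T ?s2" using hold1 f2 by (simp add: holds_text_def)
      have "wp select (wp collect (wp sort_blocks (wp name_blocks (wp double (wp compute_lcps (wp emit ?Q)))))) ?s2 (n1 - ?N)"
      proof (rule wp_use[OF wp_select[OF hold2]], goal_cases)
        case 1
        then show ?case using lc1 f2 by simp
      next
        case 2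
        then show ?case using iK by simp
      next
        case 3
        then show ?case using n n1 by linarith
      next
        case (4 s3 n3)
        note f3 = select_frame[OF 4(2)]
        have r: "Suc (i + K - 2) = i + K - 1" using iK by simp
        have hold3: "holds_text T s3" and lc3: "\<forall>u. ar s3 Lc u = 0" and n3: "n1 - ?N \<le> n3 + 357 * ?N"
          and lab3: "\<forall>p\<in>{1..?N}. (ar s3 Lab p < Suc ?N \<longleftrightarrow> text_suffix T p < text_suffix T ?hi) \<and> (ar s3 Lab p = Suc ?N \<longleftrightarrow> p = ?hi)"
          using 4(1) r by auto
        have sd3: "\<forall>p\<in>{1..?N}. 0 < ar s3 Sd p \<longleftrightarrow> text_suffix T p < text_suffix T ?lo" using sd f3 by simp
        show ?case
        proof (rule wp_collect[OF hold3 iK sd3 lab3], goal_cases)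
          case 1
          then show ?case using n n1 n3 by linarith
        next
          case (2 s4)
          have "ar s4 Lc = ar s3 Lc" using 2(2) by (simp add: frame_def collect_def)
          then have "\<forall>u. ar s4 Lc u = 0" using lc3 by simp
          then show ?case by (rule middle[OF 2(1)]) (use n n1 n3 in linarith)
        qed
      qed
      moreover have "i + K \<le> 4 * ?N + 8" using iK by simp
      ultimately show ?case using f2 by (simp add: numeral_2_eq_2)
    qed
  qed
  moreover have "wp (a ;; b) Q = wp a (wp b Q)" for a b and Q :: "'a hstate \<Rightarrow> nat \<Rightarrow> bool" by (intro ext) simp
  ultimately show ?thesis using regs unfolding main_def by simp
qed

text \<open>A single program delivers both outputs, since the transform goes to the symbol memory
  behind the text and the index to the word memory; each conjunct forgets one of them.\<close>

theorem theorem1: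
  "solvable_in_time (rank_range_input :: 'a::linorder list \<Rightarrow> nat \<Rightarrow> nat \<Rightarrow> bool)
     outputs_bwt_segment (\<lambda>K N. real K * log 2 (real K) + real N)
   \<and> solvable_in_time (rank_range_input :: 'a::linorder list \<Rightarrow> nat \<Rightarrow> nat \<Rightarrow> bool)
     outputs_partial_index (\<lambda>K N. real K * log 2 (real K) + real N)"
proof -
  define G where "G = growth main"
  \<comment> \<open>Initial values are at most \<open>4 * N + 8\<close>, each of the at most
    \<open>812 * N * N\<close> charged stretches adds at most \<open>G\<close>, and addresses
    multiply by 20; so everything stays below \<open>Z * N * N\<close>, which
    \<open>(Z + 2) * floorlog 2 N\<close> bits hold.\<close>
  define Z where "Z = 20 * (13 + 812 * G) + 20"
  define C where "C = real (steps main) * 812"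
  have run: "\<exists>t s'. exec ((Z + 2) * floorlog 2 (length T)) (compile main) s t s' \<and>
      real t \<le> C * (real K * log 2 (real K) + real (length T)) \<and>
      outputs_bwt_segment T K i s' \<and> outputs_partial_index T K i s'"
    if inp: "rank_range_input T K i" and init: "initial_state T K i s" for T :: "'a list" and K i s
  proof -
    let ?N = "length T"
    define L where "L = nat \<lceil>log 2 (real K)\<rceil>"
    have iK: "1 \<le> i" "1 \<le> K" "i + K \<le> Suc ?N" "K \<le> ?N" and T: "endmarked T"
      using inp by (auto simp: rank_range_input_def)
    have N1: "1 \<le> ?N" using iK by simp
    have log0: "0 \<le> log 2 (real K)" using iK by simp
    have L2: "real L \<le> log 2 (real K) + 1" using log0 unfolding L_def by linarith
    have KL: "K \<le> 2 ^ L"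
    proof -
      have "log 2 (real K) \<le> real L" using log0 unfolding L_def by linarith
      then have "real K \<le> 2 powr real L" using iK by (simp add: log_le_iff)
      then have "real K \<le> real (2 ^ L)" by (simp add: powr_realpow)
      then show ?thesis by (simp only: of_nat_le_iff)
    qed
    \<comment> \<open>A crude bound is enough here, as it only serves the word size:
      \<open>K * L\<close> may be replaced by \<open>N * N\<close> at the price of a constant factor
      in the number of bits.\<close>
    have LN: "L \<le> ?N"
    proof -
      have "K \<le> 2 ^ (K - 1)" using less_exp[of "K - 1"] iK(2) by linarith
      then have "real K \<le> real (2 ^ (K - 1))" by (rule of_nat_mono)
      then have "real K \<le> 2 powr real (K - 1)" by (subst powr_realpow) simp_all
      then have "log 2 (real K) \<le> real (K - 1)" using iK(2) by (subst log_le_iff) simp_all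
      then have "real L \<le> real K" using L2 iK by simp
      then show ?thesis using iK by simp
    qed
    let ?s = "\<lparr>size_of = ?N, rg = \<lambda>x. regs s (reg_name x), ar = \<lambda>_ _. 0, sy = syms s\<rparr>"
    have regs: "regs s = (\<lambda>_. 0)(''N'' := ?N, ''K'' := K, ''i'' := i)" and mem: "mem s = (\<lambda>_. 0)"
      and syms: "\<forall>j\<in>{1..?N}. syms s j = text_symbol T j" using init by (auto simp: initial_state_def)
    have "wp main (\<lambda>s' n'. (\<forall>x<K. ar s' Out x = suffix_of_rank T (i + x)) \<and>
     (\<forall>x<K - 1. ar s' Out (K + x) = lcp T (suffix_of_rank T (i + x)) (suffix_of_rank T (i + x + 1))) \<and>
     (\<forall>x<K. sy s' (Suc ?N + x) = bwt T (i + x))) ?s (800 * ?N + 11 * K * L)"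
      by (rule wp_main[OF _ _ _ _ iK(1-3) KL]) (use T syms regs in \<open>simp_all add: holds_text_def\<close>)
    then obtain t s' where t: "hexec main ?s t s'" "t \<le> 800 * ?N + 11 * K * L"
      and post: "\<forall>x<K. ar s' Out x = suffix_of_rank T (i + x)"
       "\<forall>x<K - 1. ar s' Out (K + x) = lcp T (suffix_of_rank T (i + x)) (suffix_of_rank T (i + x + 1))"
       "\<forall>x<K. sy s' (Suc ?N + x) = bwt T (i + x)"
      unfolding wp_def by blast
    have rep: "represents ?s s" using regs mem by (simp add: represents_def)
    have val: "values_below ?s (4 * ?N + 8)" using regs iK by (auto simp: values_below_def)
    have NN: "?N \<le> ?N * ?N" using N1 by simp
    have fit: "20 * (4 * ?N + 8 + growth main * (t + 1) + size_of ?s) + 20 < 2 ^ ((Z + 2) * floorlog 2 ?N)"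
    proof -
      have bound: "20 * (a + g + n) + 20 \<le> 20 * (13 * m + h) + 20 * m" if "g \<le> h" "a + n \<le> 13 * m" "1 \<le> m"
        for a n m g h :: nat
      proof (rule add_le_mono)
        have "a + g + n \<le> 13 * m + h" using that(1,2) by linarith
        then show "20 * (a + g + n) \<le> 20 * (13 * m + h)" by (rule mult_le_mono2)
      qed (use that(3) in simp)
      have "K * L \<le> ?N * ?N" by (rule mult_le_mono[OF iK(4) LN])
      moreover have "11 * K * L = 11 * (K * L)" by simp
      ultimately have "t + 1 \<le> 812 * (?N * ?N)" using t(2) NN N1 by linarith
      then have "G * (t + 1) \<le> G * (812 * (?N * ?N))" by (rule mult_le_mono2)
      moreover have "4 * ?N + 8 + ?N \<le> 13 * (?N * ?N)" "1 \<le> ?N * ?N" using NN N1 by linarith+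
      ultimately have "20 * (4 * ?N + 8 + G * (t + 1) + ?N) + 20 \<le> 20 * (13 * (?N * ?N) + G * (812 * (?N * ?N))) + 20 * (?N * ?N)"
        by (rule bound)
      also have "\<dots> = Z * (?N * ?N)" by (simp add: Z_def algebra_simps)
      finally have "20 * (4 * ?N + 8 + growth main * (t + 1) + size_of ?s) + 20 \<le> Z * (?N * ?N)" by (simp add: G_def)
      also have "\<dots> < 2 ^ ((Z + 2) * floorlog 2 ?N)"
      proof -
        have b: "?N < 2 ^ floorlog 2 ?N" using floorlog_bounds[of ?N 2] N1 by (cases T) simp_all
        then have f1: "1 \<le> floorlog 2 ?N" using N1 by (cases "floorlog 2 ?N") auto
        have "?N * ?N < 2 ^ floorlog 2 ?N * 2 ^ floorlog 2 ?N" by (rule mult_strict_mono[OF b b]) simp_all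
        moreover have "Z < 2 ^ Z" by (rule less_exp)
        ultimately have "Z * (?N * ?N) < 2 ^ Z * (2 ^ floorlog 2 ?N * 2 ^ floorlog 2 ?N)"
          by (intro mult_strict_mono[of Z "2 ^ Z" "?N * ?N"]) simp_all
        also have "\<dots> = 2 ^ (Z + floorlog 2 ?N + floorlog 2 ?N)" by (simp add: power_add)
        also have "\<dots> \<le> 2 ^ ((Z + 2) * floorlog 2 ?N)"
        proof (rule power_increasing)
          have "Z \<le> Z * floorlog 2 ?N" using f1 by simp
          then show "Z + floorlog 2 ?N + floorlog 2 ?N \<le> (Z + 2) * floorlog 2 ?N" by (simp add: algebra_simps)
        qed simp
        finally show ?thesis .
      qed
      finally show ?thesis .
    qed
    from compile_correct[OF t(1) rep val fit] obtain u \<sigma>' where u: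
      "exec ((Z + 2) * floorlog 2 ?N) (compile main) s u \<sigma>'" "u \<le> steps main * (t + 1)" "represents s' \<sigma>'" "size_of s' = ?N"
      by auto
    \<comment> \<open>Rounding the logarithm up costs \<open>11 * K \<le> 11 * N\<close> in
      addition, so \<open>812 = 801 + 11\<close>.\<close>
    have "real (t + 1) \<le> 812 * (real K * log 2 (real K) + real ?N)"
    proof -
      have "real K * real L \<le> real K * (log 2 (real K) + 1)" using L2 by (intro mult_left_mono) auto
      moreover have "real (t + 1) \<le> 801 * real ?N + 11 * (real K * real L)"
      proof -
        have "t + 1 \<le> 801 * ?N + 11 * (K * L)" using t(2) N1 by simp
        then have "real (t + 1) \<le> real (801 * ?N + 11 * (K * L))" by (rule of_nat_mono)
        then show ?thesis by simp
      qed
      moreover have "0 \<le> real K * log 2 (real K)" using log0 by simp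
      moreover have "real K \<le> real ?N" using iK by simp
      ultimately show ?thesis by (simp add: algebra_simps)
    qed
    then have "real (steps main) * real (t + 1) \<le> real (steps main) * (812 * (real K * log 2 (real K) + real ?N))"
      by (rule mult_left_mono) simp
    moreover have "real u \<le> real (steps main) * real (t + 1)" using of_nat_mono[OF u(2), where 'a = real] by (simp only: of_nat_mult)
    ultimately have time: "real u \<le> C * (real K * log 2 (real K) + real ?N)" unfolding C_def mult.assoc by (rule order_trans[rotated])
    have m: "mem \<sigma>' j = ar s' Out j" if "j < 2 * ?N" for j using u(3,4) that by (simp add: represents_def)
    have sy: "syms \<sigma>' = sy s'" using u(3) by (simp add: represents_def)
    have "outputs_bwt_segment T K i \<sigma>'" using post(3) sy by (simp add: outputs_bwt_segment_def)
    moreover have "outputs_partial_index T K i \<sigma>'"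
      using post(1,2) m iK by (auto simp: outputs_partial_index_def)
    ultimately show ?thesis using u(1) time by blast
  qed
  have solve: "solvable_in_time (rank_range_input :: 'a list \<Rightarrow> nat \<Rightarrow> nat \<Rightarrow> bool) post (\<lambda>K N. real K * log 2 (real K) + real N)"
    if post: "\<And>T K i \<sigma>. outputs_bwt_segment T K i \<sigma> \<Longrightarrow> outputs_partial_index T K i \<sigma> \<Longrightarrow> post T K i \<sigma>"
    for post :: "'a list \<Rightarrow> nat \<Rightarrow> nat \<Rightarrow> 'a state \<Rightarrow> bool"
    unfolding solvable_in_time_def
  proof (rule exI[of _ "compile main"], rule exI[of _ "Z + 2"], rule conjI[rotated], rule exI[of _ C], intro allI impI)
    fix T :: "'a list" and K i s assume "rank_range_input T K i" "initial_state T K i s"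
    from run[OF this] post
    show "\<exists>t s'. exec ((Z + 2) * floorlog 2 (length T)) (compile main) s t s' \<and>
      real t \<le> C * (real K * log 2 (real K) + real (length T)) \<and> post T K i s'" by blast
  qed simp
  show ?thesis by (intro conjI solve)
qed

end
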